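(* Let $K$ be an algebraically closed field and let an algebraic group $G$ act on a variety $X$ over $K$. For $x\in X$ and every open neighbourhood $U\subset X$ of $x$ we have $$G\text{-}\mathrm{par}(U)=G\text{-}\mathrm{mod}(U),$$ and therefore $G\text{-}\mathrm{par}(x)=G\text{-}\mathrm{mod}(x)$ for all $x\in X$.
   Context: Varieties are separated schemes of finite type over $K$, points are closed points. $\dim$ is the dimension of constructible sets, with $\dim\emptyset=-\infty$. A Rosenlicht stratification of $X$ under $G$ is a finite disjoint decomposition $X=X_1\cup\dots\cup X_s$ into $G$-invariant locally closed subvarieties, $X_i$ open dense in $X\setminus(X_1\cup\dots\cup X_{i-1})$, such that each $X_i$ has a geometric quotient $p_i:X_i\to X_i/G$ which is a variety (it always exists by Rosenlicht's theorem). Fix any such stratification. For an open set $U\subset X$, $$G\text{-}\mathrm{mod}(U):=\max_{1\le i\le s}\dim p_i(U\cap X_i),$$ and for $x\in X$, $G\text{-}\mathrm{mod}(x):=\min\{G\text{-}\mathrm{mod}(U): U\text{ an open neighbourhood of }x\}$. For $W\subset X$ constructible and $x\in W$, $\dim_xW$ is the maximum of $\dim Z$ over the irreducible components $Z$ of $W$ containing $x$. For $U$ open in $X$ and $i\ge0$, $$U(i):=\{y\in U:\dim_y(U\cap G\cdot y)=i\},\qquad G\text{-}\mathrm{par}(U):=\max_{i\ge0}\{\dim U(i)-i\},$$ and $G\text{-}\mathrm{par}(x):=\min\{G\text{-}\mathrm{par}(U):U\text{ an open neighbourhood of }x\}$. *)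

theory Defs
  imports "HOL-Analysis.Analysis" "HOL-Algebra.Algebraic_Closure_Type" "HOL-Algebra.Generated_Rings"
begin

(* frees the identifier X *)
no_notation Polynomials.var ("X\<index>")

text \<open>
  A scheme of finite type over an algebraically closed field \<open>K\<close> is represented by the ringed
  space of its closed points (the language of maximal spectra, as in the appendix to the first
  chapter of EGA I); the passage to closed points is an equivalence of categories. Structure
  sheaves are sheaves of \<open>K\<close>-algebras and may contain nilpotents: nothing is assumed reduced,
  irreducible or affine.

  The field is the type \<^typ>\<open>'k\<close>. All structure sheaves take their sections in one type
  \<^typ>\<open>'r\<close>; this is no restriction, since finitely many schemes can be transported to a
  common type of sections.
\<close>

section \<open>Dimension of subsets of a topological space\<close>

definition irreducible_in :: "'a topology \<Rightarrow> 'a set \<Rightarrow> bool" where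
  "irreducible_in T S \<longleftrightarrow> S \<subseteq> topspace T \<and> S \<noteq> {} \<and>
     (\<forall>A B. closedin T A \<and> closedin T B \<and> S \<subseteq> A \<union> B \<longrightarrow> S \<subseteq> A \<or> S \<subseteq> B)"

text \<open>Krull dimension of the subspace \<open>S\<close>. As the supremum of the empty set in \<^typ>\<open>ereal\<close>
  is \<open>-\<infinity>\<close>, this gives \<open>dim {} = -\<infinity>\<close>.\<close>

definition dim_of :: "'a topology \<Rightarrow> 'a set \<Rightarrow> ereal" where
  "dim_of T S = Sup {ereal (real n) | n. \<exists>Z :: nat \<Rightarrow> 'a set.
     (\<forall>i\<le>n. closedin (subtopology T S) (Z i) \<and> irreducible_in (subtopology T S) (Z i)) \<and>
     (\<forall>i<n. Z i \<subset> Z (Suc i))}"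

definition irreducible_component :: "'a topology \<Rightarrow> 'a set \<Rightarrow> 'a set \<Rightarrow> bool" where
  "irreducible_component T W Z \<longleftrightarrow> Z \<subseteq> W \<and> irreducible_in T Z \<and>
     (\<forall>Z'. Z \<subseteq> Z' \<and> Z' \<subseteq> W \<and> irreducible_in T Z' \<longrightarrow> Z' = Z)"

definition dim_at :: "'a topology \<Rightarrow> 'a set \<Rightarrow> 'a \<Rightarrow> ereal" where
  "dim_at T W x = Sup {dim_of T Z | Z. irreducible_component T W Z \<and> x \<in> Z}"

definition locally_closed_in :: "'a topology \<Rightarrow> 'a set \<Rightarrow> bool" where
  "locally_closed_in T S \<longleftrightarrow> (\<exists>U C. openin T U \<and> closedin T C \<and> S = U \<inter> C)"


section \<open>Spaces with a sheaf of algebras\<close>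

text \<open>\<open>cst X U\<close> is the structure map \<open>K \<rightarrow> \<O>\<^sub>X(U)\<close>.\<close>

record ('x, 'r, 'k) kspace =
  zar :: "'x topology"
  sec :: "'x set \<Rightarrow> 'r ring"
  res :: "'x set \<Rightarrow> 'x set \<Rightarrow> 'r \<Rightarrow> 'r"
  cst :: "'x set \<Rightarrow> 'k \<Rightarrow> 'r"

abbreviation points :: "('x, 'r, 'k) kspace \<Rightarrow> 'x set" where
  "points X \<equiv> topspace (zar X)"

definition sheaf_of_algebras :: "('x, 'r, 'k::field) kspace \<Rightarrow> bool" where
  "sheaf_of_algebras X \<longleftrightarrow>
     (\<forall>U. openin (zar X) U \<longrightarrow> cring (sec X U)
        \<and> cst X U \<in> ring_hom ring_of_type_algebra (sec X U)) \<and>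
     (\<forall>U V. openin (zar X) U \<and> openin (zar X) V \<and> V \<subseteq> U \<longrightarrow>
        res X U V \<in> ring_hom (sec X U) (sec X V) \<and>
        (\<forall>c. res X U V (cst X U c) = cst X V c)) \<and>
     (\<forall>U f. openin (zar X) U \<and> f \<in> carrier (sec X U) \<longrightarrow> res X U U f = f) \<and>
     (\<forall>U V W f. openin (zar X) U \<and> openin (zar X) V \<and> openin (zar X) W \<and> W \<subseteq> V \<and> V \<subseteq> U \<and>
        f \<in> carrier (sec X U) \<longrightarrow> res X V W (res X U V f) = res X U W f) \<and>
     (\<forall>\<V> s. (\<forall>V\<in>\<V>. openin (zar X) V \<and> s V \<in> carrier (sec X V)) \<and>
        (\<forall>V\<in>\<V>. \<forall>V'\<in>\<V>. res X V (V \<inter> V') (s V) = res X V' (V \<inter> V') (s V')) \<longrightarrow>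
        (\<exists>!f. f \<in> carrier (sec X (\<Union>\<V>)) \<and> (\<forall>V\<in>\<V>. res X (\<Union>\<V>) V f = s V)))"

text \<open>The sections over \<open>U\<close> vanishing at \<open>x\<close>, i.e. those whose germ at \<open>x\<close> is not a unit.\<close>

definition vanishing :: "('x, 'r, 'k) kspace \<Rightarrow> 'x set \<Rightarrow> 'x \<Rightarrow> 'r set" where
  "vanishing X U x = {f \<in> carrier (sec X U).
     \<forall>V. openin (zar X) V \<and> x \<in> V \<and> V \<subseteq> U \<longrightarrow> res X U V f \<notin> Units (sec X V)}"

definition value_at :: "('x, 'r, 'k) kspace \<Rightarrow> 'x set \<Rightarrow> 'x \<Rightarrow> 'r \<Rightarrow> 'k" where
  "value_at X U x f = (THE c. f \<ominus>\<^bsub>sec X U\<^esub> cst X U c \<in> vanishing X U x)"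

definition nonzero_locus :: "('x, 'r, 'k) kspace \<Rightarrow> 'x set \<Rightarrow> 'r \<Rightarrow> 'x set" where
  "nonzero_locus X U f = {x \<in> U. f \<notin> vanishing X U x}"

text \<open>An open set \<open>U\<close> is affine if \<open>A = \<O>(U)\<close> is a finitely generated algebra and the canonical
  map from \<open>(U, \<O>|U)\<close> to the maximal spectrum of \<open>A\<close>, \<open>x \<mapsto> {f. f(x) = 0}\<close>, is an isomorphism
  of ringed spaces: it is bijective, the sets \<open>D(f)\<close> form a basis of the topology, and
  \<open>A \<rightarrow> \<O>(D(f))\<close> is the localization at \<open>f\<close>.\<close>

definition affine_open :: "('x, 'r, 'k) kspace \<Rightarrow> 'x set \<Rightarrow> bool" where
  "affine_open X U \<longleftrightarrow> openin (zar X) U \<and>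
     (\<exists>S. finite S \<and> S \<subseteq> carrier (sec X U) \<and>
        generate_ring (sec X U) (range (cst X U) \<union> S) = carrier (sec X U)) \<and>
     bij_betw (vanishing X U) U {\<mm>. maximalideal \<mm> (sec X U)} \<and>
     (\<forall>f \<in> carrier (sec X U). openin (zar X) (nonzero_locus X U f)) \<and>
     (\<forall>W x. openin (zar X) W \<and> x \<in> W \<and> W \<subseteq> U \<longrightarrow>
        (\<exists>f \<in> carrier (sec X U). x \<in> nonzero_locus X U f \<and> nonzero_locus X U f \<subseteq> W)) \<and>
     (\<forall>f \<in> carrier (sec X U). let D = nonzero_locus X U f; A = sec X U; B = sec X D in
        res X U D f \<in> Units B \<and>
        (\<forall>b \<in> carrier B. \<exists>a \<in> carrier A. \<exists>n::nat. res X U D a = (res X U D f [^]\<^bsub>B\<^esub> n) \<otimes>\<^bsub>B\<^esub> b) \<and>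
        (\<forall>a \<in> carrier A. res X U D a = \<zero>\<^bsub>B\<^esub> \<longrightarrow> (\<exists>n::nat. (f [^]\<^bsub>A\<^esub> n) \<otimes>\<^bsub>A\<^esub> a = \<zero>\<^bsub>A\<^esub>)))"

definition finite_type_scheme :: "('x, 'r, 'k::field) kspace \<Rightarrow> bool" where
  "finite_type_scheme X \<longleftrightarrow> sheaf_of_algebras X \<and>
     (\<exists>\<U>. finite \<U> \<and> (\<forall>U\<in>\<U>. affine_open X U) \<and> \<Union>\<U> = points X)"

text \<open>The Zariski topology of the product: a basis is given by the loci in \<open>U \<times> V\<close> where
  \<open>\<Sum>\<^sub>i a\<^sub>i \<otimes> b\<^sub>i \<in> \<O>(U) \<otimes> \<O>(V)\<close> does not vanish.\<close>

definition product_topology_zar ::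
  "('x, 'r, 'k::field) kspace \<Rightarrow> ('y, 'r, 'k) kspace \<Rightarrow> ('x \<times> 'y) topology" where
  "product_topology_zar X Y = topology_generated_by
     {{(x, y) \<in> U \<times> V. (\<Sum>i<n. value_at X U x (a i) * value_at Y V y (b i)) \<noteq> 0} | U V n a b.
        openin (zar X) U \<and> openin (zar Y) V \<and>
        (\<forall>i<n::nat. a i \<in> carrier (sec X U) \<and> b i \<in> carrier (sec Y V))}"

definition separated :: "('x, 'r, 'k::field) kspace \<Rightarrow> bool" where
  "separated X \<longleftrightarrow> closedin (product_topology_zar X X) {(x, x) | x. x \<in> points X}"

definition variety :: "('x, 'r, 'k::field) kspace \<Rightarrow> bool" where
  "variety X \<longleftrightarrow> finite_type_scheme X \<and> separated X"


section \<open>Morphisms and products\<close>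

text \<open>A morphism \<open>X \<rightarrow> Y\<close> is a map on points together with a comorphism
  \<open>com f V : \<O>\<^sub>Y(V) \<rightarrow> \<O>\<^sub>X(f\<^sup>-\<^sup>1 V)\<close>.\<close>

record ('x, 'y, 'r) kmor =
  pt :: "'x \<Rightarrow> 'y"
  com :: "'y set \<Rightarrow> 'r \<Rightarrow> 'r"

definition preim :: "('x, 'r, 'k) kspace \<Rightarrow> ('x, 'y, 'r) kmor \<Rightarrow> 'y set \<Rightarrow> 'x set" where
  "preim X f V = {x \<in> points X. pt f x \<in> V}"

definition morphism ::
  "('x, 'r, 'k) kspace \<Rightarrow> ('y, 'r, 'k) kspace \<Rightarrow> ('x, 'y, 'r) kmor \<Rightarrow> bool" where
  "morphism X Y f \<longleftrightarrow> continuous_map (zar X) (zar Y) (pt f) \<and>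
     (\<forall>V. openin (zar Y) V \<longrightarrow>
        com f V \<in> ring_hom (sec Y V) (sec X (preim X f V)) \<and>
        (\<forall>c. com f V (cst Y V c) = cst X (preim X f V) c) \<and>
        (\<forall>x \<in> preim X f V. com f V ` vanishing Y V (pt f x) \<subseteq> vanishing X (preim X f V) x)) \<and>
     (\<forall>V W a. openin (zar Y) V \<and> openin (zar Y) W \<and> W \<subseteq> V \<and> a \<in> carrier (sec Y V) \<longrightarrow>
        res X (preim X f V) (preim X f W) (com f V a) = com f W (res Y V W a))"

definition mor_eq ::
  "('x, 'r, 'k) kspace \<Rightarrow> ('y, 'r, 'k) kspace \<Rightarrow> ('x, 'y, 'r) kmor \<Rightarrow> ('x, 'y, 'r) kmor \<Rightarrow> bool" where
  "mor_eq X Y f g \<longleftrightarrow> (\<forall>x \<in> points X. pt f x = pt g x) \<and>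
     (\<forall>V a. openin (zar Y) V \<and> a \<in> carrier (sec Y V) \<longrightarrow> com f V a = com g V a)"

definition mor_id :: "('x, 'x, 'r) kmor" where
  "mor_id = \<lparr>pt = (\<lambda>x. x), com = (\<lambda>_ a. a)\<rparr>"

text \<open>\<open>mor_comp Y g f\<close> is the composite \<open>g \<circ> f\<close> of \<open>f : X \<rightarrow> Y\<close> and \<open>g : Y \<rightarrow> Z\<close>.\<close>

definition mor_comp ::
  "('y, 'r, 'k) kspace \<Rightarrow> ('y, 'z, 'r) kmor \<Rightarrow> ('x, 'y, 'r) kmor \<Rightarrow> ('x, 'z, 'r) kmor" where
  "mor_comp Y g f = \<lparr>pt = pt g \<circ> pt f, com = (\<lambda>W. com f (preim Y g W) \<circ> com g W)\<rparr>"

text \<open>The constant morphism \<open>X \<rightarrow> Spec K \<rightarrow> Y\<close> given by the point \<open>y\<close>. (If \<open>y \<notin> V\<close>, then the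
  comorphism lands in the zero ring \<open>\<O>\<^sub>X({})\<close>.)\<close>

definition mor_const ::
  "('x, 'r, 'k) kspace \<Rightarrow> ('y, 'r, 'k) kspace \<Rightarrow> 'y \<Rightarrow> ('x, 'y, 'r) kmor" where
  "mor_const X Y y =
     \<lparr>pt = (\<lambda>_. y), com = (\<lambda>V a. cst X {x \<in> points X. y \<in> V} (value_at Y V y a))\<rparr>"

definition lin_indep :: "('x, 'r, 'k::field) kspace \<Rightarrow> 'x set \<Rightarrow> nat \<Rightarrow> (nat \<Rightarrow> 'r) \<Rightarrow> bool" where
  "lin_indep X U n a \<longleftrightarrow> (\<forall>c :: nat \<Rightarrow> 'k.
     (\<Oplus>\<^bsub>sec X U\<^esub>i\<in>{..<n}. cst X U (c i) \<otimes>\<^bsub>sec X U\<^esub> a i) = \<zero>\<^bsub>sec X U\<^esub> \<longrightarrow> (\<forall>i<n. c i = 0))"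

text \<open>\<open>P\<close> is the product of \<open>X\<close> and \<open>Y\<close> over \<open>K\<close> with projections \<open>p\<close> and \<open>q\<close>. Its closed points
  are the pairs of closed points, and for affine open \<open>U\<close> and \<open>V\<close> the set \<open>U \<times> V\<close> is an affine open
  on which \<open>\<O>(U) \<otimes>\<^sub>K \<O>(V) \<rightarrow> \<O>(U \<times> V)\<close> is an isomorphism. Surjectivity is stated as generation by
  the two images, injectivity as: \<open>\<Sum>\<^sub>i a\<^sub>i \<otimes> b\<^sub>i \<mapsto> 0\<close> with linearly independent \<open>a\<^sub>i\<close> only
  if all \<open>b\<^sub>i\<close> are \<open>0\<close>.\<close>

definition is_product ::
  "('x, 'r, 'k::field) kspace \<Rightarrow> ('y, 'r, 'k) kspace \<Rightarrow> ('x \<times> 'y, 'r, 'k) kspace \<Rightarrow>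
   ('x \<times> 'y, 'x, 'r) kmor \<Rightarrow> ('x \<times> 'y, 'y, 'r) kmor \<Rightarrow> bool" where
  "is_product X Y P p q \<longleftrightarrow>
     finite_type_scheme P \<and> points P = points X \<times> points Y \<and>
     morphism P X p \<and> (\<forall>z \<in> points P. pt p z = fst z) \<and>
     morphism P Y q \<and> (\<forall>z \<in> points P. pt q z = snd z) \<and>
     (\<forall>U V. affine_open X U \<and> affine_open Y V \<longrightarrow> affine_open P (U \<times> V) \<and>
        (let A = sec X U; B = sec Y V; C = sec P (U \<times> V);
             \<alpha> = (\<lambda>a. res P (preim P p U) (U \<times> V) (com p U a));
             \<beta> = (\<lambda>b. res P (preim P q V) (U \<times> V) (com q V b))
         in generate_ring C (\<alpha> ` carrier A \<union> \<beta> ` carrier B) = carrier C \<and>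
            (\<forall>n a b. (\<forall>i<n. a i \<in> carrier A \<and> b i \<in> carrier B) \<and> lin_indep X U n a \<and>
               (\<Oplus>\<^bsub>C\<^esub>i\<in>{..<n}. \<alpha> (a i) \<otimes>\<^bsub>C\<^esub> \<beta> (b i)) = \<zero>\<^bsub>C\<^esub> \<longrightarrow> (\<forall>i<n. b i = \<zero>\<^bsub>B\<^esub>))))"

text \<open>\<open>h : T \<rightarrow> P\<close> is the morphism \<open>(f, g)\<close> into the product \<open>P\<close> of \<open>X\<close> and \<open>Y\<close>.\<close>

definition is_pairing ::
  "('t, 'r, 'k) kspace \<Rightarrow> ('x, 'r, 'k) kspace \<Rightarrow> ('y, 'r, 'k) kspace \<Rightarrow> ('x \<times> 'y, 'r, 'k) kspace \<Rightarrow>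
   ('x \<times> 'y, 'x, 'r) kmor \<Rightarrow> ('x \<times> 'y, 'y, 'r) kmor \<Rightarrow>
   ('t, 'x, 'r) kmor \<Rightarrow> ('t, 'y, 'r) kmor \<Rightarrow> ('t, 'x \<times> 'y, 'r) kmor \<Rightarrow> bool" where
  "is_pairing T X Y P p q f g h \<longleftrightarrow> morphism T P h \<and>
     mor_eq T X (mor_comp P p h) f \<and> mor_eq T Y (mor_comp P q h) g"


section \<open>Algebraic groups and actions\<close>

text \<open>An action of \<open>G\<close> on \<open>X\<close> is recorded with its product \<open>G \<times> X\<close>; an algebraic group
  with its action on itself by left translation, i.e. with its multiplication.\<close>

record ('g, 'x, 'r, 'k) kaction =
  prod_sp :: "('g \<times> 'x, 'r, 'k) kspace"
  pr1 :: "('g \<times> 'x, 'g, 'r) kmor"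
  pr2 :: "('g \<times> 'x, 'x, 'r) kmor"
  act :: "('g \<times> 'x, 'x, 'r) kmor"

record ('g, 'r, 'k) kgroup =
  grp_sp :: "('g, 'r, 'k) kspace"
  mult_act :: "('g, 'g, 'r, 'k) kaction"
  unit_pt :: 'g
  inv_mor :: "('g, 'g, 'r) kmor"

text \<open>The two axioms of an action as identities of morphisms \<open>G \<times> (G \<times> X) \<rightarrow> X\<close> and \<open>X \<rightarrow> X\<close>.
  In the first, with \<open>(g, (h, x)) \<in> T = G \<times> (G \<times> X)\<close>, the morphisms \<open>u\<close>, \<open>v\<close>, \<open>w\<close> are
  \<open>(g, h x)\<close>, \<open>(g, h)\<close> and \<open>(g h, x)\<close>.\<close>

definition is_action ::
  "('g, 'r, 'k::field) kgroup \<Rightarrow> ('x, 'r, 'k) kspace \<Rightarrow> ('g, 'x, 'r, 'k) kaction \<Rightarrow> bool" where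
  "is_action \<G> X \<A> \<longleftrightarrow>
     (let G = grp_sp \<G>; M = mult_act \<G>; GG = prod_sp M; P = prod_sp \<A> in
        is_product G X P (pr1 \<A>) (pr2 \<A>) \<and> morphism P X (act \<A>) \<and>
        (\<exists>T r s u v w. is_product G P T r s \<and>
           is_pairing T G X P (pr1 \<A>) (pr2 \<A>) r (mor_comp P (act \<A>) s) u \<and>
           is_pairing T G G GG (pr1 M) (pr2 M) r (mor_comp P (pr1 \<A>) s) v \<and>
           is_pairing T G X P (pr1 \<A>) (pr2 \<A>) (mor_comp GG (act M) v) (mor_comp P (pr2 \<A>) s) w \<and>
           mor_eq T X (mor_comp P (act \<A>) u) (mor_comp P (act \<A>) w)) \<and>
        (\<exists>u. is_pairing X G X P (pr1 \<A>) (pr2 \<A>) (mor_const X G (unit_pt \<G>)) mor_id u \<and>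
           mor_eq X X (mor_comp P (act \<A>) u) mor_id))"

definition algebraic_group :: "('g, 'r, 'k::field) kgroup \<Rightarrow> bool" where
  "algebraic_group \<G> \<longleftrightarrow>
     (let G = grp_sp \<G>; M = mult_act \<G>; GG = prod_sp M; e = mor_const G G (unit_pt \<G>);
          \<iota> = inv_mor \<G> in
        variety G \<and> unit_pt \<G> \<in> points G \<and> is_action \<G> G M \<and> morphism G G \<iota> \<and>
        (\<exists>u. is_pairing G G G GG (pr1 M) (pr2 M) mor_id e u \<and>
           mor_eq G G (mor_comp GG (act M) u) mor_id) \<and>
        (\<exists>u. is_pairing G G G GG (pr1 M) (pr2 M) \<iota> mor_id u \<and>
           mor_eq G G (mor_comp GG (act M) u) e) \<and>
        (\<exists>u. is_pairing G G G GG (pr1 M) (pr2 M) mor_id \<iota> u \<and>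
           mor_eq G G (mor_comp GG (act M) u) e))"

definition orbit :: "('g, 'r, 'k) kgroup \<Rightarrow> ('g, 'x, 'r, 'k) kaction \<Rightarrow> 'x \<Rightarrow> 'x set" where
  "orbit \<G> \<A> x = {pt (act \<A>) (g, x) | g. g \<in> points (grp_sp \<G>)}"

text \<open>Geometric quotient in the sense of Mumford: \<open>\<pi>\<close> is invariant, surjective with the orbits as
  fibres, submersive, and \<open>\<O>\<^sub>Y\<close> is the sheaf of invariants in \<open>\<pi>\<^sub>* \<O>\<^sub>X\<close>.\<close>

definition geometric_quotient ::
  "('g, 'r, 'k::field) kgroup \<Rightarrow> ('x, 'r, 'k) kspace \<Rightarrow> ('g, 'x, 'r, 'k) kaction \<Rightarrow>
   ('y, 'r, 'k) kspace \<Rightarrow> ('x, 'y, 'r) kmor \<Rightarrow> bool" where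
  "geometric_quotient \<G> X \<A> Y \<pi> \<longleftrightarrow> morphism X Y \<pi> \<and>
     mor_eq (prod_sp \<A>) Y (mor_comp X \<pi> (act \<A>)) (mor_comp X \<pi> (pr2 \<A>)) \<and>
     pt \<pi> ` points X = points Y \<and>
     (\<forall>x \<in> points X. \<forall>x' \<in> points X. pt \<pi> x' = pt \<pi> x \<longleftrightarrow> x' \<in> orbit \<G> \<A> x) \<and>
     (\<forall>V. V \<subseteq> points Y \<longrightarrow> (openin (zar Y) V \<longleftrightarrow> openin (zar X) (preim X \<pi> V))) \<and>
     (\<forall>V. openin (zar Y) V \<longrightarrow> bij_betw (com \<pi> V) (carrier (sec Y V))
        {f \<in> carrier (sec X (preim X \<pi> V)).
           com (act \<A>) (preim X \<pi> V) f = com (pr2 \<A>) (preim X \<pi> V) f})"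


section \<open>Rosenlicht stratifications, modality and parameter numbers\<close>

text \<open>A locally closed subscheme \<open>Z\<close> of \<open>X\<close>, with inclusion \<open>j\<close>: the topology is induced, and
  every section of \<open>\<O>\<^sub>Z\<close> is locally induced by a section of \<open>\<O>\<^sub>X\<close>. The scheme structure on the
  underlying set is not prescribed; it may be the reduced one.\<close>

definition subvariety ::
  "('x, 'r, 'k::field) kspace \<Rightarrow> ('x, 'r, 'k) kspace \<Rightarrow> ('x, 'x, 'r) kmor \<Rightarrow> bool" where
  "subvariety X Z j \<longleftrightarrow> variety Z \<and> locally_closed_in (zar X) (points Z) \<and>
     zar Z = subtopology (zar X) (points Z) \<and>
     morphism Z X j \<and> (\<forall>z \<in> points Z. pt j z = z) \<and>
     (\<forall>V s z. openin (zar Z) V \<and> s \<in> carrier (sec Z V) \<and> z \<in> V \<longrightarrow>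
        (\<exists>U a W. openin (zar X) U \<and> a \<in> carrier (sec X U) \<and> openin (zar Z) W \<and>
           z \<in> W \<and> W \<subseteq> U \<inter> V \<and> res Z (preim Z j U) W (com j U a) = res Z V W s))"

text \<open>A \<open>G\<close>-invariant subvariety \<open>Z\<close> of \<open>X\<close>: the action on \<open>X\<close> restricts to an action \<open>\<B>\<close> on \<open>Z\<close>;
  here \<open>u\<close> is the morphism \<open>id \<times> j : G \<times> Z \<rightarrow> G \<times> X\<close>.\<close>

definition invariant_subvariety ::
  "('g, 'r, 'k::field) kgroup \<Rightarrow> ('x, 'r, 'k) kspace \<Rightarrow> ('g, 'x, 'r, 'k) kaction \<Rightarrow>
   ('x, 'r, 'k) kspace \<Rightarrow> ('x, 'x, 'r) kmor \<Rightarrow> ('g, 'x, 'r, 'k) kaction \<Rightarrow> bool" where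
  "invariant_subvariety \<G> X \<A> Z j \<B> \<longleftrightarrow> subvariety X Z j \<and> is_action \<G> Z \<B> \<and>
     (\<exists>u. is_pairing (prod_sp \<B>) (grp_sp \<G>) X (prod_sp \<A>) (pr1 \<A>) (pr2 \<A>)
            (pr1 \<B>) (mor_comp Z j (pr2 \<B>)) u \<and>
          mor_eq (prod_sp \<B>) X (mor_comp (prod_sp \<A>) (act \<A>) u) (mor_comp Z j (act \<B>)))"

record ('g, 'x, 'y, 'r, 'k) stratum =
  str_sp :: "('x, 'r, 'k) kspace"
  str_inc :: "('x, 'x, 'r) kmor"
  str_act :: "('g, 'x, 'r, 'k) kaction"
  str_quot :: "('y, 'r, 'k) kspace"
  str_proj :: "('x, 'y, 'r) kmor"

definition rosenlicht_stratification ::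
  "('g, 'r, 'k::field) kgroup \<Rightarrow> ('x, 'r, 'k) kspace \<Rightarrow> ('g, 'x, 'r, 'k) kaction \<Rightarrow>
   nat \<Rightarrow> (nat \<Rightarrow> ('g, 'x, 'y, 'r, 'k) stratum) \<Rightarrow> bool" where
  "rosenlicht_stratification \<G> X \<A> s S \<longleftrightarrow>
     (\<Union>i\<in>{1..s}. points (str_sp (S i))) = points X \<and>
     disjoint_family_on (\<lambda>i. points (str_sp (S i))) {1..s} \<and>
     (\<forall>i\<in>{1..s}.
        invariant_subvariety \<G> X \<A> (str_sp (S i)) (str_inc (S i)) (str_act (S i)) \<and>
        (let Z = points (str_sp (S i));
             R = points X - (\<Union>j\<in>{1..<i}. points (str_sp (S j)))
         in openin (subtopology (zar X) R) Z \<and> (subtopology (zar X) R) closure_of Z = R) \<and>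
        variety (str_quot (S i)) \<and>
        geometric_quotient \<G> (str_sp (S i)) (str_act (S i)) (str_quot (S i)) (str_proj (S i)))"

definition G_mod :: "nat \<Rightarrow> (nat \<Rightarrow> ('g, 'x, 'y, 'r, 'k) stratum) \<Rightarrow> 'x set \<Rightarrow> ereal" where
  "G_mod s S U = Max ((\<lambda>i. dim_of (zar (str_quot (S i)))
     (pt (str_proj (S i)) ` (U \<inter> points (str_sp (S i))))) ` {1..s})"

text \<open>The minima over neighbourhoods are written as infima; they are attained, since the
  dimensions occurring are \<open>-\<infinity>\<close> or natural numbers.\<close>

definition G_mod_at ::
  "('x, 'r, 'k) kspace \<Rightarrow> nat \<Rightarrow> (nat \<Rightarrow> ('g, 'x, 'y, 'r, 'k) stratum) \<Rightarrow> 'x \<Rightarrow> ereal" where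
  "G_mod_at X s S x = Inf {G_mod s S U | U. openin (zar X) U \<and> x \<in> U}"

definition orbit_dim_locus ::
  "('g, 'r, 'k) kgroup \<Rightarrow> ('x, 'r, 'k) kspace \<Rightarrow> ('g, 'x, 'r, 'k) kaction \<Rightarrow>
   'x set \<Rightarrow> nat \<Rightarrow> 'x set" where
  "orbit_dim_locus \<G> X \<A> U i = {y \<in> U. dim_at (zar X) (U \<inter> orbit \<G> \<A> y) y = ereal (real i)}"

text \<open>The maximum over all \<open>i\<close> is a supremum in which only finitely many terms differ from
  \<open>-\<infinity>\<close>.\<close>

definition G_par ::
  "('g, 'r, 'k) kgroup \<Rightarrow> ('x, 'r, 'k) kspace \<Rightarrow> ('g, 'x, 'r, 'k) kaction \<Rightarrow> 'x set \<Rightarrow> ereal" where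
  "G_par \<G> X \<A> U = (SUP i. dim_of (zar X) (orbit_dim_locus \<G> X \<A> U i) - ereal (real i))"

definition G_par_at ::
  "('g, 'r, 'k) kgroup \<Rightarrow> ('x, 'r, 'k) kspace \<Rightarrow> ('g, 'x, 'r, 'k) kaction \<Rightarrow> 'x \<Rightarrow> ereal" where
  "G_par_at \<G> X \<A> x = Inf {G_par \<G> X \<A> U | U. openin (zar X) U \<and> x \<in> U}"

end

theory Submission
  imports Defs "HOL-Library.Function_Algebras" "HOL-Library.Poly_Mapping"
begin

text \<open>
  Over a dense open subset, the fibres of a dominant morphism \<open>E \<rightarrow> D\<close> of irreducible varieties have
  pure dimension \<open>dim E - dim D\<close>. On affine charts, write the algebra of functions as a tower of simple
  extensions. The number of transcendental steps is the dimension: homomorphisms into \<open>K\<close> extend along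
  the tower, which yields chains of closed sets of this length, and it is also the growth exponent of
  the algebra, which drops on proper closed subsets and so bounds all chains. The fibres of a geometric
  quotient are orbits, and orbits are homogeneous, so their dimension can be computed in any open set
  that they meet.

  If an irreducible set \<open>C\<close> of dimension \<open>n\<close> is contained in \<open>p\<^sub>t(U \<inter> X\<^sub>t)\<close>, a component of the
  preimage of its closure which dominates it has dimension at least \<open>n + k\<close>, where \<open>k\<close> is the
  dimension of its generic orbits, and a nonempty open subset of this component lies in \<open>U(k)\<close>.
  Conversely, an irreducible \<open>C \<subseteq> U(i)\<close> meets some \<open>X\<^sub>t\<close> densely, and the closure of its image under
  \<open>p\<^sub>t\<close> has dimension at least \<open>dim C - i\<close>; as \<open>p\<^sub>t\<close> is an open map, \<open>p\<^sub>t(U \<inter> X\<^sub>t)\<close> contains a nonempty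
  open subset of this closure.
\<close>

text \<open>The counts \<open>n\<close> and \<open>k\<close> are the numbers of transcendental steps
  of one concrete tower. Adjoining first the pulled back coordinates of the base (\<open>n\<close>
  steps) and then generators of the source (\<open>k\<close> further steps) makes additivity
  automatic: the concatenated tower belongs to the total space, its lower part to the image, its
  upper part to the fibres. Branching bounds each dimension from below by such a count, growth from
  above, so the choice of generators cannot matter.

  The obstacle is uniformity over the base. The fibre bounds must hold on a whole nonempty open set,
  so \<open>tower_branch\<close> and \<open>tower_growth\<close> produce one element outside the
  prime ideal before any point is chosen; it collects coefficients and eliminants, and everything
  specializes well where it is nonzero. Hence ideals stay subsets \<open>P\<close> of an ambient
  ring and denominators are cleared throughout.

  On the geometric side, a fibre of the quotient map restricted to one component is only part of an
  orbit. For the inequality from modality to parameters the generic fibre is therefore taken in an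
  open set that avoids the other components.\<close>

hide_const (open) up_ring.coeff up_ring.monom Polynomials.degree
  Polynomials.lead_coeff Module.smult

section \<open>Extension of algebra homomorphisms\<close>

text \<open>Over a finite field the product of all \<open>x - a\<close>, plus 1, would be
  nonconstant without a root. Infinitude is what turns a transcendental step into infinitely many
  specializations.\<close>

lemma infinite_alg_closed: "infinite (UNIV :: 'k::alg_closed_field set)"
proof
  assume fin: "finite (UNIV :: 'k set)"
  define p :: "'k poly" where "p = (\<Prod>a\<in>UNIV. [:- a, 1:]) + 1"
  have root: "poly p x = 1" for x
    using fin by (auto simp: p_def poly_prod prod_zero_iff)
  have "degree (\<Prod>a\<in>UNIV. [:- a, 1:] :: 'k poly) = card (UNIV :: 'k set)"
    by (simp add: degree_prod_eq_sum_degree)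
  moreover have "card (UNIV :: 'k set) > 0" using fin by (simp add: card_gt_0_iff)
  ultimately have "degree p > 0"
    unfolding p_def by (subst degree_add_eq_left) auto
  then obtain x where "poly p x = 0" using alg_closed_imp_poly_has_root by blast
  with root show False by simp
qed

text \<open>Algebras are subsets of one ambient ring, so towers of extensions stay within one type.
  The instances are the ring of all functions on a type of points (\<open>fa\<close>) and the
  polynomials in countably many variables (\<open>pm\<close>).\<close>

locale kalg =
  fixes \<kappa> :: "'k::alg_closed_field \<Rightarrow> 'b::comm_ring_1"
  assumes \<kappa>_1 [simp]: "\<kappa> 1 = 1"
    and \<kappa>_add: "\<kappa> (c + d) = \<kappa> c + \<kappa> d"
    and \<kappa>_mult: "\<kappa> (c * d) = \<kappa> c * \<kappa> d"
begin

lemma \<kappa>_0 [simp]: "\<kappa> 0 = 0"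
  using \<kappa>_add[of 0 0] by simp

lemma \<kappa>_uminus: "\<kappa> (- c) = - \<kappa> c"
  using \<kappa>_add[of c "- c"] by (simp add: eq_neg_iff_add_eq_0 add.commute)

lemma \<kappa>_power: "\<kappa> (c ^ n) = \<kappa> c ^ n"
  by (induction n) (auto simp: \<kappa>_mult)

section \<open>Subalgebras, simple extensions and ideals that are prime on a subalgebra\<close>

definition subalg :: "'b set \<Rightarrow> bool" where
  "subalg A \<longleftrightarrow> range \<kappa> \<subseteq> A \<and> (\<forall>x\<in>A. \<forall>y\<in>A. x + y \<in> A \<and> x * y \<in> A)"

lemma subalgD:
  assumes "subalg A"
  shows "\<kappa> c \<in> A" "0 \<in> A" "1 \<in> A" "x \<in> A \<Longrightarrow> y \<in> A \<Longrightarrow> x + y \<in> A"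
    "x \<in> A \<Longrightarrow> y \<in> A \<Longrightarrow> x * y \<in> A" "x \<in> A \<Longrightarrow> - x \<in> A"
    "x \<in> A \<Longrightarrow> y \<in> A \<Longrightarrow> x - y \<in> A" "x \<in> A \<Longrightarrow> x ^ n \<in> A"
    "(\<And>i. i \<in> I \<Longrightarrow> f i \<in> A) \<Longrightarrow> sum f I \<in> A"
proof -
  have k: "\<kappa> c \<in> A" for c using assms by (auto simp: subalg_def)
  show "\<kappa> c \<in> A" by (rule k)
  show 0: "0 \<in> A" and 1: "1 \<in> A" using k[of 0] k[of 1] by auto
  show p: "x + y \<in> A" if "x \<in> A" "y \<in> A" for x y using assms that by (auto simp: subalg_def)
  show m: "x * y \<in> A" if "x \<in> A" "y \<in> A" for x y using assms that by (auto simp: subalg_def)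
  show n: "- x \<in> A" if "x \<in> A" for x
    using m[OF k[of "- 1"] that] by (simp add: \<kappa>_uminus)
  show "x \<in> A \<Longrightarrow> y \<in> A \<Longrightarrow> x - y \<in> A" using p[of x "- y"] n[of y] by auto
  show "x \<in> A \<Longrightarrow> x ^ n \<in> A" by (induction n) (auto intro: m 1)
  show "(\<And>i. i \<in> I \<Longrightarrow> f i \<in> A) \<Longrightarrow> sum f I \<in> A"
    by (induction I rule: infinite_finite_induct) (auto intro: 0 p)
qed

lemma subalg_range: "subalg (range \<kappa>)"
  unfolding subalg_def by (auto simp flip: \<kappa>_add \<kappa>_mult)

definition polys :: "'b set \<Rightarrow> 'b poly set" where
  "polys A = {f. \<forall>i. coeff f i \<in> A}"

lemma polys_closed:
  assumes "subalg A"
  shows "0 \<in> polys A" "1 \<in> polys A" "f \<in> polys A \<Longrightarrow> g \<in> polys A \<Longrightarrow> f + g \<in> polys A"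
    "f \<in> polys A \<Longrightarrow> g \<in> polys A \<Longrightarrow> f - g \<in> polys A"
    "f \<in> polys A \<Longrightarrow> g \<in> polys A \<Longrightarrow> f * g \<in> polys A"
    "a \<in> A \<Longrightarrow> monom a n \<in> polys A" "a \<in> A \<Longrightarrow> f \<in> polys A \<Longrightarrow> smult a f \<in> polys A"
    "a \<in> A \<Longrightarrow> f \<in> polys A \<Longrightarrow> pCons a f \<in> polys A" "a \<in> A \<Longrightarrow> [:a:] \<in> polys A"
    "f \<in> polys A \<Longrightarrow> coeff f i \<in> A"
  using subalgD(1-8)[OF assms]
  by (auto simp: polys_def coeff_mult coeff_pCons intro!: subalgD(9)[OF assms] split: nat.splits)

definition adjoin :: "'b set \<Rightarrow> 'b \<Rightarrow> 'b set" where
  "adjoin A b = (\<lambda>f. poly f b) ` polys A"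

lemma adjoin_subalg:
  assumes "subalg A" shows "subalg (adjoin A b)"
proof -
  have "\<kappa> c \<in> adjoin A b" for c
  proof -
    have "[:\<kappa> c:] \<in> polys A" using assms by (simp add: polys_closed subalgD)
    then show ?thesis unfolding adjoin_def by (rule rev_image_eqI) simp
  qed
  moreover have "x + y \<in> adjoin A b \<and> x * y \<in> adjoin A b" if "x \<in> adjoin A b" "y \<in> adjoin A b" for x y
  proof -
    from that obtain f g where "f \<in> polys A" "g \<in> polys A" "x = poly f b" "y = poly g b"
      by (auto simp: adjoin_def)
    then have "x + y = poly (f + g) b" "x * y = poly (f * g) b" "f + g \<in> polys A" "f * g \<in> polys A"
      using assms by (simp_all add: polys_closed)
    then show ?thesis unfolding adjoin_def by blast
  qed
  ultimately show ?thesis by (auto simp: subalg_def)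
qed

lemma adjoin_superset:
  assumes "subalg A" shows "A \<subseteq> adjoin A b" "b \<in> adjoin A b"
proof -
  show "A \<subseteq> adjoin A b"
  proof
    fix x assume "x \<in> A"
    then have "[:x:] \<in> polys A" using assms by (simp add: polys_closed)
    then show "x \<in> adjoin A b" unfolding adjoin_def by (rule rev_image_eqI) simp
  qed
  have "[:0, 1:] \<in> polys A" using assms by (simp add: polys_closed subalgD)
  then show "b \<in> adjoin A b" unfolding adjoin_def by (rule rev_image_eqI) simp
qed

lemma adjoin_least:
  assumes "subalg R" "A \<subseteq> R" "b \<in> R" shows "adjoin A b \<subseteq> R"
proof
  fix x assume "x \<in> adjoin A b"
  then obtain f where f: "\<forall>i. coeff f i \<in> A" "x = poly f b" by (auto simp: adjoin_def polys_def)
  show "x \<in> R" unfolding f(2) poly_altdef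
    using assms f(1) by (intro subalgD(9)[OF assms(1)] subalgD(5)[OF assms(1)] subalgD(8)[OF assms(1)]) auto
qed

text \<open>An ideal of the ambient ring, tested for primality only on \<open>R\<close>. In the ring
  of all functions on a space, the functions vanishing on an irreducible set do not form a prime
  ideal in general; they become prime only against regular functions.\<close>

definition rel_prime :: "'b set \<Rightarrow> 'b set \<Rightarrow> bool" where
  "rel_prime R P \<longleftrightarrow> 0 \<in> P \<and> (\<forall>x\<in>P. \<forall>y\<in>P. x + y \<in> P) \<and> (\<forall>x\<in>P. \<forall>r. r * x \<in> P) \<and> 1 \<notin> P \<and>
     (\<forall>x\<in>R. \<forall>y\<in>R. x * y \<in> P \<longrightarrow> x \<in> P \<or> y \<in> P)"

lemma rel_primeD:
  assumes "rel_prime R P"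
  shows "0 \<in> P" "x \<in> P \<Longrightarrow> y \<in> P \<Longrightarrow> x + y \<in> P" "x \<in> P \<Longrightarrow> r * x \<in> P" "x \<in> P \<Longrightarrow> x * r \<in> P" "1 \<notin> P"
    "x \<in> R \<Longrightarrow> y \<in> R \<Longrightarrow> x * y \<in> P \<Longrightarrow> x \<in> P \<or> y \<in> P" "x \<in> P \<Longrightarrow> - x \<in> P"
    "x \<in> P \<Longrightarrow> y \<in> P \<Longrightarrow> x - y \<in> P" "(\<And>i. i \<in> I \<Longrightarrow> f i \<in> P) \<Longrightarrow> sum f I \<in> P"
proof -
  show 0: "0 \<in> P" and 1: "1 \<notin> P" using assms by (auto simp: rel_prime_def)
  show p: "x + y \<in> P" if "x \<in> P" "y \<in> P" for x y using assms that by (auto simp: rel_prime_def)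
  show m: "r * x \<in> P" if "x \<in> P" for x r using assms that by (auto simp: rel_prime_def)
  show "x * r \<in> P" if "x \<in> P" using m[OF that, of r] by (simp add: mult.commute)
  show "x \<in> P \<or> y \<in> P" if "x \<in> R" "y \<in> R" "x * y \<in> P"
    using assms that unfolding rel_prime_def by blast
  show n: "- x \<in> P" if "x \<in> P" for x
    using m[OF that, of "- 1"] by simp
  show "x - y \<in> P" if "x \<in> P" "y \<in> P" using p[OF that(1) n[OF that(2)]] by simp
  show "(\<And>i. i \<in> I \<Longrightarrow> f i \<in> P) \<Longrightarrow> sum f I \<in> P"
    by (induction I rule: infinite_finite_induct) (auto intro: 0 p)
qed

lemma rel_prime_power:
  assumes "subalg R" "rel_prime R P" "x \<in> R" "x ^ n \<in> P" shows "x \<in> P"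
  using assms(4)
proof (induction n)
  case (Suc n)
  then show ?case
    using rel_primeD(6)[OF assms(2,3) subalgD(8)[OF assms(1,3)], of n] by auto
qed (use rel_primeD[OF assms(2)] in auto)

lemma rel_prime_\<kappa>:
  assumes "rel_prime R P" "\<kappa> c \<in> P" shows "c = 0"
proof (rule ccontr)
  assume "c \<noteq> 0"
  then have "\<kappa> (inverse c) * \<kappa> c = 1" by (simp flip: \<kappa>_mult)
  then show False using rel_primeD(3,5)[OF assms(1)] assms(2) by metis
qed

lemma poly_in_P:
  assumes "rel_prime R P" "\<And>i. coeff f i \<in> P" shows "poly f b \<in> P"
  unfolding poly_altdef by (intro rel_primeD(9)[OF assms(1)] rel_primeD(4)[OF assms(1)] assms(2))

text \<open>Algebraicity over the fraction field of \<open>A\<close> modulo \<open>P\<close>, with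
  denominators cleared. Any coefficient outside \<open>P\<close> may witness nontriviality, since
  the leading one can be zero modulo \<open>P\<close>.\<close>

definition algebraic_over :: "'b set \<Rightarrow> 'b set \<Rightarrow> 'b \<Rightarrow> bool" where
  "algebraic_over P A b \<longleftrightarrow> (\<exists>f\<in>polys A. poly f b \<in> P \<and> (\<exists>i. coeff f i \<notin> P))"

text \<open>Leading terms that are zero modulo \<open>P\<close> are dropped one by one; the
  coefficient outside \<open>P\<close> stops this, and no residue modulo \<open>P\<close> changes.
  The degree of the result is then its degree modulo \<open>P\<close>.\<close>

lemma truncate_poly:
  assumes "subalg A" "rel_prime R P" "f \<in> polys A" "coeff f i \<notin> P"
  obtains g where "g \<in> polys A" "degree g \<le> degree f" "lead_coeff g \<notin> P"
    "\<And>i. coeff (g - f) i \<in> P"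
proof -
  have "\<exists>g\<in>polys A. degree g \<le> degree f \<and> lead_coeff g \<notin> P \<and> (\<forall>i. coeff (g - f) i \<in> P)"
    using assms(3,4)
  proof (induction "degree f" arbitrary: f rule: less_induct)
    case less
    show ?case
    proof (cases "lead_coeff f \<in> P")
      case False
      then show ?thesis using less.prems rel_primeD(1)[OF assms(2)] by (intro bexI[of _ f]) auto
    next
      case True
      let ?g = "f - monom (lead_coeff f) (degree f)"
      have "degree f \<noteq> 0"
      proof
        assume "degree f = 0"
        with True less.prems(2) rel_primeD(1)[OF assms(2)] show False by (cases i) (auto simp: coeff_eq_0)
      qed
      moreover have "degree ?g \<le> degree f" by (simp add: degree_diff_le degree_monom_le)
      moreover have "coeff ?g (degree f) = 0" by simp
      ultimately have deg: "degree ?g < degree f"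
        by (metis coeff_0 leading_coeff_0_iff nat_less_le degree_0 bot_nat_0.not_eq_extremum)
      have "coeff ?g i \<notin> P" using less.prems(2) True by auto
      moreover have "?g \<in> polys A" using less.prems assms(1) by (simp add: polys_closed)
      ultimately obtain h where h: "h \<in> polys A" "degree h \<le> degree ?g" "lead_coeff h \<notin> P"
        "\<forall>i. coeff (h - ?g) i \<in> P" using less.hyps[OF deg] by blast
      have "coeff (h - f) i \<in> P" for i
      proof -
        have "coeff (h - f) i = coeff (h - ?g) i - (if i = degree f then lead_coeff f else 0)"
          by auto
        moreover have "(if i = degree f then lead_coeff f else 0) \<in> P"
          using True rel_primeD(1)[OF assms(2)] by simp
        ultimately show ?thesis using h(4) rel_primeD(8)[OF assms(2)] by (simp only:)
      qed
      then show ?thesis using h deg by (intro bexI[of _ h]) auto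
    qed
  qed
  then show ?thesis using that by blast
qed

text \<open>The substitute for the minimal polynomial. A relation of smaller degree with a
  coefficient outside \<open>P\<close> could be truncated to one with a good leading coefficient,
  against the least choice of the degree.\<close>

lemma minimal_relation:
  assumes "subalg A" "rel_prime R P" "algebraic_over P A b"
  obtains p where "p \<in> polys A" "poly p b \<in> P" "lead_coeff p \<notin> P" "degree p > 0"
    "\<And>f i. f \<in> polys A \<Longrightarrow> poly f b \<in> P \<Longrightarrow> degree f < degree p \<Longrightarrow> coeff f i \<in> P"
proof -
  let ?Q = "\<lambda>d. \<exists>f\<in>polys A. poly f b \<in> P \<and> degree f = d \<and> lead_coeff f \<notin> P"
  have trunc: "\<exists>d\<le>degree f. ?Q d" if f: "f \<in> polys A" "poly f b \<in> P" "coeff f i \<notin> P" for f i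
  proof -
    obtain g where g: "g \<in> polys A" "degree g \<le> degree f" "lead_coeff g \<notin> P" "\<And>i. coeff (g - f) i \<in> P"
      using truncate_poly[OF assms(1,2) f(1,3)] by blast
    have "poly g b \<in> P" using rel_primeD(2)[OF assms(2) poly_in_P[OF assms(2) g(4)] f(2), of b] by simp
    with g show ?thesis by blast
  qed
  have ex: "\<exists>d. ?Q d" using assms(3) trunc unfolding algebraic_over_def by blast
  define d where "d = (LEAST d. ?Q d)"
  have "?Q d" unfolding d_def using ex by (rule LeastI_ex)
  then obtain p where p: "p \<in> polys A" "poly p b \<in> P" "degree p = d" "lead_coeff p \<notin> P" by blast
  have "degree p > 0"
  proof (rule ccontr)
    assume "\<not> degree p > 0"
    then obtain c where "p = [:c:]" by (metis degree_eq_zeroE neq0_conv)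
    with p show False by simp
  qed
  moreover have "coeff f i \<in> P" if f: "f \<in> polys A" "poly f b \<in> P" "degree f < degree p" for f i
  proof (rule ccontr)
    assume "coeff f i \<notin> P"
    then obtain d' where d': "d' \<le> degree f" "?Q d'" using trunc[OF f(1,2)] by blast
    have "d \<le> d'" unfolding d_def using d'(2) by (rule Least_le)
    then have "d \<le> degree f" using d'(1) by simp
    with f p show False by simp
  qed
  ultimately show ?thesis using that p by blast
qed

text \<open>Each cancellation of a top term multiplies by the leading coefficient of
  \<open>g\<close> instead of dividing by it; \<open>N\<close> counts these multiplications.\<close>

lemma pseudo_division:
  assumes "subalg A" "f \<in> polys A" "g \<in> polys A" "degree g > 0"
  obtains N s t where "s \<in> polys A" "t \<in> polys A" "degree t < degree g"
    "smult (lead_coeff g ^ N) f = g * s + t"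
proof -
  have "\<exists>N s t. s \<in> polys A \<and> t \<in> polys A \<and> degree t < degree g \<and> smult (lead_coeff g ^ N) f = g * s + t"
    using assms(2)
  proof (induction "degree f" arbitrary: f rule: less_induct)
    case less
    show ?case
    proof (cases "degree f < degree g")
      case True
      then show ?thesis using less.prems polys_closed(1)[OF assms(1)]
        by (intro exI[of _ "0::nat"] exI[of _ "0 :: 'b poly"] exI[of _ f]) auto
    next
      case False
      let ?m = "monom (lead_coeff f) (degree f - degree g)"
      let ?f = "smult (lead_coeff g) f - ?m * g"
      have m: "?m \<in> polys A" using less.prems assms(1) by (simp add: polys_closed)
      have f: "?f \<in> polys A" using less.prems assms m by (simp add: polys_closed)
      have "degree (?m * g) \<le> degree ?m + degree g" by (rule degree_mult_le)
      also have "\<dots> \<le> degree f" using False degree_monom_le[of "lead_coeff f" "degree f - degree g"] by linarith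
      finally have "degree ?f \<le> degree f" by (intro degree_diff_le) (auto simp: degree_smult_le)
      moreover have "coeff ?f (degree f) = 0"
        using False by (simp add: coeff_monom_mult mult.commute[of _ "lead_coeff g"])
      ultimately have deg: "degree ?f < degree f"
        using False assms(4) by (metis degree_0 leading_coeff_0_iff nat_less_le not_less order_le_less_trans)
      obtain N s t where st: "s \<in> polys A" "t \<in> polys A" "degree t < degree g"
        "smult (lead_coeff g ^ N) ?f = g * s + t" using less.hyps[OF deg f] by blast
      have "smult (lead_coeff g ^ Suc N) f = smult (lead_coeff g ^ N) ?f + smult (lead_coeff g ^ N) (?m * g)"
        by (simp add: smult_diff_right mult.commute)
      also have "\<dots> = (g * s + t) + smult (lead_coeff g ^ N) (?m * g)"
        by (simp only: st(4))
      also have "\<dots> = g * (s + smult (lead_coeff g ^ N) ?m) + t"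
        by (simp add: algebra_simps)
      finally have "smult (lead_coeff g ^ Suc N) f = g * (s + smult (lead_coeff g ^ N) ?m) + t" .
      moreover have "s + smult (lead_coeff g ^ N) ?m \<in> polys A"
        using st m assms by (simp add: polys_closed subalgD)
      ultimately show ?thesis using st by blast
    qed
  qed
  then show ?thesis using that by blast
qed

text \<open>A \<open>K\<close>-point of the spectrum of \<open>A\<close> modulo \<open>P\<close>.
  Functions on the whole ambient type are used, so that extending a homomorphism means prescribing
  values on a larger subset; agreement is always asked on \<open>A\<close> only.\<close>

definition hom_on :: "'b set \<Rightarrow> 'b set \<Rightarrow> ('b \<Rightarrow> 'k) \<Rightarrow> bool" where
  "hom_on P A \<phi> \<longleftrightarrow> (\<forall>c. \<phi> (\<kappa> c) = c) \<and> (\<forall>x\<in>A. \<forall>y\<in>A. \<phi> (x + y) = \<phi> x + \<phi> y \<and> \<phi> (x * y) = \<phi> x * \<phi> y) \<and>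
     (\<forall>x\<in>A. x \<in> P \<longrightarrow> \<phi> x = 0)"

lemma hom_onD:
  assumes "hom_on P A \<phi>"
  shows "\<phi> (\<kappa> c) = c" "x \<in> A \<Longrightarrow> y \<in> A \<Longrightarrow> \<phi> (x + y) = \<phi> x + \<phi> y"
    "x \<in> A \<Longrightarrow> y \<in> A \<Longrightarrow> \<phi> (x * y) = \<phi> x * \<phi> y" "x \<in> A \<Longrightarrow> x \<in> P \<Longrightarrow> \<phi> x = 0"
    "\<phi> 0 = 0" "\<phi> 1 = 1"
proof -
  show k: "\<phi> (\<kappa> c) = c" for c using assms by (simp add: hom_on_def)
  show "\<phi> 0 = 0" "\<phi> 1 = 1" using k[of 0] k[of 1] by simp_all
qed (use assms in \<open>simp_all add: hom_on_def\<close>)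

lemma hom_on_sum:
  assumes "subalg A" "hom_on P A \<phi>" "\<And>i. i \<in> I \<Longrightarrow> f i \<in> A"
  shows "\<phi> (sum f I) = (\<Sum>i\<in>I. \<phi> (f i))"
  using assms(3)
proof (induction I rule: infinite_finite_induct)
  case (insert x F)
  then have "sum f F \<in> A" by (intro subalgD(9)[OF assms(1)]) auto
  with insert show ?case using hom_onD(2)[OF assms(2)] by auto
qed (use hom_onD[OF assms(2)] in auto)

lemma hom_on_power:
  assumes "subalg A" "hom_on P A \<phi>" "x \<in> A"
  shows "\<phi> (x ^ n) = \<phi> x ^ n"
  by (induction n) (use hom_onD[OF assms(2)] subalgD[OF assms(1)] assms(3) in auto)

lemma hom_on_diff:
  assumes "subalg A" "hom_on P A \<phi>" "x \<in> A" "y \<in> A"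
  shows "\<phi> (x - y) = \<phi> x - \<phi> y"
  using hom_onD(2)[OF assms(2), of "x - y" y] assms subalgD(7)[OF assms(1)] by (simp add: algebra_simps)

lemma map_poly_hom:
  assumes "subalg A" "hom_on P A \<phi>" "f \<in> polys A" "g \<in> polys A"
  shows "map_poly \<phi> (f + g) = map_poly \<phi> f + map_poly \<phi> g"
    "map_poly \<phi> (f * g) = map_poly \<phi> f * map_poly \<phi> g"
proof -
  note [simp] = hom_onD(5)[OF assms(2)]
  show "map_poly \<phi> (f + g) = map_poly \<phi> f + map_poly \<phi> g"
    using assms by (intro poly_eqI) (simp add: coeff_map_poly hom_onD(2)[OF assms(2)] polys_closed)
  show "map_poly \<phi> (f * g) = map_poly \<phi> f * map_poly \<phi> g"
    using assms(1,3,4)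
    by (intro poly_eqI)
      (simp add: coeff_map_poly coeff_mult hom_on_sum[OF assms(1,2)] hom_onD(3)[OF assms(2)] polys_closed subalgD)
qed

text \<open>The value at \<open>poly f b\<close> is read off from an arbitrarily chosen representing
  polynomial. Condition \<open>wd\<close> says that \<open>v\<close> satisfies the specialization of
  each relation of \<open>b\<close> modulo \<open>P\<close>, which makes the value independent of
  that choice.\<close>

lemma extend_hom:
  assumes "subalg A" "hom_on P A \<phi>" 
    and wd: "\<And>f. f \<in> polys A \<Longrightarrow> poly f b \<in> P \<Longrightarrow> poly (map_poly \<phi> f) v = 0"
    and P: "rel_prime R P"
  obtains \<psi> where "hom_on P (adjoin A b) \<psi>" "\<And>x. x \<in> A \<Longrightarrow> \<psi> x = \<phi> x" "\<psi> b = v"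
    "\<And>f. f \<in> polys A \<Longrightarrow> \<psi> (poly f b) = poly (map_poly \<phi> f) v"
proof -
  note [simp] = hom_onD(5)[OF assms(2)] hom_onD(6)[OF assms(2)]
  define \<psi> where "\<psi> x = poly (map_poly \<phi> (SOME f. f \<in> polys A \<and> poly f b = x)) v" for x
  have \<psi>: "\<psi> (poly f b) = poly (map_poly \<phi> f) v" if f: "f \<in> polys A" for f
  proof -
    define g where "g = (SOME g. g \<in> polys A \<and> poly g b = poly f b)"
    have g: "g \<in> polys A \<and> poly g b = poly f b" unfolding g_def by (rule someI[of _ f]) (use f in auto)
    have "f - g \<in> polys A" using f g assms(1) by (simp add: polys_closed)
    moreover have "poly (f - g) b \<in> P" using g rel_primeD(1)[OF P] by simp
    ultimately have "poly (map_poly \<phi> (f - g)) v = 0" by (rule wd)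
    moreover have "map_poly \<phi> f = map_poly \<phi> (f - g) + map_poly \<phi> g"
      using map_poly_hom(1)[OF assms(1,2) \<open>f - g \<in> polys A\<close>, of g] g by simp
    ultimately show ?thesis unfolding \<psi>_def g_def[symmetric] by simp
  qed
  have A: "\<psi> x = \<phi> x" if "x \<in> A" for x
  proof -
    have "\<psi> (poly [:x:] b) = poly (map_poly \<phi> [:x:]) v" using that assms(1) by (intro \<psi>) (simp add: polys_closed)
    then show ?thesis by (simp add: map_poly_pCons)
  qed
  have "\<psi> (poly [:0,1:] b) = poly (map_poly \<phi> [:0,1:]) v" using assms(1) by (intro \<psi>) (simp add: polys_closed subalgD)
  then have b: "\<psi> b = v" by (simp add: map_poly_pCons)
  have "hom_on P (adjoin A b) \<psi>"
    unfolding hom_on_def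
  proof (intro conjI ballI allI impI)
    show "\<psi> (\<kappa> c) = c" for c using A[of "\<kappa> c"] subalgD(1)[OF assms(1)] hom_onD(1)[OF assms(2)] by auto
  next
    fix x y assume "x \<in> adjoin A b" "y \<in> adjoin A b"
    then obtain f g where fg: "f \<in> polys A" "g \<in> polys A" "x = poly f b" "y = poly g b"
      by (auto simp: adjoin_def)
    have "\<psi> (poly (f + g) b) = \<psi> x + \<psi> y" "\<psi> (poly (f * g) b) = \<psi> x * \<psi> y"
      using \<psi>[of "f + g"] \<psi>[of "f * g"] \<psi>[of f] \<psi>[of g] fg assms(1)
      by (simp_all add: polys_closed map_poly_hom[OF assms(1,2)] del: poly_add poly_mult)
        (simp_all add: poly_add poly_mult)
    then show "\<psi> (x + y) = \<psi> x + \<psi> y" "\<psi> (x * y) = \<psi> x * \<psi> y" using fg by simp_all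
  next
    fix x assume "x \<in> adjoin A b" "x \<in> P"
    then show "\<psi> x = 0" using \<psi> wd by (auto simp: adjoin_def)
  qed
  then show ?thesis using that A b \<psi> by blast
qed

end

section \<open>Generic extension of homomorphisms over a simple extension\<close>

context kalg
begin

text \<open>Over the fraction field, the extension by an algebraic \<open>b\<close> is a field, so
  \<open>g\<close> divides a nonzero constant; \<open>d\<close> is that constant with denominators
  cleared. The proof is the Euclidean algorithm for \<open>p\<close> and a polynomial of
  \<open>g\<close>, phrased as minimality of a degree: a gcd of positive degree would split off a
  cofactor of \<open>p\<close> that is a relation of \<open>b\<close> of smaller degree.\<close>

lemma bezout_minimal:
  assumes R: "subalg R" "rel_prime R P" and A: "subalg A" "A \<subseteq> R" "b \<in> R"
    and p: "p \<in> polys A" "poly p b \<in> P" "lead_coeff p \<notin> P" "degree p > 0"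
    and min': "\<forall>f\<in>polys A. poly f b \<in> P \<longrightarrow> degree f < degree p \<longrightarrow> (\<forall>i. coeff f i \<in> P)"
    and g: "g \<in> adjoin A b" "g \<notin> P"
  obtains d V where "d \<in> A" "d \<notin> P" "V \<in> polys A" "d - g * poly V b \<in> P"
proof -
  note P = rel_primeD[OF R(2)]
  have min: "coeff f i \<in> P" if "f \<in> polys A" "poly f b \<in> P" "degree f < degree p" for f i
    using min' that by blast
  have inR: "poly f b \<in> R" if "f \<in> polys A" for f
    using adjoin_least[OF R(1) A(2,3)] that by (auto simp: adjoin_def)
  \<comment> \<open>\<open>S H\<close> says that \<open>H\<close> represents a nonzero multiple of
    \<open>g\<close> modulo \<open>P\<close>; one of least degree \<open>h\<close> plays the
    gcd.\<close>
  define S where "S H \<longleftrightarrow> H \<in> polys A \<and> poly H b \<notin> P \<and> (\<exists>V\<in>polys A. poly H b - g * poly V b \<in> P)" for H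
  obtain G where G: "G \<in> polys A" "g = poly G b" using g(1) by (auto simp: adjoin_def)
  have "S G" unfolding S_def using G g(2) P(1) polys_closed(2)[OF A(1)]
    by (auto intro!: bexI[of _ 1])
  define h where "h = (LEAST n. \<exists>H. S H \<and> degree H = n)"
  have "\<exists>H. S H \<and> degree H = h" unfolding h_def by (rule LeastI_ex) (use \<open>S G\<close> in blast)
  then obtain H0 where H0: "S H0" "degree H0 = h" by blast
  have least: "h \<le> degree H" if "S H" for H
    unfolding h_def using that by (intro Least_le) blast
  have "\<exists>i. coeff H0 i \<notin> P"
    using H0(1) poly_in_P[OF R(2)] unfolding S_def by blast
  then obtain H where H: "H \<in> polys A" "degree H \<le> h" "lead_coeff H \<notin> P" "\<And>i. coeff (H - H0) i \<in> P"
    using truncate_poly[OF A(1) R(2), of H0] H0 unfolding S_def by metis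
  have HH0: "poly H b - poly H0 b \<in> P" using poly_in_P[OF R(2) H(4), of b] by simp
  obtain V where V: "V \<in> polys A" "poly H0 b - g * poly V b \<in> P" using H0(1) by (auto simp: S_def)
  have HV: "poly H b - g * poly V b \<in> P" using P(2)[OF HH0 V(2)] by simp
  have Hb: "poly H b \<notin> P"
  proof
    assume "poly H b \<in> P"
    from P(8)[OF this HH0] H0(1) show False by (simp add: S_def)
  qed
  have SH: "S H" unfolding S_def using H(1) Hb HV V(1) by blast
  have dH: "degree H = h" using least[OF SH] H(2) by simp
  \<comment> \<open>Reducing \<open>H\<close> modulo \<open>p\<close> changes
    \<open>poly H b\<close> only by a power of a leading coefficient and by elements of
    \<open>P\<close>, so the remainder would again satisfy \<open>S\<close>.\<close>
  have "h < degree p"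
  proof -
    obtain N s t where st: "s \<in> polys A" "t \<in> polys A" "degree t < degree p"
      "smult (lead_coeff p ^ N) H = p * s + t" using pseudo_division[OF A(1) H(1) p(1,4)] by blast
    let ?c = "lead_coeff p ^ N"
    have "?c * poly H b = poly p b * poly s b + poly t b"
      using arg_cong[OF st(4), of "\<lambda>f. poly f b"] by simp
    then have tb: "poly t b = ?c * poly H b - poly p b * poly s b" by simp
    have c: "lead_coeff p \<in> R" using p(1) A by (auto simp: polys_def)
    have "poly t b \<notin> P"
    proof
      assume "poly t b \<in> P"
      from P(2)[OF this P(4)[OF p(2), of "poly s b"]] have "?c * poly H b \<in> P" by (simp add: tb)
      then have "?c \<in> P" using P(6) Hb inR[OF H(1)] subalgD(8)[OF R(1) c] by blast
      then show False using rel_prime_power[OF R c] p(3) by blast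
    qed
    moreover have "poly t b - g * poly (smult ?c V) b = ?c * (poly H b - g * poly V b) - poly p b * poly s b"
      by (simp add: tb algebra_simps)
    then have "poly t b - g * poly (smult ?c V) b \<in> P"
      using P(8)[OF P(3)[OF HV, of ?c] P(4)[OF p(2), of "poly s b"]] by simp
    moreover have "smult ?c V \<in> polys A" using V(1) A(1) p(1) by (simp add: polys_closed subalgD)
    ultimately have "S t" unfolding S_def using st(2) by blast
    from least[OF this] st(3) show ?thesis by simp
  qed
  \<comment> \<open>Otherwise \<open>p\<close> is divided by \<open>H\<close>. By minimality of
    \<open>h\<close> the remainder \<open>t\<close> is zero at \<open>b\<close> modulo
    \<open>P\<close>, hence, its degree being below that of \<open>p\<close>, zero coefficientwise.
    So \<open>p\<close> is \<open>H * s\<close> up to a factor outside \<open>P\<close>, and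
    primality gives \<open>poly s b \<in> P\<close>.\<close>
  have "h = 0"
  proof (rule ccontr)
    assume "h \<noteq> 0"
    then have "degree H > 0" using dH by simp
    then obtain N s t where st: "s \<in> polys A" "t \<in> polys A" "degree t < degree H"
      "smult (lead_coeff H ^ N) p = H * s + t" using pseudo_division[OF A(1) p(1) H(1)] by blast
    let ?c = "lead_coeff H ^ N"
    have "?c * poly p b = poly H b * poly s b + poly t b"
      using arg_cong[OF st(4), of "\<lambda>f. poly f b"] by simp
    then have tb: "poly t b = ?c * poly p b - poly H b * poly s b" by simp
    have cH: "lead_coeff H \<in> R" using H(1) A by (auto simp: polys_def)
    have tP: "poly t b \<in> P"
    proof (rule ccontr)
      assume "poly t b \<notin> P"
      moreover have "poly t b - g * poly (- V * s) b = ?c * poly p b - (poly H b - g * poly V b) * poly s b"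
        by (simp add: tb algebra_simps)
      then have "poly t b - g * poly (- V * s) b \<in> P"
        using P(8)[OF P(3)[OF p(2), of ?c] P(4)[OF HV, of "poly s b"]] by simp
      moreover have "- V * s \<in> polys A"
        using polys_closed(4)[OF A(1) polys_closed(1)[OF A(1)] polys_closed(5)[OF A(1) V(1) st(1)]] by simp
      ultimately have "S t" unfolding S_def using st(2) by blast
      from least[OF this] st(3) dH show False by simp
    qed
    have tc: "coeff t i \<in> P" for i using min[OF st(2) tP] st(3) dH \<open>h < degree p\<close> by simp
    have "poly H b * poly s b = ?c * poly p b - poly t b" by (simp add: tb)
    then have "poly H b * poly s b \<in> P" using P(8)[OF P(3)[OF p(2), of ?c] tP] by simp
    then have sP: "poly s b \<in> P" using P(6) Hb inR H(1) st(1) by blast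
    have "\<exists>i. coeff s i \<notin> P"
    proof (rule ccontr)
      assume "\<nexists>i. coeff s i \<notin> P"
      then have "coeff (H * s) (degree p) \<in> P" unfolding coeff_mult by (intro P(9) P(3)) auto
      from P(2)[OF this tc] have "?c * lead_coeff p \<in> P"
        using arg_cong[OF st(4), of "\<lambda>f. coeff f (degree p)"] by simp
      moreover have "lead_coeff p \<in> R" using p(1) A by (auto simp: polys_def)
      ultimately have "?c \<in> P" using P(6) p(3) subalgD(8)[OF R(1) cH] by blast
      then show False using rel_prime_power[OF R cH] H(3) by blast
    qed
    then obtain s' where s': "s' \<in> polys A" "lead_coeff s' \<notin> P" "\<And>i. coeff (s' - s) i \<in> P"
      using truncate_poly[OF A(1) R(2) st(1)] by metis
    have "poly s' b \<in> P" using P(2)[OF poly_in_P[OF R(2) s'(3), of b] sP] by simp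
    \<comment> \<open>The coefficient at \<open>?n\<close> survives modulo \<open>P\<close>, so the
      degree of \<open>p\<close> is at least \<open>degree H + degree s'\<close>. Then
      \<open>s'\<close> is a relation of \<open>b\<close> of degree smaller than that of
      \<open>p\<close>, a contradiction.\<close>
    let ?n = "degree H + degree s'"
    have "coeff (H * s') ?n = lead_coeff H * lead_coeff s'" by (rule coeff_mult_degree_sum)
    moreover have "lead_coeff s' \<in> R" using s'(1) A by (auto simp: polys_def)
    ultimately have Hs': "coeff (H * s') ?n \<notin> P" using P(6)[OF cH, of "lead_coeff s'"] H(3) s'(2) by auto
    have Hd: "coeff (H * (s' - s)) ?n \<in> P" unfolding coeff_mult by (intro P(9) P(3) s'(3))
    have eq: "coeff (H * s') ?n = coeff (H * (s' - s)) ?n + (?c * coeff p ?n - coeff t ?n)"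
      using arg_cong[OF st(4), of "\<lambda>f. coeff f ?n"] by (simp add: algebra_simps)
    have "coeff p ?n \<notin> P"
    proof
      assume "coeff p ?n \<in> P"
      then have "?c * coeff p ?n - coeff t ?n \<in> P" by (intro P(8) P(3) tc)
      from P(2)[OF Hd this] have "coeff (H * s') ?n \<in> P" unfolding eq .
      with Hs' show False by blast
    qed
    then have "?n \<le> degree p" using P(1) coeff_eq_0[of p ?n] by (cases "?n \<le> degree p") auto
    then have "degree s' < degree p" using \<open>degree H > 0\<close> by simp
    from min[OF s'(1) \<open>poly s' b \<in> P\<close> this] s'(2) show False by blast
  qed
  then obtain d where d: "H = [:d:]" using dH by (metis degree_eq_zeroE)
  then have "d \<in> A" using H(1) polys_closed(10)[OF A(1), of H 0] by simp
  moreover have "d \<notin> P" "d - g * poly V b \<in> P" using d Hb HV by auto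
  ultimately show ?thesis using that V(1) by blast
qed

text \<open>In the algebraic case \<open>q\<close> is the leading coefficient of the minimal
  relation times the \<open>d\<close> of \<open>bezout_minimal\<close>: the first factor keeps the
  specialized relation nonconstant, hence solvable, and the second forces
  \<open>\<psi> g \<noteq> 0\<close>, as \<open>d\<close> is a multiple of \<open>g\<close> modulo
  \<open>P\<close>. In the transcendental case every \<open>v\<close> is allowed, and
  \<open>q\<close> is a coefficient of a polynomial for \<open>g\<close>, so that only the finitely
  many roots of its specialization are excluded.\<close>

lemma extension_step:
  assumes R: "subalg R" "rel_prime R P" and A: "subalg A" "A \<subseteq> R" "b \<in> R"
    and g: "g \<in> adjoin A b" "g \<notin> P"
  shows "\<exists>q\<in>A. q \<notin> P \<and> (\<forall>\<phi>. hom_on P A \<phi> \<longrightarrow> \<phi> q \<noteq> 0 \<longrightarrow>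
     (if algebraic_over P A b
      then \<exists>\<psi>. hom_on P (adjoin A b) \<psi> \<and> (\<forall>x\<in>A. \<psi> x = \<phi> x) \<and> \<psi> g \<noteq> 0
      else infinite {v. \<exists>\<psi>. hom_on P (adjoin A b) \<psi> \<and> (\<forall>x\<in>A. \<psi> x = \<phi> x) \<and> \<psi> b = v \<and> \<psi> g \<noteq> 0}))"
proof (cases "algebraic_over P A b")
  case True
  note P = rel_primeD[OF R(2)]
  obtain p where p: "p \<in> polys A" "poly p b \<in> P" "lead_coeff p \<notin> P" "degree p > 0"
    and min: "\<And>f i. f \<in> polys A \<Longrightarrow> poly f b \<in> P \<Longrightarrow> degree f < degree p \<Longrightarrow> coeff f i \<in> P"
    using minimal_relation[OF A(1) R(2) True] by metis
  obtain d V where d: "d \<in> A" "d \<notin> P" "V \<in> polys A" "d - g * poly V b \<in> P"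
    using bezout_minimal[OF R A p _ g] min by blast
  let ?c = "lead_coeff p"
  have c: "?c \<in> A" using p(1) by (simp add: polys_def)
  have "?c * d \<notin> P" using P(6) c d p(3) A(2) by blast
  moreover have "?c * d \<in> A" using c d A(1) by (simp add: subalgD)
  moreover have "\<exists>\<psi>. hom_on P (adjoin A b) \<psi> \<and> (\<forall>x\<in>A. \<psi> x = \<phi> x) \<and> \<psi> g \<noteq> 0"
    if \<phi>: "hom_on P A \<phi>" "\<phi> (?c * d) \<noteq> 0" for \<phi>
  proof -
    note hom = hom_onD[OF \<phi>(1)]
    have nz: "\<phi> ?c \<noteq> 0" "\<phi> d \<noteq> 0" using \<phi>(2) hom(3)[OF c d(1)] by auto
    have "coeff (map_poly \<phi> p) (degree p) \<noteq> 0" using nz hom(5) by (simp add: coeff_map_poly)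
    then have "degree (map_poly \<phi> p) \<ge> degree p" by (rule le_degree)
    then obtain v where v: "poly (map_poly \<phi> p) v = 0"
      using p(4) alg_closed_imp_poly_has_root[of "map_poly \<phi> p"] by auto
    \<comment> \<open>A root of the specialized minimal relation satisfies all specialized
      relations: pseudo-division by \<open>p\<close> leaves a remainder with coefficients in
      \<open>P\<close>, which \<open>\<phi>\<close> kills, and \<open>\<phi> ?c\<close> is
      nonzero.\<close>
    have wd: "poly (map_poly \<phi> f) v = 0" if f: "f \<in> polys A" "poly f b \<in> P" for f
    proof -
      obtain N s t where st: "s \<in> polys A" "t \<in> polys A" "degree t < degree p"
        "smult (?c ^ N) f = p * s + t" using pseudo_division[OF A(1) f(1) p(1,4)] by blast
      have "?c ^ N * poly f b = poly p b * poly s b + poly t b"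
        using arg_cong[OF st(4), of "\<lambda>f. poly f b"] by simp
      then have "poly t b = ?c ^ N * poly f b - poly p b * poly s b" by simp
      then have "poly t b \<in> P" using P(8)[OF P(3)[OF f(2)] P(4)[OF p(2)]] by simp
      then have "coeff t i \<in> P" for i using min[OF st(2)] st(3) by blast
      then have t0: "map_poly \<phi> t = 0"
        using st(2) hom(4,5) by (intro poly_eqI) (auto simp: coeff_map_poly polys_def)
      have cN: "[:?c ^ N:] \<in> polys A" using c A(1) by (simp add: polys_closed subalgD)
      have "map_poly \<phi> ([:?c ^ N:] * f) = map_poly \<phi> (p * s + t)" using st(4) by simp
      then have "map_poly \<phi> [:?c ^ N:] * map_poly \<phi> f = map_poly \<phi> p * map_poly \<phi> s"
        using map_poly_hom(2)[OF A(1) \<phi>(1) cN f(1)] map_poly_hom(2)[OF A(1) \<phi>(1) p(1) st(1)]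
          map_poly_hom(1)[OF A(1) \<phi>(1) polys_closed(5)[OF A(1) p(1) st(1)] st(2)] t0 by simp
      from arg_cong[OF this, of "\<lambda>f. poly f v"] have "\<phi> (?c ^ N) * poly (map_poly \<phi> f) v = 0"
        using v hom(5) by (simp add: map_poly_pCons)
      moreover have "\<phi> (?c ^ N) \<noteq> 0" using hom_on_power[OF A(1) \<phi>(1) c] nz by simp
      ultimately show ?thesis by simp
    qed
    obtain \<psi> where \<psi>: "hom_on P (adjoin A b) \<psi>" "\<And>x. x \<in> A \<Longrightarrow> \<psi> x = \<phi> x"
      using extend_hom[OF A(1) \<phi>(1) _ R(2)] wd by blast
    have "\<psi> g \<noteq> 0"
    proof
      assume g0: "\<psi> g = 0"
      have Vb: "poly V b \<in> adjoin A b" using d(3) by (auto simp: adjoin_def)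
      have dA: "d \<in> adjoin A b" using d(1) adjoin_superset[OF A(1)] by blast
      note sub = adjoin_subalg[OF A(1), of b]
      have "\<psi> (d - g * poly V b) = 0"
        using hom_onD(4)[OF \<psi>(1) _ d(4)] sub g(1) Vb dA by (simp add: subalgD)
      moreover have "\<psi> (d - g * poly V b) = \<psi> d - \<psi> g * \<psi> (poly V b)"
        using hom_on_diff[OF sub \<psi>(1) dA] hom_onD(3)[OF \<psi>(1)] g(1) Vb sub by (simp add: subalgD)
      ultimately show False using g0 nz \<psi>(2)[OF d(1)] by simp
    qed
    then show ?thesis using \<psi> by blast
  qed
  ultimately show ?thesis using True by (intro bexI[of _ "?c * d"]) auto
next
  case False
  obtain G where G: "G \<in> polys A" "g = poly G b" using g(1) by (auto simp: adjoin_def)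
  obtain i where i: "coeff G i \<notin> P" using poly_in_P[OF R(2)] G(2) g(2) by blast
  have "coeff G i \<in> A" using G by (simp add: polys_def)
  moreover have "infinite {v. \<exists>\<psi>. hom_on P (adjoin A b) \<psi> \<and> (\<forall>x\<in>A. \<psi> x = \<phi> x) \<and> \<psi> b = v \<and> \<psi> g \<noteq> 0}"
    (is "infinite ?S") if \<phi>: "hom_on P A \<phi>" "\<phi> (coeff G i) \<noteq> 0" for \<phi>
  proof
    assume fin: "finite ?S"
    note hom = hom_onD[OF \<phi>(1)]
    have "coeff (map_poly \<phi> G) i \<noteq> 0" using \<phi>(2) hom(5) by (simp add: coeff_map_poly)
    then have "map_poly \<phi> G \<noteq> 0" by auto
    then have fin0: "finite {v. poly (map_poly \<phi> G) v = 0}" by (rule poly_roots_finite)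
    have "v \<in> ?S" if v: "poly (map_poly \<phi> G) v \<noteq> 0" for v
    proof -
      have wd: "poly (map_poly \<phi> f) v = 0" if f: "f \<in> polys A" "poly f b \<in> P" for f
      proof -
        have "coeff f i \<in> P" for i using False f unfolding algebraic_over_def by blast
        then have "map_poly \<phi> f = 0"
          using f(1) hom(4,5) by (intro poly_eqI) (auto simp: coeff_map_poly polys_def)
        then show ?thesis by simp
      qed
      obtain \<psi> where "hom_on P (adjoin A b) \<psi>" "\<And>x. x \<in> A \<Longrightarrow> \<psi> x = \<phi> x" "\<psi> b = v"
        "\<And>f. f \<in> polys A \<Longrightarrow> \<psi> (poly f b) = poly (map_poly \<phi> f) v"
        using extend_hom[OF A(1) \<phi>(1) _ R(2)] wd by blast
      then show ?thesis using v G by auto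
    qed
    then have "(UNIV :: 'k set) \<subseteq> ?S \<union> {v. poly (map_poly \<phi> G) v = 0}" by blast
    then have "finite (UNIV :: 'k set)" by (rule finite_subset) (use fin fin0 in simp)
    with infinite_alg_closed[where 'k = 'k] show False by (rule notE)
  qed
  ultimately show ?thesis using i False by (intro bexI[of _ "coeff G i"]) auto
qed

text \<open>\<open>k\<close> is the transcendence degree modulo \<open>P\<close>, recorded as a
  count bound to the given list of generators and its order.\<close>

inductive tower :: "'b set \<Rightarrow> 'b set \<Rightarrow> 'b list \<Rightarrow> nat \<Rightarrow> bool" for P where
  Nil: "tower P A [] 0"
| algebraic: "algebraic_over P A b \<Longrightarrow> tower P (adjoin A b) bs k \<Longrightarrow> tower P A (b # bs) k"
| transcendental: "\<not> algebraic_over P A b \<Longrightarrow> tower P (adjoin A b) bs k \<Longrightarrow> tower P A (b # bs) (Suc k)"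

lemma tower_exists: "\<exists>k. tower P A bs k"
proof (induction bs arbitrary: A)
  case (Cons b bs)
  then show ?case by (metis tower.intros(2,3))
qed (auto intro: tower.intros)

abbreviation adjoin_list :: "'b set \<Rightarrow> 'b list \<Rightarrow> 'b set" where
  "adjoin_list \<equiv> foldl adjoin"

lemma adjoin_list_subalg: "subalg A \<Longrightarrow> subalg (adjoin_list A bs)"
  by (induction bs arbitrary: A) (auto intro: adjoin_subalg)

lemma adjoin_list_superset: "subalg A \<Longrightarrow> A \<subseteq> adjoin_list A bs \<and> set bs \<subseteq> adjoin_list A bs"
proof (induction bs arbitrary: A)
  case (Cons b bs)
  from Cons.IH[OF adjoin_subalg[OF Cons.prems, of b]] adjoin_superset[OF Cons.prems, of b]
  show ?case by auto
qed auto

lemma adjoin_list_least: "subalg R \<Longrightarrow> subalg A \<Longrightarrow> A \<subseteq> R \<Longrightarrow> set bs \<subseteq> R \<Longrightarrow> adjoin_list A bs \<subseteq> R"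
proof (induction bs arbitrary: A)
  case (Cons b bs)
  then show ?case using adjoin_least[OF Cons.prems(1,3), of b] adjoin_subalg[OF Cons.prems(2)] by simp
qed auto

lemma tower_append:
  "tower P A bs n \<Longrightarrow> tower P (adjoin_list A bs) cs k \<Longrightarrow> tower P A (bs @ cs) (n + k)"
  by (induction rule: tower.induct) (auto intro: tower.intros)

end

text \<open>\<open>branch k Z\<close> says that \<open>Z\<close> can be split \<open>k\<close> times along infinitely many values of a
  function; for closed \<open>Z\<close> in a Noetherian space this forces \<open>dim Z \<ge> k\<close>.\<close>

fun branch :: "('p \<Rightarrow> 'b \<Rightarrow> 'k) \<Rightarrow> 'b set \<Rightarrow> nat \<Rightarrow> 'p set \<Rightarrow> bool" where
  "branch e R 0 Z \<longleftrightarrow> Z \<noteq> {}"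
| "branch e R (Suc k) Z \<longleftrightarrow> (\<exists>b\<in>R. infinite {v. branch e R k {z\<in>Z. e z b = v}})"

text \<open>Branching sees only the values on \<open>R\<close>. This carries it from sets of
  homomorphisms to the points that realize them.\<close>

lemma branch_transfer:
  assumes "branch e R k Z" "\<And>z. z \<in> Z \<Longrightarrow> \<exists>z'\<in>Z'. \<forall>f\<in>R. e' z' f = e z f"
  shows "branch e' R k Z'"
  using assms
proof (induction k arbitrary: Z Z')
  case (Suc k)
  then obtain b where b: "b \<in> R" "infinite {v. branch e R k {z\<in>Z. e z b = v}}" by auto
  have "branch e' R k {z\<in>Z'. e' z b = v}" if "branch e R k {z\<in>Z. e z b = v}" for v
    using that by (rule Suc.IH) (use Suc.prems(2) b(1) in fastforce)
  then have "{v. branch e R k {z\<in>Z. e z b = v}} \<subseteq> {v. branch e' R k {z\<in>Z'. e' z b = v}}" by blast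
  with b show ?case using infinite_super by auto
qed fastforce

lemma branch_mono: "branch e R k Z \<Longrightarrow> Z \<subseteq> Z' \<Longrightarrow> branch e R k Z'"
  by (erule branch_transfer) auto

context kalg
begin

text \<open>The condition \<open>g\<close> at the top is pushed down the tower by
  \<open>extension_step\<close>, one simple extension at a time, until a single condition
  \<open>q\<close> on the base is left. Going up again, an algebraic step offers one extension and a
  transcendental step infinitely many values of \<open>b\<close>, which is one level of
  branching.\<close>

theorem tower_branch:
  assumes "subalg R" "rel_prime R P" "subalg A" "set bs \<subseteq> R" "A \<subseteq> R" "tower P A bs k"
    "g \<in> adjoin_list A bs" "g \<notin> P"
  obtains q where "q \<in> A" "q \<notin> P"
    "\<And>\<phi>. hom_on P A \<phi> \<Longrightarrow> \<phi> q \<noteq> 0 \<Longrightarrow>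
       branch (\<lambda>\<psi>. \<psi>) R k {\<psi>. hom_on P (adjoin_list A bs) \<psi> \<and> (\<forall>x\<in>A. \<psi> x = \<phi> x) \<and> \<psi> g \<noteq> 0}"
proof -
  have "\<exists>q\<in>A. q \<notin> P \<and> (\<forall>\<phi>. hom_on P A \<phi> \<longrightarrow> \<phi> q \<noteq> 0 \<longrightarrow>
       branch (\<lambda>\<psi>. \<psi>) R k {\<psi>. hom_on P (adjoin_list A bs) \<psi> \<and> (\<forall>x\<in>A. \<psi> x = \<phi> x) \<and> \<psi> g \<noteq> 0})"
    using assms(6,3-5,7,8)
  proof (induction rule: tower.induct)
    case (Nil A)
    then show ?case by auto
  next
    case (algebraic A b bs k)
    let ?B = "adjoin_list (adjoin A b) bs"
    note sub = adjoin_subalg[OF algebraic.prems(1), of b]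
    note AB = adjoin_superset[OF algebraic.prems(1), of b]
    have b: "b \<in> R" "adjoin A b \<subseteq> R" "set bs \<subseteq> R"
      using algebraic.prems(2,3) adjoin_least[OF assms(1) algebraic.prems(3)] by auto
    obtain g1 where g1: "g1 \<in> adjoin A b" "g1 \<notin> P" "\<And>\<phi>. hom_on P (adjoin A b) \<phi> \<Longrightarrow> \<phi> g1 \<noteq> 0 \<Longrightarrow>
       branch (\<lambda>\<psi>. \<psi>) R k {\<psi>. hom_on P ?B \<psi> \<and> (\<forall>x\<in>adjoin A b. \<psi> x = \<phi> x) \<and> \<psi> g \<noteq> 0}"
      using algebraic.IH[OF sub b(3,2)] algebraic.prems(4,5) by auto
    obtain q where q: "q \<in> A" "q \<notin> P" "\<And>\<phi>. hom_on P A \<phi> \<Longrightarrow> \<phi> q \<noteq> 0 \<Longrightarrow>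
       \<exists>\<psi>. hom_on P (adjoin A b) \<psi> \<and> (\<forall>x\<in>A. \<psi> x = \<phi> x) \<and> \<psi> g1 \<noteq> 0"
      using extension_step[OF assms(1,2) algebraic.prems(1,3) b(1) g1(1,2)] algebraic.hyps(1) by auto
    have "branch (\<lambda>\<psi>. \<psi>) R k {\<psi>. hom_on P ?B \<psi> \<and> (\<forall>x\<in>A. \<psi> x = \<phi> x) \<and> \<psi> g \<noteq> 0}"
      if \<phi>: "hom_on P A \<phi>" "\<phi> q \<noteq> 0" for \<phi>
    proof -
      obtain \<psi>1 where \<psi>1: "hom_on P (adjoin A b) \<psi>1" "\<forall>x\<in>A. \<psi>1 x = \<phi> x" "\<psi>1 g1 \<noteq> 0"
        using q(3)[OF \<phi>] by blast
      show ?thesis by (rule branch_mono[OF g1(3)[OF \<psi>1(1,3)]]) (use \<psi>1(2) AB in auto)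
    qed
    then show ?case using q by auto
  next
    case (transcendental A b bs k)
    let ?B = "adjoin_list (adjoin A b) bs"
    note sub = adjoin_subalg[OF transcendental.prems(1), of b]
    note AB = adjoin_superset[OF transcendental.prems(1), of b]
    have b: "b \<in> R" "adjoin A b \<subseteq> R" "set bs \<subseteq> R"
      using transcendental.prems(2,3) adjoin_least[OF assms(1) transcendental.prems(3)] by auto
    obtain g1 where g1: "g1 \<in> adjoin A b" "g1 \<notin> P" "\<And>\<phi>. hom_on P (adjoin A b) \<phi> \<Longrightarrow> \<phi> g1 \<noteq> 0 \<Longrightarrow>
       branch (\<lambda>\<psi>. \<psi>) R k {\<psi>. hom_on P ?B \<psi> \<and> (\<forall>x\<in>adjoin A b. \<psi> x = \<phi> x) \<and> \<psi> g \<noteq> 0}"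
      using transcendental.IH[OF sub b(3,2)] transcendental.prems(4,5) by auto
    obtain q where q: "q \<in> A" "q \<notin> P" "\<And>\<phi>. hom_on P A \<phi> \<Longrightarrow> \<phi> q \<noteq> 0 \<Longrightarrow>
       infinite {v. \<exists>\<psi>. hom_on P (adjoin A b) \<psi> \<and> (\<forall>x\<in>A. \<psi> x = \<phi> x) \<and> \<psi> b = v \<and> \<psi> g1 \<noteq> 0}"
      using extension_step[OF assms(1,2) transcendental.prems(1,3) b(1) g1(1,2)] transcendental.hyps(1) by auto
    have "branch (\<lambda>\<psi>. \<psi>) R (Suc k) {\<psi>. hom_on P ?B \<psi> \<and> (\<forall>x\<in>A. \<psi> x = \<phi> x) \<and> \<psi> g \<noteq> 0}"
      (is "branch _ _ _ ?Z") if \<phi>: "hom_on P A \<phi>" "\<phi> q \<noteq> 0" for \<phi>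
    proof -
      have "branch (\<lambda>\<psi>. \<psi>) R k {\<psi>\<in>?Z. \<psi> b = v}"
        if v: "\<exists>\<psi>. hom_on P (adjoin A b) \<psi> \<and> (\<forall>x\<in>A. \<psi> x = \<phi> x) \<and> \<psi> b = v \<and> \<psi> g1 \<noteq> 0" for v
      proof -
        obtain \<psi>1 where \<psi>1: "hom_on P (adjoin A b) \<psi>1" "\<forall>x\<in>A. \<psi>1 x = \<phi> x" "\<psi>1 b = v" "\<psi>1 g1 \<noteq> 0"
          using v by blast
        show ?thesis by (rule branch_mono[OF g1(3)[OF \<psi>1(1,4)]]) (use \<psi>1(2,3) AB in auto)
      qed
      then have "{v. \<exists>\<psi>. hom_on P (adjoin A b) \<psi> \<and> (\<forall>x\<in>A. \<psi> x = \<phi> x) \<and> \<psi> b = v \<and> \<psi> g1 \<noteq> 0}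
         \<subseteq> {v. branch (\<lambda>\<psi>. \<psi>) R k {\<psi>\<in>?Z. \<psi> b = v}}" by blast
      from infinite_super[OF this q(3)[OF \<phi>]] show ?thesis using b(1) by auto
    qed
    then show ?case using q by auto
  qed
  then show ?thesis using that by blast
qed

end

subsection \<open>The Hilbert basis theorem\<close>

text \<open>Combinations are built one term at a time with coefficients from a subset
  \<open>B\<close>. For a subalgebra \<open>B\<close> containing \<open>S\<close> this is the ideal
  generated in \<open>B\<close>, not the one generated in the ambient type.\<close>

inductive_set idl :: "'c::comm_ring_1 set \<Rightarrow> 'c set \<Rightarrow> 'c set" for B S where
  zero: "0 \<in> idl B S"
| step: "h \<in> idl B S \<Longrightarrow> u \<in> B \<Longrightarrow> s \<in> S \<Longrightarrow> h + u * s \<in> idl B S"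

lemma idl_add:
  assumes "x \<in> idl B S" "y \<in> idl B S" shows "x + y \<in> idl B S"
  using assms(2)
proof (induction rule: idl.induct)
  case (step h u s)
  then show ?case using idl.step[of "x + h" B S u s] by (simp add: add.assoc)
qed (use assms(1) in simp)

lemma idl_base: "s \<in> S \<Longrightarrow> u \<in> B \<Longrightarrow> u * s \<in> idl B S"
  using idl.step[OF idl.zero, of u B s S] by simp

lemma idl_mult:
  assumes "\<And>x y. x \<in> B \<Longrightarrow> y \<in> B \<Longrightarrow> x * y \<in> B" "x \<in> idl B S" "u \<in> B"
  shows "u * x \<in> idl B S"
  using assms(2)
proof (induction rule: idl.induct)
  case (step h v s)
  then show ?case using idl.step[of "u * h" B S "u * v" s] assms by (simp add: algebra_simps)
qed (simp add: idl.zero)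

lemma idl_mono: "x \<in> idl B S \<Longrightarrow> S \<subseteq> T \<Longrightarrow> x \<in> idl B T"
  by (induction rule: idl.induct) (auto intro: idl.intros)

lemma idl_finite:
  assumes "x \<in> idl B (range a)"
  obtains M :: nat where "x \<in> idl B (a ` {..<M})"
proof -
  have "\<exists>M. x \<in> idl B (a ` {..<M})" using assms
  proof (induction rule: idl.induct)
    case zero
    show ?case using idl.zero by blast
  next
    case (step h u s)
    then obtain M n where M: "h \<in> idl B (a ` {..<M})" "s = a n" by blast
    have "h \<in> idl B (a ` {..<max M (Suc n)})" using M(1) by (rule idl_mono) auto
    then have "h + u * s \<in> idl B (a ` {..<max M (Suc n)})" using M(2) step by (intro idl.step) auto
    then show ?case by blast
  qed
  then show ?thesis using that by blast
qed

text \<open>The ascending chain condition for ideals generated by initial segments of a sequence.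
  This form directly refutes strictly descending closed sets, whose separating functions come as a
  sequence.\<close>

definition noeth :: "'c::comm_ring_1 set \<Rightarrow> bool" where
  "noeth A \<longleftrightarrow> (\<forall>a :: nat \<Rightarrow> 'c. range a \<subseteq> A \<longrightarrow> (\<exists>m. a m \<in> idl A (a ` {..<m})))"

context kalg
begin

lemma noeth_field: "noeth (range \<kappa>)"
  unfolding noeth_def
proof (intro allI impI)
  fix a :: "nat \<Rightarrow> 'b" assume a: "range a \<subseteq> range \<kappa>"
  show "\<exists>m. a m \<in> idl (range \<kappa>) (a ` {..<m})"
  proof (cases "a 0 = 0")
    case True
    then show ?thesis using idl.zero by (intro exI[of _ 0]) simp
  next
    case False
    obtain c d where cd: "a 0 = \<kappa> c" "a 1 = \<kappa> d" using a by blast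
    with False have "c \<noteq> 0" by auto
    then have "a 1 = \<kappa> (d / c) * a 0" using cd by (simp flip: \<kappa>_mult)
    then show ?thesis using idl_base[of "a 0" "a ` {..<1}" "\<kappa> (d / c)" "range \<kappa>"] by (intro exI[of _ 1]) auto
  qed
qed

text \<open>Hilbert's basis theorem for polynomials over \<open>A\<close>, transported along
  evaluation at \<open>b\<close>. Generators are picked with least degree outside the ideal of the
  earlier ones; if this never ended, the leading coefficients would contradict
  \<open>noeth A\<close>.\<close>

theorem noeth_adjoin:
  assumes A: "subalg A" and noe: "noeth A"
  shows "noeth (adjoin A b)"
  unfolding noeth_def
proof (intro allI impI)
  fix x :: "nat \<Rightarrow> 'b" assume x: "range x \<subseteq> adjoin A b"
  note pc = polys_closed[OF A]
  note sub = adjoin_subalg[OF A, of b]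
  have mulB: "u * v \<in> adjoin A b" if "u \<in> adjoin A b" "v \<in> adjoin A b" for u v
    by (rule subalgD(5)[OF sub that])
  \<comment> \<open>The preimage in the polynomial ring of the ideal generated by the whole
    sequence; degrees and leading coefficients are available only there.\<close>
  define I where "I = {f\<in>polys A. poly f b \<in> idl (adjoin A b) (range x)}"
  have evA: "poly f b \<in> adjoin A b" if "f \<in> polys A" for f using that by (auto simp: adjoin_def)
  have I_add: "f + u * g \<in> I" if "f \<in> I" "u \<in> polys A" "g \<in> I" for f u g
  proof -
    have "f + u * g \<in> polys A" using that pc(3,5) by (simp add: I_def)
    moreover have "poly u b * poly g b \<in> idl (adjoin A b) (range x)"
      using that(3) by (intro idl_mult[OF mulB _ evA[OF that(2)]]) (simp_all add: I_def)
    then have "poly (f + u * g) b \<in> idl (adjoin A b) (range x)"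
      using that(1) by (simp add: I_def idl_add)
    ultimately show ?thesis by (simp add: I_def)
  qed
  have I_idl: "h \<in> I" if "h \<in> idl (polys A) S" "S \<subseteq> I" for h S
    using that(1)
  proof (induction rule: idl.induct)
    case zero
    show ?case using pc(1) by (simp add: I_def idl.zero)
  next
    case (step h u s)
    then show ?case using I_add that(2) by blast
  qed
  define pick where "pick S = arg_min degree (\<lambda>f. f \<in> I \<and> f \<notin> idl (polys A) S)" for S
  define G where "G = rec_nat {} (\<lambda>_ S. insert (pick S) S)"
  have G: "G 0 = {}" "G (Suc n) = insert (pick (G n)) (G n)" for n by (simp_all add: G_def)
  define g where "g n = pick (G n)" for n
  have Gg: "G n = g ` {..<n}" for n by (induction n) (auto simp: G g_def lessThan_Suc)
  have ex: "\<exists>n. I \<subseteq> idl (polys A) (G n)"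
  proof (rule ccontr)
    assume no: "\<nexists>n. I \<subseteq> idl (polys A) (G n)"
    have gI: "g n \<in> I \<and> g n \<notin> idl (polys A) (G n)" for n
    proof -
      obtain f where "f \<in> I" "f \<notin> idl (polys A) (G n)" using no by blast
      then show ?thesis unfolding g_def pick_def
        using arg_min_natI[of "\<lambda>f. f \<in> I \<and> f \<notin> idl (polys A) (G n)" f degree] by blast
    qed
    have min: "degree (g n) \<le> degree f" if "f \<in> I" "f \<notin> idl (polys A) (G n)" for n f
      unfolding g_def pick_def using that by (intro arg_min_nat_le) auto
    have mono: "degree (g i) \<le> degree (g n)" if "i \<le> n" for i n
    proof (rule min)
      show "g n \<notin> idl (polys A) (G i)"
        using gI[of n] idl_mono[of "g n" "polys A" "G i" "G n"] that by (force simp: Gg)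
    qed (use gI in simp)
    have gA: "g n \<in> polys A" for n using gI by (auto simp: I_def)
    have "range (\<lambda>n. lead_coeff (g n)) \<subseteq> A" using gA by (auto simp: polys_def)
    then obtain m where m: "lead_coeff (g m) \<in> idl A ((\<lambda>n. lead_coeff (g n)) ` {..<m})"
      using noe unfolding noeth_def by blast
    let ?D = "degree (g m)"
    \<comment> \<open>A relation among leading coefficients is lifted to polynomials by multiplying
      with powers of the variable, which is possible as the degrees of the \<open>g i\<close> do not
      decrease. Subtracting \<open>H\<close> lowers the degree of \<open>g m\<close> but keeps it
      outside the ideal of the earlier generators.\<close>
    have "\<exists>H\<in>idl (polys A) (G m). degree H \<le> ?D \<and> coeff H ?D = c"
      if "c \<in> idl A ((\<lambda>n. lead_coeff (g n)) ` {..<m})" for c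
      using that
    proof (induction rule: idl.induct)
      case zero
      then show ?case by (intro bexI[of _ 0]) (auto intro: idl.zero)
    next
      case (step h u s)
      then obtain H i where H: "H \<in> idl (polys A) (G m)" "degree H \<le> ?D" "coeff H ?D = h"
        "i < m" "s = lead_coeff (g i)" by auto
      let ?H = "H + monom u (?D - degree (g i)) * g i"
      have le: "degree (g i) \<le> ?D" using mono H(4) by simp
      have "?H \<in> idl (polys A) (G m)" using H step.hyps pc(6) by (intro idl.step) (auto simp: Gg)
      moreover have "degree ?H \<le> ?D"
      proof (intro degree_add_le H(2))
        have "degree (monom u (?D - degree (g i)) * g i) \<le> degree (monom u (?D - degree (g i))) + degree (g i)"
          by (rule degree_mult_le)
        also have "\<dots> \<le> ?D" using degree_monom_le[of u "?D - degree (g i)"] le by linarith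
        finally show "degree (monom u (?D - degree (g i)) * g i) \<le> ?D" .
      qed
      moreover have "coeff ?H ?D = h + u * s" using H le by (simp add: coeff_monom_mult)
      ultimately show ?case by blast
    qed
    from this[OF m] obtain H where H: "H \<in> idl (polys A) (G m)" "degree H \<le> ?D" "coeff H ?D = lead_coeff (g m)"
      by blast
    have HI: "H \<in> I" by (rule I_idl[OF H(1)]) (use gI in \<open>auto simp: Gg\<close>)
    let ?h = "g m - H"
    have "?h \<in> I" using I_add[of "g m" "- 1" H] gI HI pc(4)[OF pc(1) pc(2)] by simp
    moreover have "?h \<notin> idl (polys A) (G m)" using idl_add[of ?h "polys A" "G m" H] H(1) gI by auto
    moreover from this have "?h \<noteq> 0" by (metis idl.zero)
    then have "degree ?h < ?D"
    proof -
      have le: "degree ?h \<le> ?D" using H(2) by (intro degree_diff_le) auto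
      have "degree ?h \<noteq> ?D"
      proof
        assume "degree ?h = ?D"
        then have "lead_coeff ?h = 0" using H(3) by simp
        then have "?h = 0" by (simp only: leading_coeff_0_iff)
        with \<open>?h \<noteq> 0\<close> show False by contradiction
      qed
      with le show ?thesis by simp
    qed
    ultimately show False using min[of ?h m] by auto
  qed
  define N where "N = (LEAST n. I \<subseteq> idl (polys A) (G n))"
  have N: "I \<subseteq> idl (polys A) (G N)" unfolding N_def by (rule LeastI_ex[OF ex])
  have gI: "g n \<in> I" if "n < N" for n
  proof -
    have "\<not> I \<subseteq> idl (polys A) (G n)" using not_less_Least that unfolding N_def by blast
    then obtain f where "f \<in> I" "f \<notin> idl (polys A) (G n)" by blast
    then show ?thesis unfolding g_def pick_def
      using arg_min_natI[of "\<lambda>f. f \<in> I \<and> f \<notin> idl (polys A) (G n)" f degree] by blast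
  qed
  have "\<forall>n. \<exists>M. g n \<in> I \<longrightarrow> poly (g n) b \<in> idl (adjoin A b) (x ` {..<M})"
    using idl_finite unfolding I_def by blast
  then obtain M where M: "\<And>n. g n \<in> I \<Longrightarrow> poly (g n) b \<in> idl (adjoin A b) (x ` {..<M n})" by metis
  \<comment> \<open>Each of the finitely many generators needs only finitely many members of the
    sequence. All of these lie before index \<open>L\<close>, so \<open>x L\<close> depends on its
    predecessors.\<close>
  define L where "L = Max (M ` {..N})"
  have L: "poly (g n) b \<in> idl (adjoin A b) (x ` {..<L})" if "n < N" for n
  proof (rule idl_mono[OF M[OF gI[OF that]]])
    have "M n \<le> L" using that unfolding L_def by (intro Max_ge) auto
    then show "x ` {..<M n} \<subseteq> x ` {..<L}" by auto
  qed
  have GN: "poly f b \<in> idl (adjoin A b) (x ` {..<L})" if "f \<in> idl (polys A) (G N)" for f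
    using that
  proof (induction rule: idl.induct)
    case (step h u s)
    then have "poly s b \<in> idl (adjoin A b) (x ` {..<L})" using L by (auto simp: Gg)
    then have "poly u b * poly s b \<in> idl (adjoin A b) (x ` {..<L})"
      by (intro idl_mult[OF mulB] evA step.hyps)
    from idl_add[OF step.IH this] show ?case by simp
  qed (simp add: idl.zero)
  obtain f where f: "f \<in> polys A" "x L = poly f b" using x by (auto simp: adjoin_def)
  have "1 * x L \<in> idl (adjoin A b) (range x)" using subalgD(3)[OF sub] by (intro idl_base) auto
  then have "f \<in> I" using f by (simp add: I_def)
  then have "x L \<in> idl (adjoin A b) (x ` {..<L})" using N GN[of f] f(2) by auto
  then show "\<exists>m. x m \<in> idl (adjoin A b) (x ` {..<m})" ..
qed

lemma noeth_adjoin_list: "subalg A \<Longrightarrow> noeth A \<Longrightarrow> noeth (adjoin_list A bs)"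
proof (induction bs arbitrary: A)
  case (Cons b bs)
  show ?case using Cons.IH[OF adjoin_subalg[OF Cons.prems(1)] noeth_adjoin[OF Cons.prems]] by simp
qed simp

end

section \<open>Growth of algebras\<close>

context kalg
begin

section \<open>Bounds for the linear dimension of subsets\<close>

sublocale vs: vector_space "\<lambda>c x. \<kappa> c * x"
  by unfold_locales (simp_all add: \<kappa>_add \<kappa>_mult algebra_simps)

text \<open>A family instead of a set: the products counted in \<open>growth_drop\<close> are
  indexed by pairs, and their distinctness is a consequence of independence.\<close>

definition indep_family :: "'i set \<Rightarrow> ('i \<Rightarrow> 'b) \<Rightarrow> bool" where
  "indep_family I v \<longleftrightarrow> (\<forall>c. (\<Sum>i\<in>I. \<kappa> (c i) * v i) = 0 \<longrightarrow> (\<forall>i\<in>I. c i = 0))"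

lemma indep_family_card_le:
  assumes "finite I" "indep_family I v" "v ` I \<subseteq> vs.span T" "finite T"
  shows "card I \<le> card T"
proof -
  have inj: "inj_on v I"
  proof (rule inj_onI, rule ccontr)
    fix i j assume ij: "i \<in> I" "j \<in> I" "v i = v j" "i \<noteq> j"
    let ?c = "\<lambda>k. if k = i then 1 else if k = j then - 1 else (0 :: 'k)"
    have "(\<Sum>k\<in>I. \<kappa> (?c k) * v k) = (\<Sum>k\<in>{i, j}. \<kappa> (?c k) * v k)"
      using assms(1) ij by (intro sum.mono_neutral_right) auto
    also have "\<dots> = 0" using ij by (simp add: \<kappa>_uminus)
    finally have "(\<Sum>k\<in>I. \<kappa> (?c k) * v k) = 0" .
    then have "?c i = 0" using assms(2)[unfolded indep_family_def, rule_format, of ?c i] ij(1) by blast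
    then show False by simp
  qed
  have "\<not> vs.dependent (v ` I)"
  proof
    assume "vs.dependent (v ` I)"
    then obtain u w where u: "w \<in> v ` I" "u w \<noteq> 0" "(\<Sum>w\<in>v ` I. \<kappa> (u w) * w) = 0"
      using vs.dependent_finite[of "v ` I"] assms(1) by blast
    then have "(\<Sum>i\<in>I. \<kappa> (u (v i)) * v i) = 0" using inj by (simp add: sum.reindex)
    then have "\<forall>i\<in>I. u (v i) = 0" using assms(2)[unfolded indep_family_def, rule_format, of "\<lambda>i. u (v i)"] by blast
    with u show False by blast
  qed
  with vs.independent_span_bound[OF assms(4) this assms(3)] inj show ?thesis
    by (simp add: card_image)
qed

lemma indep_family_id: "finite B \<Longrightarrow> \<not> vs.dependent B \<Longrightarrow> indep_family B (\<lambda>x. x)"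
  unfolding indep_family_def using vs.dependent_finite[of B] by blast

text \<open>A bound for the dimension of the span of \<open>V\<close>; the sets of products to which
  it is applied are not subspaces.\<close>

definition dimle :: "'b set \<Rightarrow> nat \<Rightarrow> bool" where
  "dimle V M \<longleftrightarrow> (\<exists>T. finite T \<and> card T \<le> M \<and> V \<subseteq> vs.span T)"

lemma dimleI:
  assumes "\<And>B. finite B \<Longrightarrow> \<not> vs.dependent B \<Longrightarrow> B \<subseteq> V \<Longrightarrow> card B \<le> M"
  shows "dimle V M"
proof -
  obtain B where B: "B \<subseteq> V" "\<not> vs.dependent B" "V \<subseteq> vs.span B"
    by (rule vs.maximal_independent_subset)
  have "finite B"
  proof (rule ccontr)
    assume "infinite B"
    then obtain B' where "B' \<subseteq> B" "finite B'" "card B' = Suc M" using infinite_arbitrarily_large by blast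
    with assms[of B'] B vs.independent_mono[of B B'] show False by auto
  qed
  with assms[of B] B show ?thesis unfolding dimle_def by blast
qed

lemma dimle_card: "dimle V M \<Longrightarrow> finite I \<Longrightarrow> indep_family I v \<Longrightarrow> v ` I \<subseteq> V \<Longrightarrow> card I \<le> M"
proof -
  assume d: "dimle V M" and I: "finite I" "indep_family I v" "v ` I \<subseteq> V"
  from d obtain T where T: "finite T" "card T \<le> M" "V \<subseteq> vs.span T" unfolding dimle_def by blast
  have "card I \<le> card T" by (rule indep_family_card_le[OF I(1,2) _ T(1)]) (use I(3) T(3) in blast)
  with T(2) show ?thesis by simp
qed

definition is_domain :: "'b set \<Rightarrow> bool" where
  "is_domain A \<longleftrightarrow> (\<forall>x\<in>A. \<forall>y\<in>A. x * y = 0 \<longrightarrow> x = 0 \<or> y = 0)"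

lemma is_domain_power: "subalg A \<Longrightarrow> is_domain A \<Longrightarrow> c \<in> A \<Longrightarrow> c \<noteq> 0 \<Longrightarrow> c ^ n \<noteq> 0"
proof (induction n)
  case (Suc n)
  then show ?case using subalgD(8)[OF Suc.prems(1,3), of n] unfolding is_domain_def by auto
qed simp

text \<open>Multiplication by \<open>c\<close> is injective and linear on the domain
  \<open>A\<close>, so it preserves independence. This undoes the clearing of denominators.\<close>

lemma dimle_cancel:
  assumes A: "subalg A" "is_domain A" and c: "c \<in> A" "c \<noteq> 0" and V: "V \<subseteq> A"
    and d: "dimle ((*) c ` V) M"
  shows "dimle V M"
proof (rule dimleI)
  fix B assume B: "finite B" "\<not> vs.dependent B" "B \<subseteq> V"
  have "indep_family B ((*) c)"
    unfolding indep_family_def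
  proof (intro allI impI)
    fix a assume "(\<Sum>i\<in>B. \<kappa> (a i) * (c * i)) = 0"
    then have "c * (\<Sum>i\<in>B. \<kappa> (a i) * i) = 0" by (simp add: sum_distrib_left mult.left_commute)
    moreover have "(\<Sum>i\<in>B. \<kappa> (a i) * i) \<in> A"
      using B V subalgD(1,5)[OF A(1)] by (intro subalgD(9)[OF A(1)]) blast
    ultimately have "(\<Sum>i\<in>B. \<kappa> (a i) * i) = 0" using A(2) c unfolding is_domain_def by blast
    then show "\<forall>i\<in>B. a i = 0" using indep_family_id[OF B(1,2)] unfolding indep_family_def by blast
  qed
  then show "card B \<le> M" using dimle_card[OF d B(1)] B(3) by blast
qed

section \<open>Polynomial growth and simple extensions\<close>

definition Fpow :: "'b set \<Rightarrow> nat \<Rightarrow> 'b set" where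
  "Fpow F s = {prod_list xs | xs. set xs \<subseteq> F \<and> length xs \<le> s}"

lemma Fpow_mult: "x \<in> Fpow F s \<Longrightarrow> y \<in> Fpow F t \<Longrightarrow> x * y \<in> Fpow F (s + t)"
proof -
  assume "x \<in> Fpow F s" "y \<in> Fpow F t"
  then obtain xs ys where "set (xs @ ys) \<subseteq> F" "length (xs @ ys) \<le> s + t" "x * y = prod_list (xs @ ys)"
    unfolding Fpow_def by force
  then show ?thesis unfolding Fpow_def by blast
qed

lemma Fpow_mono: "x \<in> Fpow F s \<Longrightarrow> F \<subseteq> G \<Longrightarrow> s \<le> t \<Longrightarrow> x \<in> Fpow G t"
  unfolding Fpow_def by (auto 0 3)

lemma Fpow_1: "1 \<in> Fpow F s"
  unfolding Fpow_def by (auto intro!: exI[of _ "[]"])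

lemma Fpow_base: "x \<in> F \<Longrightarrow> x \<in> Fpow F (Suc 0)"
  unfolding Fpow_def by (auto intro!: exI[of _ "[x]"])

lemma Fpow_power: "x \<in> F \<Longrightarrow> x ^ n \<in> Fpow F n"
proof (induction n)
  case (Suc n)
  then show ?case using Fpow_mult[OF Fpow_base[of x F], of "x ^ n" n] by simp
qed (simp add: Fpow_1)

lemma Fpow_subset:
  assumes "subalg A" "F \<subseteq> A" shows "Fpow F s \<subseteq> A"
proof -
  have "set xs \<subseteq> F \<Longrightarrow> prod_list xs \<in> A" for xs
    by (induction xs) (use assms subalgD(3,5)[OF assms(1)] in auto)
  then show ?thesis by (auto simp: Fpow_def)
qed

text \<open>A bound from above on the Gelfand-Kirillov dimension. Quantifying over all finite
  \<open>F\<close> makes it independent of a choice of generators. At \<open>s = 0\<close> the empty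
  product spans a line while \<open>0 ^ l\<close> is 0 for positive \<open>l\<close>, hence the
  restriction to \<open>s \<ge> 1\<close>.\<close>

definition growth :: "'b set \<Rightarrow> nat \<Rightarrow> bool" where
  "growth A l \<longleftrightarrow> (\<forall>F. finite F \<and> F \<subseteq> A \<longrightarrow> (\<exists>C. \<forall>s\<ge>1. dimle (Fpow F s) (C * s ^ l)))"

lemma growthD: "growth A l \<Longrightarrow> finite F \<Longrightarrow> F \<subseteq> A \<Longrightarrow> \<exists>C. \<forall>s\<ge>1. dimle (Fpow F s) (C * s ^ l)"
  unfolding growth_def by blast

lemma growth_field: "growth (range \<kappa>) 0"
  unfolding growth_def
proof (intro allI impI, intro exI[of _ 1] allI impI)
  fix F and s :: nat assume "finite F \<and> F \<subseteq> range \<kappa>"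
  then have "Fpow F s \<subseteq> range \<kappa>" using Fpow_subset[OF subalg_range] by blast
  also have "range \<kappa> \<subseteq> vs.span {1}"
    using vs.span_scale[OF vs.span_base[of 1 "{1}"]] by auto
  finally show "dimle (Fpow F s) (1 * s ^ 0)" unfolding dimle_def by (intro exI[of _ "{1}"]) auto
qed

lemma mult_span:
  assumes "\<And>y. y \<in> S \<Longrightarrow> x * y \<in> vs.span T" "y \<in> vs.span S"
  shows "x * y \<in> vs.span T"
  using assms(2)
proof (induction rule: vs.span_induct_alt)
  case (step c a b)
  then show ?case
    using vs.span_add[OF vs.span_scale[OF assms(1)[OF step(1)], of c] step(2)] by (simp add: algebra_simps)
qed (simp add: vs.span_zero)

text \<open>Each element of \<open>F\<close> is written as a polynomial in \<open>b\<close> and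
  products are multiplied out: \<open>s\<close> factors bring \<open>s\<close> coefficients and an
  exponent of at most \<open>d * s\<close>, where \<open>d\<close> bounds the degrees and
  \<open>G\<close> collects the coefficients.\<close>

lemma Fpow_adjoin:
  assumes "finite F" "F \<subseteq> adjoin A b"
  shows "\<exists>G d. finite G \<and> G \<subseteq> A \<and>
    (\<forall>s. Fpow F s \<subseteq> vs.span {\<gamma> * b ^ i | \<gamma> i. \<gamma> \<in> Fpow G s \<and> i \<le> d * s})"
proof -
  have "\<forall>f\<in>F. \<exists>p\<in>polys A. f = poly p b" using assms(2) by (auto simp: adjoin_def)
  from bchoice[OF this[unfolded Bex_def]]
  obtain p where p: "\<And>f. f \<in> F \<Longrightarrow> p f \<in> polys A" "\<And>f. f \<in> F \<Longrightarrow> f = poly (p f) b" by blast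
  define d where "d = Max (insert 0 ((\<lambda>f. degree (p f)) ` F))"
  have d: "degree (p f) \<le> d" if "f \<in> F" for f unfolding d_def using that assms(1) by (intro Max_ge) auto
  define G where "G = (\<Union>f\<in>F. coeff (p f) ` {..d})"
  have f_eq: "f = (\<Sum>k\<le>degree (p f). coeff (p f) k * b ^ k)" if "f \<in> F" for f
    using p(2)[OF that] unfolding poly_altdef .
  let ?S = "\<lambda>s. {\<gamma> * b ^ i | \<gamma> i. \<gamma> \<in> Fpow G s \<and> i \<le> d * s}"
  have pl: "prod_list xs \<in> vs.span (?S (length xs))" if "set xs \<subseteq> F" for xs
    using that
  proof (induction xs)
    case Nil
    have "(1 :: 'b) = 1 * b ^ 0" by simp
    then have "1 \<in> ?S (length [])" using Fpow_1 by blast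
    then show ?case by (simp add: vs.span_base)
  next
    case (Cons f xs)
    then have f: "f \<in> F" by simp
    have "f * prod_list xs \<in> vs.span (?S (Suc (length xs)))"
    proof (rule mult_span[OF _ Cons.IH])
      show "set xs \<subseteq> F" using Cons.prems by simp
    next
      fix y assume "y \<in> ?S (length xs)"
      then obtain \<gamma> i where y: "\<gamma> \<in> Fpow G (length xs)" "i \<le> d * length xs" "y = \<gamma> * b ^ i" by blast
      have "f * y = (\<Sum>k\<le>degree (p f). coeff (p f) k * b ^ k) * y" using f_eq[OF f] by simp
      also have "\<dots> = (\<Sum>k\<le>degree (p f). (coeff (p f) k * \<gamma>) * b ^ (k + i))"
        unfolding y(3) sum_distrib_right by (simp add: algebra_simps power_add)
      also have "\<dots> \<in> vs.span (?S (Suc (length xs)))"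
      proof (intro vs.span_sum vs.span_base)
        fix k assume "k \<in> {..degree (p f)}"
        then have k: "k \<le> d" using d[OF f] by simp
        then have "coeff (p f) k \<in> G" using f by (auto simp: G_def)
        then have "coeff (p f) k * \<gamma> \<in> Fpow G (Suc (length xs))"
          using Fpow_mult[OF Fpow_base y(1)] by simp
        moreover have "k + i \<le> d * Suc (length xs)" using k y(2) by simp
        ultimately show "coeff (p f) k * \<gamma> * b ^ (k + i) \<in> ?S (Suc (length xs))" by blast
      qed
      finally show "f * y \<in> vs.span (?S (Suc (length xs)))" .
    qed
    then show ?case by simp
  qed
  have mono: "?S m \<subseteq> ?S s" if "m \<le> s" for m s
  proof -
    have "d * m \<le> d * s" using that by simp
    then show ?thesis using Fpow_mono[of _ G m G s] that by (blast intro: order_trans)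
  qed
  have "Fpow F s \<subseteq> vs.span (?S s)" for s
  proof
    fix x assume "x \<in> Fpow F s"
    then obtain xs where xs: "set xs \<subseteq> F" "length xs \<le> s" "x = prod_list xs" unfolding Fpow_def by blast
    then show "x \<in> vs.span (?S s)" using pl[OF xs(1)] vs.span_mono[OF mono[OF xs(2)]] by blast
  qed
  moreover have "finite G" "G \<subseteq> A" using assms(1) p(1) by (auto simp: G_def polys_def)
  ultimately show ?thesis by blast
qed

lemma span_powers_card:
  assumes "V \<subseteq> vs.span T" "finite T" "finite I"
  obtains T' where "finite T'" "card T' \<le> card T * card I"
    "{\<gamma> * b ^ i | \<gamma> i. \<gamma> \<in> V \<and> i \<in> I} \<subseteq> vs.span T'"
proof
  let ?T = "(\<lambda>(\<tau>, i). \<tau> * b ^ i) ` (T \<times> I)"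
  show "finite ?T" using assms by simp
  show "card ?T \<le> card T * card I" using card_image_le[of "T \<times> I"] assms by (simp add: card_cartesian_product)
  show "{\<gamma> * b ^ i | \<gamma> i. \<gamma> \<in> V \<and> i \<in> I} \<subseteq> vs.span ?T"
  proof
    fix x assume "x \<in> {\<gamma> * b ^ i | \<gamma> i. \<gamma> \<in> V \<and> i \<in> I}"
    then obtain \<gamma> i where x: "\<gamma> \<in> V" "i \<in> I" "x = b ^ i * \<gamma>" by (auto simp: mult.commute)
    show "x \<in> vs.span ?T" unfolding x(3)
    proof (rule mult_span)
      show "\<gamma> \<in> vs.span T" using x assms by blast
      show "b ^ i * y \<in> vs.span ?T" if "y \<in> T" for y
        using that x(2) by (intro vs.span_base) (auto simp: mult.commute)
    qed
  qed
qed

text \<open>The exponents \<open>i \<le> d * s\<close> of \<open>b\<close> contribute one more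
  factor that is linear in \<open>s\<close>.\<close>

lemma growth_adjoin:
  assumes "growth A l" shows "growth (adjoin A b) (Suc l)"
  unfolding growth_def
proof (intro allI impI)
  fix F assume F: "finite F \<and> F \<subseteq> adjoin A b"
  then obtain G d where G: "finite G" "G \<subseteq> A"
    "\<And>s. Fpow F s \<subseteq> vs.span {\<gamma> * b ^ i | \<gamma> i. \<gamma> \<in> Fpow G s \<and> i \<le> d * s}"
    using Fpow_adjoin[of F A b] by blast
  then obtain C where C: "\<And>s. s \<ge> 1 \<Longrightarrow> dimle (Fpow G s) (C * s ^ l)"
    using growthD[OF assms G(1,2)] by blast
  have "dimle (Fpow F s) (C * (d + 1) * s ^ Suc l)" if s: "s \<ge> 1" for s
  proof -
    obtain T where T: "finite T" "card T \<le> C * s ^ l" "Fpow G s \<subseteq> vs.span T"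
      using C[OF s] unfolding dimle_def by blast
    obtain T' where T': "finite T'" "card T' \<le> card T * card {..d * s}"
      "{\<gamma> * b ^ i | \<gamma> i. \<gamma> \<in> Fpow G s \<and> i \<in> {..d * s}} \<subseteq> vs.span T'"
      using span_powers_card[OF T(3,1), of "{..d * s}"] by blast
    have "card T' \<le> (C * s ^ l) * (d * s + 1)" using T'(2) mult_le_mono1[OF T(2), of "d * s + 1"] by simp
    also have "\<dots> \<le> (C * s ^ l) * ((d + 1) * s)" using s by (intro mult_le_mono) auto
    finally have "card T' \<le> C * (d + 1) * s ^ Suc l" by (simp add: algebra_simps)
    moreover have "Fpow F s \<subseteq> vs.span T'"
    proof -
      have "Fpow F s \<subseteq> vs.span (vs.span T')" using G(3)[of s] vs.span_mono[OF T'(3)] by auto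
      then show ?thesis by (simp add: vs.span_span)
    qed
    ultimately show ?thesis using T'(1) unfolding dimle_def by blast
  qed
  then show "\<exists>C. \<forall>s\<ge>1. dimle (Fpow F s) (C * s ^ Suc l)" by blast
qed

text \<open>In effect \<open>lead_coeff p * b\<close> is integral: each factor
  \<open>lead_coeff p\<close> pays for one use of the relation \<open>p\<close>, which trades
  \<open>b ^ degree p\<close> for lower powers at the cost of one more coefficient from
  \<open>H\<close>.\<close>

lemma integral_powers:
  assumes p: "poly p b = 0" "degree p > 0" and H: "coeff p ` {..degree p} \<subseteq> H"
  shows "lead_coeff p ^ j * b ^ j \<in> vs.span {\<gamma> * b ^ i | \<gamma> i. \<gamma> \<in> Fpow H j \<and> i < degree p}"
proof (induction j)
  case 0
  have "(1 :: 'b) = 1 * b ^ 0" by simp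
  then have "1 \<in> {\<gamma> * b ^ i | \<gamma> i. \<gamma> \<in> Fpow H 0 \<and> i < degree p}" using Fpow_1 p(2) by blast
  then show ?case by (simp add: vs.span_base)
next
  case (Suc j)
  let ?c = "lead_coeff p"
  have c: "?c \<in> H" using H by auto
  have "(\<Sum>i<degree p. coeff p i * b ^ i) + ?c * b ^ degree p = 0"
    using p(1) by (simp add: poly_altdef atMost_Suc lessThan_Suc_atMost[symmetric])
  then have rel: "?c * b ^ degree p = - (\<Sum>i<degree p. coeff p i * b ^ i)" by (simp add: eq_neg_iff_add_eq_0 add.commute)
  let ?S = "\<lambda>j. {\<gamma> * b ^ i | \<gamma> i. \<gamma> \<in> Fpow H j \<and> i < degree p}"
  have "(?c * b) * (?c ^ j * b ^ j) \<in> vs.span (?S (Suc j))"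
  proof (rule mult_span[OF _ Suc])
    fix y assume "y \<in> ?S j"
    then obtain \<gamma> i where y: "\<gamma> \<in> Fpow H j" "i < degree p" "y = \<gamma> * b ^ i" by blast
    show "?c * b * y \<in> vs.span (?S (Suc j))"
    proof (cases "Suc i < degree p")
      case True
      have "?c * b * y = (?c * \<gamma>) * b ^ Suc i" by (simp add: y(3) algebra_simps)
      moreover have "?c * \<gamma> \<in> Fpow H (Suc j)" using Fpow_mult[OF Fpow_base[OF c] y(1)] by simp
      ultimately show ?thesis using True by (intro vs.span_base) blast
    next
      case False
      then have "degree p = Suc i" using y(2) by simp
      then have "?c * b * y = \<gamma> * (?c * b ^ degree p)" by (simp add: y(3) algebra_simps)
      also have "\<dots> = - (\<Sum>k<degree p. (coeff p k * \<gamma>) * b ^ k)"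
        by (simp add: rel sum_distrib_left sum_distrib_right algebra_simps)
      also have "\<dots> \<in> vs.span (?S (Suc j))"
      proof (intro vs.span_neg vs.span_sum vs.span_base)
        fix k assume k: "k \<in> {..<degree p}"
        then have "coeff p k \<in> H" using H by auto
        then have "coeff p k * \<gamma> \<in> Fpow H (Suc j)" using Fpow_mult[OF Fpow_base y(1)] by simp
        with k show "coeff p k * \<gamma> * b ^ k \<in> ?S (Suc j)" by blast
      qed
      finally show ?thesis .
    qed
  qed
  then show ?case by (simp add: algebra_simps)
qed

text \<open>Multiplying by \<open>lead_coeff p ^ (d * s)\<close> brings all exponents of
  \<open>b\<close> below \<open>degree p\<close>, a range that does not grow with \<open>s\<close>,
  so the exponent \<open>l\<close> is kept. In a domain the multiplier can be cancelled.\<close>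

lemma growth_algebraic:
  assumes gr: "growth A l" and A: "subalg A" and dom: "is_domain (adjoin A b)"
    and p: "p \<in> polys A" "p \<noteq> 0" "poly p b = 0"
  shows "growth (adjoin A b) l"
  unfolding growth_def
proof (intro allI impI)
  fix F assume F: "finite F \<and> F \<subseteq> adjoin A b"
  then obtain G d where G: "finite G" "G \<subseteq> A"
    "\<And>s. Fpow F s \<subseteq> vs.span {\<gamma> * b ^ i | \<gamma> i. \<gamma> \<in> Fpow G s \<and> i \<le> d * s}"
    using Fpow_adjoin[of F A b] by blast
  note sub = adjoin_subalg[OF A, of b]
  let ?c = "lead_coeff p"
  have c: "?c \<in> adjoin A b" "?c \<noteq> 0" using p adjoin_superset[OF A] by (auto simp: polys_def)
  have deg: "degree p > 0"
  proof (rule ccontr)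
    assume "\<not> degree p > 0"
    then obtain a where "p = [:a:]" by (metis degree_eq_zeroE neq0_conv)
    with p show False by simp
  qed
  define H where "H = G \<union> coeff p ` {..degree p}"
  have H: "finite H" "H \<subseteq> A" "G \<subseteq> H" "coeff p ` {..degree p} \<subseteq> H" using G p(1) by (auto simp: H_def polys_def)
  obtain C where C: "\<And>s. s \<ge> 1 \<Longrightarrow> dimle (Fpow H s) (C * s ^ l)"
    using growthD[OF gr H(1,2)] by blast
  have "dimle (Fpow F s) ((C * (d + 1) ^ l * degree p) * s ^ l)" if s: "s \<ge> 1" for s
  proof (rule dimle_cancel[OF sub dom subalgD(8)[OF sub c(1)] is_domain_power[OF sub dom c]])
    show "Fpow F s \<subseteq> adjoin A b" using Fpow_subset[OF sub] F by blast
    let ?n = "(d + 1) * s"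
    have "?n \<ge> 1" using s by simp
    then obtain T where T: "finite T" "card T \<le> C * ?n ^ l" "Fpow H ?n \<subseteq> vs.span T"
      using C unfolding dimle_def by blast
    obtain T' where T': "finite T'" "card T' \<le> card T * card {..<degree p}"
      "{\<gamma> * b ^ i | \<gamma> i. \<gamma> \<in> Fpow H ?n \<and> i \<in> {..<degree p}} \<subseteq> vs.span T'"
      using span_powers_card[OF T(3,1), of "{..<degree p}"] by blast
    have "?c ^ (d * s) * x \<in> vs.span T'" if "x \<in> Fpow F s" for x
    proof (rule mult_span)
      show "x \<in> vs.span {\<gamma> * b ^ i | \<gamma> i. \<gamma> \<in> Fpow G s \<and> i \<le> d * s}" using that G(3) by blast
      fix y assume "y \<in> {\<gamma> * b ^ i | \<gamma> i. \<gamma> \<in> Fpow G s \<and> i \<le> d * s}"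
      then obtain \<gamma> i where y: "\<gamma> \<in> Fpow G s" "i \<le> d * s" "y = \<gamma> * b ^ i" by blast
      have "?c ^ (d * s) = ?c ^ (d * s - i) * ?c ^ i" using y(2) by (simp flip: power_add)
      then have "?c ^ (d * s) * y = (?c ^ (d * s - i) * \<gamma>) * (?c ^ i * b ^ i)" by (simp add: y(3) algebra_simps)
      also have "\<dots> \<in> vs.span T'"
      proof (rule mult_span[OF _ integral_powers[OF p(3) deg H(4)]])
        fix z assume "z \<in> {\<gamma> * b ^ k | \<gamma> k. \<gamma> \<in> Fpow H i \<and> k < degree p}"
        then obtain \<gamma>' k where z: "\<gamma>' \<in> Fpow H i" "k < degree p" "z = \<gamma>' * b ^ k" by blast
        have "?c ^ (d * s - i) \<in> Fpow H (d * s - i)" using H(4) by (intro Fpow_power) auto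
        moreover have "\<gamma> \<in> Fpow H s" using y(1) H(3) by (rule Fpow_mono) simp
        ultimately have "?c ^ (d * s - i) * \<gamma> * \<gamma>' \<in> Fpow H (d * s - i + s + i)"
          using z(1) by (intro Fpow_mult)
        moreover have "d * s - i + s + i = ?n" using y(2) by simp
        ultimately have "?c ^ (d * s - i) * \<gamma> * \<gamma>' \<in> Fpow H ?n" by simp
        then have "(?c ^ (d * s - i) * \<gamma> * \<gamma>') * b ^ k \<in> vs.span T'" using T'(3) z(2) by blast
        then show "?c ^ (d * s - i) * \<gamma> * z \<in> vs.span T'" by (simp add: z(3) algebra_simps)
      qed
      finally show "?c ^ (d * s) * y \<in> vs.span T'" .
    qed
    moreover have "card T' \<le> (C * (d + 1) ^ l * degree p) * s ^ l"
    proof -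
      have "card T' \<le> card T * degree p" using T'(2) by simp
      also have "\<dots> \<le> (C * ?n ^ l) * degree p" using T(2) by (rule mult_le_mono1)
      also have "\<dots> = (C * (d + 1) ^ l * degree p) * s ^ l" by (simp only: power_mult_distrib mult_ac)
      finally show ?thesis .
    qed
    ultimately show "dimle ((*) (?c ^ (d * s)) ` Fpow F s) ((C * (d + 1) ^ l * degree p) * s ^ l)"
      using T'(1) unfolding dimle_def by blast
  qed
  then show "\<exists>C. \<forall>s\<ge>1. dimle (Fpow F s) (C * s ^ l)" by blast
qed

section \<open>Growth under specialization\<close>

definition alg_endo :: "('b \<Rightarrow> 'b) \<Rightarrow> bool" where
  "alg_endo h \<longleftrightarrow> (\<forall>c. h (\<kappa> c) = \<kappa> c) \<and> (\<forall>x y. h (x + y) = h x + h y \<and> h (x * y) = h x * h y)"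

lemma alg_endoD:
  assumes "alg_endo h"
  shows "h (\<kappa> c) = \<kappa> c" "h (x + y) = h x + h y" "h (x * y) = h x * h y" "h 0 = 0" "h 1 = 1"
    "h (sum f I) = (\<Sum>i\<in>I. h (f i))" "h (x ^ n) = h x ^ n" "h (prod_list xs) = prod_list (map h xs)"
proof -
  show k: "h (\<kappa> c) = \<kappa> c" for c using assms by (auto simp: alg_endo_def)
  show a: "h (x + y) = h x + h y" for x y using assms by (auto simp: alg_endo_def)
  show m: "h (x * y) = h x * h y" for x y using assms by (auto simp: alg_endo_def)
  show 0: "h 0 = 0" "h 1 = 1" using k[of 0] k[of 1] by auto
  show "h (sum f I) = (\<Sum>i\<in>I. h (f i))" by (induction I rule: infinite_finite_induct) (auto simp: a 0)
  show "h (x ^ n) = h x ^ n" by (induction n) (auto simp: m 0)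
  show "h (prod_list xs) = prod_list (map h xs)" by (induction xs) (auto simp: m 0)
qed

lemma alg_endo_subalg: "alg_endo h \<Longrightarrow> subalg A \<Longrightarrow> subalg (h ` A)"
  unfolding subalg_def
  by (auto simp: alg_endoD(1) simp flip: alg_endoD(2,3) intro!: image_eqI[of "\<kappa> _" h "\<kappa> _"])

lemma alg_endo_poly: "alg_endo h \<Longrightarrow> h (poly f b) = poly (map_poly h f) (h b)"
  by (induction f) (auto simp: alg_endoD map_poly_pCons)

lemma alg_endo_adjoin:
  assumes "alg_endo h" "subalg A" shows "h ` adjoin A b = adjoin (h ` A) (h b)"
proof
  show "h ` adjoin A b \<subseteq> adjoin (h ` A) (h b)"
    unfolding adjoin_def polys_def
    by (auto simp: alg_endo_poly[OF assms(1)] coeff_map_poly alg_endoD(4)[OF assms(1)])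
  show "adjoin (h ` A) (h b) \<subseteq> h ` adjoin A b"
    using adjoin_superset[OF assms(2), of b] alg_endo_subalg[OF assms(1) adjoin_subalg[OF assms(2)]]
    by (intro adjoin_least) auto
qed

lemma is_domain_subset: "is_domain A \<Longrightarrow> B \<subseteq> A \<Longrightarrow> is_domain B"
  unfolding is_domain_def by blast

text \<open>One element \<open>a\<close> serves all specializations \<open>h\<close>. In an
  algebraic step it receives a coefficient of a relation, so that the relation stays nontrivial
  under \<open>h\<close> and growth does not increase; in a transcendental step growth increases by
  at most one, whatever \<open>h\<close> does to the generator.\<close>

lemma tower_growth:
  assumes R: "subalg R" "rel_prime R P"
    and t: "tower P A bs k" "subalg A" "A \<subseteq> R" "set bs \<subseteq> R"
  shows "\<exists>a\<in>R. a \<notin> P \<and> (\<forall>h l. alg_endo h \<longrightarrow> (\<forall>x\<in>R. x \<in> P \<longrightarrow> h x = 0) \<longrightarrow> is_domain (h ` R) \<longrightarrow>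
     h a \<noteq> 0 \<longrightarrow> growth (h ` A) l \<longrightarrow> growth (h ` adjoin_list A bs) (l + k))"
  using t
proof (induction rule: tower.induct)
  case (Nil A)
  then show ?case using R by (intro bexI[of _ 1]) (auto simp: rel_primeD subalgD)
next
  case (algebraic A b bs k)
  have b: "b \<in> R" "adjoin A b \<subseteq> R" "set bs \<subseteq> R"
    using algebraic.prems adjoin_least[OF R(1) algebraic.prems(2)] by auto
  obtain a where a: "a \<in> R" "a \<notin> P" "\<And>h l. alg_endo h \<Longrightarrow> (\<forall>x\<in>R. x \<in> P \<longrightarrow> h x = 0) \<Longrightarrow>
     is_domain (h ` R) \<Longrightarrow> h a \<noteq> 0 \<Longrightarrow> growth (h ` adjoin A b) l \<Longrightarrow>
     growth (h ` adjoin_list (adjoin A b) bs) (l + k)"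
    using algebraic.IH[OF adjoin_subalg[OF algebraic.prems(1)] b(2,3)] by blast
  obtain p i where p: "p \<in> polys A" "poly p b \<in> P" "coeff p i \<notin> P"
    using algebraic.hyps(1) unfolding algebraic_over_def by blast
  have c: "coeff p i \<in> A" using p(1) by (simp add: polys_def)
  have "coeff p i * a \<notin> P" using rel_primeD(6)[OF R(2)] c a p(3) algebraic.prems(2) by blast
  moreover have "coeff p i * a \<in> R" using subalgD(5)[OF R(1)] c a(1) algebraic.prems(2) by blast
  moreover have "growth (h ` adjoin_list (adjoin A b) bs) (l + k)"
    if h: "alg_endo h" "\<forall>x\<in>R. x \<in> P \<longrightarrow> h x = 0" "is_domain (h ` R)" "h (coeff p i * a) \<noteq> 0"
      "growth (h ` A) l" for h l
  proof (rule a(3)[OF h(1-3)])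
    note hD = alg_endoD[OF h(1)]
    show "h a \<noteq> 0" using h(4) hD(3) by auto
    have "h (coeff p i) \<noteq> 0" using h(4) hD(3) by auto
    then have "coeff (map_poly h p) i \<noteq> 0" by (simp add: coeff_map_poly hD(4))
    then have p0: "map_poly h p \<noteq> 0" by auto
    have "poly p b \<in> R" using p(1) b(2) by (auto simp: adjoin_def)
    then have root: "poly (map_poly h p) (h b) = 0"
      using h(2) p(2) by (simp flip: alg_endo_poly[OF h(1)])
    have "map_poly h p \<in> polys (h ` A)" using p(1) by (auto simp: polys_def coeff_map_poly hD(4))
    moreover have "is_domain (adjoin (h ` A) (h b))"
      unfolding alg_endo_adjoin[OF h(1) algebraic.prems(1), symmetric]
      using is_domain_subset[OF h(3) image_mono[OF b(2)]] .
    ultimately show "growth (h ` adjoin A b) l"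
      unfolding alg_endo_adjoin[OF h(1) algebraic.prems(1)]
      using growth_algebraic[OF h(5) alg_endo_subalg[OF h(1) algebraic.prems(1)]] p0 root by blast
  qed
  ultimately show ?case by (intro bexI[of _ "coeff p i * a"]) auto
next
  case (transcendental A b bs k)
  have b: "b \<in> R" "adjoin A b \<subseteq> R" "set bs \<subseteq> R"
    using transcendental.prems adjoin_least[OF R(1) transcendental.prems(2)] by auto
  obtain a where a: "a \<in> R" "a \<notin> P" "\<And>h l. alg_endo h \<Longrightarrow> (\<forall>x\<in>R. x \<in> P \<longrightarrow> h x = 0) \<Longrightarrow>
     is_domain (h ` R) \<Longrightarrow> h a \<noteq> 0 \<Longrightarrow> growth (h ` adjoin A b) l \<Longrightarrow>
     growth (h ` adjoin_list (adjoin A b) bs) (l + k)"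
    using transcendental.IH[OF adjoin_subalg[OF transcendental.prems(1)] b(2,3)] by blast
  have "growth (h ` adjoin_list (adjoin A b) bs) (l + Suc k)"
    if h: "alg_endo h" "\<forall>x\<in>R. x \<in> P \<longrightarrow> h x = 0" "is_domain (h ` R)" "h a \<noteq> 0"
      "growth (h ` A) l" for h l
    using a(3)[OF h(1-4), of "Suc l"] growth_adjoin[OF h(5), of "h b"]
    by (simp add: alg_endo_adjoin[OF h(1) transcendental.prems(1)])
  then show ?case using a(1,2) by auto
qed

lemma Fpow_lift:
  assumes "b \<in> Fpow (h ` F) s" "alg_endo h"
  obtains x where "x \<in> Fpow F s" "h x = b"
proof -
  obtain ys where ys: "set ys \<subseteq> h ` F" "length ys \<le> s" "b = prod_list ys" using assms(1) by (auto simp: Fpow_def)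
  then have "\<forall>y\<in>set ys. \<exists>x. x \<in> F \<and> h x = y" by blast
  from bchoice[OF this] obtain g where g: "\<And>y. y \<in> set ys \<Longrightarrow> g y \<in> F \<and> h (g y) = y" by blast
  have "map h (map g ys) = ys" using g by (auto intro: map_idI)
  then have "h (prod_list (map g ys)) = b" using ys(3) alg_endoD(8)[OF assms(2)] by simp
  moreover have "prod_list (map g ys) \<in> Fpow F s" unfolding Fpow_def using g ys(2) by (auto intro!: exI[of _ "map g ys"])
  ultimately show ?thesis using that by blast
qed

text \<open>The condition \<open>h' (h x) = h' x\<close> says that \<open>h'\<close> factors through
  \<open>h\<close>, so spanning sets can be mapped forward. Growth is thus inherited by smaller sets
  of points.\<close>

lemma growth_image:
  assumes gr: "growth (h ` R) l" and hh: "alg_endo h" "alg_endo h'" "\<And>x. h' (h x) = h' x"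
  shows "growth (h' ` R) l"
  unfolding growth_def
proof (intro allI impI)
  fix F' assume F': "finite F' \<and> F' \<subseteq> h' ` R"
  then obtain F where F: "finite F" "F \<subseteq> R" "F' = h' ` F" using finite_subset_image[of F' h' R] by blast
  then obtain C where C: "\<And>s. s \<ge> 1 \<Longrightarrow> dimle (Fpow (h ` F) s) (C * s ^ l)"
    using growthD[OF gr, of "h ` F"] by blast
  have "dimle (Fpow F' s) (C * s ^ l)" if s: "s \<ge> 1" for s
  proof -
    obtain T where T: "finite T" "card T \<le> C * s ^ l" "Fpow (h ` F) s \<subseteq> vs.span T"
      using C[OF s] unfolding dimle_def by blast
    have sp: "h' y \<in> vs.span (h' ` T)" if "y \<in> vs.span T" for y
      using that
    proof (induction rule: vs.span_induct_alt)
      case base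
      then show ?case by (simp add: alg_endoD[OF hh(2)] vs.span_zero)
    next
      case (step c x y)
      then show ?case
        using vs.span_add[OF vs.span_scale[OF vs.span_base[of "h' x" "h' ` T"], of c] step(2)]
        by (simp add: alg_endoD[OF hh(2)])
    qed
    have "x \<in> vs.span (h' ` T)" if "x \<in> Fpow F' s" for x
    proof -
      have "x \<in> Fpow (h' ` (h ` F)) s" using that F(3) hh(3) by (simp add: image_image)
      then obtain y where "y \<in> Fpow (h ` F) s" "h' y = x" using Fpow_lift[OF _ hh(2)] by blast
      then show ?thesis using sp T(3) by blast
    qed
    moreover have "card (h' ` T) \<le> C * s ^ l" using card_image_le[OF T(1), of h'] T(2) by linarith
    ultimately show ?thesis unfolding dimle_def using T(1) by blast
  qed
  then show "\<exists>C. \<forall>s\<ge>1. dimle (Fpow F' s) (C * s ^ l)" by blast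
qed

text \<open>If \<open>f\<close> vanishes on a smaller set, the products \<open>f^j * b\<close> with \<open>b\<close> independent on the smaller
  set are independent on the larger one.\<close>

lemma growth_drop:
  assumes R: "subalg R" and dom: "is_domain (h ` R)" and gr: "growth (h ` R) l"
    and hh: "alg_endo h" "alg_endo h'" "\<And>x. h' (h x) = h' x"
    and f: "f \<in> R" "h' f = 0" "h f \<noteq> 0"
  shows "l \<ge> 1 \<and> growth (h' ` R) (l - 1)"
proof -
  note h'D = alg_endoD[OF hh(2)]
  have sub: "subalg (h ` R)" by (rule alg_endo_subalg[OF hh(1) R])
  have key: "\<exists>C. \<forall>s\<ge>1. \<forall>B. finite B \<longrightarrow> \<not> vs.dependent B \<longrightarrow> B \<subseteq> Fpow F' s \<longrightarrow> (s + 1) * card B \<le> C * s ^ l"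
    if F': "finite F'" "F' \<subseteq> h' ` R" for F'
  proof -
    obtain F where F: "finite F" "F \<subseteq> R" "F' = h' ` F" using finite_subset_image[OF F'] by blast
    define F0 where "F0 = insert (h f) (h ` F)"
    have F0: "finite F0" "F0 \<subseteq> h ` R" using F f(1) by (auto simp: F0_def)
    then obtain C where C: "\<And>s. s \<ge> 1 \<Longrightarrow> dimle (Fpow F0 s) (C * s ^ l)"
      using growthD[OF gr F0] by blast
    have "(s + 1) * card B \<le> C * 2 ^ l * s ^ l"
      if s: "s \<ge> 1" and B: "finite B" "\<not> vs.dependent B" "B \<subseteq> Fpow F' s" for s B
    proof -
      have "\<exists>x\<in>Fpow (h ` F) s. h' x = b" if "b \<in> B" for b
      proof -
        have "b \<in> Fpow (h' ` (h ` F)) s" using that B(3) F(3) hh(3) by (auto simp: image_image)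
        then show ?thesis using Fpow_lift[OF _ hh(2)] by blast
      qed
      then have "\<forall>b\<in>B. \<exists>x. x \<in> Fpow (h ` F) s \<and> h' x = b" by blast
      from bchoice[OF this]
      obtain L where L: "\<And>b. b \<in> B \<Longrightarrow> L b \<in> Fpow (h ` F) s" "\<And>b. b \<in> B \<Longrightarrow> h' (L b) = b" by blast
      have LR: "L b \<in> h ` R" if "b \<in> B" for b using L(1)[OF that] Fpow_subset[OF sub, of "h ` F"] F(2) by blast
      let ?v = "\<lambda>(j, b). h f ^ j * L b"
      have "indep_family ({..s} \<times> B) ?v"
        unfolding indep_family_def
      proof (intro allI impI, rule ccontr)
        fix c assume sum0: "(\<Sum>i\<in>{..s} \<times> B. \<kappa> (c i) * ?v i) = 0" and "\<not> (\<forall>i\<in>{..s} \<times> B. c i = 0)"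
        define w where "w j = (\<Sum>b\<in>B. \<kappa> (c (j, b)) * L b)" for j
        have wR: "w j \<in> h ` R" for j unfolding w_def
          by (intro subalgD(9)[OF sub] subalgD(5)[OF sub] subalgD(1)[OF sub] LR)
        have nz: "\<exists>j. j \<le> s \<and> (\<exists>b\<in>B. c (j, b) \<noteq> 0)" using \<open>\<not> (\<forall>i\<in>{..s} \<times> B. c i = 0)\<close> by auto
        \<comment> \<open>The least power of \<open>h f\<close> that occurs can be cancelled in the
          domain. Applying \<open>h'\<close> then kills all terms with a further factor
          \<open>f\<close> and leaves a relation among the elements of \<open>B\<close>.\<close>
        define j0 where "j0 = (LEAST j. j \<le> s \<and> (\<exists>b\<in>B. c (j, b) \<noteq> 0))"
        have j0: "j0 \<le> s" "\<exists>b\<in>B. c (j0, b) \<noteq> 0" using LeastI_ex[OF nz] unfolding j0_def by auto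
        have less0: "w j = 0" if "j < j0" for j
        proof -
          have "\<forall>b\<in>B. c (j, b) = 0" using not_less_Least[of j] that j0(1) unfolding j0_def by fastforce
          then show ?thesis by (simp add: w_def)
        qed
        have "0 = (\<Sum>(j, b)\<in>{..s} \<times> B. \<kappa> (c (j, b)) * (h f ^ j * L b))"
          using sum0 by (simp add: split_def)
        also have "\<dots> = (\<Sum>j\<le>s. h f ^ j * w j)"
          unfolding w_def sum.cartesian_product[symmetric] sum_distrib_left
          by (intro sum.cong refl) (simp only: mult_ac)
        also have "\<dots> = (\<Sum>j\<in>{j0..s}. h f ^ j * w j)"
          using less0 by (intro sum.mono_neutral_right) (auto simp: not_le)
        also have "\<dots> = (\<Sum>j\<in>{j0..s}. h f ^ j0 * (h f ^ (j - j0) * w j))"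
          by (intro sum.cong) (auto simp: mult.assoc[symmetric] power_add[symmetric])
        also have "\<dots> = h f ^ j0 * (\<Sum>j\<in>{j0..s}. h f ^ (j - j0) * w j)" by (simp add: sum_distrib_left)
        finally have eq: "h f ^ j0 * (\<Sum>j\<in>{j0..s}. h f ^ (j - j0) * w j) = 0" ..
        have hf: "h f \<in> h ` R" using f(1) by blast
        have "(\<Sum>j\<in>{j0..s}. h f ^ (j - j0) * w j) \<in> h ` R"
          by (intro subalgD(9)[OF sub] subalgD(5)[OF sub] subalgD(8)[OF sub] wR hf)
        moreover have "h f ^ j0 \<noteq> 0" "h f ^ j0 \<in> h ` R"
          using is_domain_power[OF sub dom hf f(3)] subalgD(8)[OF sub hf] by auto
        ultimately have "(\<Sum>j\<in>{j0..s}. h f ^ (j - j0) * w j) = 0"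
          using eq dom unfolding is_domain_def by blast
        then have "0 = h' (\<Sum>j\<in>{j0..s}. h f ^ (j - j0) * w j)" by (simp add: h'D)
        also have "\<dots> = (\<Sum>j\<in>{j0..s}. 0 ^ (j - j0) * h' (w j))" by (simp add: h'D hh(3) f(2))
        also have "\<dots> = (\<Sum>j\<in>{j0}. 0 ^ (j - j0) * h' (w j))"
          using j0(1) by (intro sum.mono_neutral_right) (auto simp: power_0_left)
        also have "\<dots> = (\<Sum>b\<in>B. \<kappa> (c (j0, b)) * b)" by (simp add: w_def h'D L(2))
        finally have "(\<Sum>b\<in>B. \<kappa> (c (j0, b)) * b) = 0" ..
        then have "\<forall>b\<in>B. c (j0, b) = 0"
          using indep_family_id[OF B(1,2)] unfolding indep_family_def
          by (elim allE[of _ "\<lambda>b. c (j0, b)"]) blast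
        with j0(2) show False by blast
      qed
      moreover have "?v ` ({..s} \<times> B) \<subseteq> Fpow F0 (2 * s)"
      proof (rule image_subsetI)
        fix i assume "i \<in> {..s} \<times> B"
        then obtain j b where i: "i = (j, b)" and jb: "j \<in> {..s}" "b \<in> B" by blast
        have "h f ^ j \<in> Fpow F0 j" by (rule Fpow_power) (simp add: F0_def)
        moreover have "L b \<in> Fpow F0 s" using L(1)[OF jb(2)] by (rule Fpow_mono) (auto simp: F0_def)
        ultimately have "h f ^ j * L b \<in> Fpow F0 (j + s)" by (rule Fpow_mult)
        moreover have "j + s \<le> 2 * s" using jb(1) by simp
        ultimately have "h f ^ j * L b \<in> Fpow F0 (2 * s)" by (rule Fpow_mono[OF _ subset_refl])
        then show "?v i \<in> Fpow F0 (2 * s)" by (simp add: i)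
      qed
      moreover have "dimle (Fpow F0 (2 * s)) (C * (2 * s) ^ l)" using s by (intro C) simp
      moreover have "finite ({..s} \<times> B)" using B(1) by simp
      ultimately have "card ({..s} \<times> B) \<le> C * (2 * s) ^ l" using dimle_card by blast
      then show ?thesis by (simp add: card_cartesian_product power_mult_distrib mult.assoc)
    qed
    then show ?thesis by blast
  qed
  \<comment> \<open>For \<open>l = 0\<close> the bound on \<open>s + 1\<close> would not depend on
    \<open>s\<close>; the independent set consisting of 1 refutes it at
    \<open>s = C + 1\<close>.\<close>
  have "l \<noteq> 0"
  proof
    assume l: "l = 0"
    obtain C where C: "\<And>s B. s \<ge> 1 \<Longrightarrow> finite B \<Longrightarrow> \<not> vs.dependent B \<Longrightarrow> B \<subseteq> Fpow {} s \<Longrightarrow> (s + 1) * card B \<le> C * s ^ l"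
      using key[of "{}"] by blast
    have "\<not> vs.dependent {1 :: 'b}" by simp
    from C[OF _ _ this, of "C + 1"] show False using l Fpow_1 by simp
  qed
  then obtain m where l: "l = Suc m" using not0_implies_Suc by blast
  have "growth (h' ` R) m"
    unfolding growth_def
  proof (intro allI impI)
    fix F' assume "finite F' \<and> F' \<subseteq> h' ` R"
    then obtain C where C: "\<And>s B. s \<ge> 1 \<Longrightarrow> finite B \<Longrightarrow> \<not> vs.dependent B \<Longrightarrow> B \<subseteq> Fpow F' s \<Longrightarrow> (s + 1) * card B \<le> C * s ^ l"
      using key[of F'] by blast
    have "dimle (Fpow F' s) (C * s ^ m)" if s: "s \<ge> 1" for s
    proof (rule dimleI)
      fix B assume "finite B" "\<not> vs.dependent B" "B \<subseteq> Fpow F' s"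
      from C[OF s this] have "(s + 1) * card B \<le> C * s ^ l" .
      also have "\<dots> = s * (C * s ^ m)" by (simp add: l)
      finally have "s * card B \<le> s * (C * s ^ m)" by (rule order_trans[rotated]) simp
      then show "card B \<le> C * s ^ m" by (rule mult_left_le_imp_le) (use s in simp)
    qed
    then show "\<exists>C. \<forall>s\<ge>1. dimle (Fpow F' s) (C * s ^ m)" by blast
  qed
  with l show ?thesis by simp
qed

end

no_notation Congruence.eq_closure_of (\<open>closure'_of\<index>\<close>)

section \<open>Irreducible sets and dimension\<close>

lemma irreducible_inD:
  assumes "irreducible_in T S"
  shows "S \<subseteq> topspace T" "S \<noteq> {}"
    "closedin T A \<Longrightarrow> closedin T B \<Longrightarrow> S \<subseteq> A \<union> B \<Longrightarrow> S \<subseteq> A \<or> S \<subseteq> B"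
  using assms unfolding irreducible_in_def by blast+

lemma irreducible_in_subtopology:
  assumes "Z \<subseteq> S"
  shows "irreducible_in (subtopology T S) Z \<longleftrightarrow> irreducible_in T Z"
proof
  assume Z: "irreducible_in (subtopology T S) Z"
  have "Z \<subseteq> A \<or> Z \<subseteq> B" if "closedin T A" "closedin T B" "Z \<subseteq> A \<union> B" for A B
  proof -
    have "closedin (subtopology T S) (A \<inter> S)" "closedin (subtopology T S) (B \<inter> S)"
      using that by (auto simp: closedin_subtopology)
    from irreducible_inD(3)[OF Z this] assms that(3) show ?thesis by blast
  qed
  then show "irreducible_in T Z" using irreducible_inD(1,2)[OF Z] by (auto simp: irreducible_in_def)
next
  assume Z: "irreducible_in T Z"
  have "Z \<subseteq> A \<or> Z \<subseteq> B"
    if AB: "closedin (subtopology T S) A" "closedin (subtopology T S) B" "Z \<subseteq> A \<union> B" for A B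
  proof -
    obtain A' B' where "closedin T A'" "closedin T B'" "A = A' \<inter> S" "B = B' \<inter> S"
      using AB by (auto simp: closedin_subtopology)
    with irreducible_inD(3)[OF Z, of A' B'] AB(3) assms show ?thesis by blast
  qed
  then show "irreducible_in (subtopology T S) Z"
    using irreducible_inD(1,2)[OF Z] assms by (auto simp: irreducible_in_def)
qed

lemma irreducible_in_between:
  assumes "irreducible_in T Z" "Z \<subseteq> W" "W \<subseteq> T closure_of Z"
  shows "irreducible_in T W"
  unfolding irreducible_in_def
proof (intro conjI allI impI)
  show "W \<subseteq> topspace T" using assms(3) closure_of_subset_topspace[of T Z] by blast
  show "W \<noteq> {}" using assms(2) irreducible_inD(2)[OF assms(1)] by blast
  fix A B assume AB: "closedin T A \<and> closedin T B \<and> W \<subseteq> A \<union> B"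
  then have "Z \<subseteq> A \<or> Z \<subseteq> B" using assms(2) by (intro irreducible_inD(3)[OF assms(1)]) auto
  then have "T closure_of Z \<subseteq> A \<or> T closure_of Z \<subseteq> B" using AB closure_of_minimal[of Z] by blast
  then show "W \<subseteq> A \<or> W \<subseteq> B" using assms(3) by blast
qed

lemma closure_of_between:
  assumes "Z \<subseteq> W" "W \<subseteq> T closure_of Z" shows "T closure_of W = T closure_of Z"
proof
  show "T closure_of W \<subseteq> T closure_of Z" using assms(2) by (rule closure_of_minimal) simp
  show "T closure_of Z \<subseteq> T closure_of W" using assms(1) by (rule closure_of_mono)
qed

lemma closedin_subtopology_closure_of:
  assumes "closedin (subtopology T S) Z" shows "T closure_of Z \<inter> S = Z"
proof -
  obtain C where C: "closedin T C" "Z = C \<inter> S" using assms by (auto simp: closedin_subtopology)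
  then have "T closure_of Z \<subseteq> C" by (intro closure_of_minimal) auto
  moreover have "Z \<subseteq> T closure_of Z" using C closedin_subset[OF C(1)] by (intro closure_of_subset) auto
  ultimately show ?thesis using C by blast
qed

lemma closure_of_psubset:
  assumes "closedin (subtopology T S) A" "closedin (subtopology T S) B" "A \<subset> B"
  shows "T closure_of A \<subset> T closure_of B"
proof (rule psubsetI)
  show "T closure_of A \<subseteq> T closure_of B" using assms(3) by (intro closure_of_mono) blast
  show "T closure_of A \<noteq> T closure_of B"
  proof
    assume "T closure_of A = T closure_of B"
    then have "T closure_of A \<inter> S = T closure_of B \<inter> S" by simp
    then have "A = B" unfolding assms(1,2)[THEN closedin_subtopology_closure_of] .
    with assms(3) show False by blast
  qed
qed

lemma irreducible_in_closure: "irreducible_in T Z \<Longrightarrow> irreducible_in T (T closure_of Z)"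
  using irreducible_in_between[of T Z "T closure_of Z"] closure_of_subset[OF irreducible_inD(1)[of T Z]] by blast

lemma irreducible_in_open:
  assumes "irreducible_in T Z" "openin T U" "U \<inter> Z \<noteq> {}"
  shows "Z \<subseteq> T closure_of (Z \<inter> U)" "irreducible_in T (Z \<inter> U)" "T closure_of (Z \<inter> U) = T closure_of Z"
proof -
  note Z = irreducible_inD[OF assms(1)]
  have "Z \<subseteq> T closure_of (Z \<inter> U) \<union> (topspace T - U)"
    using Z(1) closure_of_subset[of "Z \<inter> U" T] by auto
  moreover have "closedin T (topspace T - U)" using assms(2) by auto
  ultimately have "Z \<subseteq> T closure_of (Z \<inter> U) \<or> Z \<subseteq> topspace T - U"
    using Z(3)[of "T closure_of (Z \<inter> U)" "topspace T - U"] by simp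
  then show cl: "Z \<subseteq> T closure_of (Z \<inter> U)" using assms(3) by blast
  show "irreducible_in T (Z \<inter> U)"
    unfolding irreducible_in_def
  proof (intro conjI allI impI)
    fix A B assume AB: "closedin T A \<and> closedin T B \<and> Z \<inter> U \<subseteq> A \<union> B"
    then have "T closure_of (Z \<inter> U) \<subseteq> A \<union> B" by (intro closure_of_minimal) auto
    then show "Z \<inter> U \<subseteq> A \<or> Z \<inter> U \<subseteq> B" using Z(3)[of A B] AB cl by blast
  qed (use assms(3) Z in auto)
  have "T closure_of Z \<subseteq> T closure_of (Z \<inter> U)" using cl by (intro closure_of_minimal) auto
  moreover have "T closure_of (Z \<inter> U) \<subseteq> T closure_of Z" by (intro closure_of_mono) blast
  ultimately show "T closure_of (Z \<inter> U) = T closure_of Z" by blast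
qed

lemma irreducible_in_singleton: "x \<in> topspace T \<Longrightarrow> irreducible_in T {x}"
  by (auto simp: irreducible_in_def)

lemma irreducible_in_finite_cover:
  assumes "irreducible_in T Z" "finite F" "\<And>A. A \<in> F \<Longrightarrow> closedin T A" "Z \<subseteq> \<Union>F"
  shows "\<exists>A\<in>F. Z \<subseteq> A"
  using assms(2-4)
proof (induction F rule: finite_induct)
  case empty
  then show ?case using irreducible_inD(2)[OF assms(1)] by simp
next
  case (insert A F)
  have "closedin T (\<Union>F)" using insert by (intro closedin_Union) auto
  then have "Z \<subseteq> A \<or> Z \<subseteq> \<Union>F" using insert.prems by (intro irreducible_inD(3)[OF assms(1)]) auto
  then show ?case using insert by auto
qed

text \<open>The closures of the pieces form a finite closed cover, and one member of it must contain
  \<open>Z\<close>.\<close>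

lemma irreducible_dense_piece:
  assumes "irreducible_in T Z" "finite I" "Z \<subseteq> (\<Union>i\<in>I. X i)"
  obtains i where "i \<in> I" "Z \<subseteq> T closure_of (Z \<inter> X i)"
proof -
  have "Z \<subseteq> \<Union>((\<lambda>i. T closure_of (Z \<inter> X i)) ` I)"
  proof
    fix z assume z: "z \<in> Z"
    then obtain i where "i \<in> I" "z \<in> X i" using assms(3) by blast
    moreover have "Z \<inter> X i \<subseteq> T closure_of (Z \<inter> X i)"
      using irreducible_inD(1)[OF assms(1)] by (intro closure_of_subset) auto
    ultimately show "z \<in> \<Union>((\<lambda>i. T closure_of (Z \<inter> X i)) ` I)" using z by auto
  qed
  then have "\<exists>A\<in>(\<lambda>i. T closure_of (Z \<inter> X i)) ` I. Z \<subseteq> A"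
    using assms(2) by (intro irreducible_in_finite_cover[OF assms(1)]) auto
  then show ?thesis using that by blast
qed

text \<open>Zorn's lemma. If the union of a chain is covered by two closed sets without lying in
  either, the larger of two offending members already lies in neither.\<close>

lemma irreducible_component_exists:
  assumes "irreducible_in T W" "W \<subseteq> S"
  obtains Z where "irreducible_component T S Z" "W \<subseteq> Z"
proof -
  define \<A> where "\<A> = {Z. Z \<subseteq> S \<and> irreducible_in T Z \<and> W \<subseteq> Z}"
  have "\<exists>M\<in>\<A>. \<forall>X\<in>\<A>. M \<subseteq> X \<longrightarrow> X = M"
  proof (rule subset_Zorn_nonempty)
    show "\<A> \<noteq> {}" using assms by (auto simp: \<A>_def)
    fix \<C> assume C: "\<C> \<noteq> {}" "subset.chain \<A> \<C>"
    then have sub: "\<C> \<subseteq> \<A>" and lin: "\<And>A B. A \<in> \<C> \<Longrightarrow> B \<in> \<C> \<Longrightarrow> A \<subseteq> B \<or> B \<subseteq> A"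
      by (auto simp: subset_chain_def)
    have "irreducible_in T (\<Union>\<C>)"
      unfolding irreducible_in_def
    proof (intro conjI allI impI)
      have irr: "irreducible_in T Z" if "Z \<in> \<C>" for Z using sub that by (auto simp: \<A>_def)
      show "\<Union>\<C> \<subseteq> topspace T" using irreducible_inD(1)[OF irr] by (rule Union_least)
      obtain Z where "Z \<in> \<C>" using C(1) by blast
      then show "\<Union>\<C> \<noteq> {}" using irreducible_inD(2)[OF irr] by auto
      fix A B assume AB: "closedin T A \<and> closedin T B \<and> \<Union>\<C> \<subseteq> A \<union> B"
      show "\<Union>\<C> \<subseteq> A \<or> \<Union>\<C> \<subseteq> B"
      proof (rule ccontr)
        assume "\<not> (\<Union>\<C> \<subseteq> A \<or> \<Union>\<C> \<subseteq> B)"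
        then obtain Z1 Z2 where Z: "Z1 \<in> \<C>" "\<not> Z1 \<subseteq> A" "Z2 \<in> \<C>" "\<not> Z2 \<subseteq> B" by blast
        then obtain Z where "Z \<in> \<C>" "\<not> Z \<subseteq> A" "\<not> Z \<subseteq> B" using lin[OF Z(1,3)] by blast
        moreover from this have "irreducible_in T Z" using sub by (auto simp: \<A>_def)
        ultimately show False using irreducible_inD(3)[of T Z A B] AB by blast
      qed
    qed
    then show "\<Union>\<C> \<in> \<A>" using C(1) sub by (auto simp: \<A>_def)
  qed
  then obtain Z where "Z \<in> \<A>" "\<forall>X\<in>\<A>. Z \<subseteq> X \<longrightarrow> X = Z" by blast
  then have "irreducible_component T S Z \<and> W \<subseteq> Z"
    by (auto simp: irreducible_component_def \<A>_def)
  then show ?thesis using that by blast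
qed

text \<open>Arbitrary irreducible subsets are compared through their closures in the whole space.
  This form is monotone in \<open>S\<close> and survives cutting with an open set that meets all
  members; chains of closed subsets of \<open>S\<close> would have to change with
  \<open>S\<close>.\<close>

definition has_chain :: "'a topology \<Rightarrow> 'a set \<Rightarrow> nat \<Rightarrow> bool" where
  "has_chain T S n \<longleftrightarrow> (\<exists>Z :: nat \<Rightarrow> 'a set. (\<forall>i\<le>n. irreducible_in T (Z i) \<and> Z i \<subseteq> S) \<and>
     (\<forall>i<n. T closure_of Z i \<subset> T closure_of Z (Suc i)))"

text \<open>The closed members are the traces on \<open>S\<close> of the closures; each lies between
  an irreducible set and its closure.\<close>

lemma has_chain_iff_closed_chain:
  "has_chain T S n \<longleftrightarrow> (\<exists>Z :: nat \<Rightarrow> 'a set.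
     (\<forall>i\<le>n. closedin (subtopology T S) (Z i) \<and> irreducible_in (subtopology T S) (Z i)) \<and>
     (\<forall>i<n. Z i \<subset> Z (Suc i)))"
proof
  assume "has_chain T S n"
  then obtain Z where Z: "\<And>i. i \<le> n \<Longrightarrow> irreducible_in T (Z i)" "\<And>i. i \<le> n \<Longrightarrow> Z i \<subseteq> S"
    "\<And>i. i < n \<Longrightarrow> T closure_of Z i \<subset> T closure_of Z (Suc i)" unfolding has_chain_def by blast
  define W where "W i = T closure_of Z i \<inter> S" for i
  have ZW: "Z i \<subseteq> W i" if "i \<le> n" for i
    unfolding W_def using closure_of_subset[OF irreducible_inD(1)[OF Z(1)[OF that]]] Z(2)[OF that] by blast
  have "closedin (subtopology T S) (W i) \<and> irreducible_in (subtopology T S) (W i)" if "i \<le> n" for i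
  proof
    show "closedin (subtopology T S) (W i)"
      using closedin_closure_of[of T "Z i"] unfolding W_def closedin_subtopology by blast
    have "irreducible_in T (W i)"
      using Z(1)[OF that] ZW[OF that] by (rule irreducible_in_between) (auto simp: W_def)
    then show "irreducible_in (subtopology T S) (W i)" by (subst irreducible_in_subtopology) (auto simp: W_def)
  qed
  moreover have "W i \<subset> W (Suc i)" if "i < n" for i
  proof -
    have cl: "T closure_of W j = T closure_of Z j" if "j \<le> n" for j
      using ZW[OF that] by (rule closure_of_between) (auto simp: W_def)
    have "W i \<noteq> W (Suc i)" using Z(3)[OF that] cl[of i] cl[of "Suc i"] that by auto
    moreover have "W i \<subseteq> W (Suc i)" using Z(3)[OF that] by (auto simp: W_def)
    ultimately show ?thesis by blast
  qed
  ultimately show "\<exists>Z. (\<forall>i\<le>n. closedin (subtopology T S) (Z i) \<and> irreducible_in (subtopology T S) (Z i)) \<and>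
     (\<forall>i<n. Z i \<subset> Z (Suc i))" by blast
next
  assume "\<exists>Z. (\<forall>i\<le>n. closedin (subtopology T S) (Z i) \<and> irreducible_in (subtopology T S) (Z i)) \<and>
     (\<forall>i<n. Z i \<subset> Z (Suc i))"
  then obtain Z where Z: "\<And>i. i \<le> n \<Longrightarrow> closedin (subtopology T S) (Z i)"
    "\<And>i. i \<le> n \<Longrightarrow> irreducible_in (subtopology T S) (Z i)" "\<And>i. i < n \<Longrightarrow> Z i \<subset> Z (Suc i)" by blast
  have sub: "Z i \<subseteq> S" if "i \<le> n" for i using closedin_subset[OF Z(1)[OF that]] by auto
  have irr: "irreducible_in T (Z i)" if "i \<le> n" for i
    using Z(2)[OF that] irreducible_in_subtopology[OF sub[OF that]] by blast
  have "T closure_of Z i \<subset> T closure_of Z (Suc i)" if "i < n" for i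
    using that by (intro closure_of_psubset[OF Z(1) Z(1) Z(3)]) auto
  then show "has_chain T S n" unfolding has_chain_def using irr sub by blast
qed

lemma dim_of_eq_Sup: "dim_of T S = Sup {ereal (real n) | n. has_chain T S n}"
  unfolding dim_of_def has_chain_iff_closed_chain ..

lemma has_chain_truncate:
  assumes "has_chain T S n" "m \<le> n" shows "has_chain T S m"
proof -
  obtain Z where Z: "\<forall>i\<le>n. irreducible_in T (Z i) \<and> Z i \<subseteq> S"
    "\<forall>i<n. T closure_of Z i \<subset> T closure_of Z (Suc i)" using assms(1) unfolding has_chain_def by blast
  have "\<forall>i\<le>m. irreducible_in T (Z i) \<and> Z i \<subseteq> S" using Z(1) assms(2) by (meson order_trans)
  moreover have "\<forall>i<m. T closure_of Z i \<subset> T closure_of Z (Suc i)" using Z(2) assms(2) by (meson less_le_trans)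
  ultimately show ?thesis unfolding has_chain_def by blast
qed

lemma has_chain_mono:
  assumes "has_chain T S n" "S \<subseteq> S'" shows "has_chain T S' n"
proof -
  obtain Z where Z: "\<forall>i\<le>n. irreducible_in T (Z i) \<and> Z i \<subseteq> S"
    "\<forall>i<n. T closure_of Z i \<subset> T closure_of Z (Suc i)" using assms(1) unfolding has_chain_def by blast
  have "\<forall>i\<le>n. irreducible_in T (Z i) \<and> Z i \<subseteq> S'" using Z(1) assms(2) by blast
  with Z(2) show ?thesis unfolding has_chain_def by blast
qed

text \<open>Chain lengths are closed downwards, so without a chain of length \<open>n\<close> the
  supremum is at most \<open>n - 1\<close>, taken in the real numbers: for \<open>n = 0\<close> the
  bound is -1.\<close>

lemma dim_of_ge_iff: "ereal (real n) \<le> dim_of T S \<longleftrightarrow> has_chain T S n"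
proof
  show "has_chain T S n \<Longrightarrow> ereal (real n) \<le> dim_of T S"
    unfolding dim_of_eq_Sup by (intro Sup_upper) blast
  assume le: "ereal (real n) \<le> dim_of T S"
  show "has_chain T S n"
  proof (rule ccontr)
    assume no: "\<not> has_chain T S n"
    have "dim_of T S \<le> ereal (real n - 1)"
      unfolding dim_of_eq_Sup
    proof (rule Sup_least, clarify)
      fix m assume "has_chain T S m"
      then have "m < n" using has_chain_truncate no not_le by blast
      then show "ereal (real m) \<le> ereal (real n - 1)" by simp
    qed
    with le have "ereal (real n) \<le> ereal (real n - 1)" by (rule order_trans)
    then show False by simp
  qed
qed

lemma dim_of_le: "(\<And>n. has_chain T S n \<Longrightarrow> ereal (real n) \<le> M) \<Longrightarrow> dim_of T S \<le> M"
  unfolding dim_of_eq_Sup by (rule Sup_least) blast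

lemma dim_of_mono: "S \<subseteq> S' \<Longrightarrow> dim_of T S \<le> dim_of T S'"
  by (rule dim_of_le) (simp add: dim_of_ge_iff has_chain_mono)

lemma dim_of_eq_nat:
  assumes "has_chain T S n" "\<And>m. has_chain T S m \<Longrightarrow> m \<le> n"
  shows "dim_of T S = ereal (real n)"
  by (intro antisym dim_of_le) (use assms dim_of_ge_iff in auto)

lemma has_chain_subtopology:
  assumes "S \<subseteq> Y" shows "has_chain (subtopology T Y) S n \<longleftrightarrow> has_chain T S n"
  unfolding has_chain_iff_closed_chain using assms by (simp add: subtopology_subtopology Int_absorb1)

lemma dim_of_subtopology: "S \<subseteq> Y \<Longrightarrow> dim_of (subtopology T Y) S = dim_of T S"
  by (simp add: dim_of_eq_Sup has_chain_subtopology)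

text \<open>A homeomorphism moves a point of the smallest member of a chain to \<open>y\<close>.
  Then all members contain \<open>y\<close>, and cutting with the open set \<open>U\<close> changes
  none of their closures, so the full dimension of \<open>Q\<close> is visible at \<open>y\<close>
  inside \<open>U\<close>.\<close>

lemma dim_of_homogeneous:
  assumes hom: "\<And>y z. y \<in> Q \<Longrightarrow> z \<in> Q \<Longrightarrow> \<exists>h. homeomorphic_map T T h \<and> h ` Q = Q \<and> h y = z"
    and Q: "Q \<subseteq> topspace T" and U: "openin T U" "y \<in> U" "y \<in> Q"
  shows "dim_of T (U \<inter> Q) = dim_of T Q" "dim_at T (U \<inter> Q) y = dim_of T Q"
proof -
  have chain: "\<exists>Z. (\<forall>i\<le>n. irreducible_in T (Z i) \<and> Z i \<subseteq> U \<inter> Q \<and> y \<in> Z i) \<and>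
     (\<forall>i<n. T closure_of Z i \<subset> T closure_of Z (Suc i))" if hc: "has_chain T Q n" for n
  proof -
    obtain Z where Z: "\<And>i. i \<le> n \<Longrightarrow> closedin (subtopology T Q) (Z i)"
      "\<And>i. i \<le> n \<Longrightarrow> irreducible_in (subtopology T Q) (Z i)" "\<And>i. i < n \<Longrightarrow> Z i \<subset> Z (Suc i)"
      using hc[unfolded has_chain_iff_closed_chain] by blast
    have subQ: "Z i \<subseteq> Q" if "i \<le> n" for i using closedin_subset[OF Z(1)[OF that]] by auto
    have mono: "Z 0 \<subseteq> Z i" if "i \<le> n" for i using that
    proof (induction i)
      case (Suc i)
      then show ?case using Z(3)[of i] by auto
    qed simp
    obtain z where z: "z \<in> Z 0" using irreducible_inD(2)[OF Z(2)[of 0]] by auto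
    then have "z \<in> Q" using subQ[of 0] by blast
    from hom[OF this U(3)] obtain h where h: "homeomorphic_map T T h" "h ` Q = Q" "h z = y" by blast
    have irr: "irreducible_in T (h ` Z i)" if "i \<le> n" for i
    proof -
      have Zi: "irreducible_in T (Z i)"
        by (rule irreducible_in_subtopology[OF subQ[OF that], THEN iffD1, OF Z(2)[OF that]])
      note top = homeomorphic_imp_surjective_map[OF h(1)]
      have cont: "continuous_map T T h" using h(1) by (rule homeomorphic_imp_continuous_map)
      show ?thesis
        unfolding irreducible_in_def
      proof (intro conjI allI impI)
        show "h ` Z i \<subseteq> topspace T" using image_mono[OF irreducible_inD(1)[OF Zi], of h] top by simp
        show "h ` Z i \<noteq> {}" using irreducible_inD(2)[OF Zi] by blast
        fix A B assume AB: "closedin T A \<and> closedin T B \<and> h ` Z i \<subseteq> A \<union> B"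
        have "closedin T {x \<in> topspace T. h x \<in> A}" "closedin T {x \<in> topspace T. h x \<in> B}"
          using AB by (auto intro: closedin_continuous_map_preimage[OF cont])
        moreover have "Z i \<subseteq> {x \<in> topspace T. h x \<in> A} \<union> {x \<in> topspace T. h x \<in> B}"
          using AB irreducible_inD(1)[OF Zi] by blast
        ultimately show "h ` Z i \<subseteq> A \<or> h ` Z i \<subseteq> B" using irreducible_inD(3)[OF Zi] by blast
      qed
    qed
    have yZ: "y \<in> h ` Z i \<inter> U" if "i \<le> n" for i using mono[OF that] z h(3) U(2) by blast
    have clh: "T closure_of (h ` Z i) = h ` (T closure_of Z i)" if "i \<le> n" for i
      using homeomorphic_map_closure_of[OF h(1), of "Z i"] subQ[OF that] Q by blast
    have "T closure_of (h ` Z i \<inter> U) \<subset> T closure_of (h ` Z (Suc i) \<inter> U)" if i: "i < n" for i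
    proof -
      have "T closure_of Z i \<subset> T closure_of Z (Suc i)"
        using i by (intro closure_of_psubset[OF Z(1) Z(1) Z(3)]) auto
      moreover have "inj_on h (topspace T)" using h(1) by (rule homeomorphic_imp_injective_map)
      ultimately have "h ` (T closure_of Z i) \<subset> h ` (T closure_of Z (Suc i))"
        using closure_of_subset_topspace[of T "Z (Suc i)"]
        by (intro image_strict_mono) (auto intro: inj_on_subset)
      then have "T closure_of (h ` Z i) \<subset> T closure_of (h ` Z (Suc i))" using clh i by simp
      moreover have "T closure_of (h ` Z j \<inter> U) = T closure_of (h ` Z j)" if "j \<le> n" for j
        using irreducible_in_open(3)[OF irr[OF that] U(1)] yZ[OF that] by blast
      ultimately show ?thesis using i by simp
    qed
    moreover have "irreducible_in T (h ` Z i \<inter> U) \<and> h ` Z i \<inter> U \<subseteq> U \<inter> Q \<and> y \<in> h ` Z i \<inter> U"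
      if "i \<le> n" for i
      using irreducible_in_open(2)[OF irr[OF that] U(1)] yZ[OF that] subQ[OF that] h(2) by blast
    ultimately show ?thesis by (intro exI[of _ "\<lambda>i. h ` Z i \<inter> U"]) blast
  qed
  show "dim_of T (U \<inter> Q) = dim_of T Q"
  proof (rule antisym)
    show "dim_of T Q \<le> dim_of T (U \<inter> Q)"
    proof (rule dim_of_le)
      fix n assume "has_chain T Q n"
      from chain[OF this] obtain Z where Z: "\<forall>i\<le>n. irreducible_in T (Z i) \<and> Z i \<subseteq> U \<inter> Q \<and> y \<in> Z i"
        "\<forall>i<n. T closure_of Z i \<subset> T closure_of Z (Suc i)" by (elim exE conjE)
      then have "has_chain T (U \<inter> Q) n" unfolding has_chain_def by (intro exI[of _ Z]) simp
      then show "ereal (real n) \<le> dim_of T (U \<inter> Q)" by (simp add: dim_of_ge_iff)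
    qed
  qed (auto intro: dim_of_mono)
  show "dim_at T (U \<inter> Q) y = dim_of T Q"
  proof (rule antisym)
    show "dim_at T (U \<inter> Q) y \<le> dim_of T Q"
      unfolding dim_at_def by (rule Sup_least) (auto simp: irreducible_component_def intro!: dim_of_mono)
    show "dim_of T Q \<le> dim_at T (U \<inter> Q) y"
    proof (rule dim_of_le)
      fix n assume "has_chain T Q n"
      from chain[OF this] obtain Z where "\<forall>i\<le>n. irreducible_in T (Z i) \<and> Z i \<subseteq> U \<inter> Q \<and> y \<in> Z i"
        "\<forall>i<n. T closure_of Z i \<subset> T closure_of Z (Suc i)" by (elim exE conjE)
      then have Z: "\<And>i. i \<le> n \<Longrightarrow> irreducible_in T (Z i) \<and> Z i \<subseteq> U \<inter> Q \<and> y \<in> Z i"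
        "\<And>i. i < n \<Longrightarrow> T closure_of Z i \<subset> T closure_of Z (Suc i)" by simp_all
      \<comment> \<open>Only the closures in a chain are nested. The closure of the top member
        within \<open>U \<inter> Q\<close> contains all members and is irreducible, so one component
        through \<open>y\<close> contains the whole chain.\<close>
      define V where "V = T closure_of Z n \<inter> (U \<inter> Q)"
      have ZnV: "Z n \<subseteq> V" unfolding V_def using Z(1)[of n] closure_of_subset[OF irreducible_inD(1)[of T "Z n"]] by blast
      have "irreducible_in T V"
        by (rule irreducible_in_between[of T "Z n"]) (use Z(1)[of n] ZnV in \<open>auto simp: V_def\<close>)
      then obtain C where C: "irreducible_component T (U \<inter> Q) C" "V \<subseteq> C"
        using irreducible_component_exists[of T V "U \<inter> Q"] by (auto simp: V_def)
      have clm: "T closure_of Z i \<subseteq> T closure_of Z n" if "i \<le> n" for i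
        using that
      proof (induction "n - i" arbitrary: i)
        case (Suc d)
        then have "i < n" by simp
        then have "d = n - Suc i" "Suc i \<le> n" using Suc(2) by auto
        from Suc(1)[OF this] Z(2)[OF \<open>i < n\<close>] show ?case by blast
      qed simp
      have "Z i \<subseteq> C" if "i \<le> n" for i
      proof -
        have "Z i \<subseteq> T closure_of Z i"
          using Z(1)[OF that] by (intro closure_of_subset irreducible_inD(1)) simp
        then show ?thesis using clm[OF that] Z(1)[OF that] C(2) unfolding V_def by blast
      qed
      then have "has_chain T C n" unfolding has_chain_def using Z by (intro exI[of _ Z]) simp
      then have "ereal (real n) \<le> dim_of T C" by (simp add: dim_of_ge_iff)
      also have "\<dots> \<le> dim_at T (U \<inter> Q) y"
      proof -
        have "y \<in> C" using ZnV C(2) Z(1)[of n] by blast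
        then show ?thesis unfolding dim_at_def using C(1) by (intro Sup_upper) blast
      qed
      finally show "ereal (real n) \<le> dim_at T (U \<inter> Q) y" .
    qed
  qed
qed

subsection \<open>Noetherian spaces\<close>

definition noeth_space :: "'a topology \<Rightarrow> bool" where
  "noeth_space T \<longleftrightarrow> \<not> (\<exists>C :: nat \<Rightarrow> 'a set. \<forall>n. closedin T (C n) \<and> C (Suc n) \<subset> C n)"

lemma noeth_spaceD:
  assumes "noeth_space T" "\<And>n. closedin T (C n)" "\<And>n. C (Suc n) \<subset> C n"
  shows False
  using assms(1) unfolding noeth_space_def
  by (elim notE, intro exI[of _ C] allI conjI assms(2,3))

lemma noeth_space_subtopology:
  assumes "noeth_space T" shows "noeth_space (subtopology T S)"
  unfolding noeth_space_def
proof
  assume "\<exists>C. \<forall>n. closedin (subtopology T S) (C n) \<and> C (Suc n) \<subset> C n"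
  then obtain C where C0: "\<forall>n. closedin (subtopology T S) (C n) \<and> C (Suc n) \<subset> C n" by (elim exE)
  note C = C0[rule_format, THEN conjunct1] C0[rule_format, THEN conjunct2]
  have "T closure_of C (Suc n) \<subset> T closure_of C n" for n
    by (rule closure_of_psubset[OF C(1) C(1) C(2)])
  then show False by (rule noeth_spaceD[OF assms, of "\<lambda>n. T closure_of C n", rotated]) simp
qed

text \<open>A strictly descending sequence drops infinitely often on one and the same member of the
  cover.\<close>

lemma noeth_space_finite_cover:
  assumes "finite \<U>" "topspace T \<subseteq> \<Union>\<U>" "\<And>U. U \<in> \<U> \<Longrightarrow> noeth_space (subtopology T U)"
  shows "noeth_space T"
  unfolding noeth_space_def
proof
  assume "\<exists>C. \<forall>n. closedin T (C n) \<and> C (Suc n) \<subset> C n"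
  then obtain C where C0: "\<forall>n. closedin T (C n) \<and> C (Suc n) \<subset> C n" by (elim exE)
  note C = C0[rule_format, THEN conjunct1] C0[rule_format, THEN conjunct2]
  have "\<forall>n. \<exists>U. U \<in> \<U> \<and> C (Suc n) \<inter> U \<subset> C n \<inter> U"
  proof
    fix n
    obtain x where x: "x \<in> C n" "x \<notin> C (Suc n)" using C(2)[of n] by auto
    then obtain U where "U \<in> \<U>" "x \<in> U" using closedin_subset[OF C(1)[of n]] assms(2) by blast
    then show "\<exists>U. U \<in> \<U> \<and> C (Suc n) \<inter> U \<subset> C n \<inter> U"
      using x C(2)[of n] by (intro exI[of _ U]) auto
  qed
  from choice[OF this] obtain u where u0: "\<forall>n. u n \<in> \<U> \<and> C (Suc n) \<inter> u n \<subset> C n \<inter> u n" by (elim exE)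
  note u = u0[rule_format, THEN conjunct1] u0[rule_format, THEN conjunct2]
  have "\<exists>U\<in>\<U>. infinite {n. u n = U}"
  proof (rule ccontr)
    assume "\<not> (\<exists>U\<in>\<U>. infinite {n. u n = U})"
    then have "finite (\<Union>U\<in>\<U>. {n. u n = U})" using assms(1) by auto
    moreover have "(\<Union>U\<in>\<U>. {n. u n = U}) = UNIV" using u(1) by blast
    ultimately show False by simp
  qed
  then obtain U where U: "U \<in> \<U>" "infinite {n. u n = U}" by (elim bexE)
  define e where "e = enumerate {n. u n = U}"
  have e: "u (e k) = U" "e k < e (Suc k)" for k
    using enumerate_in_set[OF U(2), of k] enumerate_step[OF U(2), of k] by (auto simp: e_def)
  have dec: "C m \<subseteq> C n" if "n \<le> m" for n m
    by (rule lift_Suc_antimono_le[OF _ that]) (use C(2) in auto)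
  have "C (e (Suc k)) \<inter> U \<subset> C (e k) \<inter> U" for k
    using u(2)[of "e k"] e[of k] dec[of "Suc (e k)" "e (Suc k)"] by auto
  moreover have "closedin (subtopology T U) (C n \<inter> U)" for n using C(1) by (auto simp: closedin_subtopology)
  ultimately show False by (intro noeth_spaceD[OF assms(3)[OF U(1)], of "\<lambda>k. C (e k) \<inter> U"])
qed

lemma noeth_space_decompose:
  assumes "noeth_space T" "closedin T S"
  obtains F where "finite F" "\<Union>F = S" "\<And>A. A \<in> F \<Longrightarrow> closedin T A \<and> irreducible_in T A"
proof -
  let ?r = "{(A, B). closedin T A \<and> closedin T B \<and> A \<subset> B}"
  have "wf ?r"
    unfolding wf_iff_no_infinite_down_chain
  proof
    assume "\<exists>f. \<forall>i. (f (Suc i), f i) \<in> ?r"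
    then obtain f where "\<forall>i. (f (Suc i), f i) \<in> ?r" by (elim exE)
    then have "closedin T (f i)" "f (Suc i) \<subset> f i" for i by simp_all
    then show False by (rule noeth_spaceD[OF assms(1)])
  qed
  then have "closedin T S \<longrightarrow> (\<exists>F. finite F \<and> \<Union>F = S \<and> (\<forall>A\<in>F. closedin T A \<and> irreducible_in T A))"
  proof (induction S rule: wf_induct_rule)
    case (less S)
    show ?case
    proof (intro impI)
      assume S: "closedin T S"
      show "\<exists>F. finite F \<and> \<Union>F = S \<and> (\<forall>A\<in>F. closedin T A \<and> irreducible_in T A)"
      proof (cases "S = {} \<or> irreducible_in T S")
        case True
        then show ?thesis
        proof
          assume "S = {}"
          then show ?thesis by (intro exI[of _ "{}"]) auto
        next
          assume "irreducible_in T S"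
          then show ?thesis using S by (intro exI[of _ "{S}"]) auto
        qed
      next
        case False
        then obtain A B where AB: "closedin T A" "closedin T B" "S \<subseteq> A \<union> B" "\<not> S \<subseteq> A" "\<not> S \<subseteq> B"
          using closedin_subset[OF S] unfolding irreducible_in_def by blast
        have "(S \<inter> A, S) \<in> ?r" "(S \<inter> B, S) \<in> ?r" using AB S by (auto intro: closedin_Int)
        then obtain F G where "finite F" "\<Union>F = S \<inter> A" "\<forall>A\<in>F. closedin T A \<and> irreducible_in T A"
          "finite G" "\<Union>G = S \<inter> B" "\<forall>A\<in>G. closedin T A \<and> irreducible_in T A"
          using less[of "S \<inter> A"] less[of "S \<inter> B"] by auto
        then show ?thesis using AB(3) by (intro exI[of _ "F \<union> G"]) auto
      qed
    qed
  qed
  then show ?thesis using that assms(2) by blast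
qed

text \<open>Infinitely many level sets of \<open>b\<close> contain a chain of length
  \<open>k\<close>, but \<open>Z\<close> is a union of finitely many irreducible pieces, so two of
  these chains end in the same piece \<open>A v\<close>. Their tops cannot both be dense there,
  since \<open>b\<close> is constant on them with different values; one of the two chains is
  extended by the piece.\<close>

lemma branch_has_chain:
  assumes noe: "noeth_space T" and X: "X \<subseteq> topspace T"
    and cl: "\<And>f v. f \<in> R \<Longrightarrow> closedin (subtopology T X) {x\<in>X. f x = v}"
    and "branch (\<lambda>x f. f x) R k Z" "Z \<subseteq> X"
  shows "has_chain T Z k"
  using assms(4,5)
proof (induction k arbitrary: Z)
  case 0
  then obtain z where "z \<in> Z" by auto
  then show ?case unfolding has_chain_def
    using irreducible_in_singleton[of z T] X 0 by (intro exI[of _ "\<lambda>_. {z}"]) auto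
next
  case (Suc k)
  then obtain b where b: "b \<in> R" "infinite {v. branch (\<lambda>x f. f x) R k {z\<in>Z. b z = v}}" (is "infinite ?V") by auto
  let ?T = "subtopology T Z"
  have topZ: "topspace ?T = Z" using Suc.prems(2) X by auto
  obtain F where F: "finite F" "\<Union>F = Z" "\<And>A. A \<in> F \<Longrightarrow> closedin ?T A \<and> irreducible_in ?T A"
    using noeth_space_decompose[OF noeth_space_subtopology[OF noe, of Z], of Z] topZ closedin_topspace[of ?T] by auto
  have "\<forall>v\<in>?V. \<exists>C. (\<forall>i\<le>k. irreducible_in T (C i) \<and> C i \<subseteq> {z\<in>Z. b z = v}) \<and>
      (\<forall>i<k. T closure_of C i \<subset> T closure_of C (Suc i))"
  proof
    fix v assume "v \<in> ?V"
    then show "\<exists>C. (\<forall>i\<le>k. irreducible_in T (C i) \<and> C i \<subseteq> {z\<in>Z. b z = v}) \<and>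
      (\<forall>i<k. T closure_of C i \<subset> T closure_of C (Suc i))"
      using Suc.IH[of "{z\<in>Z. b z = v}"] Suc.prems(2) unfolding has_chain_def by blast
  qed
  from bchoice[OF this] obtain C where C0: "\<forall>v\<in>?V. (\<forall>i\<le>k. irreducible_in T (C v i) \<and> C v i \<subseteq> {z\<in>Z. b z = v}) \<and>
      (\<forall>i<k. T closure_of C v i \<subset> T closure_of C v (Suc i))" by (elim exE)
  have C: "irreducible_in T (C v i) \<and> C v i \<subseteq> {z\<in>Z. b z = v}" if "v \<in> ?V" "i \<le> k" for v i
    using bspec[OF C0 that(1), THEN conjunct1] that(2) by simp
  have C': "T closure_of C v i \<subset> T closure_of C v (Suc i)" if "v \<in> ?V" "i < k" for v i
    using bspec[OF C0 that(1), THEN conjunct2] that(2) by (elim allE[of _ i]) simp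
  have "\<exists>A. A \<in> F \<and> C v k \<subseteq> A" if v: "v \<in> ?V" for v
  proof -
    have "irreducible_in ?T (C v k)" using C[OF v, of k] by (subst irreducible_in_subtopology) auto
    moreover have "C v k \<subseteq> \<Union>F" using C[OF v, of k] F(2) by auto
    ultimately show ?thesis using irreducible_in_finite_cover[of ?T "C v k" F] F(1,3) by blast
  qed
  then have "\<forall>v\<in>?V. \<exists>A. A \<in> F \<and> C v k \<subseteq> A" by blast
  from bchoice[OF this]
  obtain A where A: "\<And>v. v \<in> ?V \<Longrightarrow> A v \<in> F" "\<And>v. v \<in> ?V \<Longrightarrow> C v k \<subseteq> A v" by blast
  have "\<not> inj_on A ?V"
    using b(2) F(1) A(1) finite_imageD[of A ?V] finite_subset[of "A ` ?V" F] by blast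
  then obtain v v' where v: "v \<in> ?V" "v' \<in> ?V" "v \<noteq> v'" "A v = A v'" by (auto simp: inj_on_def)
  have irrA: "irreducible_in T (A v)" and subA: "A v \<subseteq> Z"
  proof -
    show "A v \<subseteq> Z" using F(2) A(1)[OF v(1)] by blast
    then show "irreducible_in T (A v)" using F(3)[OF A(1)[OF v(1)]] irreducible_in_subtopology[of "A v" Z T] by blast
  qed
  have ext: "has_chain T Z (Suc k)" if w: "w \<in> ?V" "A w = A v" "T closure_of C w k \<noteq> T closure_of A v" for w
  proof -
    have "T closure_of C w k \<subset> T closure_of A v"
      using A(2)[OF w(1)] w(2,3) closure_of_mono[of "C w k" "A v" T] by auto
    then show ?thesis
      unfolding has_chain_def
    proof (intro exI[of _ "\<lambda>i. if i \<le> k then C w i else A v"] conjI allI impI)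
      fix i
      show "irreducible_in T (if i \<le> k then C w i else A v)" using C[OF w(1)] irrA by simp
      show "(if i \<le> k then C w i else A v) \<subseteq> Z" using C[OF w(1), of i] subA by auto
      assume "i < Suc k"
      then show "T closure_of (if i \<le> k then C w i else A v) \<subset> T closure_of (if Suc i \<le> k then C w (Suc i) else A v)"
        using C'[OF w(1), of i] \<open>T closure_of C w k \<subset> T closure_of A v\<close> by (cases "i = k") simp_all
    qed
  qed
  show ?case
  proof (cases "T closure_of C v k = T closure_of A v \<and> T closure_of C v' k = T closure_of A v")
    case False
    then show ?thesis using ext[of v] ext[of v'] v by auto
  next
    case True
    have Cv: "irreducible_in T (C v k)" "C v k \<subseteq> {z\<in>Z. b z = v}" using C[OF v(1), of k] by auto
    have Cv': "irreducible_in T (C v' k)" "C v' k \<subseteq> {z\<in>Z. b z = v'}" using C[OF v(2), of k] by auto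
    obtain D where D: "closedin T D" "{x\<in>X. b x = v} = D \<inter> X"
      using cl[OF b(1), of v] by (auto simp: closedin_subtopology)
    have "C v k \<subseteq> D" using Cv D(2) Suc.prems(2) by blast
    then have "T closure_of C v k \<subseteq> D" using D(1) by (rule closure_of_minimal)
    moreover obtain z where z: "z \<in> C v' k" using irreducible_inD(2)[OF Cv'(1)] by blast
    moreover have "z \<in> T closure_of C v' k" using z closure_of_subset[OF irreducible_inD(1)[OF Cv'(1)]] by blast
    ultimately have "z \<in> D \<inter> X" using True Cv'(2) Suc.prems(2) by auto
    then have "b z = v" using D(2) by blast
    then show ?thesis using z Cv'(2) v(3) by blast
  qed
qed

section \<open>Algebras of functions and generic fibres\<close>

lemma (in kalg) hom_on_mono:
  assumes "hom_on P A \<phi>" "B \<subseteq> A" "Q \<subseteq> P" shows "hom_on Q B \<phi>"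
  using assms unfolding hom_on_def by (simp add: subset_iff)

interpretation fa: kalg "\<lambda>c (_ :: 'x). c :: 'k::alg_closed_field"
  by unfold_locales (simp_all add: fun_eq_iff)

text \<open>All functions with this property, regular or not. Taken as \<open>P\<close>, it makes
  residues modulo \<open>P\<close> the same thing as functions on \<open>C\<close>.\<close>

definition vanish :: "'x set \<Rightarrow> ('x \<Rightarrow> 'k::zero) set" where
  "vanish C = {f. \<forall>x\<in>C. f x = 0}"

abbreviation constants :: "('x \<Rightarrow> 'k) set" where
  "constants \<equiv> range (\<lambda>c (_ :: 'x). c)"

lemma fun_power_apply: "(f ^ n) x = (f x :: 'k::comm_ring_1) ^ n"
  by (induction n) auto

lemma fun_sum_apply: "(sum f I) x = (\<Sum>i\<in>I. f i x :: 'k::comm_ring_1)"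
  by (induction I rule: infinite_finite_induct) auto

lemma poly_fun_apply: "poly f b x = (\<Sum>i\<le>degree f. coeff f i x * (b x :: 'k::comm_ring_1) ^ i)"
  unfolding poly_altdef by (simp add: fun_sum_apply fun_power_apply)

text \<open>Composition with a retraction onto \<open>C\<close> models restriction to \<open>C\<close> by an endomorphism.\<close>

definition retract_to :: "'x set \<Rightarrow> ('x \<Rightarrow> 'k) \<Rightarrow> 'x \<Rightarrow> 'k" where
  "retract_to C f = (\<lambda>x. f (if x \<in> C then x else (SOME c. c \<in> C)))"

lemma retract_to_endo: "fa.alg_endo (retract_to C)"
  by (auto simp: fa.alg_endo_def retract_to_def fun_eq_iff)

lemma retract_to_eq_0:
  assumes "C \<noteq> {}" shows "retract_to C f = 0 \<longleftrightarrow> f \<in> vanish C"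
proof
  assume eq: "retract_to C f = 0"
  have "f x = 0" if "x \<in> C" for x using fun_cong[OF eq, of x] that by (simp add: retract_to_def)
  then show "f \<in> vanish C" by (simp add: vanish_def)
next
  assume f: "f \<in> vanish C"
  have "(SOME c. c \<in> C) \<in> C" using assms by (simp add: some_in_eq)
  with f show "retract_to C f = 0" by (simp add: retract_to_def vanish_def fun_eq_iff)
qed

lemma retract_to_subset:
  assumes "C' \<subseteq> C" "C' \<noteq> {}" shows "retract_to C' (retract_to C f) = retract_to C' f"
proof -
  have "(SOME c. c \<in> C') \<in> C'" using assms by (simp add: some_in_eq)
  with assms(1) show ?thesis by (auto simp: retract_to_def fun_eq_iff)
qed

text \<open>The classical notion of an affine variety, as an algebra of functions on its points;
  sections are replaced by their values, which removes nilpotents. Elements of \<open>R\<close> are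
  total functions, and requiring homomorphisms to kill \<open>vanish X\<close> makes only the values
  on \<open>X\<close> count.\<close>

definition chart :: "'x topology \<Rightarrow> 'x set \<Rightarrow> ('x \<Rightarrow> 'k::alg_closed_field) set \<Rightarrow> bool" where
  "chart T X R \<longleftrightarrow> openin T X \<and> (\<exists>rs. R = fa.adjoin_list constants rs) \<and>
     (\<forall>f\<in>R. openin T {x\<in>X. f x \<noteq> 0}) \<and>
     (\<forall>W x. openin T W \<and> x \<in> W \<inter> X \<longrightarrow> (\<exists>f\<in>R. f x \<noteq> 0 \<and> {x\<in>X. f x \<noteq> 0} \<subseteq> W)) \<and>
     (\<forall>\<phi>. fa.hom_on (vanish X) R \<phi> \<longrightarrow> (\<exists>x\<in>X. \<forall>f\<in>R. \<phi> f = f x)) \<and>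
     (\<forall>x\<in>X. \<forall>y\<in>X. (\<forall>f\<in>R. f x = f y) \<longrightarrow> x = y)"

lemma chartI:
  assumes "openin T X" "\<exists>rs. R = fa.adjoin_list constants rs" "\<And>f. f \<in> R \<Longrightarrow> openin T {x\<in>X. f x \<noteq> 0}"
    "\<And>W x. openin T W \<Longrightarrow> x \<in> W \<inter> X \<Longrightarrow> \<exists>f\<in>R. f x \<noteq> 0 \<and> {x\<in>X. f x \<noteq> 0} \<subseteq> W"
    "\<And>\<phi>. fa.hom_on (vanish X) R \<phi> \<Longrightarrow> \<exists>x\<in>X. \<forall>f\<in>R. \<phi> f = f x"
    "\<And>x y. x \<in> X \<Longrightarrow> y \<in> X \<Longrightarrow> \<forall>f\<in>R. f x = f y \<Longrightarrow> x = y"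
  shows "chart T X R"
  unfolding chart_def
proof (intro conjI ballI allI impI)
  show "\<exists>f\<in>R. f x \<noteq> 0 \<and> {x\<in>X. f x \<noteq> 0} \<subseteq> W" if "openin T W \<and> x \<in> W \<inter> X" for W x
    using that by (elim conjE) (rule assms(4))
qed (fact assms)+

lemma chartD:
  assumes "chart T X R"
  shows "openin T X" "fa.subalg R" "f \<in> R \<Longrightarrow> openin T {x\<in>X. f x \<noteq> 0}"
    "openin T W \<Longrightarrow> x \<in> W \<Longrightarrow> x \<in> X \<Longrightarrow> \<exists>f\<in>R. f x \<noteq> 0 \<and> {x\<in>X. f x \<noteq> 0} \<subseteq> W"
    "fa.hom_on (vanish X) R \<phi> \<Longrightarrow> \<exists>x\<in>X. \<forall>f\<in>R. \<phi> f = f x" "X \<subseteq> topspace T"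
    "x \<in> X \<Longrightarrow> y \<in> X \<Longrightarrow> (\<And>f. f \<in> R \<Longrightarrow> f x = f y) \<Longrightarrow> x = y"
proof -
  show "x \<in> X \<Longrightarrow> y \<in> X \<Longrightarrow> (\<And>f. f \<in> R \<Longrightarrow> f x = f y) \<Longrightarrow> x = y"
    using assms by (auto simp: chart_def)
  show X: "openin T X" using assms by (auto simp: chart_def)
  then show "X \<subseteq> topspace T" by (rule openin_subset)
  show "fa.subalg R" using assms fa.adjoin_list_subalg[OF fa.subalg_range] by (auto simp: chart_def)
  show "f \<in> R \<Longrightarrow> openin T {x\<in>X. f x \<noteq> 0}" using assms by (auto simp: chart_def)
  show "openin T W \<Longrightarrow> x \<in> W \<Longrightarrow> x \<in> X \<Longrightarrow> \<exists>f\<in>R. f x \<noteq> 0 \<and> {x\<in>X. f x \<noteq> 0} \<subseteq> W"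
    using assms by (auto simp: chart_def)
  show "fa.hom_on (vanish X) R \<phi> \<Longrightarrow> \<exists>x\<in>X. \<forall>f\<in>R. \<phi> f = f x" using assms by (auto simp: chart_def)
qed

lemma chart_zero_closed:
  assumes "chart T X R" "f \<in> R" shows "closedin (subtopology T X) {x\<in>X. f x = v}"
proof -
  have "f - (\<lambda>_. v) \<in> R" using fa.subalgD(1,7)[OF chartD(2)[OF assms(1)]] assms(2) by blast
  then have "openin T {x\<in>X. (f - (\<lambda>_. v)) x \<noteq> 0}" by (rule chartD(3)[OF assms(1)])
  then have "closedin T (topspace T - {x\<in>X. f x \<noteq> v})" by (intro closedin_diff closedin_topspace) simp
  then show ?thesis
    unfolding closedin_subtopology using chartD(6)[OF assms(1)]
    by (intro exI[of _ "topspace T - {x\<in>X. f x \<noteq> v}"]) auto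
qed

lemma chart_separate:
  assumes "chart T X R" "z \<in> X" "z \<notin> T closure_of C" "C \<subseteq> X"
  obtains f where "f \<in> R" "f z \<noteq> 0" "f \<in> vanish C"
proof -
  have "C \<subseteq> T closure_of C" using assms(4) chartD(6)[OF assms(1)] by (intro closure_of_subset) auto
  moreover have "openin T (topspace T - T closure_of C)" by auto
  then obtain f where "f \<in> R" "f z \<noteq> 0" "{x\<in>X. f x \<noteq> 0} \<subseteq> topspace T - T closure_of C"
    using chartD(4)[OF assms(1), of "topspace T - T closure_of C" z] assms(2,3) chartD(6)[OF assms(1)] by blast
  ultimately show ?thesis using that[of f] assms(4) unfolding vanish_def by blast
qed

text \<open>If a product vanishes on \<open>E\<close>, the complements of the two nonvanishing loci
  are closed and cover \<open>E\<close>.\<close>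

lemma chart_rel_prime:
  assumes "chart T X R" "E \<subseteq> X" "irreducible_in T E"
  shows "fa.rel_prime R (vanish E)"
  unfolding fa.rel_prime_def
proof (intro conjI ballI impI allI)
  show "(1 :: 'a \<Rightarrow> 'b) \<notin> vanish E" using irreducible_inD(2)[OF assms(3)] by (auto simp: vanish_def)
  fix f g assume fg: "f \<in> R" "g \<in> R" "f * g \<in> vanish E"
  let ?A = "\<lambda>f. topspace T - {x\<in>X. f x \<noteq> 0}"
  have "E \<subseteq> ?A f \<union> ?A g" using fg(3) assms(2) chartD(6)[OF assms(1)] by (auto simp: vanish_def)
  moreover have "closedin T (?A f)" "closedin T (?A g)" 
    using chartD(3)[OF assms(1)] fg by (intro closedin_diff closedin_topspace; simp)+
  ultimately have "E \<subseteq> ?A f \<or> E \<subseteq> ?A g" using irreducible_inD(3)[OF assms(3)] by blast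
  then show "f \<in> vanish E \<or> g \<in> vanish E" using assms(2) by (auto simp: vanish_def)
qed (auto simp: vanish_def)

lemma chart_is_domain:
  assumes "chart T X R" "E \<subseteq> X" "irreducible_in T E"
  shows "fa.is_domain (retract_to E ` R)"
  unfolding fa.is_domain_def
proof clarify
  fix f g assume fg: "f \<in> R" "g \<in> R" "retract_to E f * retract_to E g = 0" "retract_to E g \<noteq> 0"
  have E: "E \<noteq> {}" using irreducible_inD(2)[OF assms(3)] .
  have "retract_to E (f * g) = 0" using fg(3) fa.alg_endoD(3)[OF retract_to_endo, of E f g] by simp
  then have "f * g \<in> vanish E" by (simp add: retract_to_eq_0[OF E])
  then have "f \<in> vanish E \<or> g \<in> vanish E"
    using fa.rel_primeD(6)[OF chart_rel_prime[OF assms] fg(1,2)] by blast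
  then show "retract_to E f = 0" using fg(4) by (auto simp: retract_to_eq_0[OF E])
qed

text \<open>A strictly descending sequence yields functions \<open>f n\<close> that vanish on
  \<open>C (Suc n)\<close> but not on \<open>C n\<close>. Some \<open>f m\<close> is a combination
  of the earlier ones, all of which vanish on \<open>C m\<close>.\<close>

lemma chart_noeth_space:
  assumes "chart T X R" shows "noeth_space (subtopology T X)"
  unfolding noeth_space_def
proof
  assume "\<exists>C. \<forall>n. closedin (subtopology T X) (C n) \<and> C (Suc n) \<subset> C n"
  then obtain C where C0: "\<forall>n. closedin (subtopology T X) (C n) \<and> C (Suc n) \<subset> C n" by (elim exE)
  note C = C0[rule_format, THEN conjunct1] C0[rule_format, THEN conjunct2]
  have "\<exists>f. f \<in> R \<and> f \<in> vanish (C (Suc n)) \<and> f \<notin> vanish (C n)" for n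
  proof -
    obtain z where z: "z \<in> C n" "z \<notin> C (Suc n)" using C(2)[of n] by auto
    obtain D where D: "closedin T D" "C (Suc n) = D \<inter> X" using C(1)[of "Suc n"] by (auto simp: closedin_subtopology)
    have zX: "z \<in> X" using z(1) closedin_subset[OF C(1)[of n]] by auto
    have "T closure_of (C (Suc n)) \<subseteq> D" using D by (intro closure_of_minimal) auto
    then have "z \<notin> T closure_of (C (Suc n))" using z(2) zX D(2) by blast
    then obtain f where "f \<in> R" "f z \<noteq> 0" "f \<in> vanish (C (Suc n))"
      using chart_separate[OF assms zX] D(2) by blast
    then show ?thesis using z(1) by (auto simp: vanish_def)
  qed
  then have "\<forall>n. \<exists>f. f \<in> R \<and> f \<in> vanish (C (Suc n)) \<and> f \<notin> vanish (C n)" ..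
  from choice[OF this] obtain f where "\<forall>n. f n \<in> R \<and> f n \<in> vanish (C (Suc n)) \<and> f n \<notin> vanish (C n)" by (elim exE)
  then have f: "\<And>n. f n \<in> R" "\<And>n. f n \<in> vanish (C (Suc n))" "\<And>n. f n \<notin> vanish (C n)" by simp_all
  obtain rs where "R = fa.adjoin_list constants rs" using assms by (auto simp: chart_def)
  then have "noeth R" using fa.noeth_adjoin_list[OF fa.subalg_range fa.noeth_field] by simp
  then obtain m where m: "f m \<in> idl R (f ` {..<m})"
    unfolding noeth_def using f(1) by blast
  have dec: "C j \<subseteq> C i" if "i \<le> j" for i j
    by (rule lift_Suc_antimono_le[OF _ that]) (use C(2) in auto)
  have "g \<in> vanish (C m)" if "g \<in> idl R (f ` {..<m})" for g
    using that
  proof (induction rule: idl.induct)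
    case (step h u s)
    then obtain i where "i < m" "s = f i" by blast
    then show ?case using f(2)[of i] dec[of "Suc i" m] step by (auto simp: vanish_def subset_iff)
  qed (simp add: vanish_def)
  with m f(3) show False by blast
qed

text \<open>Each strict inclusion costs one unit of the growth exponent by
  \<open>growth_drop\<close>, applied to a function that vanishes on the smaller set but not on the
  larger. The exponent starts at \<open>l\<close> on the largest member and cannot become
  negative.\<close>

lemma chain_growth:
  assumes ch: "chart T X R" and S: "S \<subseteq> X" "has_chain T S L"
    and gr: "\<And>C. C \<subseteq> S \<Longrightarrow> irreducible_in T C \<Longrightarrow> fa.growth (retract_to C ` R) l"
  shows "L \<le> l"
proof -
  obtain Z where Z: "\<And>i. i \<le> L \<Longrightarrow> closedin (subtopology T S) (Z i)"
    "\<And>i. i \<le> L \<Longrightarrow> irreducible_in (subtopology T S) (Z i)" "\<And>i. i < L \<Longrightarrow> Z i \<subset> Z (Suc i)"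
    using S(2)[unfolded has_chain_iff_closed_chain] by blast
  have sub: "Z i \<subseteq> S" if "i \<le> L" for i using closedin_subset[OF Z(1)[OF that]] by auto
  have irr: "irreducible_in T (Z i)" if "i \<le> L" for i
    using Z(2)[OF that] irreducible_in_subtopology[OF sub[OF that]] by blast
  have "j \<le> l \<and> fa.growth (retract_to (Z (L - j)) ` R) (l - j)" if "j \<le> L" for j
    using that
  proof (induction j)
    case 0
    then show ?case using gr[OF sub irr, of L] by simp
  next
    case (Suc j)
    define i where "i = L - Suc j"
    have i: "i < L" "Suc i = L - j" using Suc.prems by (auto simp: i_def)
    note irri = irr[of i] irr[of "Suc i"]
    obtain z where z: "z \<in> Z (Suc i)" "z \<notin> Z i" using Z(3)[OF i(1)] by blast
    obtain D where D: "closedin T D" "Z i = D \<inter> S" using Z(1)[of i] i(1) by (auto simp: closedin_subtopology)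
    have zS: "z \<in> S" using z(1) sub[of "Suc i"] i(1) by auto
    have "T closure_of (Z i) \<subseteq> D" using D by (intro closure_of_minimal) auto
    then have "z \<notin> T closure_of (Z i)" using z(2) zS D(2) by blast
    moreover have "z \<in> X" "Z i \<subseteq> X" using zS S(1) sub[of i] i(1) by auto
    ultimately obtain f where f: "f \<in> R" "f z \<noteq> 0" "f \<in> vanish (Z i)"
      using chart_separate[OF ch] by blast
    have ne: "Z i \<noteq> {}" "Z (Suc i) \<noteq> {}" using irri i(1) irreducible_inD(2) by auto
    have "l - j \<ge> 1 \<and> fa.growth (retract_to (Z i) ` R) (l - j - 1)"
    proof (rule fa.growth_drop[OF chartD(2)[OF ch]])
      show "fa.is_domain (retract_to (Z (Suc i)) ` R)"
        using irri i(1) sub[of "Suc i"] S(1) by (intro chart_is_domain[OF ch]) auto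
      show "fa.growth (retract_to (Z (Suc i)) ` R) (l - j)" using Suc i by simp
      show "retract_to (Z i) (retract_to (Z (Suc i)) x) = retract_to (Z i) x" for x :: "'a \<Rightarrow> 'b"
        using Z(3)[OF i(1)] ne by (intro retract_to_subset) auto
      show "retract_to (Z i) f = 0" using f(3) by (simp add: retract_to_eq_0[OF ne(1)])
      show "retract_to (Z (Suc i)) f \<noteq> 0" using f(2) z(1) by (auto simp: retract_to_eq_0[OF ne(2)] vanish_def)
    qed (use f(1) in \<open>auto intro: retract_to_endo\<close>)
    then show ?case using i by (auto simp: i_def)
  qed
  from this[of L] show ?thesis by simp
qed

text \<open>A point off \<open>E\<close> would be separated from \<open>E\<close> by a function in
  \<open>vanish E\<close>, and \<open>\<psi>\<close> kills that function.\<close>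

lemma chart_points_of_homs:
  assumes ch: "chart T X R" and E: "closedin (subtopology T X) E"
    and \<psi>: "fa.hom_on (vanish E) R \<psi>"
  shows "\<exists>x\<in>E. \<forall>f\<in>R. f x = \<psi> f"
proof -
  obtain D where D: "closedin T D" "E = D \<inter> X" using E by (auto simp: closedin_subtopology)
  have "fa.hom_on (vanish X) R \<psi>" using \<psi> D(2) unfolding fa.hom_on_def vanish_def by auto
  then obtain x where x: "x \<in> X" "\<And>f. f \<in> R \<Longrightarrow> \<psi> f = f x" using chartD(5)[OF ch] by blast
  have "x \<in> E"
  proof (rule ccontr)
    assume "x \<notin> E"
    moreover have "T closure_of E \<subseteq> D" using D by (intro closure_of_minimal) auto
    ultimately obtain f where f: "f \<in> R" "f x \<noteq> 0" "f \<in> vanish E"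
      using chart_separate[OF ch x(1), of E] x(1) D(2) by blast
    then show False using fa.hom_onD(4)[OF \<psi> f(1,3)] x(2)[OF f(1)] by simp
  qed
  then show ?thesis using x(2) by auto
qed

lemma chart_branch_has_chain:
  assumes ch: "chart T X R" and Z: "branch (\<lambda>x f. f x) R k Z" "Z \<subseteq> X"
  shows "has_chain T Z k"
proof -
  have "has_chain (subtopology T X) Z k"
  proof (rule branch_has_chain[OF chart_noeth_space[OF ch] _ _ Z])
    show "X \<subseteq> topspace (subtopology T X)" using chartD(6)[OF ch] by auto
    show "closedin (subtopology (subtopology T X) X) {x\<in>X. f x = v}" if "f \<in> R" for f v
      using chart_zero_closed[OF ch that] by (simp add: subtopology_subtopology)
  qed
  then show ?thesis using has_chain_subtopology[OF Z(2)] by blast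
qed

lemma retract_to_constants: "retract_to C ` constants = constants"
  by (auto simp: retract_to_def image_iff)

text \<open>From above: constants have growth 0, so functions on \<open>E\<close>, and on each
  irreducible subset of it, have growth \<open>m\<close>. From below: with \<open>W\<close> shrunk
  to a principal open set, the homomorphisms from \<open>tower_branch\<close> that do not kill its
  function \<open>f\<close> are points of \<open>E\<close> in \<open>W\<close>.\<close>

theorem chart_dim:
  assumes ch: "chart T X R" and E: "closedin (subtopology T X) E" "irreducible_in T E"
    and R: "R = fa.adjoin_list constants rs" and t: "fa.tower (vanish E) constants rs m"
    and W: "openin T W" "W \<inter> E \<noteq> {}"
  shows "dim_of T (E \<inter> W) = ereal (real m)"
proof (rule dim_of_eq_nat)
  have EX: "E \<subseteq> X" using closedin_subset[OF E(1)] by auto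
  note P = chart_rel_prime[OF ch EX E(2)]
  have rsR: "set rs \<subseteq> R" "constants \<subseteq> R" using fa.adjoin_list_superset[OF fa.subalg_range] R by auto
  have ne: "E \<noteq> {}" using W by blast
  show "n \<le> m" if n: "has_chain T (E \<inter> W) n" for n
  proof (rule chain_growth[OF ch _ n])
    show "E \<inter> W \<subseteq> X" using EX by blast
    fix C assume C: "C \<subseteq> E \<inter> W" "irreducible_in T C"
    obtain a where a: "a \<in> R" "a \<notin> vanish E" "\<And>h l. fa.alg_endo h \<Longrightarrow> (\<forall>x\<in>R. x \<in> vanish E \<longrightarrow> h x = 0) \<Longrightarrow>
       fa.is_domain (h ` R) \<Longrightarrow> h a \<noteq> 0 \<Longrightarrow> fa.growth (h ` constants) l \<Longrightarrow> fa.growth (h ` R) (l + m)"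
      using fa.tower_growth[OF chartD(2)[OF ch] P t fa.subalg_range rsR(2,1)] unfolding R[symmetric] by blast
    have "fa.growth (retract_to E ` R) (0 + m)"
    proof (rule a(3)[OF retract_to_endo _ chart_is_domain[OF ch EX E(2)]])
      show "\<forall>x\<in>R. x \<in> vanish E \<longrightarrow> retract_to E x = 0" by (simp add: retract_to_eq_0[OF ne])
      show "retract_to E a \<noteq> 0" using a(2) by (simp add: retract_to_eq_0[OF ne])
      show "fa.growth (retract_to E ` constants) 0" using fa.growth_field by (simp add: retract_to_constants)
    qed
    then have gE: "fa.growth (retract_to E ` R) m" by simp
    have "C \<subseteq> E" using C(1) by blast
    then show "fa.growth (retract_to C ` R) m"
      by (intro fa.growth_image[OF gE retract_to_endo retract_to_endo]
          retract_to_subset irreducible_inD(2)[OF C(2)])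
  qed
  obtain x where x: "x \<in> W" "x \<in> E" using W by blast
  then obtain f where f: "f \<in> R" "f x \<noteq> 0" "{x\<in>X. f x \<noteq> 0} \<subseteq> W" using chartD(4)[OF ch W(1)] EX by blast
  have "f \<notin> vanish E" using f(2) x(2) by (auto simp: vanish_def)
  then obtain q where q: "q \<in> constants" "q \<notin> vanish E" "\<And>\<phi>. fa.hom_on (vanish E) constants \<phi> \<Longrightarrow> \<phi> q \<noteq> 0 \<Longrightarrow>
       branch (\<lambda>\<psi>. \<psi>) R m {\<psi>. fa.hom_on (vanish E) R \<psi> \<and> (\<forall>x\<in>constants. \<psi> x = \<phi> x) \<and> \<psi> f \<noteq> 0}"
    using fa.tower_branch[OF chartD(2)[OF ch] P fa.subalg_range rsR t, of f] f(1) unfolding R[symmetric] by blast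
  have "fa.hom_on (vanish E) constants (\<lambda>f. f x)"
    unfolding fa.hom_on_def using x(2) by (auto simp: vanish_def)
  moreover have "q x \<noteq> 0" using q(1,2) by (auto simp: vanish_def)
  ultimately have "branch (\<lambda>\<psi>. \<psi>) R m {\<psi>. fa.hom_on (vanish E) R \<psi> \<and> (\<forall>f\<in>constants. \<psi> f = f x) \<and> \<psi> f \<noteq> 0}"
    by (rule q(3))
  then have "branch (\<lambda>x f. f x) R m (E \<inter> {x\<in>X. f x \<noteq> 0})"
  proof (rule branch_transfer)
    fix \<psi> assume "\<psi> \<in> {\<psi>. fa.hom_on (vanish E) R \<psi> \<and> (\<forall>f\<in>constants. \<psi> f = f x) \<and> \<psi> f \<noteq> 0}"
    then obtain y where "y \<in> E" "\<forall>f\<in>R. f y = \<psi> f" "\<psi> f \<noteq> 0" using chart_points_of_homs[OF ch E(1)] by blast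
    then show "\<exists>z'\<in>E \<inter> {x\<in>X. f x \<noteq> 0}. \<forall>f\<in>R. f z' = \<psi> f" using f(1) EX by (intro bexI[of _ y]) auto
  qed
  then have "has_chain T (E \<inter> {x\<in>X. f x \<noteq> 0}) m" using EX by (intro chart_branch_has_chain[OF ch]) auto
  then show "has_chain T (E \<inter> W) m" by (rule has_chain_mono) (use f(3) in blast)
qed

text \<open>In the tower \<open>qs\<close> comes before \<open>rs\<close>. Evaluation at
  \<open>x\<close> is a homomorphism on the algebra \<open>A\<close> of \<open>qs\<close>; its
  extensions to \<open>R\<close> are points with the same values of \<open>qs\<close>, and they
  branch \<open>k\<close> times. On an irreducible subset of a level set \<open>A\<close> restricts
  to constants, so only the \<open>k\<close> upper steps contribute to growth. The returned element
  is the product of both genericity conditions.\<close>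

theorem chart_generic_fibre:
  assumes ch: "chart T X R" and E: "closedin (subtopology T X) E" "irreducible_in T E"
    and R: "R = fa.adjoin_list constants rs" and qs: "set qs \<subseteq> R"
    and t: "fa.tower (vanish E) constants qs n"
  obtains k a where "a \<in> R" "a \<notin> vanish E"
    "\<And>W. openin T W \<Longrightarrow> W \<inter> E \<noteq> {} \<Longrightarrow> dim_of T (E \<inter> W) = ereal (real (n + k))"
    "\<And>x. x \<in> E \<Longrightarrow> a x \<noteq> 0 \<Longrightarrow> has_chain T {x'\<in>E. \<forall>q\<in>set qs. q x' = q x} k"
    "\<And>x L. x \<in> E \<Longrightarrow> has_chain T {x'\<in>E. a x' \<noteq> 0 \<and> (\<forall>q\<in>set qs. q x' = q x)} L \<Longrightarrow> L \<le> k"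
proof -
  have EX: "E \<subseteq> X" using closedin_subset[OF E(1)] by auto
  note P = chart_rel_prime[OF ch EX E(2)]
  note subR = chartD(2)[OF ch]
  define A where "A = fa.adjoin_list constants qs"
  have A: "fa.subalg A" unfolding A_def by (rule fa.adjoin_list_subalg[OF fa.subalg_range])
  have cR: "constants \<subseteq> R" and rsR: "set rs \<subseteq> R" using fa.adjoin_list_superset[OF fa.subalg_range] R by auto
  have AR: "A \<subseteq> R" unfolding A_def using fa.adjoin_list_least[OF subR fa.subalg_range cR qs] .
  have qsA: "set qs \<subseteq> A" "constants \<subseteq> A" unfolding A_def using fa.adjoin_list_superset[OF fa.subalg_range] by auto
  \<comment> \<open>\<open>rs\<close> generates \<open>R\<close> over the constants, hence also over
    \<open>A\<close>; counting its steps over \<open>A\<close> gives the relative number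
    \<open>k\<close>.\<close>
  have R2: "R = fa.adjoin_list A rs"
  proof
    show "fa.adjoin_list A rs \<subseteq> R" using fa.adjoin_list_least[OF subR A AR rsR] .
    have "set rs \<subseteq> fa.adjoin_list A rs" "constants \<subseteq> fa.adjoin_list A rs"
      using fa.adjoin_list_superset[OF A] qsA(2) by blast+
    then show "R \<subseteq> fa.adjoin_list A rs"
      unfolding R by (intro fa.adjoin_list_least fa.adjoin_list_subalg A fa.subalg_range)
  qed
  obtain k where k: "fa.tower (vanish E) A rs k" using fa.tower_exists by blast
  have tqr: "fa.tower (vanish E) constants (qs @ rs) (n + k)"
    using fa.tower_append[OF t] k unfolding A_def by blast
  have Rqr: "R = fa.adjoin_list constants (qs @ rs)" using R2 by (simp add: A_def)
  obtain a where a: "a \<in> R" "a \<notin> vanish E" "\<And>h l. fa.alg_endo h \<Longrightarrow> (\<forall>x\<in>R. x \<in> vanish E \<longrightarrow> h x = 0) \<Longrightarrow>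
       fa.is_domain (h ` R) \<Longrightarrow> h a \<noteq> 0 \<Longrightarrow> fa.growth (h ` A) l \<Longrightarrow> fa.growth (h ` R) (l + k)"
    using fa.tower_growth[OF subR P k A AR rsR] unfolding R2[symmetric] by blast
  have "1 \<in> R" using fa.subalgD(3)[OF subR] .
  then obtain q where q: "q \<in> A" "q \<notin> vanish E" "\<And>\<phi>. fa.hom_on (vanish E) A \<phi> \<Longrightarrow> \<phi> q \<noteq> 0 \<Longrightarrow>
       branch (\<lambda>\<psi>. \<psi>) R k {\<psi>. fa.hom_on (vanish E) R \<psi> \<and> (\<forall>x\<in>A. \<psi> x = \<phi> x) \<and> \<psi> 1 \<noteq> 0}"
    using fa.tower_branch[OF subR P A rsR AR k, of 1] fa.rel_primeD(5)[OF P] unfolding R2[symmetric] by blast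
  show ?thesis
  proof (rule that)
    show "a * q \<in> R" using fa.subalgD(5)[OF subR a(1)] q(1) AR by blast
    show "a * q \<notin> vanish E" using fa.rel_primeD(6)[OF P a(1)] q(1,2) AR a(2) by blast
    show "dim_of T (E \<inter> W) = ereal (real (n + k))" if "openin T W" "W \<inter> E \<noteq> {}" for W
      using chart_dim[OF ch E Rqr tqr that] .
  next
    fix x assume x: "x \<in> E" "(a * q) x \<noteq> 0"
    have "fa.hom_on (vanish E) A (\<lambda>f. f x)"
      unfolding fa.hom_on_def using x(1) by (auto simp: vanish_def)
    then have "branch (\<lambda>\<psi>. \<psi>) R k {\<psi>. fa.hom_on (vanish E) R \<psi> \<and> (\<forall>f\<in>A. \<psi> f = f x) \<and> \<psi> 1 \<noteq> 0}"
      using x(2) by (intro q(3)) auto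
    then have "branch (\<lambda>x f. f x) R k {x'\<in>E. \<forall>q\<in>set qs. q x' = q x}"
    proof (rule branch_transfer)
      fix \<psi> assume "\<psi> \<in> {\<psi>. fa.hom_on (vanish E) R \<psi> \<and> (\<forall>f\<in>A. \<psi> f = f x) \<and> \<psi> 1 \<noteq> 0}"
      then obtain y where y: "y \<in> E" "\<forall>f\<in>R. f y = \<psi> f" "\<forall>f\<in>A. \<psi> f = f x"
        using chart_points_of_homs[OF ch E(1)] by blast
      have "f y = f x" if "f \<in> set qs" for f
        using bspec[OF y(2) subsetD[OF qs that]] bspec[OF y(3) subsetD[OF qsA(1) that]] by simp
      then show "\<exists>z'\<in>{x'\<in>E. \<forall>q\<in>set qs. q x' = q x}. \<forall>f\<in>R. f z' = \<psi> f"
        using y(1,2) by (intro bexI[of _ y]) auto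
    qed
    then show "has_chain T {x'\<in>E. \<forall>q\<in>set qs. q x' = q x} k"
      using EX by (intro chart_branch_has_chain[OF ch]) auto
  next
    fix x L assume x: "x \<in> E" and L: "has_chain T {x'\<in>E. (a * q) x' \<noteq> 0 \<and> (\<forall>q\<in>set qs. q x' = q x)} L"
      (is "has_chain T ?F L")
    show "L \<le> k"
    proof (rule chain_growth[OF ch _ L])
      show "?F \<subseteq> X" using EX by blast
      fix C assume C: "C \<subseteq> ?F" "irreducible_in T C"
      have ne: "C \<noteq> {}" by (rule irreducible_inD(2)[OF C(2)])
      have CX: "C \<subseteq> X" using C(1) EX by blast
      have "A \<subseteq> {f. \<forall>x'\<in>?F. f x' = f x}"
        unfolding A_def by (rule fa.adjoin_list_least[OF _ fa.subalg_range]) (auto simp: fa.subalg_def)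
      then have Ax: "f x' = f x" if "f \<in> A" "x' \<in> C" for f x' using that C(1) by blast
      have "retract_to C ` A = constants"
      proof
        show "constants \<subseteq> retract_to C ` A" using retract_to_constants[of C] qsA(2) by (metis image_mono)
        show "retract_to C ` A \<subseteq> constants"
        proof clarify
          fix f assume f: "f \<in> A"
          have "retract_to C f = (\<lambda>_. f x)"
            unfolding retract_to_def using Ax[OF f] someI_ex[of "\<lambda>c. c \<in> C"] ne by (auto simp: fun_eq_iff)
          then show "retract_to C f \<in> constants" by blast
        qed
      qed
      then have "fa.growth (retract_to C ` A) 0" using fa.growth_field by simp
      moreover have "\<forall>x\<in>R. x \<in> vanish E \<longrightarrow> retract_to C x = 0"
        using C(1) by (auto simp: retract_to_eq_0[OF ne] vanish_def)
      moreover have "retract_to C a \<noteq> 0" using ne C(1) by (auto simp: retract_to_eq_0[OF ne] vanish_def)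
      ultimately have "fa.growth (retract_to C ` R) (0 + k)"
        by (intro a(3)[OF retract_to_endo _ chart_is_domain[OF ch CX C(2)]])
      then show "fa.growth (retract_to C ` R) k" by simp
    qed
  qed
qed

text \<open>Localization at \<open>g\<close>, with \<open>inverse (g x)\<close> as a total function.
  A homomorphism on the larger algebra kills \<open>g\<close> times this function minus 1, which
  vanishes on the principal set, so the point that it defines satisfies
  \<open>g x \<noteq> 0\<close>.\<close>

lemma chart_principal:
  assumes ch: "chart T X R" and g: "g \<in> R"
  shows "chart T {x\<in>X. g x \<noteq> 0} (fa.adjoin R (\<lambda>x. inverse (g x)))"
proof -
  let ?g = "\<lambda>x. inverse (g x)" and ?X = "{x\<in>X. g x \<noteq> 0}"
  note subR = chartD(2)[OF ch]
  note sup = fa.adjoin_superset[OF subR, of ?g]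
  obtain rs where rs: "R = fa.adjoin_list constants rs" using ch by (auto simp: chart_def)
  have "openin T ?X" by (rule chartD(3)[OF ch g])
  moreover have "\<exists>rs. fa.adjoin R ?g = fa.adjoin_list constants rs"
    using rs by (intro exI[of _ "rs @ [?g]"]) simp
  moreover have "openin T {x\<in>?X. f x \<noteq> 0}" if f: "f \<in> fa.adjoin R ?g" for f
  proof -
    obtain h where h: "\<And>i. coeff h i \<in> R" "f = poly h ?g" using f by (auto simp: fa.adjoin_def fa.polys_def)
    \<comment> \<open>Clearing denominators: where \<open>g\<close> is nonzero, \<open>r\<close> is
      \<open>g ^ degree h\<close> times \<open>f\<close>.\<close>
    define r where "r = (\<Sum>i\<le>degree h. coeff h i * g ^ (degree h - i))"
    have "r \<in> R" unfolding r_def by (intro fa.subalgD(9)[OF subR] fa.subalgD(5)[OF subR] fa.subalgD(8)[OF subR] h g)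
    have "r x = g x ^ degree h * f x" if "g x \<noteq> 0" for x
    proof -
      have "r x = (\<Sum>i\<le>degree h. coeff h i x * g x ^ (degree h - i))"
        by (simp add: r_def fun_sum_apply fun_power_apply)
      also have "\<dots> = (\<Sum>i\<le>degree h. g x ^ degree h * (coeff h i x * inverse (g x) ^ i))"
        using that by (intro sum.cong refl) (simp add: power_diff field_simps)
      finally show ?thesis by (simp add: h(2) poly_fun_apply sum_distrib_left)
    qed
    then have "{x\<in>?X. f x \<noteq> 0} = ?X \<inter> {x\<in>X. r x \<noteq> 0}" by auto
    then show ?thesis using chartD(3)[OF ch g] chartD(3)[OF ch \<open>r \<in> R\<close>] by (simp add: openin_Int)
  qed
  moreover have "\<exists>f\<in>fa.adjoin R ?g. f x \<noteq> 0 \<and> {x\<in>?X. f x \<noteq> 0} \<subseteq> W" if W: "openin T W" "x \<in> W \<inter> ?X" for W x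
  proof -
    obtain f where "f \<in> R" "f x \<noteq> 0" "{x\<in>X. f x \<noteq> 0} \<subseteq> W" using chartD(4)[OF ch W(1)] W(2) by blast
    then show ?thesis using sup(1) by (intro bexI[of _ f]) auto
  qed
  moreover have "\<exists>x\<in>?X. \<forall>f\<in>fa.adjoin R ?g. \<phi> f = f x" if \<phi>: "fa.hom_on (vanish ?X) (fa.adjoin R ?g) \<phi>" for \<phi>
  proof -
    note sub = fa.adjoin_subalg[OF subR, of ?g]
    have "fa.hom_on (vanish X) R \<phi>" by (rule fa.hom_on_mono[OF \<phi> sup(1)]) (auto simp: vanish_def)
    then obtain x where x: "x \<in> X" "\<And>f. f \<in> R \<Longrightarrow> \<phi> f = f x" using chartD(5)[OF ch] by blast
    have gA: "g \<in> fa.adjoin R ?g" using g sup by blast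
    have "\<phi> (g * ?g - 1) = 0"
      using sup(2) gA sub by (intro fa.hom_onD(4)[OF \<phi>]) (auto simp: vanish_def intro!: fa.subalgD)
    moreover have "\<phi> (g * ?g - 1) = g x * \<phi> ?g - 1"
      using fa.hom_on_diff[OF sub \<phi>, of "g * ?g" 1] fa.hom_onD(3)[OF \<phi> gA sup(2)] fa.hom_onD(6)[OF \<phi>]
        fa.subalgD(3,5)[OF sub] gA sup(2) x(2)[OF g] by simp
    ultimately have gx: "g x * \<phi> ?g = 1" by simp
    then have "g x \<noteq> 0" by auto
    have "fa.adjoin R ?g \<subseteq> {f\<in>fa.adjoin R ?g. \<phi> f = f x}"
    proof (rule fa.adjoin_least)
      show "fa.subalg {f \<in> fa.adjoin R ?g. \<phi> f = f x}"
        unfolding fa.subalg_def using fa.hom_onD[OF \<phi>] fa.subalgD(1,4,5)[OF sub] by auto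
      show "R \<subseteq> {f \<in> fa.adjoin R ?g. \<phi> f = f x}" using x(2) sup(1) by auto
      show "?g \<in> {f \<in> fa.adjoin R ?g. \<phi> f = f x}"
        using sup(2) gx \<open>g x \<noteq> 0\<close> by (auto simp: field_simps)
    qed
    then show ?thesis using x(1) \<open>g x \<noteq> 0\<close> by blast
  qed
  moreover have "x = y" if "x \<in> ?X" "y \<in> ?X" "\<forall>f\<in>fa.adjoin R ?g. f x = f y" for x y
    using that sup(1) by (intro chartD(7)[OF ch]) auto
  ultimately show ?thesis by (rule chartI)
qed

text \<open>The hypothesis on \<open>D\<close> says that pulling back along \<open>p\<close> is
  injective on functions, as it is for the closure \<open>D\<close> of the image of \<open>E\<close>
  in a chart. Relations can then be transferred coefficient by coefficient in both
  directions.\<close>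

lemma algebraic_over_pullback:
  fixes p :: "'x \<Rightarrow> 'y" and A :: "('x \<Rightarrow> 'k::alg_closed_field) set" and A' :: "('y \<Rightarrow> 'k) set"
  assumes Q: "fa.subalg A" "fa.subalg A'" 
    and D: "\<And>f. f \<in> fa.adjoin A' b' \<Longrightarrow> (\<forall>x\<in>E. f (p x) = 0) \<longleftrightarrow> f \<in> vanish D"
    and rel: "\<And>f. f \<in> A \<Longrightarrow> \<exists>f'\<in>A'. \<forall>x\<in>E. f x = f' (p x)" "\<And>f'. f' \<in> A' \<Longrightarrow> \<exists>f\<in>A. \<forall>x\<in>E. f x = f' (p x)"
    and b: "\<And>x. x \<in> E \<Longrightarrow> b x = b' (p x)"
  shows "fa.algebraic_over (vanish E) A b \<longleftrightarrow> fa.algebraic_over (vanish D) A' b'"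
    "\<And>f. f \<in> fa.adjoin A b \<Longrightarrow> \<exists>f'\<in>fa.adjoin A' b'. \<forall>x\<in>E. f x = f' (p x)"
    "\<And>f'. f' \<in> fa.adjoin A' b' \<Longrightarrow> \<exists>f\<in>fa.adjoin A b. \<forall>x\<in>E. f x = f' (p x)"
proof -
  have ev: "poly f b x = poly f' b' (p x)"
    if "\<And>i x. x \<in> E \<Longrightarrow> coeff f i x = coeff f' i (p x)" "x \<in> E" for f f' x
  proof -
    \<comment> \<open>Corresponding coefficients agree only over \<open>E\<close>, so the degrees of
      the two polynomials may differ.\<close>
    define n where "n = max (degree f) (degree f')"
    have "poly f b x = (\<Sum>i\<le>n. coeff f i x * b x ^ i)"
      unfolding poly_fun_apply n_def by (rule sum.mono_neutral_left) (auto simp: coeff_eq_0)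
    also have "\<dots> = (\<Sum>i\<le>n. coeff f' i (p x) * b' (p x) ^ i)" using that b by simp
    also have "\<dots> = poly f' b' (p x)"
      unfolding poly_fun_apply n_def by (rule sum.mono_neutral_right) (auto simp: coeff_eq_0)
    finally show ?thesis .
  qed
  have lift: "\<exists>f'\<in>fa.polys A'. \<forall>i. \<forall>x\<in>E. coeff f i x = coeff f' i (p x)" if f: "f \<in> fa.polys A" for f
  proof -
    have "\<forall>i. \<exists>c. c \<in> A' \<and> (\<forall>x\<in>E. coeff f i x = c (p x))" using f rel(1) unfolding fa.polys_def by blast
    from choice[OF this] obtain c where c0: "\<forall>i. c i \<in> A' \<and> (\<forall>x\<in>E. coeff f i x = c i (p x))" by (elim exE)
    then have c: "\<And>i. c i \<in> A'" "\<And>i x. x \<in> E \<Longrightarrow> coeff f i x = c i (p x)" by simp_all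
    define f' where "f' = (\<Sum>i\<le>degree f. monom (c i) i)"
    have cf: "coeff f' i = (if i \<le> degree f then c i else 0)" for i
      by (simp add: f'_def coeff_sum coeff_monom)
    have "f' \<in> fa.polys A'" using c(1) fa.subalgD(2)[OF Q(2)] by (simp add: fa.polys_def cf)
    moreover have "coeff f i x = coeff f' i (p x)" if "x \<in> E" for i x
      using c(2)[OF that, of i] by (cases "i \<le> degree f") (simp_all add: cf coeff_eq_0)
    ultimately show ?thesis by blast
  qed
  have lift': "\<exists>f\<in>fa.polys A. \<forall>i. \<forall>x\<in>E. coeff f i x = coeff f' i (p x)" if f: "f' \<in> fa.polys A'" for f'
  proof -
    have "\<forall>i. \<exists>c. c \<in> A \<and> (\<forall>x\<in>E. c x = coeff f' i (p x))" using f rel(2) unfolding fa.polys_def by blast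
    from choice[OF this] obtain c where c0: "\<forall>i. c i \<in> A \<and> (\<forall>x\<in>E. c i x = coeff f' i (p x))" by (elim exE)
    then have c: "\<And>i. c i \<in> A" "\<And>i x. x \<in> E \<Longrightarrow> c i x = coeff f' i (p x)" by simp_all
    define g where "g = (\<Sum>i\<le>degree f'. monom (c i) i)"
    have cf: "coeff g i = (if i \<le> degree f' then c i else 0)" for i
      by (simp add: g_def coeff_sum coeff_monom)
    have "g \<in> fa.polys A" using c(1) fa.subalgD(2)[OF Q(1)] by (simp add: fa.polys_def cf)
    moreover have "coeff g i x = coeff f' i (p x)" if "x \<in> E" for i x
      using c(2)[OF that, of i] by (cases "i \<le> degree f'") (simp_all add: cf coeff_eq_0)
    ultimately show ?thesis by blast
  qed
  show "\<exists>f'\<in>fa.adjoin A' b'. \<forall>x\<in>E. f x = f' (p x)" if f: "f \<in> fa.adjoin A b" for f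
  proof -
    obtain g where g: "g \<in> fa.polys A" "f = poly g b" using f by (auto simp: fa.adjoin_def)
    obtain g' where g': "g' \<in> fa.polys A'" "\<forall>i. \<forall>x\<in>E. coeff g i x = coeff g' i (p x)" using lift[OF g(1)] by blast
    then show ?thesis using ev[of g g'] g(2) by (intro bexI[of _ "poly g' b'"]) (auto simp: fa.adjoin_def)
  qed
  show "\<exists>f\<in>fa.adjoin A b. \<forall>x\<in>E. f x = f' (p x)" if f: "f' \<in> fa.adjoin A' b'" for f'
  proof -
    obtain g' where g': "g' \<in> fa.polys A'" "f' = poly g' b'" using f by (auto simp: fa.adjoin_def)
    obtain g where g: "g \<in> fa.polys A" "\<forall>i. \<forall>x\<in>E. coeff g i x = coeff g' i (p x)" using lift'[OF g'(1)] by blast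
    then show ?thesis using ev[of g g'] g'(2) by (intro bexI[of _ "poly g b"]) (auto simp: fa.adjoin_def)
  qed
  have corr: "poly g b \<in> vanish E \<longleftrightarrow> poly g' b' \<in> vanish D" "\<And>i. coeff g i \<in> vanish E \<longleftrightarrow> coeff g' i \<in> vanish D"
    if g': "g' \<in> fa.polys A'" "\<forall>i. \<forall>x\<in>E. coeff g i x = coeff g' i (p x)" for g g'
  proof -
    have "poly g' b' \<in> fa.adjoin A' b'" using g'(1) by (auto simp: fa.adjoin_def)
    from D[OF this] show "poly g b \<in> vanish E \<longleftrightarrow> poly g' b' \<in> vanish D"
      using ev[of g g'] g'(2) by (auto simp: vanish_def)
    fix i
    have "coeff g' i \<in> fa.adjoin A' b'" using g'(1) fa.adjoin_superset(1)[OF Q(2)] by (auto simp: fa.polys_def)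
    from D[OF this] show "coeff g i \<in> vanish E \<longleftrightarrow> coeff g' i \<in> vanish D"
      using g'(2) by (auto simp: vanish_def)
  qed
  show "fa.algebraic_over (vanish E) A b \<longleftrightarrow> fa.algebraic_over (vanish D) A' b'"
  proof
    assume "fa.algebraic_over (vanish E) A b"
    then obtain g i where g: "g \<in> fa.polys A" "poly g b \<in> vanish E" "coeff g i \<notin> vanish E"
      unfolding fa.algebraic_over_def by blast
    obtain g' where g': "g' \<in> fa.polys A'" "\<forall>i. \<forall>x\<in>E. coeff g i x = coeff g' i (p x)" using lift[OF g(1)] by blast
    show "fa.algebraic_over (vanish D) A' b'"
      unfolding fa.algebraic_over_def using g g'(1) corr[OF g'] by blast
  next
    assume "fa.algebraic_over (vanish D) A' b'"
    then obtain g' i where g': "g' \<in> fa.polys A'" "poly g' b' \<in> vanish D" "coeff g' i \<notin> vanish D"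
      unfolding fa.algebraic_over_def by blast
    obtain g where g: "g \<in> fa.polys A" "\<forall>i. \<forall>x\<in>E. coeff g i x = coeff g' i (p x)" using lift'[OF g'(1)] by blast
    show "fa.algebraic_over (vanish E) A b"
      unfolding fa.algebraic_over_def using g' g(1) corr[OF g'(1) g(2)] by blast
  qed
qed

text \<open>Dominance identifies the tower of the image with the tower of pulled back functions.
  This makes the dimension of the image the first summand in the dimension of the source.\<close>

lemma tower_pullback:
  fixes p :: "'x \<Rightarrow> 'y" and A :: "('x \<Rightarrow> 'k::alg_closed_field) set" and A' :: "('y \<Rightarrow> 'k) set"
  assumes Q: "fa.subalg Q" and D: "\<And>f. f \<in> Q \<Longrightarrow> (\<forall>x\<in>E. f (p x) = 0) \<longleftrightarrow> f \<in> vanish D"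
    and t: "fa.tower (vanish D) A' bs' n" "fa.subalg A" "fa.subalg A'" "A' \<subseteq> Q" "set bs' \<subseteq> Q"
    and rel: "\<And>f. f \<in> A \<Longrightarrow> \<exists>f'\<in>A'. \<forall>x\<in>E. f x = f' (p x)" "\<And>f'. f' \<in> A' \<Longrightarrow> \<exists>f\<in>A. \<forall>x\<in>E. f x = f' (p x)"
    and bs: "list_all2 (\<lambda>b b'. \<forall>x\<in>E. b x = b' (p x)) bs bs'"
  shows "fa.tower (vanish E) A bs n"
  using t rel bs
proof (induction arbitrary: A bs rule: fa.tower.induct)
  case (Nil A')
  then show ?case by (auto intro: fa.tower.intros)
next
  case (algebraic A' b' bs' n)
  obtain b cs where b: "bs = b # cs" "\<And>x. x \<in> E \<Longrightarrow> b x = b' (p x)"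
    "list_all2 (\<lambda>b b'. \<forall>x\<in>E. b x = b' (p x)) cs bs'"
    using algebraic.prems(7) by (auto simp: list_all2_Cons2)
  have sub: "fa.adjoin A' b' \<subseteq> Q" using algebraic.prems fa.adjoin_least[OF Q] by simp
  have D': "(\<forall>x\<in>E. f (p x) = 0) \<longleftrightarrow> f \<in> vanish D" if "f \<in> fa.adjoin A' b'" for f using D sub that by blast
  note pb = algebraic_over_pullback[where A = A and A' = A' and b = b and b' = b' and E = E and D = D and p = p, OF algebraic.prems(1,2) D' algebraic.prems(5,6) b(2)]
  have "fa.tower (vanish E) (fa.adjoin A b) cs n"
    using algebraic.prems pb(2,3) b(3) sub
    by (intro algebraic.IH fa.adjoin_subalg) auto
  moreover have "fa.algebraic_over (vanish E) A b" using pb(1) algebraic.hyps(1) by blast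
  ultimately show ?case unfolding b(1) by (rule fa.tower.algebraic[rotated])
next
  case (transcendental A' b' bs' n)
  obtain b cs where b: "bs = b # cs" "\<And>x. x \<in> E \<Longrightarrow> b x = b' (p x)"
    "list_all2 (\<lambda>b b'. \<forall>x\<in>E. b x = b' (p x)) cs bs'"
    using transcendental.prems(7) by (auto simp: list_all2_Cons2)
  have sub: "fa.adjoin A' b' \<subseteq> Q" using transcendental.prems fa.adjoin_least[OF Q] by simp
  have D': "(\<forall>x\<in>E. f (p x) = 0) \<longleftrightarrow> f \<in> vanish D" if "f \<in> fa.adjoin A' b'" for f using D sub that by blast
  note pb = algebraic_over_pullback[where A = A and A' = A' and b = b and b' = b' and E = E and D = D and p = p, OF transcendental.prems(1,2) D' transcendental.prems(5,6) b(2)]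
  have "fa.tower (vanish E) (fa.adjoin A b) cs n"
    using transcendental.prems pb(2,3) b(3) sub
    by (intro transcendental.IH fa.adjoin_subalg) auto
  moreover have "\<not> fa.algebraic_over (vanish E) A b" using pb(1) transcendental.hyps(1) by blast
  ultimately show ?case unfolding b(1) by (rule fa.tower.transcendental[rotated])
qed

section \<open>The Nullstellensatz\<close>

lemma poly_mapping_add_single_induct:
  assumes "P 0" "\<And>f a b. P f \<Longrightarrow> P (f + Poly_Mapping.single a b)"
  shows "P (f :: 'a \<Rightarrow>\<^sub>0 'b::comm_monoid_add)"
proof (induction f rule: Poly_Mapping.update_induct)
  case (update f a b)
  have "Poly_Mapping.update a b f = f + Poly_Mapping.single a b"
    using update(1) by (intro poly_mapping_eqI)
      (auto simp: lookup_update lookup_add lookup_single in_keys_iff)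
  then show ?case using assms(2)[OF update(3)] by simp
qed (rule assms(1))

text \<open>The bridge from rings with a carrier to polynomials as a type, where \<open>kalg\<close>
  applies: evaluation at the sequence \<open>s\<close>. With \<open>s\<close> constantly zero the
  locale provides the arithmetic of the structure map for a ring of sections.\<close>

locale poly_eval = cring R for R :: "('r, 'm) ring_scheme" (structure) +
  fixes \<kappa> :: "'k::alg_closed_field \<Rightarrow> 'r" and s :: "nat \<Rightarrow> 'r"
  assumes \<kappa>_hom: "\<kappa> \<in> ring_hom ring_of_type_algebra R"
    and s_closed [simp]: "s i \<in> carrier R"
begin

lemma \<kappa>_closed [simp]: "\<kappa> c \<in> carrier R"
  using ring_hom_closed[OF \<kappa>_hom, of c] by (simp add: ring_of_type_algebra_def)

lemma \<kappa>_add: "\<kappa> (c + d) = \<kappa> c \<oplus> \<kappa> d"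
  using ring_hom_add[OF \<kappa>_hom, of c d] by (simp add: ring_of_type_algebra_def)

lemma \<kappa>_mult: "\<kappa> (c * d) = \<kappa> c \<otimes> \<kappa> d"
  using ring_hom_mult[OF \<kappa>_hom, of c d] by (simp add: ring_of_type_algebra_def)

lemma \<kappa>_one [simp]: "\<kappa> 1 = \<one>"
  using ring_hom_one[OF \<kappa>_hom] by (simp add: ring_of_type_algebra_def)

lemma \<kappa>_zero [simp]: "\<kappa> 0 = \<zero>"
proof -
  have "\<kappa> 0 \<oplus> \<kappa> 0 = \<kappa> 0 \<oplus> \<zero>" using \<kappa>_add[of 0 0] by simp
  then show ?thesis using add.l_cancel[of "\<kappa> 0" "\<kappa> 0" \<zero>] by simp
qed

definition mon :: "(nat \<Rightarrow>\<^sub>0 nat) \<Rightarrow> 'r" where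
  "mon m = (\<Otimes>i\<in>Poly_Mapping.keys m. s i [^] Poly_Mapping.lookup m i)"

lemma mon_superset:
  "finite I \<Longrightarrow> Poly_Mapping.keys m \<subseteq> I \<Longrightarrow> mon m = (\<Otimes>i\<in>I. s i [^] Poly_Mapping.lookup m i)"
  unfolding mon_def by (rule finprod_mono_neutral_cong_left) (auto simp: in_keys_iff)

lemma mon_closed [simp]: "mon m \<in> carrier R"
  unfolding mon_def by (rule finprod_closed) auto

lemma mon_0 [simp]: "mon 0 = \<one>"
  by (simp add: mon_def)

lemma mon_add: "mon (m + m') = mon m \<otimes> mon m'"
proof -
  let ?I = "Poly_Mapping.keys m \<union> Poly_Mapping.keys m'"
  have "mon (m + m') = (\<Otimes>i\<in>?I. s i [^] Poly_Mapping.lookup (m + m') i)"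
    by (rule mon_superset) (use Poly_Mapping.keys_add[of m m'] in auto)
  also have "\<dots> = (\<Otimes>i\<in>?I. s i [^] Poly_Mapping.lookup m i \<otimes> s i [^] Poly_Mapping.lookup m' i)"
    by (rule finprod_cong') (auto simp: lookup_add nat_pow_mult)
  also have "\<dots> = mon m \<otimes> mon m'"
    by (subst finprod_multf) (auto simp: mon_superset[of ?I])
  finally show ?thesis .
qed

definition ev :: "((nat \<Rightarrow>\<^sub>0 nat) \<Rightarrow>\<^sub>0 'k) \<Rightarrow> 'r" where
  "ev f = (\<Oplus>m\<in>Poly_Mapping.keys f. \<kappa> (Poly_Mapping.lookup f m) \<otimes> mon m)"

lemma ev_superset:
  "finite B \<Longrightarrow> Poly_Mapping.keys f \<subseteq> B \<Longrightarrow> ev f = (\<Oplus>m\<in>B. \<kappa> (Poly_Mapping.lookup f m) \<otimes> mon m)"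
  unfolding ev_def by (rule add.finprod_mono_neutral_cong_left) (auto simp: in_keys_iff)

lemma ev_closed [simp]: "ev f \<in> carrier R"
  unfolding ev_def by (rule finsum_closed) auto

lemma ev_0 [simp]: "ev 0 = \<zero>"
  by (simp add: ev_def)

lemma ev_add: "ev (f + g) = ev f \<oplus> ev g"
proof -
  let ?B = "Poly_Mapping.keys f \<union> Poly_Mapping.keys g"
  have "ev (f + g) = (\<Oplus>m\<in>?B. \<kappa> (Poly_Mapping.lookup (f + g) m) \<otimes> mon m)"
    by (rule ev_superset) (use Poly_Mapping.keys_add[of f g] in auto)
  also have "\<dots> = (\<Oplus>m\<in>?B. \<kappa> (Poly_Mapping.lookup f m) \<otimes> mon m \<oplus> \<kappa> (Poly_Mapping.lookup g m) \<otimes> mon m)"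
    by (rule finsum_cong') (auto simp: lookup_add \<kappa>_add l_distr)
  also have "\<dots> = ev f \<oplus> ev g"
    by (subst finsum_addf) (auto simp: ev_superset[of ?B])
  finally show ?thesis .
qed

lemma ev_single [simp]: "ev (Poly_Mapping.single a b) = \<kappa> b \<otimes> mon a"
  by (subst ev_superset[of "{a}"]) (auto simp: finsum_singleton)

lemma ev_mult: "ev (f * g) = ev f \<otimes> ev g"
proof -
  have 1: "ev (Poly_Mapping.single a b * g) = ev (Poly_Mapping.single a b) \<otimes> ev g" for a b g
  proof (induction g rule: poly_mapping_add_single_induct)
    case (2 g c d)
    then show ?case
      by (simp add: distrib_left ev_add mult_single \<kappa>_mult mon_add r_distr del: ev_single)
        (simp add: \<kappa>_mult mon_add m_ac)
  qed simp
  show ?thesis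
  proof (induction f rule: poly_mapping_add_single_induct)
    case (2 f a b)
    then show ?case by (simp add: distrib_right ev_add 1 l_distr del: ev_single)
  qed simp
qed

lemma ev_1 [simp]: "ev 1 = \<one>"
  using ev_single[of 0 1] by (simp del: ev_single)

lemma ev_uminus: "ev (- f) = \<ominus> ev f"
proof -
  have "ev (- f) \<oplus> ev f = \<zero>" by (simp flip: ev_add)
  then show ?thesis by (simp add: minus_equality)
qed

lemma ev_diff: "ev (f - g) = ev f \<ominus> ev g"
  using ev_add[of f "- g"] by (simp add: ev_uminus a_minus_def)

lemma ev_var: "ev (Poly_Mapping.single (Poly_Mapping.single i 1) 1) = s i"
proof -
  have "mon (Poly_Mapping.single i 1) = (\<Otimes>j\<in>{i}. s j [^] Poly_Mapping.lookup (Poly_Mapping.single i 1 :: nat \<Rightarrow>\<^sub>0 nat) j)"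
    by (rule mon_superset) auto
  then show ?thesis by simp
qed

end

interpretation pm: kalg "\<lambda>c :: 'k::alg_closed_field. Poly_Mapping.single (0 :: nat \<Rightarrow>\<^sub>0 nat) c"
  by unfold_locales (simp_all add: single_add mult_single)

lemma branch_nonempty: "branch e R k Z \<Longrightarrow> Z \<noteq> {}"
proof (induction k arbitrary: Z)
  case (Suc k)
  then obtain b where "infinite {v. branch e R k {z\<in>Z. e z b = v}}" by auto
  then have "{v. branch e R k {z\<in>Z. e z b = v}} \<noteq> {}" by (metis finite.emptyI)
  then obtain v where "branch e R k {z\<in>Z. e z b = v}" by blast
  from Suc.IH[OF this] show ?case by blast
qed simp

lemma (in cring) maximalideal_inverse:
  assumes "maximalideal I R" "h \<in> carrier R" "h \<notin> I"
  obtains u where "u \<in> carrier R" "\<one> \<ominus> u \<otimes> h \<in> I"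
proof -
  interpret I: maximalideal I R by (rule assms(1))
  let ?J = "set_add R I (PIdl h)"
  have J: "ideal ?J R" by (intro add_ideals I.is_ideal cgenideal_ideal assms)
  have mem: "a \<oplus> u \<otimes> h \<in> ?J" if "a \<in> I" "u \<in> carrier R" for a u
    using that by (auto simp: set_add_def' cgenideal_def)
  have "I \<subseteq> ?J"
  proof
    fix a assume a: "a \<in> I"
    then show "a \<in> ?J" using mem[OF a zero_closed] assms(2) I.Icarr[OF a] by simp
  qed
  moreover have "h \<in> ?J" using mem[OF I.zero_closed one_closed] assms(2) by simp
  moreover have "?J \<subseteq> carrier R" using ideal.Icarr[OF J] by blast
  ultimately have "?J = carrier R" using I.I_maximal[OF J] assms(3) by blast
  then have "\<one> \<in> ?J" by simp
  then obtain a u where au: "a \<in> I" "u \<in> carrier R" "\<one> = a \<oplus> u \<otimes> h"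
    by (auto simp: set_add_def' cgenideal_def)
  have "\<one> \<ominus> u \<otimes> h = a"
    unfolding au(3) using au(1,2) assms(2) I.Icarr[OF au(1)] by algebra
  then show ?thesis using that[OF au(2)] au(1) by simp
qed

text \<open>The preimage \<open>P\<close> of the maximal ideal under evaluation is prime on a
  polynomial algebra, and \<open>tower_branch\<close> with \<open>g = 1\<close> supplies a
  homomorphism \<open>\<psi>\<close> to \<open>K\<close> that kills \<open>P\<close>. The residue of
  \<open>f\<close> is the value of \<open>\<psi>\<close> at a lift of \<open>f\<close>: otherwise
  the difference would be invertible modulo the ideal although \<open>\<psi>\<close> sends its lift
  to 0.\<close>

theorem nullstellensatz:
  fixes A (structure) and \<kappa> :: "'k::alg_closed_field \<Rightarrow> 'r"
  assumes A: "cring A" and \<kappa>: "\<kappa> \<in> ring_hom ring_of_type_algebra A"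
    and S: "finite S" "S \<subseteq> carrier A" "generate_ring A (range \<kappa> \<union> S) = carrier A"
    and m: "maximalideal m A" and f: "f \<in> carrier A"
  shows "\<exists>c. f \<ominus> \<kappa> c \<in> m"
proof -
  interpret cring A by (rule A)
  interpret m: maximalideal m A by (rule m)
  interpret m: primeideal m A by (rule maximalideal_prime[OF m])
  obtain ss where ss: "set ss = S" using finite_list[OF S(1)] by blast
  define s where "s i = (if i < length ss then ss ! i else \<zero>)" for i
  interpret pe: poly_eval A \<kappa> s
    by unfold_locales (use \<kappa> S(2) ss in \<open>auto simp: s_def subset_iff\<close>)
  define var where "var i = (Poly_Mapping.single (Poly_Mapping.single i 1) 1 :: (nat \<Rightarrow>\<^sub>0 nat) \<Rightarrow>\<^sub>0 'k)" for i
  let ?C = "range (\<lambda>c :: 'k. Poly_Mapping.single (0 :: nat \<Rightarrow>\<^sub>0 nat) c)"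
  define vs where "vs = map var [0..<length ss]"
  define R where "R = pm.adjoin_list ?C vs"
  have R: "pm.subalg R" unfolding R_def by (rule pm.adjoin_list_subalg[OF pm.subalg_range])
  note RD = pm.subalgD[OF R]
  have CR: "?C \<subseteq> R" "set vs \<subseteq> R" unfolding R_def using pm.adjoin_list_superset[OF pm.subalg_range] by auto
  define P where "P = {g. pe.ev g \<in> m}"
  have P: "pm.rel_prime R P"
    unfolding pm.rel_prime_def P_def
  proof (intro conjI ballI allI impI; (unfold mem_Collect_eq)?)
    show "pe.ev 1 \<notin> m" using m.one_imp_carrier m.I_notcarr by auto
    fix x y assume "pe.ev (x * y) \<in> m"
    then show "pe.ev x \<in> m \<or> pe.ev y \<in> m" using m.I_prime[of "pe.ev x" "pe.ev y"] by (simp add: pe.ev_mult)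
  qed (auto simp: pe.ev_add pe.ev_mult m.I_l_closed m.a_closed)
  obtain k where k: "pm.tower P ?C vs k" using pm.tower_exists by blast
  have "1 \<notin> P" by (rule pm.rel_primeD(5)[OF P])
  then obtain q where q: "q \<in> ?C" "q \<notin> P" "\<And>\<phi>. pm.hom_on P ?C \<phi> \<Longrightarrow> \<phi> q \<noteq> 0 \<Longrightarrow>
       branch (\<lambda>\<psi>. \<psi>) R k {\<psi>. pm.hom_on P R \<psi> \<and> (\<forall>x\<in>?C. \<psi> x = \<phi> x) \<and> \<psi> 1 \<noteq> 0}"
    using pm.tower_branch[OF R P pm.subalg_range CR(2,1) k, of 1] RD(3) unfolding R_def[symmetric] by blast
  \<comment> \<open>The constant coefficient, which is a homomorphism on the base algebra of
    constants; the members of the branching set extend it.\<close>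
  define \<phi> where "\<phi> = (\<lambda>g :: (nat \<Rightarrow>\<^sub>0 nat) \<Rightarrow>\<^sub>0 'k. Poly_Mapping.lookup g 0)"
  have "pm.hom_on P ?C \<phi>"
    unfolding pm.hom_on_def using pm.rel_prime_\<kappa>[OF P]
    by (auto simp: \<phi>_def lookup_add mult_single)
  moreover have "\<phi> q \<noteq> 0" using q(1,2) pm.rel_primeD(1)[OF P] by (auto simp: \<phi>_def)
  ultimately have "{\<psi>. pm.hom_on P R \<psi> \<and> (\<forall>x\<in>?C. \<psi> x = \<phi> x) \<and> \<psi> 1 \<noteq> 0} \<noteq> {}"
    using q(3) branch_nonempty by blast
  then obtain \<psi> where \<psi>: "pm.hom_on P R \<psi>" by blast
  have surj: "\<exists>g\<in>R. pe.ev g = x" if "x \<in> carrier A" for x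
    using that unfolding S(3)[symmetric]
  proof (induction rule: generate_ring.induct)
    case one
    show ?case using RD(3) by (intro bexI[of _ 1]) auto
  next
    case (incl h)
    then consider c where "h = \<kappa> c" | "h \<in> S" by blast
    then show ?case
    proof cases
      case 1
      then show ?thesis using CR(1) by (intro bexI[of _ "Poly_Mapping.single 0 c"]) auto
    next
      case 2
      then obtain i where "i < length ss" "h = ss ! i" using ss by (metis in_set_conv_nth)
      then have "pe.ev (var i) = h" unfolding var_def pe.ev_var by (simp add: s_def)
      moreover have "var i \<in> R" using \<open>i < length ss\<close> by (intro subsetD[OF CR(2)]) (simp add: vs_def)
      ultimately show ?thesis by blast
    qed
  next
    case (a_inv h)
    then show ?case using RD(6) pe.ev_uminus by metis
  next
    case (eng_add h1 h2)
    then show ?case using RD(4) pe.ev_add by metis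
  next
    case (eng_mult h1 h2)
    then show ?case using RD(5) pe.ev_mult by metis
  qed
  obtain g where g: "g \<in> R" "pe.ev g = f" using surj[OF f] by blast
  define g' where "g' = g - Poly_Mapping.single 0 (\<psi> g)"
  have cR: "Poly_Mapping.single 0 (\<psi> g) \<in> R" using CR(1) by blast
  have g': "g' \<in> R" "\<psi> g' = 0"
    unfolding g'_def using RD(7)[OF g(1) cR] pm.hom_on_diff[OF R \<psi> g(1) cR] pm.hom_onD(1)[OF \<psi>] by auto
  have ev_g': "pe.ev g' = f \<ominus> \<kappa> (\<psi> g)"
    unfolding g'_def by (simp add: pe.ev_diff g(2))
  have "pe.ev g' \<in> m"
  proof (rule ccontr)
    assume "pe.ev g' \<notin> m"
    then obtain u where u: "u \<in> carrier A" "\<one> \<ominus> u \<otimes> pe.ev g' \<in> m"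
      using maximalideal_inverse[OF m, of "pe.ev g'"] by auto
    obtain w where w: "w \<in> R" "pe.ev w = u" using surj[OF u(1)] by blast
    have "pe.ev (1 - w * g') = \<one> \<ominus> u \<otimes> pe.ev g'"
      by (simp add: pe.ev_diff pe.ev_mult w(2))
    then have "1 - w * g' \<in> P" using u(2) by (simp add: P_def)
    moreover have wg: "w * g' \<in> R" "1 - w * g' \<in> R" using RD(3,5,7) w(1) g'(1) by auto
    ultimately have "\<psi> (1 - w * g') = 0" using pm.hom_onD(4)[OF \<psi>] by blast
    moreover have "\<psi> (1 - w * g') = 1 - \<psi> w * \<psi> g'"
      using pm.hom_on_diff[OF R \<psi> RD(3) wg(1)] pm.hom_onD(3)[OF \<psi> w(1) g'(1)] pm.hom_onD(6)[OF \<psi>] by simp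
    ultimately show False using g'(2) by simp
  qed
  then show ?thesis unfolding ev_g' by blast
qed

section \<open>Function algebras of schemes\<close>

lemma (in poly_eval) residue_add:
  assumes "ideal m R" "f \<in> carrier R" "g \<in> carrier R" "f \<ominus> \<kappa> c \<in> m" "g \<ominus> \<kappa> d \<in> m"
  shows "f \<oplus> g \<ominus> \<kappa> (c + d) \<in> m"
proof -
  interpret m: ideal m R by (rule assms(1))
  have "f \<oplus> g \<ominus> (\<kappa> c \<oplus> \<kappa> d) = (f \<ominus> \<kappa> c) \<oplus> (g \<ominus> \<kappa> d)"
    using assms(2,3) \<kappa>_closed[of c] \<kappa>_closed[of d] by algebra
  then show ?thesis using m.a_closed[OF assms(4,5)] by (simp add: \<kappa>_add)
qed

lemma (in poly_eval) residue_mult: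
  assumes "ideal m R" "f \<in> carrier R" "g \<in> carrier R" "f \<ominus> \<kappa> c \<in> m" "g \<ominus> \<kappa> d \<in> m"
  shows "f \<otimes> g \<ominus> \<kappa> (c * d) \<in> m"
proof -
  interpret m: ideal m R by (rule assms(1))
  have "f \<otimes> g \<ominus> (\<kappa> c \<otimes> \<kappa> d) = f \<otimes> (g \<ominus> \<kappa> d) \<oplus> \<kappa> d \<otimes> (f \<ominus> \<kappa> c)"
    using assms(2,3) \<kappa>_closed[of c] \<kappa>_closed[of d] by algebra
  then show ?thesis
    using m.a_closed[OF m.I_l_closed[OF assms(5,2)] m.I_l_closed[OF assms(4) \<kappa>_closed, of d]] by (simp add: \<kappa>_mult)
qed

lemma (in poly_eval) residue_unique:
  assumes "maximalideal m R" "f \<in> carrier R" "f \<ominus> \<kappa> c \<in> m" "f \<ominus> \<kappa> d \<in> m"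
  shows "c = d"
proof (rule ccontr)
  assume "c \<noteq> d"
  interpret m: maximalideal m R by (rule assms(1))
  have "\<kappa> d = \<kappa> (d - c) \<oplus> \<kappa> c" by (simp flip: \<kappa>_add)
  then have "(f \<ominus> \<kappa> c) \<ominus> (f \<ominus> \<kappa> d) = \<kappa> (d - c)"
    using assms(2) \<kappa>_closed[of c] \<kappa>_closed[of "d - c"] by algebra
  moreover have "(f \<ominus> \<kappa> c) \<ominus> (f \<ominus> \<kappa> d) \<in> m"
    using m.a_closed[OF assms(3) m.a_inv_closed[OF assms(4)]] by (simp only: a_minus_def)
  ultimately have "\<kappa> (inverse (d - c)) \<otimes> \<kappa> (d - c) \<in> m" using m.I_l_closed \<kappa>_closed by simp
  moreover have "inverse (d - c) * (d - c) = 1" using \<open>c \<noteq> d\<close> by simp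
  ultimately have "\<one> \<in> m" by (metis \<kappa>_mult \<kappa>_one)
  then show False using m.one_imp_carrier m.I_notcarr by simp
qed

text \<open>An ideal strictly above the kernel contains an element that scales to one of value 1,
  and therefore contains 1. This turns a homomorphism to \<open>K\<close> into a maximal ideal and
  hence into a point.\<close>

lemma (in poly_eval) kernel_maximalideal:
  fixes \<Phi> :: "'r \<Rightarrow> 'k"
  assumes \<Phi>: "\<And>f g. f \<in> carrier R \<Longrightarrow> g \<in> carrier R \<Longrightarrow> \<Phi> (f \<oplus> g) = \<Phi> f + \<Phi> g"
    "\<And>f g. f \<in> carrier R \<Longrightarrow> g \<in> carrier R \<Longrightarrow> \<Phi> (f \<otimes> g) = \<Phi> f * \<Phi> g" "\<And>c. \<Phi> (\<kappa> c) = c"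
  shows "maximalideal {a \<in> carrier R. \<Phi> a = 0} R"
proof -
  let ?I = "{a \<in> carrier R. \<Phi> a = 0}"
  have z: "\<Phi> \<zero> = 0" using \<Phi>(3)[of 0] by simp
  have o: "\<Phi> \<one> = 1" using \<Phi>(3)[of 1] by simp
  have neg: "\<Phi> (\<ominus> a) = - \<Phi> a" if "a \<in> carrier R" for a
    using \<Phi>(1)[of "\<ominus> a" a] that z by (simp add: l_neg eq_neg_iff_add_eq_0)
  have "subgroup ?I (add_monoid R)"
  proof (rule add.subgroupI)
    show "?I \<noteq> {}" using z by auto
  qed (auto simp: \<Phi> neg)
  then have I: "ideal ?I R"
    by (intro idealI ring_axioms) (auto simp: \<Phi>)
  show ?thesis
  proof (rule maximalidealI[OF I])
    show "carrier R \<noteq> ?I"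
    proof
      assume "carrier R = ?I"
      then have "\<one> \<in> ?I" using one_closed by simp
      then show False using o by simp
    qed
    fix J assume J: "ideal J R" "?I \<subseteq> J" "J \<subseteq> carrier R"
    interpret J: ideal J R by (rule J(1))
    show "J = ?I \<or> J = carrier R"
    proof (rule ccontr)
      assume "\<not> (J = ?I \<or> J = carrier R)"
      then obtain a where a: "a \<in> J" "\<Phi> a \<noteq> 0" "a \<in> carrier R" using J by blast
      let ?b = "\<kappa> (inverse (\<Phi> a)) \<otimes> a"
      have b: "?b \<in> J" "?b \<in> carrier R" using J.I_l_closed[OF a(1) \<kappa>_closed] a(3) by auto
      have "\<Phi> ?b = 1" using \<Phi>(2,3) a by simp
      then have "\<Phi> (\<one> \<ominus> ?b) = 0" using \<Phi>(1)[of \<one> "\<ominus> ?b"] neg[OF b(2)] b(2) o by (simp add: a_minus_def)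
      then have "\<one> \<ominus> ?b \<in> J" using J(2) b(2) by auto
      from J.a_closed[OF this b(1)] have "\<one> \<ominus> ?b \<oplus> ?b \<in> J" .
      moreover have "\<one> \<ominus> ?b \<oplus> ?b = \<one>" using b(2) by algebra
      ultimately show False using J.one_imp_carrier \<open>\<not> (J = ?I \<or> J = carrier R)\<close> by simp
    qed
  qed
qed

lemma ring_hom_Units:
  assumes "h \<in> ring_hom R S" "cring R" "cring S" "u \<in> Units R"
  shows "h u \<in> Units S"
proof -
  interpret R: cring R by (rule assms(2))
  interpret S: cring S by (rule assms(3))
  note hD = ring_hom_closed[OF assms(1)] ring_hom_mult[OF assms(1), symmetric] ring_hom_one[OF assms(1)]
  have c: "u \<in> carrier R" "inv\<^bsub>R\<^esub> u \<in> carrier R" using assms(4) by auto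
  show ?thesis
    unfolding Units_def using c assms(4) hD
    by (auto intro!: bexI[of _ "h (inv\<^bsub>R\<^esub> u)"])
qed

locale alg_space =
  fixes X :: "('x, 'r, 'k::alg_closed_field) kspace"
  assumes sheaf: "sheaf_of_algebras X"
begin

lemma sec_cring: "openin (zar X) U \<Longrightarrow> cring (sec X U)"
  and cst_hom: "openin (zar X) U \<Longrightarrow> cst X U \<in> ring_hom ring_of_type_algebra (sec X U)"
  using sheaf[unfolded sheaf_of_algebras_def, THEN conjunct1, rule_format, of U] by simp_all

lemma res_hom: "openin (zar X) U \<Longrightarrow> openin (zar X) V \<Longrightarrow> V \<subseteq> U \<Longrightarrow> res X U V \<in> ring_hom (sec X U) (sec X V)"
  and res_cst: "openin (zar X) U \<Longrightarrow> openin (zar X) V \<Longrightarrow> V \<subseteq> U \<Longrightarrow> res X U V (cst X U c) = cst X V c"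
  using sheaf[unfolded sheaf_of_algebras_def, THEN conjunct2, THEN conjunct1, rule_format, of U V] by simp_all

lemma res_res:
  "openin (zar X) U \<Longrightarrow> openin (zar X) V \<Longrightarrow> openin (zar X) W \<Longrightarrow> W \<subseteq> V \<Longrightarrow> V \<subseteq> U \<Longrightarrow>
    f \<in> carrier (sec X U) \<Longrightarrow> res X V W (res X U V f) = res X U W f"
  using sheaf[unfolded sheaf_of_algebras_def, THEN conjunct2, THEN conjunct2, THEN conjunct2, THEN conjunct1,
    rule_format, of U V W f] by simp

lemma sec_poly_eval: "openin (zar X) U \<Longrightarrow> poly_eval (sec X U) (cst X U) (\<lambda>_. \<zero>\<^bsub>sec X U\<^esub>)"
  using sec_cring[of U] cst_hom[of U]
  by (simp add: poly_eval_def poly_eval_axioms_def cring.cring_simprules(2))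

lemma res_closed:
  "openin (zar X) U \<Longrightarrow> openin (zar X) V \<Longrightarrow> V \<subseteq> U \<Longrightarrow> f \<in> carrier (sec X U) \<Longrightarrow> res X U V f \<in> carrier (sec X V)"
  using ring_hom_closed[OF res_hom] .

text \<open>Being a unit near \<open>x\<close> depends only on the germ: a unit on some
  neighbourhood stays a unit on its intersection with \<open>V\<close>.\<close>

lemma vanishing_res_iff:
  assumes U: "openin (zar X) U" and V: "openin (zar X) V" "x \<in> V" "V \<subseteq> U" and f: "f \<in> carrier (sec X U)"
  shows "res X U V f \<in> vanishing X V x \<longleftrightarrow> f \<in> vanishing X U x"
proof
  assume "f \<in> vanishing X U x"
  then show "res X U V f \<in> vanishing X V x"
    using res_closed[OF U V(1,3) f] V U f res_res[OF U V(1) _ _ V(3) f]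
    unfolding vanishing_def by auto
next
  assume van: "res X U V f \<in> vanishing X V x"
  show "f \<in> vanishing X U x"
    unfolding vanishing_def
  proof (intro CollectI conjI allI impI notI)
    fix V' assume V': "openin (zar X) V' \<and> x \<in> V' \<and> V' \<subseteq> U" and un: "res X U V' f \<in> Units (sec X V')"
    let ?W = "V' \<inter> V"
    have W: "openin (zar X) ?W" "x \<in> ?W" "?W \<subseteq> V" "?W \<subseteq> V'" using V' V by auto
    have "res X V' ?W (res X U V' f) \<in> Units (sec X ?W)"
      using V' W by (intro ring_hom_Units[OF res_hom sec_cring sec_cring un]) auto
    then have "res X U ?W f \<in> Units (sec X ?W)" using res_res[OF U _ W(1,4) _ f] V' by simp
    then have "res X V ?W (res X U V f) \<in> Units (sec X ?W)" using res_res[OF U V(1) W(1,3) V(3) f] by simp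
    then show False using van W unfolding vanishing_def by blast
  qed (rule f)
qed

lemma vanishing_unit_mult:
  assumes U: "openin (zar X) U" "x \<in> U" and u: "u \<in> Units (sec X U)" and f: "f \<in> carrier (sec X U)"
    and van: "f \<in> vanishing X U x"
  shows "u \<otimes>\<^bsub>sec X U\<^esub> f \<in> vanishing X U x"
  unfolding vanishing_def
proof (intro CollectI conjI allI impI notI)
  interpret A: cring "sec X U" by (rule sec_cring[OF U(1)])
  show "u \<otimes>\<^bsub>sec X U\<^esub> f \<in> carrier (sec X U)" using u f by auto
  fix V assume V: "openin (zar X) V \<and> x \<in> V \<and> V \<subseteq> U"
    and un: "res X U V (u \<otimes>\<^bsub>sec X U\<^esub> f) \<in> Units (sec X V)"
  interpret B: cring "sec X V" using V by (intro sec_cring) blast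
  have h: "res X U V \<in> ring_hom (sec X U) (sec X V)" using V by (intro res_hom[OF U(1)]) auto
  let ?v = "res X U V u" and ?g = "res X U V f"
  have v: "?v \<in> Units (sec X V)" by (rule ring_hom_Units[OF h A.cring_axioms B.cring_axioms u])
  have g: "?g \<in> carrier (sec X V)" using ring_hom_closed[OF h f] .
  have "res X U V (u \<otimes>\<^bsub>sec X U\<^esub> f) = ?v \<otimes>\<^bsub>sec X V\<^esub> ?g" using ring_hom_mult[OF h _ f, of u] u by auto
  then have "?v \<otimes>\<^bsub>sec X V\<^esub> ?g \<in> Units (sec X V)" using un by simp
  then have "inv\<^bsub>sec X V\<^esub> ?v \<otimes>\<^bsub>sec X V\<^esub> (?v \<otimes>\<^bsub>sec X V\<^esub> ?g) \<in> Units (sec X V)"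
    by (rule B.Units_m_closed[OF B.Units_inv_Units[OF v]])
  moreover have "inv\<^bsub>sec X V\<^esub> ?v \<otimes>\<^bsub>sec X V\<^esub> (?v \<otimes>\<^bsub>sec X V\<^esub> ?g) = ?g"
    using g by (simp add: B.m_assoc[symmetric] B.Units_closed[OF v] B.Units_inv_closed[OF v] B.Units_l_inv[OF v])
  ultimately show False using van V unfolding vanishing_def by auto
qed

end

locale affine = alg_space X for X :: "('x, 'r, 'k::alg_closed_field) kspace" +
  fixes \<Omega> :: "'x set"
  assumes aff: "affine_open X \<Omega>"
begin

lemma open_\<Omega>: "openin (zar X) \<Omega>"
  and finitely_generated: "\<exists>S. finite S \<and> S \<subseteq> carrier (sec X \<Omega>) \<and>
    generate_ring (sec X \<Omega>) (range (cst X \<Omega>) \<union> S) = carrier (sec X \<Omega>)"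
  and vanishing_bij: "bij_betw (vanishing X \<Omega>) \<Omega> {\<mm>. maximalideal \<mm> (sec X \<Omega>)}"
  and open_nonzero_locus: "\<forall>f \<in> carrier (sec X \<Omega>). openin (zar X) (nonzero_locus X \<Omega> f)"
  and nonzero_locus_basis: "\<forall>W x. openin (zar X) W \<and> x \<in> W \<and> W \<subseteq> \<Omega> \<longrightarrow>
    (\<exists>f \<in> carrier (sec X \<Omega>). x \<in> nonzero_locus X \<Omega> f \<and> nonzero_locus X \<Omega> f \<subseteq> W)"
  using aff unfolding affine_open_def by - (elim conjE, assumption)+

lemma localization:
  assumes "f \<in> carrier (sec X \<Omega>)" "nonzero_locus X \<Omega> f = D"
  shows "res X \<Omega> D f \<in> Units (sec X D)"
    "b \<in> carrier (sec X D) \<Longrightarrow>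
      \<exists>a \<in> carrier (sec X \<Omega>). \<exists>n::nat. res X \<Omega> D a = (res X \<Omega> D f [^]\<^bsub>sec X D\<^esub> n) \<otimes>\<^bsub>sec X D\<^esub> b"
proof -
  note L = aff[unfolded affine_open_def Let_def, THEN conjunct2, THEN conjunct2, THEN conjunct2, THEN conjunct2,
    THEN conjunct2, THEN bspec, OF assms(1), unfolded assms(2)]
  show "res X \<Omega> D f \<in> Units (sec X D)" by (rule L[THEN conjunct1])
  show "b \<in> carrier (sec X D) \<Longrightarrow>
      \<exists>a \<in> carrier (sec X \<Omega>). \<exists>n::nat. res X \<Omega> D a = (res X \<Omega> D f [^]\<^bsub>sec X D\<^esub> n) \<otimes>\<^bsub>sec X D\<^esub> b"
    by (rule bspec[OF L[THEN conjunct2, THEN conjunct1]])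
qed

sublocale A: poly_eval "sec X \<Omega>" "cst X \<Omega>" "\<lambda>_. \<zero>\<^bsub>sec X \<Omega>\<^esub>"
  by (rule sec_poly_eval[OF open_\<Omega>])

abbreviation val :: "'x \<Rightarrow> 'r \<Rightarrow> 'k" where
  "val \<equiv> value_at X \<Omega>"

lemma vanishing_maximal: "x \<in> \<Omega> \<Longrightarrow> maximalideal (vanishing X \<Omega> x) (sec X \<Omega>)"
  using bij_betwE[OF vanishing_bij] by blast

text \<open>\<open>value_at\<close> is a definite description. Existence of the residue is the
  Nullstellensatz for the algebra of sections, uniqueness holds modulo every maximal ideal.\<close>

lemma val_iff:
  assumes x: "x \<in> \<Omega>" and f: "f \<in> carrier (sec X \<Omega>)"
  shows "val x f = c \<longleftrightarrow> f \<ominus>\<^bsub>sec X \<Omega>\<^esub> cst X \<Omega> c \<in> vanishing X \<Omega> x"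
proof -
  obtain S where S: "finite S" "S \<subseteq> carrier (sec X \<Omega>)"
    "generate_ring (sec X \<Omega>) (range (cst X \<Omega>) \<union> S) = carrier (sec X \<Omega>)"
    using finitely_generated by blast
  note m = vanishing_maximal[OF x]
  obtain d where d: "f \<ominus>\<^bsub>sec X \<Omega>\<^esub> cst X \<Omega> d \<in> vanishing X \<Omega> x"
    using nullstellensatz[OF A.cring_axioms cst_hom[OF open_\<Omega>] S m f] by blast
  have "val x f = d"
    unfolding value_at_def using d A.residue_unique[OF m f _ d] by (rule the_equality)
  then show ?thesis using d A.residue_unique[OF m f _ d] by blast
qed

lemma val_residue: "x \<in> \<Omega> \<Longrightarrow> f \<in> carrier (sec X \<Omega>) \<Longrightarrow> f \<ominus>\<^bsub>sec X \<Omega>\<^esub> cst X \<Omega> (val x f) \<in> vanishing X \<Omega> x"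
  using val_iff by blast

lemma vanishing_ideal: "x \<in> \<Omega> \<Longrightarrow> ideal (vanishing X \<Omega> x) (sec X \<Omega>)"
  using vanishing_maximal maximalideal.axioms(1) by blast

lemma val_add:
  "x \<in> \<Omega> \<Longrightarrow> f \<in> carrier (sec X \<Omega>) \<Longrightarrow> g \<in> carrier (sec X \<Omega>) \<Longrightarrow>
    val x (f \<oplus>\<^bsub>sec X \<Omega>\<^esub> g) = val x f + val x g"
  by (subst val_iff) (auto intro!: A.residue_add vanishing_ideal val_residue)

lemma val_mult:
  "x \<in> \<Omega> \<Longrightarrow> f \<in> carrier (sec X \<Omega>) \<Longrightarrow> g \<in> carrier (sec X \<Omega>) \<Longrightarrow>
    val x (f \<otimes>\<^bsub>sec X \<Omega>\<^esub> g) = val x f * val x g"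
  by (subst val_iff) (auto intro!: A.residue_mult vanishing_ideal val_residue)

lemma val_cst: "x \<in> \<Omega> \<Longrightarrow> val x (cst X \<Omega> c) = c"
proof -
  assume x: "x \<in> \<Omega>"
  interpret m: ideal "vanishing X \<Omega> x" "sec X \<Omega>" by (rule vanishing_ideal[OF x])
  show ?thesis
    by (subst val_iff[OF x A.\<kappa>_closed]) (simp add: A.r_neg a_minus_def)
qed

lemma val_one: "x \<in> \<Omega> \<Longrightarrow> val x \<one>\<^bsub>sec X \<Omega>\<^esub> = 1"
  using val_cst[of x 1] by simp

lemma val_uminus:
  assumes "x \<in> \<Omega>" "f \<in> carrier (sec X \<Omega>)" shows "val x (\<ominus>\<^bsub>sec X \<Omega>\<^esub> f) = - val x f"
proof -
  have "val x (\<ominus>\<^bsub>sec X \<Omega>\<^esub> f) + val x f = val x (cst X \<Omega> 0)"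
    using val_add[of x "\<ominus>\<^bsub>sec X \<Omega>\<^esub> f" f] assms by (simp add: A.l_neg)
  then show ?thesis using val_cst[OF assms(1), of 0] by (simp add: eq_neg_iff_add_eq_0)
qed

lemma val_pow:
  assumes "x \<in> \<Omega>" "f \<in> carrier (sec X \<Omega>)" shows "val x (f [^]\<^bsub>sec X \<Omega>\<^esub> (n :: nat)) = val x f ^ n"
  by (induction n) (use assms in \<open>auto simp: val_mult val_one mult.commute\<close>)

lemma vanishing_iff:
  assumes "x \<in> \<Omega>" "f \<in> carrier (sec X \<Omega>)" shows "f \<in> vanishing X \<Omega> x \<longleftrightarrow> val x f = 0"
  using val_iff[OF assms, of 0] assms(2) by (simp add: a_minus_def)

lemma nonzero_locus_eq: "f \<in> carrier (sec X \<Omega>) \<Longrightarrow> nonzero_locus X \<Omega> f = {x\<in>\<Omega>. val x f \<noteq> 0}"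
  unfolding nonzero_locus_def using vanishing_iff by auto

lemma open_nonzero: "f \<in> carrier (sec X \<Omega>) \<Longrightarrow> openin (zar X) {x\<in>\<Omega>. val x f \<noteq> 0}"
  using open_nonzero_locus nonzero_locus_eq[of f] by auto

lemma basis:
  assumes "openin (zar X) W" "x \<in> W" "W \<subseteq> \<Omega>"
  obtains f where "f \<in> carrier (sec X \<Omega>)" "val x f \<noteq> 0" "{x\<in>\<Omega>. val x f \<noteq> 0} \<subseteq> W"
proof -
  obtain f where "f \<in> carrier (sec X \<Omega>)" "x \<in> nonzero_locus X \<Omega> f" "nonzero_locus X \<Omega> f \<subseteq> W"
    using nonzero_locus_basis[rule_format, of W x] assms by blast
  then show ?thesis using that[of f] by (simp add: nonzero_locus_eq)
qed

text \<open>\<open>R\<close> is generated by the value functions of finitely many generating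
  sections. Its elements and the sections correspond through their values on
  \<open>\<Omega>\<close>, and the points behind homomorphisms come from the bijection with maximal
  ideals.\<close>

theorem chart_exists:
  obtains R where "chart (zar X) \<Omega> R"
    "\<And>r. r \<in> R \<Longrightarrow> \<exists>a\<in>carrier (sec X \<Omega>). \<forall>x\<in>\<Omega>. r x = val x a"
    "\<And>a. a \<in> carrier (sec X \<Omega>) \<Longrightarrow> \<exists>r\<in>R. \<forall>x\<in>\<Omega>. r x = val x a"
proof -
  obtain S where S: "finite S" "S \<subseteq> carrier (sec X \<Omega>)"
    "generate_ring (sec X \<Omega>) (range (cst X \<Omega>) \<union> S) = carrier (sec X \<Omega>)"
    using finitely_generated by blast
  obtain ss where ss: "set ss = S" using finite_list[OF S(1)] by blast
  define R where "R = fa.adjoin_list constants (map (\<lambda>s x. val x s) ss)"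
  have R: "fa.subalg R" unfolding R_def by (rule fa.adjoin_list_subalg[OF fa.subalg_range])
  note RD = fa.subalgD[OF R]
  have gens: "constants \<subseteq> R" "(\<lambda>s x. val x s) ` S \<subseteq> R"
    unfolding R_def using fa.adjoin_list_superset[OF fa.subalg_range, of "map (\<lambda>s x. val x s) ss"] ss by auto
  have to_fun: "\<exists>r\<in>R. \<forall>x\<in>\<Omega>. r x = val x a" if "a \<in> carrier (sec X \<Omega>)" for a
  proof -
    have gc: "generate_ring (sec X \<Omega>) (range (cst X \<Omega>) \<union> S) \<subseteq> carrier (sec X \<Omega>)" using S(3) by simp
    have "a \<in> generate_ring (sec X \<Omega>) (range (cst X \<Omega>) \<union> S)" using that S(3) by simp
    then show ?thesis
    proof (induction rule: generate_ring.induct)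
      case one
      show ?case using RD(3) by (intro bexI[of _ 1]) (auto simp: val_one)
    next
      case (incl h)
      then consider c where "h = cst X \<Omega> c" | "h \<in> S" by blast
      then show ?case
      proof cases
        case 1
        then show ?thesis using gens(1) by (intro bexI[of _ "\<lambda>_. c"]) (auto simp: val_cst)
      next
        case 2
        then show ?thesis using gens(2) by (intro bexI[of _ "\<lambda>x. val x h"]) auto
      qed
    next
      case (a_inv h)
      then obtain r where "r \<in> R" "\<forall>x\<in>\<Omega>. r x = val x h" by blast
      then show ?case using RD(6)[of r] a_inv(1) gc by (intro bexI[of _ "- r"]) (auto simp: val_uminus)
    next
      case (eng_add h1 h2)
      then obtain r1 r2 where "r1 \<in> R" "\<forall>x\<in>\<Omega>. r1 x = val x h1" "r2 \<in> R" "\<forall>x\<in>\<Omega>. r2 x = val x h2" by blast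
      moreover have "h1 \<in> carrier (sec X \<Omega>)" "h2 \<in> carrier (sec X \<Omega>)" using eng_add(1,2) gc by auto
      ultimately show ?case using RD(4)[of r1 r2] by (intro bexI[of _ "r1 + r2"]) (auto simp: val_add)
    next
      case (eng_mult h1 h2)
      then obtain r1 r2 where "r1 \<in> R" "\<forall>x\<in>\<Omega>. r1 x = val x h1" "r2 \<in> R" "\<forall>x\<in>\<Omega>. r2 x = val x h2" by blast
      moreover have "h1 \<in> carrier (sec X \<Omega>)" "h2 \<in> carrier (sec X \<Omega>)" using eng_mult(1,2) gc by auto
      ultimately show ?case using RD(5)[of r1 r2] by (intro bexI[of _ "r1 * r2"]) (auto simp: val_mult)
    qed
  qed
  have "R \<subseteq> {r. \<exists>a\<in>carrier (sec X \<Omega>). \<forall>x\<in>\<Omega>. r x = val x a}" (is "_ \<subseteq> ?B")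
    unfolding R_def
  proof (rule fa.adjoin_list_least[OF _ fa.subalg_range])
    show con: "constants \<subseteq> ?B"
    proof clarify
      fix c show "\<exists>a\<in>carrier (sec X \<Omega>). \<forall>x\<in>\<Omega>. c = val x a"
        by (intro bexI[of _ "cst X \<Omega> c"]) (auto simp: val_cst)
    qed
    show "fa.subalg ?B"
      unfolding fa.subalg_def
    proof (intro conjI ballI con)
      fix r r' assume "r \<in> ?B" "r' \<in> ?B"
      then obtain a a' where a: "a \<in> carrier (sec X \<Omega>)" "\<forall>x\<in>\<Omega>. r x = val x a"
        "a' \<in> carrier (sec X \<Omega>)" "\<forall>x\<in>\<Omega>. r' x = val x a'" by blast
      then show "r + r' \<in> ?B"
        by (intro CollectI bexI[of _ "a \<oplus>\<^bsub>sec X \<Omega>\<^esub> a'"]) (auto simp: val_add)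
      show "r * r' \<in> ?B"
        using a by (intro CollectI bexI[of _ "a \<otimes>\<^bsub>sec X \<Omega>\<^esub> a'"]) (auto simp: val_mult)
    qed
    show "set (map (\<lambda>s x. val x s) ss) \<subseteq> ?B" using ss S(2) by auto
  qed
  then have to_sec: "\<exists>a\<in>carrier (sec X \<Omega>). \<forall>x\<in>\<Omega>. r x = val x a" if "r \<in> R" for r using that by blast
  have "chart (zar X) \<Omega> R"
  proof (rule chartI[OF open_\<Omega>])
    show "\<exists>rs. R = fa.adjoin_list constants rs" unfolding R_def by blast
  next
    fix r assume "r \<in> R"
    then obtain a where a: "a \<in> carrier (sec X \<Omega>)" "\<forall>x\<in>\<Omega>. r x = val x a" using to_sec by blast
    then have "{x\<in>\<Omega>. r x \<noteq> 0} = {x\<in>\<Omega>. val x a \<noteq> 0}" by auto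
    then show "openin (zar X) {x\<in>\<Omega>. r x \<noteq> 0}" using open_nonzero[OF a(1)] by simp
  next
    fix W x assume W: "openin (zar X) W" "x \<in> W \<inter> \<Omega>"
    then have "openin (zar X) (W \<inter> \<Omega>)" using open_\<Omega> by auto
    then obtain a where a: "a \<in> carrier (sec X \<Omega>)" "val x a \<noteq> 0" "{x\<in>\<Omega>. val x a \<noteq> 0} \<subseteq> W \<inter> \<Omega>"
      using basis[of "W \<inter> \<Omega>" x] W by blast
    obtain r where "r \<in> R" "\<forall>x\<in>\<Omega>. r x = val x a" using to_fun[OF a(1)] by blast
    then show "\<exists>f\<in>R. f x \<noteq> 0 \<and> {x\<in>\<Omega>. f x \<noteq> 0} \<subseteq> W" using a W by (intro bexI[of _ r]) auto
  next
    fix \<phi> assume \<phi>: "fa.hom_on (vanish \<Omega>) R \<phi>"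
    note hom = fa.hom_onD[OF \<phi>]
    have same: "\<phi> r = \<phi> r'" if "r \<in> R" "r' \<in> R" "\<And>x. x \<in> \<Omega> \<Longrightarrow> r x = r' x" for r r'
    proof -
      have "r - r' \<in> vanish \<Omega>" using that(3) by (simp add: vanish_def)
      then show ?thesis using hom(4)[OF RD(7)[OF that(1,2)]] fa.hom_on_diff[OF R \<phi> that(1,2)] by simp
    qed
    have "\<forall>a\<in>carrier (sec X \<Omega>). \<exists>r. r \<in> R \<and> (\<forall>x\<in>\<Omega>. r x = val x a)" using to_fun by blast
    from bchoice[OF this]
    obtain \<rho> where \<rho>0: "\<forall>a\<in>carrier (sec X \<Omega>). \<rho> a \<in> R \<and> (\<forall>x\<in>\<Omega>. \<rho> a x = val x a)" by (elim exE)
    have \<rho>: "\<rho> a \<in> R" "x \<in> \<Omega> \<Longrightarrow> \<rho> a x = val x a" if "a \<in> carrier (sec X \<Omega>)" for a x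
      using bspec[OF \<rho>0 that] by simp_all
    \<comment> \<open>The lift \<open>\<rho>\<close> from sections to functions is a mere choice. It
      becomes additive and multiplicative after \<open>\<phi>\<close>, because \<open>\<phi>\<close>
      does not distinguish functions in \<open>R\<close> that agree on
      \<open>\<Omega>\<close>.\<close>
    define \<Phi> where "\<Phi> a = \<phi> (\<rho> a)" for a
    have "maximalideal {a \<in> carrier (sec X \<Omega>). \<Phi> a = 0} (sec X \<Omega>)"
    proof (rule A.kernel_maximalideal)
      fix f g assume fg: "f \<in> carrier (sec X \<Omega>)" "g \<in> carrier (sec X \<Omega>)"
      have "\<phi> (\<rho> (f \<oplus>\<^bsub>sec X \<Omega>\<^esub> g)) = \<phi> (\<rho> f + \<rho> g)"
        by (rule same) (use fg \<rho>[OF fg(1)] \<rho>[OF fg(2)] \<rho>[OF A.a_closed[OF fg]] RD(4) in \<open>auto simp: val_add\<close>)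
      then show "\<Phi> (f \<oplus>\<^bsub>sec X \<Omega>\<^esub> g) = \<Phi> f + \<Phi> g" using hom(2) \<rho> fg by (simp add: \<Phi>_def)
      have "\<phi> (\<rho> (f \<otimes>\<^bsub>sec X \<Omega>\<^esub> g)) = \<phi> (\<rho> f * \<rho> g)"
        by (rule same) (use fg \<rho>[OF fg(1)] \<rho>[OF fg(2)] \<rho>[OF A.m_closed[OF fg]] RD(5) in \<open>auto simp: val_mult\<close>)
      then show "\<Phi> (f \<otimes>\<^bsub>sec X \<Omega>\<^esub> g) = \<Phi> f * \<Phi> g" using hom(3) \<rho> fg by (simp add: \<Phi>_def)
    next
      fix c
      have "\<phi> (\<rho> (cst X \<Omega> c)) = \<phi> (\<lambda>_. c)"
        by (rule same) (use \<rho>[OF A.\<kappa>_closed] RD(1) in \<open>auto simp: val_cst\<close>)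
      then show "\<Phi> (cst X \<Omega> c) = c" using hom(1) by (simp add: \<Phi>_def)
    qed
    then have "{a \<in> carrier (sec X \<Omega>). \<Phi> a = 0} \<in> vanishing X \<Omega> ` \<Omega>"
      using bij_betw_imp_surj_on[OF vanishing_bij] by simp
    then obtain x where x: "x \<in> \<Omega>" "vanishing X \<Omega> x = {a \<in> carrier (sec X \<Omega>). \<Phi> a = 0}"
      by (elim imageE) simp
    have "\<phi> r = r x" if r: "r \<in> R" for r
    proof -
      obtain a where a: "a \<in> carrier (sec X \<Omega>)" "\<forall>x\<in>\<Omega>. r x = val x a" using to_sec[OF r] by blast
      have rc: "r - (\<lambda>_. r x) \<in> R" using RD(7)[OF r RD(1)] .
      let ?b = "a \<ominus>\<^bsub>sec X \<Omega>\<^esub> cst X \<Omega> (val x a)"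
      have b: "?b \<in> carrier (sec X \<Omega>)" using a(1) by simp
      have "?b \<in> vanishing X \<Omega> x" by (rule val_residue[OF x(1) a(1)])
      then have "\<phi> (\<rho> ?b) = 0" using x(2) by (simp add: \<Phi>_def)
      moreover have "\<phi> (\<rho> ?b) = \<phi> (r - (\<lambda>_. r x))"
        by (rule same) (use \<rho>[OF b] rc a x(1) in \<open>auto simp: val_add val_uminus val_cst a_minus_def\<close>)
      ultimately show ?thesis using fa.hom_on_diff[OF R \<phi> r RD(1)] hom(1) by simp
    qed
    then show "\<exists>x\<in>\<Omega>. \<forall>f\<in>R. \<phi> f = f x" using x(1) by blast
  next
    fix x y assume xy: "x \<in> \<Omega>" "y \<in> \<Omega>" "\<forall>f\<in>R. f x = f y"
    have "val x a = val y a" if "a \<in> carrier (sec X \<Omega>)" for a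
    proof -
      obtain r where "r \<in> R" "\<forall>x\<in>\<Omega>. r x = val x a" using to_fun[OF \<open>a \<in> _\<close>] by blast
      then show ?thesis using xy by metis
    qed
    then have *: "f \<in> vanishing X \<Omega> x \<longleftrightarrow> f \<in> vanishing X \<Omega> y" if "f \<in> carrier (sec X \<Omega>)" for f
      using vanishing_iff[OF xy(1) that] vanishing_iff[OF xy(2) that] that by simp
    have "vanishing X \<Omega> z \<subseteq> carrier (sec X \<Omega>)" for z by (auto simp: vanishing_def)
    from this[of x] this[of y] have "vanishing X \<Omega> x = vanishing X \<Omega> y" using * by blast
    then show "x = y" using inj_onD[OF bij_betw_imp_inj_on[OF vanishing_bij]] xy(1,2) by blast
  qed
  then show ?thesis by (rule that[OF _ to_sec to_fun])
qed

end

section \<open>Comorphisms as composition on values\<close>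

lemma morphismD:
  assumes "morphism X Y f"
  shows "continuous_map (zar X) (zar Y) (pt f)"
    "openin (zar Y) V \<Longrightarrow> com f V \<in> ring_hom (sec Y V) (sec X (preim X f V))"
    "openin (zar Y) V \<Longrightarrow> com f V (cst Y V c) = cst X (preim X f V) c"
    "openin (zar Y) V \<Longrightarrow> x \<in> preim X f V \<Longrightarrow> a \<in> vanishing Y V (pt f x) \<Longrightarrow> com f V a \<in> vanishing X (preim X f V) x"
    "openin (zar Y) V \<Longrightarrow> openin (zar X) (preim X f V)"
proof -
  show c: "continuous_map (zar X) (zar Y) (pt f)" using assms by (simp add: morphism_def)
  show "openin (zar Y) V \<Longrightarrow> openin (zar X) (preim X f V)"
    unfolding preim_def by (rule openin_continuous_map_preimage[OF c])
  note h = assms[unfolded morphism_def, THEN conjunct2, THEN conjunct1, rule_format, of V]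
  show "openin (zar Y) V \<Longrightarrow> com f V \<in> ring_hom (sec Y V) (sec X (preim X f V))"
    "openin (zar Y) V \<Longrightarrow> com f V (cst Y V c) = cst X (preim X f V) c"
    using h by simp_all
  show "openin (zar Y) V \<Longrightarrow> x \<in> preim X f V \<Longrightarrow> a \<in> vanishing Y V (pt f x) \<Longrightarrow> com f V a \<in> vanishing X (preim X f V) x"
    using h[THEN conjunct2, THEN conjunct2, THEN bspec, of x] by (simp add: image_subset_iff)
qed

text \<open>A comorphism preserves constants and vanishing, so \<open>a\<close> minus its value at
  the image point is mapped to a section that vanishes at \<open>x\<close>.\<close>

lemma com_residue:
  assumes f: "morphism X Y f" and X: "alg_space X" and Y: "affine Y V"
    and x: "x \<in> preim X f V" and a: "a \<in> carrier (sec Y V)"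
  shows "com f V a \<ominus>\<^bsub>sec X (preim X f V)\<^esub> cst X (preim X f V) (value_at Y V (pt f x) a)
    \<in> vanishing X (preim X f V) x"
proof -
  interpret X: alg_space X by (rule X)
  interpret Y: affine Y V by (rule Y)
  note fD = morphismD[OF f]
  let ?U = "preim X f V"
  interpret B: poly_eval "sec X ?U" "cst X ?U" "\<lambda>_. \<zero>\<^bsub>sec X ?U\<^esub>" by (rule X.sec_poly_eval[OF fD(5)[OF Y.open_\<Omega>]])
  note h = fD(2)[OF Y.open_\<Omega>]
  interpret h: ring_hom_ring "sec Y V" "sec X ?U" "com f V"
    by (intro ring_hom_ringI2 h Y.A.ring_axioms B.ring_axioms)
  have fx: "pt f x \<in> V" using x by (simp add: preim_def)
  have "com f V (a \<ominus>\<^bsub>sec Y V\<^esub> cst Y V (value_at Y V (pt f x) a)) \<in> vanishing X ?U x"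
    by (rule fD(4)[OF Y.open_\<Omega> x Y.val_residue[OF fx a]])
  moreover have "com f V (a \<ominus>\<^bsub>sec Y V\<^esub> cst Y V c) = com f V a \<ominus>\<^bsub>sec X ?U\<^esub> cst X ?U c" for c
    using a by (simp add: a_minus_def fD(3)[OF Y.open_\<Omega>])
  ultimately show ?thesis by simp
qed

lemma value_com_affine:
  assumes f: "morphism X Y f" and X: "affine X \<Omega>" and Y: "affine Y V"
    and x: "x \<in> \<Omega>" "\<Omega> \<subseteq> preim X f V" and a: "a \<in> carrier (sec Y V)"
  shows "value_at X \<Omega> x (res X (preim X f V) \<Omega> (com f V a)) = value_at Y V (pt f x) a"
proof -
  interpret X: affine X \<Omega> by (rule X)
  interpret Y: affine Y V by (rule Y)
  note fD = morphismD[OF f]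
  let ?U = "preim X f V"
  have U: "openin (zar X) ?U" by (rule fD(5)[OF Y.open_\<Omega>])
  interpret B: poly_eval "sec X ?U" "cst X ?U" "\<lambda>_. \<zero>\<^bsub>sec X ?U\<^esub>" by (rule X.sec_poly_eval[OF U])
  interpret r: ring_hom_ring "sec X ?U" "sec X \<Omega>" "res X ?U \<Omega>"
    by (intro ring_hom_ringI2 X.res_hom[OF U X.open_\<Omega> x(2)] X.A.ring_axioms B.ring_axioms)
  have ca: "com f V a \<in> carrier (sec X ?U)" using ring_hom_closed[OF fD(2)[OF Y.open_\<Omega>] a] .
  let ?c = "value_at Y V (pt f x) a"
  have "com f V a \<ominus>\<^bsub>sec X ?U\<^esub> cst X ?U ?c \<in> vanishing X ?U x"
    using com_residue[OF f X.alg_space_axioms Y _ a] x by blast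
  then have "res X ?U \<Omega> (com f V a \<ominus>\<^bsub>sec X ?U\<^esub> cst X ?U ?c) \<in> vanishing X \<Omega> x"
    using ca by (subst X.vanishing_res_iff[OF U X.open_\<Omega> x]) auto
  then have "res X ?U \<Omega> (com f V a) \<ominus>\<^bsub>sec X \<Omega>\<^esub> cst X \<Omega> ?c \<in> vanishing X \<Omega> x"
    using ca by (simp add: a_minus_def X.res_cst[OF U X.open_\<Omega> x(2)])
  then show ?thesis using ca by (subst X.val_iff[OF x(1)]) auto
qed

text \<open>On the principal open set the pulled back section is a fraction with a power of
  \<open>g\<close> as denominator, and \<open>b\<close> is its numerator. Values are controlled
  through \<open>val_iff\<close> on the affine set \<open>\<Omega>\<close>; on the principal set
  itself the computation is done with vanishing of sections, which multiplication by a unit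
  preserves.\<close>

lemma value_com_principal:
  assumes f: "morphism X Y f" and X: "affine X \<Omega>" and Y: "affine Y V"
    and g: "g \<in> carrier (sec X \<Omega>)" "{x\<in>\<Omega>. value_at X \<Omega> x g \<noteq> 0} \<subseteq> preim X f V" and a: "a \<in> carrier (sec Y V)"
  obtains b n where "b \<in> carrier (sec X \<Omega>)"
    "\<And>x. x \<in> \<Omega> \<Longrightarrow> value_at X \<Omega> x g \<noteq> 0 \<Longrightarrow>
      value_at X \<Omega> x b = value_at X \<Omega> x g ^ n * value_at Y V (pt f x) a"
proof -
  interpret X: affine X \<Omega> by (rule X)
  interpret Y: affine Y V by (rule Y)
  note fD = morphismD[OF f]
  define D where "D = {x\<in>\<Omega>. value_at X \<Omega> x g \<noteq> 0}"
  have D: "nonzero_locus X \<Omega> g = D" "openin (zar X) D" "D \<subseteq> \<Omega>" "D \<subseteq> preim X f V"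
    using X.nonzero_locus_eq[OF g(1)] X.open_nonzero[OF g(1)] g(2) by (auto simp: D_def)
  let ?U = "preim X f V"
  have U: "openin (zar X) ?U" by (rule fD(5)[OF Y.open_\<Omega>])
  interpret C: poly_eval "sec X ?U" "cst X ?U" "\<lambda>_. \<zero>\<^bsub>sec X ?U\<^esub>" by (rule X.sec_poly_eval[OF U])
  interpret B: poly_eval "sec X D" "cst X D" "\<lambda>_. \<zero>\<^bsub>sec X D\<^esub>" by (rule X.sec_poly_eval[OF D(2)])
  interpret r: ring_hom_ring "sec X ?U" "sec X D" "res X ?U D"
    by (intro ring_hom_ringI2 X.res_hom[OF U D(2,4)] C.ring_axioms B.ring_axioms)
  interpret s: ring_hom_ring "sec X \<Omega>" "sec X D" "res X \<Omega> D"
    by (intro ring_hom_ringI2 X.res_hom[OF X.open_\<Omega> D(2,3)] X.A.ring_axioms B.ring_axioms)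
  have ca: "com f V a \<in> carrier (sec X ?U)" using ring_hom_closed[OF fD(2)[OF Y.open_\<Omega>] a] .
  define e where "e = res X ?U D (com f V a)"
  have e: "e \<in> carrier (sec X D)" unfolding e_def using ca by simp
  let ?g = "res X \<Omega> D g"
  note loc = X.localization[OF g(1) D(1)]
  obtain b and n :: nat where b: "b \<in> carrier (sec X \<Omega>)" "res X \<Omega> D b = (?g [^]\<^bsub>sec X D\<^esub> n) \<otimes>\<^bsub>sec X D\<^esub> e"
    using loc(2)[OF e] by blast
  have gU: "?g [^]\<^bsub>sec X D\<^esub> n \<in> Units (sec X D)"
  proof (induction n)
    case (Suc n)
    then show ?case using loc(1) B.Units_m_closed by simp
  qed simp
  have "value_at X \<Omega> x b = value_at X \<Omega> x g ^ n * value_at Y V (pt f x) a" if x: "x \<in> \<Omega>" "value_at X \<Omega> x g \<noteq> 0" for x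
  proof -
    have xD: "x \<in> D" using x by (simp add: D_def)
    let ?c = "value_at Y V (pt f x) a"
    have "com f V a \<ominus>\<^bsub>sec X ?U\<^esub> cst X ?U ?c \<in> vanishing X ?U x"
      using com_residue[OF f X.alg_space_axioms Y _ a] xD D(4) by blast
    then have "res X ?U D (com f V a \<ominus>\<^bsub>sec X ?U\<^esub> cst X ?U ?c) \<in> vanishing X D x"
      using ca by (subst X.vanishing_res_iff[OF U D(2) xD D(4)]) auto
    then have "e \<ominus>\<^bsub>sec X D\<^esub> cst X D ?c \<in> vanishing X D x"
      unfolding e_def using ca by (simp add: a_minus_def X.res_cst[OF U D(2,4)])
    then have "(?g [^]\<^bsub>sec X D\<^esub> n) \<otimes>\<^bsub>sec X D\<^esub> (e \<ominus>\<^bsub>sec X D\<^esub> cst X D ?c) \<in> vanishing X D x"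
      using e by (intro X.vanishing_unit_mult[OF D(2) xD gU]) auto
    moreover have "(?g [^]\<^bsub>sec X D\<^esub> n) \<otimes>\<^bsub>sec X D\<^esub> (e \<ominus>\<^bsub>sec X D\<^esub> cst X D ?c) =
        res X \<Omega> D (b \<ominus>\<^bsub>sec X \<Omega>\<^esub> (g [^]\<^bsub>sec X \<Omega>\<^esub> n) \<otimes>\<^bsub>sec X \<Omega>\<^esub> cst X \<Omega> ?c)"
      using b g(1) e gU
      by (simp add: a_minus_def s.hom_nat_pow X.res_cst[OF X.open_\<Omega> D(2,3)] B.r_distr B.r_minus)
    ultimately have "res X \<Omega> D (b \<ominus>\<^bsub>sec X \<Omega>\<^esub> (g [^]\<^bsub>sec X \<Omega>\<^esub> n) \<otimes>\<^bsub>sec X \<Omega>\<^esub> cst X \<Omega> ?c) \<in> vanishing X D x"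
      by simp
    then have "b \<ominus>\<^bsub>sec X \<Omega>\<^esub> (g [^]\<^bsub>sec X \<Omega>\<^esub> n) \<otimes>\<^bsub>sec X \<Omega>\<^esub> cst X \<Omega> ?c \<in> vanishing X \<Omega> x"
      by (rule X.vanishing_res_iff[OF X.open_\<Omega> D(2) xD D(3), THEN iffD1, rotated]) (use b g(1) in simp)
    then have "value_at X \<Omega> x (b \<ominus>\<^bsub>sec X \<Omega>\<^esub> (g [^]\<^bsub>sec X \<Omega>\<^esub> n) \<otimes>\<^bsub>sec X \<Omega>\<^esub> cst X \<Omega> ?c) = 0"
      using b g(1) by (subst (asm) X.vanishing_iff[OF x(1)]) auto
    then show ?thesis
      using b g(1) x(1) by (simp add: a_minus_def X.val_add X.val_uminus X.val_mult X.val_cst X.val_pow)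
  qed
  then show ?thesis using that b(1) by blast
qed

lemma finite_type_schemeD:
  assumes "finite_type_scheme X"
  shows "alg_space X" "x \<in> points X \<Longrightarrow> \<exists>\<Omega>. affine X \<Omega> \<and> x \<in> \<Omega>"
proof -
  show X: "alg_space X" using assms by (auto simp: finite_type_scheme_def alg_space_def)
  show "x \<in> points X \<Longrightarrow> \<exists>\<Omega>. affine X \<Omega> \<and> x \<in> \<Omega>"
  proof -
    assume x: "x \<in> points X"
    have "\<exists>\<U>. finite \<U> \<and> (\<forall>U\<in>\<U>. affine_open X U) \<and> \<Union>\<U> = points X"
      using assms by (simp add: finite_type_scheme_def)
    then obtain \<U> where "\<forall>U\<in>\<U>. affine_open X U" "\<Union>\<U> = points X" by (elim exE conjE)
    moreover from this(2) x obtain U where "U \<in> \<U>" "x \<in> U" by (metis UnionE)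
    ultimately show ?thesis using X unfolding affine_def affine_axioms_def by (intro exI[of _ U]) simp
  qed
qed

lemma finite_type_noeth_space:
  fixes X :: "('x, 'r, 'k::alg_closed_field) kspace"
  assumes "finite_type_scheme X" shows "noeth_space (zar X)"
proof -
  have "\<exists>\<U>. finite \<U> \<and> (\<forall>U\<in>\<U>. affine_open X U) \<and> \<Union>\<U> = points X"
    using assms by (simp add: finite_type_scheme_def)
  then obtain \<U> where U0: "finite \<U> \<and> (\<forall>U\<in>\<U>. affine_open X U) \<and> \<Union>\<U> = points X" by (elim exE)
  then have U: "finite \<U>" "\<And>U. U \<in> \<U> \<Longrightarrow> affine_open X U" "\<Union>\<U> = points X" by simp_all
  show ?thesis
  proof (rule noeth_space_finite_cover[OF U(1)])
    fix V assume "V \<in> \<U>"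
    then interpret affine X V using finite_type_schemeD(1)[OF assms] U(2)
      by (simp add: affine_def affine_axioms_def)
    obtain R :: "('x \<Rightarrow> 'k) set" where "chart (zar X) V R" by (rule chart_exists) blast
    then show "noeth_space (subtopology (zar X) V)" by (rule chart_noeth_space)
  qed (simp add: U(3))
qed

text \<open>The source is shrunk to a principal open set inside \<open>W\<close> and inside the
  preimage of an affine \<open>V\<close>. There the composite of \<open>q\<close> with
  \<open>f\<close> is a fraction \<open>b / g ^ n\<close>, a member of the localized
  algebra.\<close>

theorem morphism_charts:
  fixes X :: "('x, 'r, 'k::alg_closed_field) kspace" and Y :: "('y, 'r, 'k) kspace"
  assumes X: "finite_type_scheme X" and Y: "finite_type_scheme Y" and f: "morphism X Y f"
    and W: "openin (zar X) W" "x \<in> W"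
  obtains V Q \<Omega> R where "chart (zar Y) V (Q :: ('y \<Rightarrow> 'k) set)" "chart (zar X) \<Omega> (R :: ('x \<Rightarrow> 'k) set)"
    "x \<in> \<Omega>" "\<Omega> \<subseteq> W" "\<And>z. z \<in> \<Omega> \<Longrightarrow> pt f z \<in> V" "\<And>q. q \<in> Q \<Longrightarrow> \<exists>r\<in>R. \<forall>z\<in>\<Omega>. r z = q (pt f z)"
proof -
  note fD = morphismD[OF f]
  have x: "x \<in> points X" using W openin_subset by blast
  then have "pt f x \<in> points Y" using continuous_map_image_subset_topspace[OF fD(1)] by blast
  then obtain V where V: "affine Y V" "pt f x \<in> V" using finite_type_schemeD(2)[OF Y] by blast
  obtain \<Omega>0 where \<Omega>0: "affine X \<Omega>0" "x \<in> \<Omega>0" using finite_type_schemeD(2)[OF X x] by blast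
  interpret X: affine X \<Omega>0 by (rule \<Omega>0)
  interpret Y: affine Y V by (rule V)
  let ?W = "W \<inter> preim X f V \<inter> \<Omega>0"
  have "openin (zar X) ?W" using W(1) fD(5)[OF Y.open_\<Omega>] X.open_\<Omega> by blast
  moreover have "x \<in> ?W" using W(2) x V(2) \<Omega>0(2) by (simp add: preim_def)
  ultimately obtain g where g: "g \<in> carrier (sec X \<Omega>0)" "X.val x g \<noteq> 0" "{z\<in>\<Omega>0. X.val z g \<noteq> 0} \<subseteq> ?W"
    using X.basis[of ?W x] by blast
  obtain R0 where R0: "chart (zar X) \<Omega>0 R0"
    "\<And>a. a \<in> carrier (sec X \<Omega>0) \<Longrightarrow> \<exists>r\<in>R0. \<forall>x\<in>\<Omega>0. r x = X.val x a" by (rule X.chart_exists) blast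
  obtain Q where Q: "chart (zar Y) V Q"
    "\<And>q. q \<in> Q \<Longrightarrow> \<exists>a\<in>carrier (sec Y V). \<forall>y\<in>V. q y = Y.val y a" by (rule Y.chart_exists) blast
  obtain gf where gf: "gf \<in> R0" "\<And>z. z \<in> \<Omega>0 \<Longrightarrow> gf z = X.val z g" using R0(2)[OF g(1)] by blast
  define \<Omega> where "\<Omega> = {z\<in>\<Omega>0. gf z \<noteq> 0}"
  have \<Omega>: "\<Omega> = {z\<in>\<Omega>0. X.val z g \<noteq> 0}" using gf(2) by (auto simp: \<Omega>_def)
  let ?R = "fa.adjoin R0 (\<lambda>z. inverse (gf z))"
  note sub0 = chartD(2)[OF R0(1)]
  note supR = fa.adjoin_superset[OF sub0, of "\<lambda>z. inverse (gf z)"]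
  note subR = fa.adjoin_subalg[OF sub0, of "\<lambda>z. inverse (gf z)"]
  have ch: "chart (zar X) \<Omega> ?R" unfolding \<Omega>_def by (rule chart_principal[OF R0(1) gf(1)])
  have pull: "\<exists>r\<in>?R. \<forall>z\<in>\<Omega>. r z = q (pt f z)" if q: "q \<in> Q" for q
  proof -
    obtain a where a: "a \<in> carrier (sec Y V)" "\<forall>y\<in>V. q y = Y.val y a" using Q(2)[OF q] by blast
    have "{z\<in>\<Omega>0. X.val z g \<noteq> 0} \<subseteq> preim X f V" using g(3) by blast
    from value_com_principal[OF f \<Omega>0(1) V(1) g(1) this a(1)]
    obtain b n where b: "b \<in> carrier (sec X \<Omega>0)" "\<And>z. z \<in> \<Omega>0 \<Longrightarrow> X.val z g \<noteq> 0 \<Longrightarrow>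
      X.val z b = X.val z g ^ n * Y.val (pt f z) a" by blast
    obtain rb where rb: "rb \<in> R0" "\<And>z. z \<in> \<Omega>0 \<Longrightarrow> rb z = X.val z b" using R0(2)[OF b(1)] by blast
    let ?r = "rb * (\<lambda>z. inverse (gf z)) ^ n"
    have "?r \<in> ?R" using supR rb(1) by (intro fa.subalgD(5)[OF subR] fa.subalgD(8)[OF subR]) auto
    moreover have "?r z = q (pt f z)" if z: "z \<in> \<Omega>" for z
    proof -
      have z': "z \<in> \<Omega>0" "X.val z g \<noteq> 0" "pt f z \<in> V" using z g(3) by (auto simp: \<Omega> preim_def)
      have "?r z = rb z * inverse (gf z) ^ n" by (simp add: fun_power_apply)
      also have "\<dots> = Y.val (pt f z) a" using z' b(2)[OF z'(1,2)] rb(2)[OF z'(1)] gf(2)[OF z'(1)]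
        by (simp add: field_simps)
      finally show ?thesis using a(2) z'(3) by simp
    qed
    ultimately show ?thesis by blast
  qed
  have "x \<in> \<Omega>" using g(2) \<Omega>0(2) by (simp add: \<Omega>)
  moreover have "\<Omega> \<subseteq> W" "\<And>z. z \<in> \<Omega> \<Longrightarrow> pt f z \<in> V" using g(3) by (auto simp: \<Omega> preim_def)
  ultimately show ?thesis using that[OF Q(1) ch] pull by blast
qed

lemma chart_nbhd:
  fixes X :: "('x, 'r, 'k::alg_closed_field) kspace"
  assumes X: "finite_type_scheme X" and W: "openin (zar X) W" "x \<in> W"
  obtains \<Omega> and R :: "('x \<Rightarrow> 'k) set" where "chart (zar X) \<Omega> R" "x \<in> \<Omega>" "\<Omega> \<subseteq> W"
proof -
  have "x \<in> points X" using W openin_subset by blast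
  then obtain \<Omega>0 where \<Omega>0: "affine X \<Omega>0" "x \<in> \<Omega>0" using finite_type_schemeD(2)[OF X] by blast
  interpret X: affine X \<Omega>0 by (rule \<Omega>0)
  obtain R :: "('x \<Rightarrow> 'k) set" where R: "chart (zar X) \<Omega>0 R" by (rule X.chart_exists) blast
  obtain g where g: "g \<in> R" "g x \<noteq> 0" "{z\<in>\<Omega>0. g z \<noteq> 0} \<subseteq> W" using chartD(4)[OF R W \<Omega>0(2)] by blast
  then show ?thesis using \<Omega>0(2) by (intro that[OF chart_principal[OF R g(1)]]) auto
qed

text \<open>The Zariski topology of a product is finer than the product topology, so continuity has
  to come from functions: sections over \<open>U \<times> V\<close> are generated by those of the
  two factors, and on a slice the sections from \<open>G\<close> become constants. Hence principal
  open sets meet the slice in principal open sets of \<open>V\<close>.\<close>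

lemma slice_continuous:
  fixes G :: "('g, 'r, 'k::alg_closed_field) kspace" and X :: "('x, 'r, 'k) kspace"
  assumes P: "is_product G X P p q" and G: "finite_type_scheme G" and X: "finite_type_scheme X"
    and g: "g \<in> points G"
  shows "continuous_map (zar X) (zar P) (\<lambda>x. (g, x))"
proof -
  have Pt: "finite_type_scheme P" "points P = points G \<times> points X" "morphism P G p" "morphism P X q"
    "\<And>z. z \<in> points P \<Longrightarrow> pt p z = fst z" "\<And>z. z \<in> points P \<Longrightarrow> pt q z = snd z"
    using P by (simp_all add: is_product_def)
  have "openin (zar X) {x \<in> points X. (g, x) \<in> W}" if W: "openin (zar P) W" for W
  proof (subst openin_subopen, intro ballI)
    fix x assume x: "x \<in> {x \<in> points X. (g, x) \<in> W}"
    obtain U where U: "affine G U" "g \<in> U" using finite_type_schemeD(2)[OF G g] by blast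
    obtain V where V: "affine X V" "x \<in> V" using finite_type_schemeD(2)[OF X] x by blast
    interpret U: affine G U by (rule U)
    interpret V: affine X V by (rule V)
    define \<alpha> where "\<alpha> = (\<lambda>a. res P (preim P p U) (U \<times> V) (com p U a))"
    define \<beta> where "\<beta> = (\<lambda>b. res P (preim P q V) (U \<times> V) (com q V b))"
    have UV: "affine_open P (U \<times> V)" and
      gen: "generate_ring (sec P (U \<times> V)) (\<alpha> ` carrier (sec G U) \<union> \<beta> ` carrier (sec X V)) = carrier (sec P (U \<times> V))"
      using P[unfolded is_product_def, THEN conjunct2, THEN conjunct2, THEN conjunct2, THEN conjunct2, THEN conjunct2,
        THEN conjunct2, rule_format, of U V] U.aff V.aff unfolding Let_def \<alpha>_def \<beta>_def by simp_all
    interpret P: affine P "U \<times> V"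
      using finite_type_schemeD(1)[OF Pt(1)] UV by (simp add: affine_def affine_axioms_def)
    have subP: "U \<times> V \<subseteq> points P" using openin_subset[OF P.open_\<Omega>] .
    have pre: "U \<times> V \<subseteq> preim P p U" "U \<times> V \<subseteq> preim P q V" using subP Pt(5,6) by (auto simp: preim_def)
    have slice: "\<exists>b\<in>carrier (sec X V). \<forall>y\<in>V. P.val (g, y) c = V.val y b" if "c \<in> carrier (sec P (U \<times> V))" for c
    proof -
      have gc: "generate_ring (sec P (U \<times> V)) (\<alpha> ` carrier (sec G U) \<union> \<beta> ` carrier (sec X V)) \<subseteq> carrier (sec P (U \<times> V))"
        using gen by simp
      have "c \<in> generate_ring (sec P (U \<times> V)) (\<alpha> ` carrier (sec G U) \<union> \<beta> ` carrier (sec X V))" using that gen by simp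
      then show ?thesis
      proof (induction rule: generate_ring.induct)
        case one
        show ?case using U(2) by (intro bexI[of _ "\<one>\<^bsub>sec X V\<^esub>"]) (auto simp: P.val_one V.val_one)
      next
        case (incl h)
        then consider a where "a \<in> carrier (sec G U)" "h = \<alpha> a" | b where "b \<in> carrier (sec X V)" "h = \<beta> b" by blast
        then show ?case
        proof cases
          case 1
          have "P.val (g, y) h = V.val y (cst X V (U.val g a))" if y: "y \<in> V" for y
          proof -
            have gy: "(g, y) \<in> U \<times> V" using U(2) y by simp
            have "P.val (g, y) h = U.val (pt p (g, y)) a"
              unfolding 1(2) \<alpha>_def by (rule value_com_affine[OF Pt(3) P.affine_axioms U(1) gy pre(1) 1(1)])
            moreover have "pt p (g, y) = g" using Pt(5)[of "(g, y)"] subP gy by auto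
            ultimately show ?thesis using V.val_cst[OF y] by simp
          qed
          then show ?thesis by (intro bexI[of _ "cst X V (U.val g a)"]) auto
        next
          case 2
          have "P.val (g, y) h = V.val y b" if y: "y \<in> V" for y
          proof -
            have gy: "(g, y) \<in> U \<times> V" using U(2) y by simp
            have "P.val (g, y) h = V.val (pt q (g, y)) b"
              unfolding 2(2) \<beta>_def by (rule value_com_affine[OF Pt(4) P.affine_axioms V(1) gy pre(2) 2(1)])
            moreover have "pt q (g, y) = y" using Pt(6)[of "(g, y)"] subP gy by auto
            ultimately show ?thesis by simp
          qed
          then show ?thesis using 2(1) by blast
        qed
      next
        case (a_inv h)
        then obtain b where b: "b \<in> carrier (sec X V)" "\<forall>y\<in>V. P.val (g, y) h = V.val y b" by blast
        have "h \<in> carrier (sec P (U \<times> V))" using a_inv(1) gc by blast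
        then show ?case using b U(2) by (intro bexI[of _ "\<ominus>\<^bsub>sec X V\<^esub> b"]) (auto simp: P.val_uminus V.val_uminus)
      next
        case (eng_add h1 h2)
        then obtain b1 b2 where b: "b1 \<in> carrier (sec X V)" "\<forall>y\<in>V. P.val (g, y) h1 = V.val y b1"
          "b2 \<in> carrier (sec X V)" "\<forall>y\<in>V. P.val (g, y) h2 = V.val y b2" by blast
        have "h1 \<in> carrier (sec P (U \<times> V))" "h2 \<in> carrier (sec P (U \<times> V))" using eng_add(1,2) gc by auto
        then show ?case using b U(2) by (intro bexI[of _ "b1 \<oplus>\<^bsub>sec X V\<^esub> b2"]) (auto simp: P.val_add V.val_add)
      next
        case (eng_mult h1 h2)
        then obtain b1 b2 where b: "b1 \<in> carrier (sec X V)" "\<forall>y\<in>V. P.val (g, y) h1 = V.val y b1"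
          "b2 \<in> carrier (sec X V)" "\<forall>y\<in>V. P.val (g, y) h2 = V.val y b2" by blast
        have "h1 \<in> carrier (sec P (U \<times> V))" "h2 \<in> carrier (sec P (U \<times> V))" using eng_mult(1,2) gc by auto
        then show ?case using b U(2) by (intro bexI[of _ "b1 \<otimes>\<^bsub>sec X V\<^esub> b2"]) (auto simp: P.val_mult V.val_mult)
      qed
    qed
    have "openin (zar P) (W \<inter> U \<times> V)" using W P.open_\<Omega> by blast
    moreover have "(g, x) \<in> W \<inter> U \<times> V" using x U(2) V(2) by auto
    ultimately obtain c where c: "c \<in> carrier (sec P (U \<times> V))" "P.val (g, x) c \<noteq> 0"
      "{z\<in>U \<times> V. P.val z c \<noteq> 0} \<subseteq> W \<inter> U \<times> V" using P.basis[of "W \<inter> U \<times> V" "(g, x)"] by blast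
    obtain b where b: "b \<in> carrier (sec X V)" "\<And>y. y \<in> V \<Longrightarrow> P.val (g, y) c = V.val y b" using slice[OF c(1)] by blast
    show "\<exists>T. openin (zar X) T \<and> x \<in> T \<and> T \<subseteq> {x \<in> points X. (g, x) \<in> W}"
    proof (intro exI[of _ "{y\<in>V. V.val y b \<noteq> 0}"] conjI)
      show "openin (zar X) {y\<in>V. V.val y b \<noteq> 0}" by (rule V.open_nonzero[OF b(1)])
      show "x \<in> {y\<in>V. V.val y b \<noteq> 0}" using c(2) b(2) V(2) by simp
      show "{y\<in>V. V.val y b \<noteq> 0} \<subseteq> {x \<in> points X. (g, x) \<in> W}"
        using c(3) b(2) U(2) openin_subset[OF V.open_\<Omega>] by fastforce
    qed
  qed
  then show ?thesis unfolding continuous_map_def using g Pt(2) by auto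
qed

section \<open>Group actions and orbits\<close>

lemma pairing_point:
  assumes P: "is_product X Y P p q" and h: "is_pairing T X Y P p q f g h" and z: "z \<in> points T"
  shows "pt h z \<in> points P" "pt h z = (pt f z, pt g z)"
proof -
  have "continuous_map (zar T) (zar P) (pt h)" using h by (simp add: is_pairing_def morphism_def)
  then show hz: "pt h z \<in> points P" using continuous_map_image_subset_topspace z by blast
  have "pt p (pt h z) = pt f z" "pt q (pt h z) = pt g z"
    using h z by (simp_all add: is_pairing_def mor_eq_def mor_comp_def)
  moreover have "pt p (pt h z) = fst (pt h z)" "pt q (pt h z) = snd (pt h z)"
    using P hz by (simp_all add: is_product_def)
  ultimately show "pt h z = (pt f z, pt g z)" by (simp add: prod_eq_iff)
qed

text \<open>The identities of morphisms are evaluated at points, where \<open>pairing_point\<close>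
  determines the auxiliary morphisms \<open>u\<close>, \<open>v\<close> and
  \<open>w\<close>.\<close>

lemma action_points:
  fixes \<G> :: "('g, 'r, 'k::alg_closed_field) kgroup"
  assumes act: "is_action \<G> X \<A>" and M: "is_product (grp_sp \<G>) (grp_sp \<G>) (prod_sp (mult_act \<G>)) (pr1 (mult_act \<G>)) (pr2 (mult_act \<G>))"
    and e: "unit_pt \<G> \<in> points (grp_sp \<G>)"
  shows "g \<in> points (grp_sp \<G>) \<Longrightarrow> x \<in> points X \<Longrightarrow> pt (act \<A>) (g, x) \<in> points X"
    "x \<in> points X \<Longrightarrow> pt (act \<A>) (unit_pt \<G>, x) = x"
    "g \<in> points (grp_sp \<G>) \<Longrightarrow> h \<in> points (grp_sp \<G>) \<Longrightarrow> x \<in> points X \<Longrightarrow>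
      pt (act \<A>) (g, pt (act \<A>) (h, x)) = pt (act \<A>) (pt (act (mult_act \<G>)) (g, h), x)"
proof -
  let ?G = "grp_sp \<G>" and ?P = "prod_sp \<A>" and ?M = "mult_act \<G>" and ?a = "pt (act \<A>)"
  have P: "is_product ?G X ?P (pr1 \<A>) (pr2 \<A>)" and am: "morphism ?P X (act \<A>)"
    using act by (simp_all add: is_action_def Let_def)
  have Pp: "points ?P = points ?G \<times> points X" using P by (simp add: is_product_def)
  show closed: "?a (g, x) \<in> points X" if "g \<in> points ?G" "x \<in> points X" for g x
    using continuous_map_image_subset_topspace[OF morphismD(1)[OF am]] that Pp by blast
  obtain u where u: "is_pairing X ?G X ?P (pr1 \<A>) (pr2 \<A>) (mor_const X ?G (unit_pt \<G>)) mor_id u"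
    "mor_eq X X (mor_comp ?P (act \<A>) u) mor_id"
    using act[unfolded is_action_def Let_def, THEN conjunct2, THEN conjunct2, THEN conjunct2] by (elim exE conjE) (rule that)
  show "?a (unit_pt \<G>, x) = x" if x: "x \<in> points X"
  proof -
    have "?a (pt u x) = x" using u(2) x by (auto simp: mor_eq_def mor_comp_def mor_id_def)
    moreover have "pt u x = (unit_pt \<G>, x)"
      using pairing_point(2)[OF P u(1) x] by (simp add: mor_const_def mor_id_def)
    ultimately show ?thesis by simp
  qed
  obtain T r s u v w where T: "is_product ?G ?P T r s"
    and u: "is_pairing T ?G X ?P (pr1 \<A>) (pr2 \<A>) r (mor_comp ?P (act \<A>) s) u"
    and v: "is_pairing T ?G ?G (prod_sp ?M) (pr1 ?M) (pr2 ?M) r (mor_comp ?P (pr1 \<A>) s) v"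
    and w: "is_pairing T ?G X ?P (pr1 \<A>) (pr2 \<A>) (mor_comp (prod_sp ?M) (act ?M) v) (mor_comp ?P (pr2 \<A>) s) w"
    and eq: "mor_eq T X (mor_comp ?P (act \<A>) u) (mor_comp ?P (act \<A>) w)"
    using act[unfolded is_action_def Let_def, THEN conjunct2, THEN conjunct2, THEN conjunct1] by (elim exE conjE) (rule that)
  assume gh: "g \<in> points ?G" "h \<in> points ?G" and x: "x \<in> points X"
  have hx: "(h, x) \<in> points ?P" using Pp gh x by simp
  then have z: "(g, (h, x)) \<in> points T" using T gh by (simp add: is_product_def)
  have rs: "pt r (g, (h, x)) = g" "pt s (g, (h, x)) = (h, x)" using T z by (simp_all add: is_product_def)
  have pr: "pt (pr1 \<A>) (h, x) = h" "pt (pr2 \<A>) (h, x) = x" using P hx by (simp_all add: is_product_def)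
  have "pt u (g, (h, x)) = (g, ?a (h, x))" using pairing_point(2)[OF P u z] rs by (simp add: mor_comp_def)
  moreover have "pt v (g, (h, x)) = (g, h)" using pairing_point(2)[OF M v z] rs pr by (simp add: mor_comp_def)
  moreover from this have "pt w (g, (h, x)) = (pt (act ?M) (g, h), x)"
    using pairing_point(2)[OF P w z] rs pr by (simp add: mor_comp_def)
  ultimately show "?a (g, ?a (h, x)) = ?a (pt (act ?M) (g, h), x)"
    using bspec[OF eq[unfolded mor_eq_def, THEN conjunct1] z] by (simp add: mor_comp_def)
qed

lemma algebraic_group_points:
  fixes \<G> :: "('g, 'r, 'k::alg_closed_field) kgroup"
  assumes G: "algebraic_group \<G>"
  defines "m \<equiv> \<lambda>g h. pt (act (mult_act \<G>)) (g, h)"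
  shows "finite_type_scheme (grp_sp \<G>)" "unit_pt \<G> \<in> points (grp_sp \<G>)"
    "is_product (grp_sp \<G>) (grp_sp \<G>) (prod_sp (mult_act \<G>)) (pr1 (mult_act \<G>)) (pr2 (mult_act \<G>))"
    "g \<in> points (grp_sp \<G>) \<Longrightarrow> h \<in> points (grp_sp \<G>) \<Longrightarrow> m g h \<in> points (grp_sp \<G>)"
    "g \<in> points (grp_sp \<G>) \<Longrightarrow> pt (inv_mor \<G>) g \<in> points (grp_sp \<G>)"
    "g \<in> points (grp_sp \<G>) \<Longrightarrow> m (pt (inv_mor \<G>) g) g = unit_pt \<G>"
    "g \<in> points (grp_sp \<G>) \<Longrightarrow> m g (pt (inv_mor \<G>) g) = unit_pt \<G>"
proof -
  let ?G = "grp_sp \<G>" and ?M = "mult_act \<G>"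
  show "finite_type_scheme ?G" and e: "unit_pt \<G> \<in> points ?G"
    using G by (simp_all add: algebraic_group_def Let_def variety_def)
  have act: "is_action \<G> ?G ?M" and i: "morphism ?G ?G (inv_mor \<G>)"
    using G by (simp_all add: algebraic_group_def Let_def)
  show P: "is_product ?G ?G (prod_sp ?M) (pr1 ?M) (pr2 ?M)" using act by (simp add: is_action_def Let_def)
  show "g \<in> points ?G \<Longrightarrow> h \<in> points ?G \<Longrightarrow> m g h \<in> points ?G"
    unfolding m_def by (rule action_points(1)[OF act P e])
  show "g \<in> points ?G \<Longrightarrow> pt (inv_mor \<G>) g \<in> points ?G"
    using continuous_map_image_subset_topspace[OF morphismD(1)[OF i]] by blast
  obtain u where u: "is_pairing ?G ?G ?G (prod_sp ?M) (pr1 ?M) (pr2 ?M) (inv_mor \<G>) mor_id u"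
    "mor_eq ?G ?G (mor_comp (prod_sp ?M) (act ?M) u) (mor_const ?G ?G (unit_pt \<G>))"
    using G[unfolded algebraic_group_def Let_def, THEN conjunct2, THEN conjunct2, THEN conjunct2, THEN conjunct2,
      THEN conjunct2, THEN conjunct1] by (elim exE conjE) (rule that)
  show "m (pt (inv_mor \<G>) g) g = unit_pt \<G>" if g: "g \<in> points ?G"
  proof -
    have "pt (act ?M) (pt u g) = unit_pt \<G>" using u(2) g by (auto simp: mor_eq_def mor_comp_def mor_const_def)
    moreover have "pt u g = (pt (inv_mor \<G>) g, g)" using pairing_point(2)[OF P u(1) g] by (simp add: mor_id_def)
    ultimately show ?thesis by (simp add: m_def)
  qed
  obtain u where u: "is_pairing ?G ?G ?G (prod_sp ?M) (pr1 ?M) (pr2 ?M) mor_id (inv_mor \<G>) u"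
    "mor_eq ?G ?G (mor_comp (prod_sp ?M) (act ?M) u) (mor_const ?G ?G (unit_pt \<G>))"
    using G[unfolded algebraic_group_def Let_def, THEN conjunct2, THEN conjunct2, THEN conjunct2, THEN conjunct2,
      THEN conjunct2, THEN conjunct2] by (elim exE conjE) (rule that)
  show "m g (pt (inv_mor \<G>) g) = unit_pt \<G>" if g: "g \<in> points ?G"
  proof -
    have "pt (act ?M) (pt u g) = unit_pt \<G>" using u(2) g by (auto simp: mor_eq_def mor_comp_def mor_const_def)
    moreover have "pt u g = (g, pt (inv_mor \<G>) g)" using pairing_point(2)[OF P u(1) g] by (simp add: mor_id_def)
    ultimately show ?thesis by (simp add: m_def)
  qed
qed

section \<open>Orbits as homogeneous spaces\<close>

locale group_action =
  fixes \<G> :: "('g, 'r, 'k::alg_closed_field) kgroup" and X :: "('x, 'r, 'k) kspace"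
    and \<A> :: "('g, 'x, 'r, 'k) kaction"
  assumes group: "algebraic_group \<G>" and X: "finite_type_scheme X" and action: "is_action \<G> X \<A>"
begin

abbreviation "G \<equiv> points (grp_sp \<G>)"
abbreviation "m g h \<equiv> pt (act (mult_act \<G>)) (g, h)"
abbreviation "\<iota> \<equiv> pt (inv_mor \<G>)"
abbreviation "a g x \<equiv> pt (act \<A>) (g, x)"
abbreviation "orb \<equiv> orbit \<G> \<A>"

lemmas grp = algebraic_group_points[OF group]
lemmas acts = action_points[OF action grp(3,2)]

lemma act_inverse:
  assumes "g \<in> G" "x \<in> points X" shows "a (\<iota> g) (a g x) = x" "a g (a (\<iota> g) x) = x"
  using acts(2,3) grp(5-7) assms by simp_all

lemma act_continuous: "g \<in> G \<Longrightarrow> continuous_map (zar X) (zar X) (a g)"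
proof -
  assume g: "g \<in> G"
  have P: "is_product (grp_sp \<G>) X (prod_sp \<A>) (pr1 \<A>) (pr2 \<A>)" "morphism (prod_sp \<A>) X (act \<A>)"
    using action by (simp_all add: is_action_def Let_def)
  show ?thesis
    using continuous_map_compose[OF slice_continuous[OF P(1) grp(1) X g] morphismD(1)[OF P(2)]]
    by (simp add: o_def)
qed

lemma act_homeomorphic: "g \<in> G \<Longrightarrow> homeomorphic_map (zar X) (zar X) (a g)"
  unfolding homeomorphic_map_maps homeomorphic_maps_def
  using act_continuous grp(5) act_inverse by (intro exI[of _ "a (\<iota> g)"]) auto

lemma orb_self: "x \<in> points X \<Longrightarrow> x \<in> orb x"
  using acts(2) grp(2) by (auto simp: orbit_def intro!: exI[of _ "unit_pt \<G>"])

lemma orb_points: "x \<in> points X \<Longrightarrow> orb x \<subseteq> points X"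
  using acts(1) by (auto simp: orbit_def)

lemma orb_trans:
  assumes "x \<in> points X" "y \<in> orb x" shows "orb y \<subseteq> orb x"
proof
  fix z assume "z \<in> orb y"
  then obtain g where g: "g \<in> G" "z = a g y" by (auto simp: orbit_def)
  obtain h where h: "h \<in> G" "y = a h x" using assms by (auto simp: orbit_def)
  have "z = a (m g h) x" using acts(3)[OF g(1) h(1) assms(1)] g h by simp
  then show "z \<in> orb x" using grp(4)[OF g(1) h(1)] by (auto simp: orbit_def)
qed

lemma orb_homogeneous:
  assumes x: "x \<in> points X" and yz: "y \<in> orb x" "z \<in> orb x"
  shows "\<exists>h. homeomorphic_map (zar X) (zar X) h \<and> h ` orb x = orb x \<and> h y = z"
proof -
  obtain g1 where g1: "g1 \<in> G" "y = a g1 x" using yz by (auto simp: orbit_def)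
  obtain g2 where g2: "g2 \<in> G" "z = a g2 x" using yz by (auto simp: orbit_def)
  let ?g = "m g2 (\<iota> g1)"
  have y: "y \<in> points X" using orb_points[OF x] yz by blast
  have g: "?g \<in> G" using grp(4,5) g1 g2 by simp
  have "a ?g y = a g2 (a (\<iota> g1) y)" using acts(3)[OF g2(1) grp(5)[OF g1(1)] y] by simp
  then have gy: "a ?g y = z" using act_inverse(1)[OF g1(1) x] g1 g2 by simp
  have inv: "a h w \<in> orb x" if "h \<in> G" "w \<in> orb x" for h w
  proof -
    have "a h w \<in> orb w" using that by (auto simp: orbit_def)
    then show ?thesis using orb_trans[OF x that(2)] by blast
  qed
  have "orb x \<subseteq> a ?g ` orb x"
  proof
    fix w assume w: "w \<in> orb x"
    then have "w = a ?g (a (\<iota> ?g) w)" using act_inverse(2)[OF g] orb_points[OF x] by auto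
    then show "w \<in> a ?g ` orb x" using inv[OF grp(5)[OF g] w] by blast
  qed
  moreover have "a ?g ` orb x \<subseteq> orb x" using inv[OF g] by blast
  ultimately show ?thesis using act_homeomorphic[OF g] gy by blast
qed

lemma orb_dim:
  assumes x: "x \<in> points X" and U: "openin (zar X) U" "y \<in> U" "y \<in> orb x"
  shows "dim_of (zar X) (U \<inter> orb x) = dim_of (zar X) (orb x)" "dim_at (zar X) (U \<inter> orb x) y = dim_of (zar X) (orb x)"
  using dim_of_homogeneous[OF orb_homogeneous[OF x] orb_points[OF x] U] by blast+

text \<open>By homogeneity the local dimension of the orbit inside \<open>U\<close> equals the
  dimension of the whole orbit, so the locus depends on \<open>U\<close> only through
  \<open>y \<in> U\<close>.\<close>

lemma mem_orbit_dim_locus: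
  assumes U: "openin (zar X) U" and y: "y \<in> U"
  shows "y \<in> orbit_dim_locus \<G> X \<A> U i \<longleftrightarrow> dim_of (zar X) (orb y) = ereal (real i)"
proof -
  have yX: "y \<in> points X" using openin_subset[OF U] y by blast
  show ?thesis unfolding orbit_dim_locus_def using orb_dim(2)[OF yX U y orb_self[OF yX]] y by simp
qed

lemma saturation_open:
  assumes "openin (zar X) U" shows "openin (zar X) (\<Union>g\<in>G. a g ` U)"
  using homeomorphic_imp_open_map[OF act_homeomorphic] assms unfolding open_map_def by (intro openin_Union) blast

end

section \<open>Generic orbits\<close>

text \<open>Inside one chart \<open>chart_dim\<close> gives the same number for all open sets that
  meet \<open>E\<close>. Two charts that meet \<open>E\<close> also meet within \<open>E\<close> by
  irreducibility, so the number is global. Every chain is seen in full in a chart around a point of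
  its smallest member.\<close>

lemma scheme_dim:
  fixes X :: "('x, 'r, 'k::alg_closed_field) kspace"
  assumes X: "finite_type_scheme X" and E: "closedin (zar X) E" "irreducible_in (zar X) E"
  obtains d :: nat where "\<And>N. openin (zar X) N \<Longrightarrow> N \<inter> E \<noteq> {} \<Longrightarrow> dim_of (zar X) (E \<inter> N) = ereal (real d)"
    "dim_of (zar X) E = ereal (real d)"
proof -
  let ?T = "zar X"
  have EX: "E \<subseteq> topspace ?T" using closedin_subset[OF E(1)] .
  have local: "\<exists>d :: nat. \<forall>N. openin ?T N \<longrightarrow> N \<inter> (E \<inter> \<Omega>) \<noteq> {} \<longrightarrow> dim_of ?T (E \<inter> \<Omega> \<inter> N) = ereal (real d)"
    if ch: "chart ?T \<Omega> (R :: ('x \<Rightarrow> 'k) set)" and ne: "\<Omega> \<inter> E \<noteq> {}" for \<Omega> R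
  proof -
    have irr: "irreducible_in ?T (E \<inter> \<Omega>)" by (rule irreducible_in_open(2)[OF E(2) chartD(1)[OF ch] ne])
    have cl: "closedin (subtopology ?T \<Omega>) (E \<inter> \<Omega>)" using E(1) by (auto simp: closedin_subtopology)
    obtain rs where rs: "R = fa.adjoin_list constants rs" using ch by (auto simp: chart_def)
    obtain d where "fa.tower (vanish (E \<inter> \<Omega>)) constants rs d" using fa.tower_exists by blast
    from chart_dim[OF ch cl irr rs this] show ?thesis by blast
  qed
  have meet: "N \<inter> (E \<inter> \<Omega>) \<noteq> {}" if N: "openin ?T N" "N \<inter> E \<noteq> {}" "openin ?T \<Omega>" "\<Omega> \<inter> E \<noteq> {}" for N \<Omega>
  proof
    assume empty: "N \<inter> (E \<inter> \<Omega>) = {}"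
    have "E \<inter> \<Omega> \<subseteq> topspace ?T - N" using empty EX by blast
    then have "?T closure_of (E \<inter> \<Omega>) \<subseteq> topspace ?T - N" using N(1) by (intro closure_of_minimal) auto
    then have "E \<subseteq> topspace ?T - N" using irreducible_in_open(1)[OF E(2) N(3,4)] by blast
    then show False using N(2) by blast
  qed
  obtain z where z: "z \<in> E" using irreducible_inD(2)[OF E(2)] by blast
  obtain \<Omega> and R :: "('x \<Rightarrow> 'k) set" where \<Omega>: "chart ?T \<Omega> R" "z \<in> \<Omega>"
    by (rule chart_nbhd[OF X openin_topspace subsetD[OF EX z]]) blast
  have ne: "\<Omega> \<inter> E \<noteq> {}" using z \<Omega>(2) by blast
  obtain d :: nat where d: "\<And>N. openin ?T N \<Longrightarrow> N \<inter> (E \<inter> \<Omega>) \<noteq> {} \<Longrightarrow> dim_of ?T (E \<inter> \<Omega> \<inter> N) = ereal (real d)"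
    using local[OF \<Omega>(1) ne] by blast
  have upper: "L \<le> d" if L: "has_chain ?T E L" for L
  proof -
    obtain Z where Z: "\<And>i. i \<le> L \<Longrightarrow> irreducible_in ?T (Z i)" "\<And>i. i \<le> L \<Longrightarrow> Z i \<subseteq> E"
      "\<And>i. i < L \<Longrightarrow> ?T closure_of Z i \<subset> ?T closure_of Z (Suc i)" using L unfolding has_chain_def by blast
    obtain y where y: "y \<in> Z 0" using irreducible_inD(2)[OF Z(1)[of 0]] by blast
    have yE: "y \<in> E" using y Z(2)[of 0] by blast
    obtain \<Omega>' and R' :: "('x \<Rightarrow> 'k) set" where \<Omega>': "chart ?T \<Omega>' R'" "y \<in> \<Omega>'"
      by (rule chart_nbhd[OF X openin_topspace subsetD[OF EX yE]]) blast
    note op = chartD(1)[OF \<Omega>'(1)]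
    have ne': "\<Omega>' \<inter> E \<noteq> {}" using yE \<Omega>'(2) by blast
    obtain d' :: nat where d': "\<And>N. openin ?T N \<Longrightarrow> N \<inter> (E \<inter> \<Omega>') \<noteq> {} \<Longrightarrow> dim_of ?T (E \<inter> \<Omega>' \<inter> N) = ereal (real d')"
      using local[OF \<Omega>'(1) ne'] by blast
    have mono: "?T closure_of Z 0 \<subseteq> ?T closure_of Z i" if "i \<le> L" for i
      using that
    proof (induction i)
      case (Suc i)
      then show ?case using Z(3)[of i] by auto
    qed simp
    have meetZ: "\<Omega>' \<inter> Z i \<noteq> {}" if "i \<le> L" for i
    proof -
      have "y \<in> ?T closure_of Z 0" using y closure_of_subset[OF irreducible_inD(1)[OF Z(1)[of 0]]] by auto
      then have "y \<in> ?T closure_of Z i" using mono[OF that] by blast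
      then show ?thesis using op \<Omega>'(2) unfolding in_closure_of by blast
    qed
    have "has_chain ?T (E \<inter> \<Omega>') L"
      unfolding has_chain_def
    proof (intro exI[of _ "\<lambda>i. Z i \<inter> \<Omega>'"] conjI allI impI)
      fix i assume i: "i \<le> L"
      show "irreducible_in ?T (Z i \<inter> \<Omega>')" by (rule irreducible_in_open(2)[OF Z(1)[OF i] op meetZ[OF i]])
      show "Z i \<inter> \<Omega>' \<subseteq> E \<inter> \<Omega>'" using Z(2)[OF i] by blast
    next
      fix i assume i: "i < L"
      have "?T closure_of (Z j \<inter> \<Omega>') = ?T closure_of Z j" if "j \<le> L" for j
        by (rule irreducible_in_open(3)[OF Z(1)[OF that] op meetZ[OF that]])
      then show "?T closure_of (Z i \<inter> \<Omega>') \<subset> ?T closure_of (Z (Suc i) \<inter> \<Omega>')" using Z(3)[OF i] i by simp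
    qed
    then have "ereal (real L) \<le> dim_of ?T (E \<inter> \<Omega>' \<inter> \<Omega>')" by (simp add: dim_of_ge_iff Int_assoc)
    also have "\<dots> = ereal (real d')" using ne' op by (intro d') auto
    finally have "L \<le> d'" by simp
    moreover have m1: "\<Omega> \<inter> (E \<inter> \<Omega>') \<noteq> {}" by (rule meet[OF chartD(1)[OF \<Omega>(1)] ne op ne'])
    have "dim_of ?T (E \<inter> \<Omega>' \<inter> \<Omega>) = ereal (real d')" by (rule d'[OF chartD(1)[OF \<Omega>(1)] m1])
    moreover have "dim_of ?T (E \<inter> \<Omega> \<inter> \<Omega>') = ereal (real d)" using m1 by (intro d[OF op]) blast
    moreover have "E \<inter> \<Omega>' \<inter> \<Omega> = E \<inter> \<Omega> \<inter> \<Omega>'" by blast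
    ultimately show "L \<le> d" by simp
  qed
  have dim: "dim_of ?T (E \<inter> N) = ereal (real d)" if N: "openin ?T N" "N \<inter> E \<noteq> {}" for N
  proof (rule dim_of_eq_nat)
    have "N \<inter> (E \<inter> \<Omega>) \<noteq> {}" by (rule meet[OF N chartD(1)[OF \<Omega>(1)] ne])
    then have "has_chain ?T (E \<inter> \<Omega> \<inter> N) d" using d[OF N(1)] dim_of_ge_iff[of d ?T "E \<inter> \<Omega> \<inter> N"] by simp
    then show "has_chain ?T (E \<inter> N) d" by (rule has_chain_mono) blast
    show "L \<le> d" if "has_chain ?T (E \<inter> N) L" for L by (rule upper[OF has_chain_mono[OF that]]) blast
  qed
  have "E \<inter> topspace ?T = E" using EX by blast
  then have dE: "dim_of ?T E = ereal (real d)" using dim[OF openin_topspace] z EX by auto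
  show ?thesis by (rule that[OF dim dE])
qed

lemma irreducible_image:
  assumes "irreducible_in T E" "continuous_map T T' f" shows "irreducible_in T' (f ` E)"
  unfolding irreducible_in_def
proof (intro conjI allI impI)
  note E = irreducible_inD[OF assms(1)]
  show "f ` E \<subseteq> topspace T'" using continuous_map_image_subset_topspace[OF assms(2)] E(1) by blast
  show "f ` E \<noteq> {}" using E(2) by blast
  fix A B assume AB: "closedin T' A \<and> closedin T' B \<and> f ` E \<subseteq> A \<union> B"
  have "closedin T {x \<in> topspace T. f x \<in> A}" "closedin T {x \<in> topspace T. f x \<in> B}"
    using AB by (auto intro: closedin_continuous_map_preimage[OF assms(2)])
  moreover have "E \<subseteq> {x \<in> topspace T. f x \<in> A} \<union> {x \<in> topspace T. f x \<in> B}" using AB E(1) by blast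
  ultimately show "f ` E \<subseteq> A \<or> f ` E \<subseteq> B" using E(3) by blast
qed

text \<open>Charts reduce this to \<open>chart_generic_fibre\<close>: the functions
  \<open>qs\<close> are pulled back coordinates of a chart of \<open>Y\<close>, so their common
  level sets are the fibres of \<open>p\<close>, and their tower is that of the closure of the
  image. Choosing the chart \<open>\<Omega>\<close> inside \<open>W\<close> places the long chains
  of the fibres inside \<open>W\<close>.\<close>

theorem generic_fibre:
  fixes X :: "('x, 'r, 'k::alg_closed_field) kspace" and Y :: "('y, 'r, 'k) kspace"
  assumes X: "finite_type_scheme X" and Y: "finite_type_scheme Y" and p: "morphism X Y p"
    and E: "closedin (zar X) E" "irreducible_in (zar X) E" and W: "openin (zar X) W" "W \<inter> E \<noteq> {}"
  obtains n k N where "dim_of (zar X) E = ereal (real (n + k))"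
    "dim_of (zar Y) (zar Y closure_of (pt p ` E)) = ereal (real n)"
    "openin (zar X) N" "N \<subseteq> W" "N \<inter> E \<noteq> {}"
    "\<And>x. x \<in> N \<inter> E \<Longrightarrow> has_chain (zar X) {x'\<in>E \<inter> W. pt p x' = pt p x} k"
    "\<And>x L. x \<in> N \<inter> E \<Longrightarrow> has_chain (zar X) {x'\<in>E \<inter> N. pt p x' = pt p x} L \<Longrightarrow> L \<le> k"
proof -
  let ?T = "zar X" and ?T' = "zar Y"
  note cont = morphismD(1)[OF p]
  obtain x0 where x0: "x0 \<in> W" "x0 \<in> E" using W(2) by blast
  obtain V \<Omega> and Q :: "('y \<Rightarrow> 'k) set" and R :: "('x \<Rightarrow> 'k) set" where
    ch: "chart ?T' V Q" "chart ?T \<Omega> R" "x0 \<in> \<Omega>" "\<Omega> \<subseteq> W" "\<And>z. z \<in> \<Omega> \<Longrightarrow> pt p z \<in> V"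
      "\<And>q. q \<in> Q \<Longrightarrow> \<exists>r\<in>R. \<forall>z\<in>\<Omega>. r z = q (pt p z)"
    by (rule morphism_charts[OF X Y p W(1) x0(1)]) blast
  define E0 where "E0 = E \<inter> \<Omega>"
  have ne: "\<Omega> \<inter> E \<noteq> {}" using x0(2) ch(3) by blast
  note irr0 = irreducible_in_open[OF E(2) chartD(1)[OF ch(2)] ne]
  have E0: "closedin (subtopology ?T \<Omega>) E0" "irreducible_in ?T E0" "E0 \<subseteq> \<Omega>"
    using E(1) irr0(2) by (auto simp: closedin_subtopology E0_def)
  define D0 where "D0 = ?T' closure_of (pt p ` E0) \<inter> V"
  have pE0: "pt p ` E0 \<subseteq> V" "pt p ` E0 \<subseteq> ?T' closure_of (pt p ` E0)"
    using ch(5) E0(3) irreducible_inD(1)[OF irreducible_image[OF E0(2) cont]] by (auto intro!: closure_of_subset)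
  have D0: "closedin (subtopology ?T' V) D0" "irreducible_in ?T' D0" "pt p ` E0 \<subseteq> D0" "D0 \<subseteq> V"
  proof -
    show "closedin (subtopology ?T' V) D0"
      unfolding D0_def closedin_subtopology using closedin_closure_of by blast
    show sub: "pt p ` E0 \<subseteq> D0" unfolding D0_def using pE0 by blast
    show "D0 \<subseteq> V" by (simp add: D0_def)
    show "irreducible_in ?T' D0"
      by (rule irreducible_in_between[OF irreducible_image[OF E0(2) cont] sub]) (simp add: D0_def)
  qed
  obtain qs' where qs': "Q = fa.adjoin_list constants qs'" using ch(1) by (auto simp: chart_def)
  have qs'Q: "set qs' \<subseteq> Q" "constants \<subseteq> Q" using fa.adjoin_list_superset[OF fa.subalg_range] qs' by auto
  obtain rs where rs: "R = fa.adjoin_list constants rs" using ch(2) by (auto simp: chart_def)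
  have "\<forall>q\<in>Q. \<exists>r. r \<in> R \<and> (\<forall>z\<in>\<Omega>. r z = q (pt p z))" using ch(6) by blast
  from bchoice[OF this] obtain \<rho> where \<rho>0: "\<forall>q\<in>Q. \<rho> q \<in> R \<and> (\<forall>z\<in>\<Omega>. \<rho> q z = q (pt p z))" by (elim exE)
  have \<rho>: "\<rho> q \<in> R" "z \<in> \<Omega> \<Longrightarrow> \<rho> q z = q (pt p z)" if "q \<in> Q" for q z using bspec[OF \<rho>0 that] by simp_all
  define qs where "qs = map \<rho> qs'"
  have qsR: "set qs \<subseteq> R" unfolding qs_def using \<rho>(1) qs'Q(1) by auto
  obtain n where n: "fa.tower (vanish D0) constants qs' n" using fa.tower_exists by blast
  \<comment> \<open>The image of \<open>E0\<close> is dense in \<open>D0\<close> and zero sets in a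
    chart are closed, so pulling back is injective on functions on \<open>D0\<close>.\<close>
  have van: "(\<forall>x\<in>E0. f (pt p x) = 0) \<longleftrightarrow> f \<in> vanish D0" if f: "f \<in> Q" for f
  proof
    assume z: "\<forall>x\<in>E0. f (pt p x) = 0"
    obtain C where C: "closedin ?T' C" "{y\<in>V. f y = 0} = C \<inter> V"
      using chart_zero_closed[OF ch(1) f, of 0] by (auto simp: closedin_subtopology)
    have "pt p ` E0 \<subseteq> C" using z pE0(1) C(2) by blast
    then have "?T' closure_of (pt p ` E0) \<subseteq> C" using C(1) by (rule closure_of_minimal)
    then have "D0 \<subseteq> {y\<in>V. f y = 0}" unfolding C(2) D0_def by blast
    then show "f \<in> vanish D0" by (auto simp: vanish_def)
  next
    assume "f \<in> vanish D0"
    then show "\<forall>x\<in>E0. f (pt p x) = 0" using D0(3) by (auto simp: vanish_def)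
  qed
  have tower: "fa.tower (vanish E0) constants qs n"
  proof (rule tower_pullback[OF chartD(2)[OF ch(1)] van n fa.subalg_range fa.subalg_range qs'Q(2,1)])
    show "\<exists>f'\<in>constants. \<forall>x\<in>E0. f x = f' (pt p x)" if "f \<in> constants" for f :: "'x \<Rightarrow> 'k" using that by auto
    show "\<exists>f\<in>constants. \<forall>x\<in>E0. f x = f' (pt p x)" if "f' \<in> constants" for f' :: "'y \<Rightarrow> 'k" using that by auto
    show "list_all2 (\<lambda>b b'. \<forall>x\<in>E0. b x = b' (pt p x)) qs qs'"
      unfolding qs_def list_all2_map1 using \<rho>(2) qs'Q(1) E0(3) by (intro list.rel_refl_strong) blast
  qed
  obtain k a where ka: "a \<in> R" "a \<notin> vanish E0"
    "\<And>W. openin ?T W \<Longrightarrow> W \<inter> E0 \<noteq> {} \<Longrightarrow> dim_of ?T (E0 \<inter> W) = ereal (real (n + k))"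
    "\<And>x. x \<in> E0 \<Longrightarrow> a x \<noteq> 0 \<Longrightarrow> has_chain ?T {x'\<in>E0. \<forall>q\<in>set qs. q x' = q x} k"
    "\<And>x L. x \<in> E0 \<Longrightarrow> has_chain ?T {x'\<in>E0. a x' \<noteq> 0 \<and> (\<forall>q\<in>set qs. q x' = q x)} L \<Longrightarrow> L \<le> k"
    by (rule chart_generic_fibre[OF ch(2) E0(1,2) rs qsR tower]) (rule that)
  define N where "N = {x\<in>\<Omega>. a x \<noteq> 0}"
  have fib: "(\<forall>q\<in>set qs. q x' = q x) \<longleftrightarrow> pt p x' = pt p x" if x: "x \<in> \<Omega>" "x' \<in> \<Omega>" for x x'
  proof
    assume "pt p x' = pt p x"
    then show "\<forall>q\<in>set qs. q x' = q x" unfolding qs_def using \<rho>(2)[OF _ x(1)] \<rho>(2)[OF _ x(2)] qs'Q(1) by auto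
  next
    assume eq: "\<forall>q\<in>set qs. q x' = q x"
    have "Q \<subseteq> {f. f (pt p x') = f (pt p x)}"
      unfolding qs'
    proof (rule fa.adjoin_list_least[OF _ fa.subalg_range])
      show "set qs' \<subseteq> {f. f (pt p x') = f (pt p x)}"
      proof
        fix q assume q: "q \<in> set qs'"
        then have "q \<in> Q" using qs'Q(1) by blast
        moreover have "\<rho> q x' = \<rho> q x" using eq q by (simp add: qs_def)
        ultimately show "q \<in> {f. f (pt p x') = f (pt p x)}" using \<rho>(2)[of q] x by simp
      qed
    qed (auto simp: fa.subalg_def)
    then show "pt p x' = pt p x" by (intro chartD(7)[OF ch(1)] ch(5) x) blast
  qed
  have dimE: "dim_of ?T E = ereal (real (n + k))"
  proof -
    obtain d where d: "\<And>N. openin ?T N \<Longrightarrow> N \<inter> E \<noteq> {} \<Longrightarrow> dim_of ?T (E \<inter> N) = ereal (real d)"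
      "dim_of ?T E = ereal (real d)" by (rule scheme_dim[OF X E]) blast
    have "dim_of ?T (E0 \<inter> \<Omega>) = ereal (real (n + k))"
      using ne by (intro ka(3) chartD(1)[OF ch(2)]) (auto simp: E0_def)
    then show ?thesis using d(1)[OF chartD(1)[OF ch(2)] ne] d(2) by (simp add: E0_def Int_assoc)
  qed
  let ?D = "?T' closure_of (pt p ` E)"
  have dimD: "dim_of ?T' ?D = ereal (real n)"
  proof -
    have irrD: "irreducible_in ?T' ?D" by (rule irreducible_in_closure[OF irreducible_image[OF E(2) cont]])
    obtain d where d: "\<And>N. openin ?T' N \<Longrightarrow> N \<inter> ?D \<noteq> {} \<Longrightarrow> dim_of ?T' (?D \<inter> N) = ereal (real d)"
      "dim_of ?T' ?D = ereal (real d)" by (rule scheme_dim[OF Y closedin_closure_of irrD]) blast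
    \<comment> \<open>\<open>E0\<close> is dense in \<open>E\<close>, so passing to the chart does
      not change the closure of the image.\<close>
    have "pt p ` E \<subseteq> ?T' closure_of (pt p ` E0)"
    proof -
      have "E \<subseteq> ?T closure_of E0" unfolding E0_def by (rule irr0(1))
      then show ?thesis using continuous_map_image_closure_subset[OF cont, of E0] by blast
    qed
    then have "?D \<subseteq> ?T' closure_of (pt p ` E0)" by (rule closure_of_minimal) simp
    moreover have "?T' closure_of (pt p ` E0) \<subseteq> ?D" by (rule closure_of_mono) (auto simp: E0_def)
    ultimately have eqD: "?D \<inter> V = D0" by (auto simp: D0_def)
    have neD: "V \<inter> D0 \<noteq> {}" using irreducible_inD(2)[OF D0(2)] D0(4) by blast
    have "dim_of ?T' (D0 \<inter> V) = ereal (real n)"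
      by (rule chart_dim[OF ch(1) D0(1,2) qs' n chartD(1)[OF ch(1)] neD])
    moreover have "D0 \<inter> V = ?D \<inter> V" using eqD by blast
    moreover have "V \<inter> ?D \<noteq> {}" using eqD neD by blast
    ultimately show ?thesis using d(1)[OF chartD(1)[OF ch(1)]] d(2) by simp
  qed
  show ?thesis
  proof (rule that[OF dimE dimD])
    show "openin ?T N" unfolding N_def by (rule chartD(3)[OF ch(2) ka(1)])
    show "N \<subseteq> W" using ch(4) by (auto simp: N_def)
    show "N \<inter> E \<noteq> {}" using ka(2) by (auto simp: N_def vanish_def E0_def)
    fix x assume x: "x \<in> N \<inter> E"
    then have x': "x \<in> E0" "a x \<noteq> 0" "x \<in> \<Omega>" by (auto simp: N_def E0_def)
    show "has_chain ?T {x'\<in>E \<inter> W. pt p x' = pt p x} k"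
    proof (rule has_chain_mono[OF ka(4)[OF x'(1,2)]])
      show "{x'\<in>E0. \<forall>q\<in>set qs. q x' = q x} \<subseteq> {x'\<in>E \<inter> W. pt p x' = pt p x}"
        using fib[OF x'(3)] E0(3) ch(4) by (auto simp: E0_def)
    qed
    fix L assume L: "has_chain ?T {x'\<in>E \<inter> N. pt p x' = pt p x} L"
    show "L \<le> k"
    proof (rule ka(5)[OF x'(1) has_chain_mono[OF L]])
      show "{x'\<in>E \<inter> N. pt p x' = pt p x} \<subseteq> {x'\<in>E0. a x' \<noteq> 0 \<and> (\<forall>q\<in>set qs. q x' = q x)}"
        using fib[OF x'(3)] by (auto simp: E0_def N_def)
    qed
  qed
qed

section \<open>Modality and parameter number\<close>

text \<open>The closures in a chain are nested, so all members lie in the closure of the last one,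
  which is itself an irreducible subset of \<open>S\<close>.\<close>

lemma has_chain_top:
  assumes "has_chain T S n"
  obtains C where "C \<subseteq> S" "irreducible_in T C" "has_chain T (T closure_of C) n"
proof -
  obtain Z where Z: "\<And>i. i \<le> n \<Longrightarrow> irreducible_in T (Z i)" "\<And>i. i \<le> n \<Longrightarrow> Z i \<subseteq> S"
    "\<And>i. i < n \<Longrightarrow> T closure_of Z i \<subset> T closure_of Z (Suc i)" using assms unfolding has_chain_def by blast
  have mono: "T closure_of Z i \<subseteq> T closure_of Z j" if "i \<le> j" "j \<le> n" for i j
    using that
  proof (induction j)
    case (Suc j)
    then show ?case using Z(3)[of j] by (cases "i = Suc j") auto
  qed simp
  have "has_chain T (T closure_of Z n) n"
    unfolding has_chain_def
  proof (intro exI[of _ Z] conjI allI impI)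
    fix i assume i: "i \<le> n"
    show "irreducible_in T (Z i)" by (rule Z(1)[OF i])
    show "Z i \<subseteq> T closure_of Z n"
      using closure_of_subset[OF irreducible_inD(1)[OF Z(1)[OF i]]] mono[OF i] by blast
  qed (rule Z(3))
  then show ?thesis using that[of "Z n"] Z(1,2)[of n] by blast
qed

lemma irreducible_dense_subset:
  assumes "irreducible_in T C" "C' \<subseteq> C" "C \<subseteq> T closure_of C'"
  shows "irreducible_in T C'"
  unfolding irreducible_in_def
proof (intro conjI allI impI)
  note C = irreducible_inD[OF assms(1)]
  show "C' \<subseteq> topspace T" using C(1) assms(2) by blast
  show "C' \<noteq> {}" using C(2) assms(3) by auto
  fix A B assume AB: "closedin T A \<and> closedin T B \<and> C' \<subseteq> A \<union> B"
  then have "T closure_of C' \<subseteq> A \<union> B" by (intro closure_of_minimal) auto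
  then show "C' \<subseteq> A \<or> C' \<subseteq> B" using C(3)[of A B] AB assms(2,3) by blast
qed

section \<open>One stratum: images in the quotient against orbit dimension loci\<close>

locale quotient_stratum =
  X: group_action \<G> X \<A> + Z: group_action \<G> Z \<B>
  for \<G> :: "('g, 'r, 'k::alg_closed_field) kgroup" and X :: "('x, 'r, 'k) kspace"
    and \<A> :: "('g, 'x, 'r, 'k) kaction" and Z :: "('x, 'r, 'k) kspace" and \<B> +
  fixes Y :: "('y, 'r, 'k) kspace" and \<pi>
  assumes zar_Z: "zar Z = subtopology (zar X) (points Z)"
    and loc_closed: "locally_closed_in (zar X) (points Z)"
    and orbits: "x \<in> points Z \<Longrightarrow> orbit \<G> \<B> x = orbit \<G> \<A> x"
    and Y: "finite_type_scheme Y"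
    and quot: "geometric_quotient \<G> Z \<B> Y \<pi>"
begin

lemma \<pi>: "morphism Z Y \<pi>"
  using quot by (simp add: geometric_quotient_def)

lemma fibre: "x \<in> points Z \<Longrightarrow> x' \<in> points Z \<Longrightarrow> pt \<pi> x' = pt \<pi> x \<longleftrightarrow> x' \<in> orbit \<G> \<B> x"
  using quot unfolding geometric_quotient_def by blast

lemma dim_Z: "S \<subseteq> points Z \<Longrightarrow> dim_of (zar Z) S = dim_of (zar X) S"
  by (subst zar_Z) (rule dim_of_subtopology)

lemma open_Z: "openin (zar X) U \<Longrightarrow> openin (zar Z) (U \<inter> points Z)"
  by (subst zar_Z) (auto simp: openin_subtopology)

text \<open>The preimage of the image of \<open>U\<close> is the union of the translates of
  \<open>U\<close>, and the quotient map is submersive.\<close>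

lemma image_open:
  assumes U: "openin (zar Z) U" shows "openin (zar Y) (pt \<pi> ` U)"
proof -
  have UZ: "U \<subseteq> points Z" by (rule openin_subset[OF U])
  have sub: "pt \<pi> ` U \<subseteq> points Y"
    using continuous_map_image_subset_topspace[OF morphismD(1)[OF \<pi>]] UZ by blast
  have "preim Z \<pi> (pt \<pi> ` U) = (\<Union>g\<in>X.G. Z.a g ` U)"
  proof (intro equalityI subsetI)
    fix x assume "x \<in> preim Z \<pi> (pt \<pi> ` U)"
    then obtain u where u: "x \<in> points Z" "u \<in> U" "pt \<pi> x = pt \<pi> u" by (auto simp: preim_def)
    then have "x \<in> orbit \<G> \<B> u" using fibre[of u x] UZ by blast
    then show "x \<in> (\<Union>g\<in>X.G. Z.a g ` U)" using u(2) by (auto simp: orbit_def)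
  next
    fix x assume "x \<in> (\<Union>g\<in>X.G. Z.a g ` U)"
    then obtain g u where g: "g \<in> X.G" "u \<in> U" "x = Z.a g u" by blast
    then have "x \<in> orbit \<G> \<B> u" by (auto simp: orbit_def)
    moreover have "u \<in> points Z" "x \<in> points Z" using g UZ Z.acts(1) by auto
    ultimately have "pt \<pi> x = pt \<pi> u" using fibre by blast
    then show "x \<in> preim Z \<pi> (pt \<pi> ` U)" using \<open>x \<in> points Z\<close> g(2) by (auto simp: preim_def)
  qed
  then have "openin (zar Z) (preim Z \<pi> (pt \<pi> ` U))" using Z.saturation_open[OF U] by simp
  then show ?thesis using quot sub unfolding geometric_quotient_def by blast
qed

text \<open>The chosen component has to dominate \<open>C\<close>, and its generic fibre has to fill
  an open part of an orbit, so that \<open>k\<close> is the full orbit dimension. The second point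
  is achieved by removing the closures of the other components from the open set in which fibres are
  taken.\<close>

theorem modality_le_parameter:
  assumes U: "openin (zar X) U" and chain: "has_chain (zar Y) (pt \<pi> ` (U \<inter> points Z)) n0"
  shows "\<exists>i. ereal (real n0) \<le> dim_of (zar X) (orbit_dim_locus \<G> X \<A> U i) - ereal (real i)"
proof -
  let ?T = "zar Z" and ?T' = "zar Y"
  note cont = morphismD(1)[OF \<pi>]
  obtain C where C: "C \<subseteq> pt \<pi> ` (U \<inter> points Z)" "irreducible_in ?T' C" "has_chain ?T' (?T' closure_of C) n0"
    by (rule has_chain_top[OF chain])
  let ?D = "?T' closure_of C"
  have CD: "C \<subseteq> ?D" by (rule closure_of_subset[OF irreducible_inD(1)[OF C(2)]])
  define U' where "U' = U \<inter> points Z"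
  have U': "openin ?T U'" "U' \<subseteq> U" "U' \<subseteq> points Z" unfolding U'_def using open_Z[OF U] by auto
  define W0 where "W0 = {x\<in>U'. pt \<pi> x \<in> ?D}"
  have W0: "W0 \<subseteq> U'" "W0 \<subseteq> points Z" using U'(3) by (auto simp: W0_def)
  have preD: "closedin ?T {x \<in> points Z. pt \<pi> x \<in> ?D}" by (rule closedin_continuous_map_preimage[OF cont closedin_closure_of])
  have topW0: "topspace (subtopology ?T W0) = W0" using W0(2) by auto
  have "closedin (subtopology ?T W0) W0" using closedin_topspace[of "subtopology ?T W0"] unfolding topW0 .
  from noeth_space_decompose[OF noeth_space_subtopology[OF finite_type_noeth_space[OF Z.X]] this]
  obtain F where F: "finite F" "\<Union>F = W0"
    "\<And>A. A \<in> F \<Longrightarrow> closedin (subtopology ?T W0) A \<and> irreducible_in (subtopology ?T W0) A" by blast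
  have FW0: "A \<subseteq> W0" if "A \<in> F" for A using F(2) that by blast
  have irrF: "irreducible_in ?T A" if "A \<in> F" for A
    by (rule irreducible_in_subtopology[OF FW0[OF that], THEN iffD1, OF F(3)[OF that, THEN conjunct2]])
  have clF: "?T closure_of A \<inter> W0 = A" if "A \<in> F" for A
    by (rule closedin_subtopology_closure_of[OF F(3)[OF that, THEN conjunct1]])
  have "C \<subseteq> (\<Union>A\<in>F. pt \<pi> ` A)"
  proof
    fix c assume c: "c \<in> C"
    then obtain x where x: "x \<in> U'" "c = pt \<pi> x" using C(1) by (auto simp: U'_def)
    then have "x \<in> W0" using c CD by (auto simp: W0_def)
    then show "c \<in> (\<Union>A\<in>F. pt \<pi> ` A)" using F(2) x(2) by blast
  qed
  then obtain A where A: "A \<in> F" "C \<subseteq> ?T' closure_of (C \<inter> pt \<pi> ` A)"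
    using irreducible_dense_piece[OF C(2) F(1), of "\<lambda>A. pt \<pi> ` A"] by blast
  \<comment> \<open>\<open>F\<close> may be redundant. A maximal member is not covered by the
    closures of the members that fail to contain it, so part of it survives the removal of
    \<open>K\<close>, and it still dominates \<open>C\<close>.\<close>
  obtain A1 where A1: "A1 \<in> F" "A \<subseteq> A1" "\<And>B. B \<in> F \<Longrightarrow> A1 \<subseteq> B \<Longrightarrow> A1 = B"
    using finite_has_maximal2[OF F(1) A(1)] by blast
  define F' where "F' = {B\<in>F. \<not> A1 \<subseteq> B}"
  define K where "K = \<Union>((\<lambda>B. ?T closure_of B) ` F')"
  have "closedin ?T K" unfolding K_def using F(1) by (intro closedin_Union) (auto simp: F'_def)
  define W where "W = U' - K"
  have W: "openin ?T W" "W \<subseteq> U'" unfolding W_def using U'(1) \<open>closedin ?T K\<close> by (auto intro: openin_diff)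
  let ?E = "?T closure_of A1"
  have A1E: "A1 \<subseteq> ?E" by (rule closure_of_subset[OF irreducible_inD(1)[OF irrF[OF A1(1)]]])
  have E: "closedin ?T ?E" "irreducible_in ?T ?E" using irreducible_in_closure[OF irrF[OF A1(1)]] by auto
  have "\<not> A1 \<subseteq> K"
  proof
    assume "A1 \<subseteq> K"
    then have "\<exists>B\<in>(\<lambda>B. ?T closure_of B) ` F'. A1 \<subseteq> B"
      unfolding K_def using F(1) by (intro irreducible_in_finite_cover[OF irrF[OF A1(1)]]) (auto simp: F'_def)
    then obtain B where B: "B \<in> F" "\<not> A1 \<subseteq> B" "A1 \<subseteq> ?T closure_of B" by (auto simp: F'_def)
    then show False using clF[OF B(1)] FW0[OF A1(1)] by blast
  qed
  then have neW: "W \<inter> ?E \<noteq> {}" using A1E FW0[OF A1(1)] W0(1) by (auto simp: W_def)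
  have "A1 \<subseteq> {x \<in> points Z. pt \<pi> x \<in> ?D}" using FW0[OF A1(1)] W0(2) by (auto simp: W0_def)
  then have ED: "?E \<subseteq> {x \<in> points Z. pt \<pi> x \<in> ?D}" using preD by (rule closure_of_minimal)
  \<comment> \<open>A point of \<open>W\<close> with the same image as a point of \<open>?E\<close>
    lies in some member of \<open>F\<close>. As \<open>W\<close> avoids \<open>K\<close>, this
    member contains \<open>A1\<close> and equals it by maximality.\<close>
  have sat: "x' \<in> ?E" if x: "x \<in> ?E" "x' \<in> W" "pt \<pi> x' = pt \<pi> x" for x x'
  proof -
    have "x' \<in> W0" using x ED W(2) by (auto simp: W0_def)
    then obtain B where B: "B \<in> F" "x' \<in> B" using F(2) by blast
    have "A1 \<subseteq> B"
    proof (rule ccontr)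
      assume "\<not> A1 \<subseteq> B"
      then have "?T closure_of B \<subseteq> K" using B(1) by (auto simp: K_def F'_def)
      moreover have "B \<subseteq> ?T closure_of B" by (rule closure_of_subset[OF irreducible_inD(1)[OF irrF[OF B(1)]]])
      ultimately show False using B(2) x(2) by (auto simp: W_def)
    qed
    then show ?thesis using A1(3)[OF B(1)] B(2) A1E by blast
  qed
  obtain n k N where g: "dim_of ?T ?E = ereal (real (n + k))"
    "dim_of ?T' (?T' closure_of (pt \<pi> ` ?E)) = ereal (real n)"
    "openin ?T N" "N \<subseteq> W" "N \<inter> ?E \<noteq> {}"
    "\<And>x. x \<in> N \<inter> ?E \<Longrightarrow> has_chain ?T {x'\<in>?E \<inter> W. pt \<pi> x' = pt \<pi> x} k"
    "\<And>x L. x \<in> N \<inter> ?E \<Longrightarrow> has_chain ?T {x'\<in>?E \<inter> N. pt \<pi> x' = pt \<pi> x} L \<Longrightarrow> L \<le> k"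
    by (rule generic_fibre[OF Z.X Y \<pi> E W(1) neW]) blast
  \<comment> \<open>\<open>n\<close> is the dimension of the closure of the image of
    \<open>?E\<close>, which may be larger than \<open>?D\<close>; domination of \<open>C\<close>
    gives the inclusion that is needed.\<close>
  have "?D \<subseteq> ?T' closure_of (pt \<pi> ` ?E)"
  proof (rule closure_of_minimal)
    have "C \<inter> pt \<pi> ` A \<subseteq> pt \<pi> ` ?E" using A1(2) A1E by blast
    from closure_of_mono[OF this] show "C \<subseteq> ?T' closure_of (pt \<pi> ` ?E)" using A(2) by blast
  qed simp
  then have "dim_of ?T' ?D \<le> ereal (real n)" using dim_of_mono g(2) by metis
  moreover have "ereal (real n0) \<le> dim_of ?T' ?D" using C(3) by (simp add: dim_of_ge_iff)
  ultimately have n0: "ereal (real n0) \<le> ereal (real n)" by (rule order_trans[rotated])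
  \<comment> \<open>For \<open>x\<close> in \<open>N\<close>, the fibre of \<open>?E\<close> through
    \<open>x\<close> lies in the orbit and has a chain of length \<open>k\<close>; conversely,
    within \<open>N\<close> the orbit lies in \<open>?E\<close>. By homogeneity the part in
    \<open>N\<close> has the dimension of the whole orbit.\<close>
  have locus: "?E \<inter> N \<subseteq> orbit_dim_locus \<G> X \<A> U k"
  proof
    fix x assume "x \<in> ?E \<inter> N"
    then have x: "x \<in> N \<inter> ?E" "x \<in> points Z" "x \<in> U" using g(4) W(2) U'(2,3) by auto
    have orb: "Z.orb x \<subseteq> points Z" by (rule Z.orb_points[OF x(2)])
    have c: "has_chain ?T (Z.orb x) k"
    proof (rule has_chain_mono[OF g(6)[OF x(1)]])
      show "{x' \<in> ?E \<inter> W. pt \<pi> x' = pt \<pi> x} \<subseteq> Z.orb x"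
        using fibre[OF x(2)] W(2) U'(3) by blast
    qed
    have "N \<inter> Z.orb x \<subseteq> {x'\<in>?E \<inter> N. pt \<pi> x' = pt \<pi> x}"
    proof
      fix x' assume x': "x' \<in> N \<inter> Z.orb x"
      then have "pt \<pi> x' = pt \<pi> x" using fibre[OF x(2), of x'] orb by blast
      moreover from this have "x' \<in> ?E" using sat[of x x'] x(1) x' g(4) by blast
      ultimately show "x' \<in> {x'\<in>?E \<inter> N. pt \<pi> x' = pt \<pi> x}" using x' by blast
    qed
    then have small: "L \<le> k" if "has_chain ?T (N \<inter> Z.orb x) L" for L
      using g(7)[OF x(1) has_chain_mono[OF that]] by blast
    have eq: "dim_of ?T (N \<inter> Z.orb x) = dim_of ?T (Z.orb x)"
      using x(1) by (intro Z.orb_dim(1)[OF x(2) g(3) _ Z.orb_self[OF x(2)]]) blast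
    have "dim_of ?T (Z.orb x) = ereal (real k)"
    proof (rule dim_of_eq_nat[OF c])
      fix L assume "has_chain ?T (Z.orb x) L"
      then have "ereal (real L) \<le> dim_of ?T (N \<inter> Z.orb x)" by (simp add: eq dim_of_ge_iff)
      then show "L \<le> k" using small by (simp only: dim_of_ge_iff)
    qed
    then have "dim_of (zar X) (X.orb x) = ereal (real k)" using dim_Z[OF orb] orbits[OF x(2)] by simp
    then show "x \<in> orbit_dim_locus \<G> X \<A> U k" using X.mem_orbit_dim_locus[OF U x(3)] by blast
  qed
  obtain d where d: "\<And>N. openin ?T N \<Longrightarrow> N \<inter> ?E \<noteq> {} \<Longrightarrow> dim_of ?T (?E \<inter> N) = ereal (real d)"
    "dim_of ?T ?E = ereal (real d)" by (rule scheme_dim[OF Z.X E]) blast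
  have EZ: "?E \<inter> N \<subseteq> points Z" using closure_of_subset_topspace[of ?T A1] by blast
  have "ereal (real (n + k)) = dim_of (zar X) (?E \<inter> N)"
    using d(1)[OF g(3,5)] d(2) g(1) dim_Z[OF EZ] by simp
  also have "\<dots> \<le> dim_of (zar X) (orbit_dim_locus \<G> X \<A> U k)" by (rule dim_of_mono[OF locus])
  finally have "ereal (real (n + k)) - ereal (real k) \<le> dim_of (zar X) (orbit_dim_locus \<G> X \<A> U k) - ereal (real k)"
    by (intro ereal_minus_mono) auto
  moreover have "ereal (real (n + k)) - ereal (real k) = ereal (real n)" by simp
  ultimately have "ereal (real n) \<le> dim_of (zar X) (orbit_dim_locus \<G> X \<A> U k) - ereal (real k)" by (simp only:)
  with n0 show ?thesis by (intro exI[of _ k]) (rule order_trans)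
qed

text \<open>The fibre dimension \<open>k\<close> of the closure \<open>?E\<close> of
  \<open>C\<close> in the stratum is at most \<open>i\<close>: fibres lie in orbits, and density
  puts a point of \<open>C\<close>, whose orbit has dimension \<open>i\<close>, into the generic
  open set. So the image keeps at least the dimension of the closure of \<open>C\<close> minus
  \<open>i\<close>.\<close>

theorem parameter_le_modality:
  assumes U: "openin (zar X) U" and C: "C \<subseteq> orbit_dim_locus \<G> X \<A> U i" "irreducible_in (zar X) C"
    and dense: "C \<subseteq> zar X closure_of (C \<inter> points Z)"
    and chain: "has_chain (zar X) (zar X closure_of C) l"
  shows "ereal (real l) \<le> dim_of (zar Y) (pt \<pi> ` (U \<inter> points Z)) + ereal (real i)"
proof -
  let ?X = "zar X" and ?T = "zar Z" and ?T' = "zar Y"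
  define C' where "C' = C \<inter> points Z"
  have C': "C' \<subseteq> C" "C' \<subseteq> points Z" "C \<subseteq> ?X closure_of C'" using dense by (auto simp: C'_def)
  have irrC': "irreducible_in ?X C'" by (rule irreducible_dense_subset[OF C(2) C'(1,3)])
  have clC: "?X closure_of C' = ?X closure_of C" using closure_of_between[OF C'(1,3)] by simp
  have CX: "C \<subseteq> ?X closure_of C" by (rule closure_of_subset[OF irreducible_inD(1)[OF C(2)]])
  have CU: "C \<subseteq> U" using C(1) by (auto simp: orbit_dim_locus_def)
  obtain V K where VK: "openin ?X V" "closedin ?X K" "points Z = V \<inter> K" using loc_closed unfolding locally_closed_in_def by blast
  have irrZ: "irreducible_in ?T C'" using irrC' irreducible_in_subtopology[OF C'(2), of ?X] zar_Z by simp
  let ?E = "?T closure_of C'"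
  have E: "closedin ?T ?E" "irreducible_in ?T ?E" using irreducible_in_closure[OF irrZ] by auto
  have C'E: "C' \<subseteq> ?E" by (rule closure_of_subset[OF irreducible_inD(1)[OF irrZ]])
  have "?E = ?X closure_of C' \<inter> points Z"
    by (subst zar_Z, subst closure_of_subtopology) (use C'(2) in \<open>auto simp: Int_absorb1\<close>)
  moreover have "?X closure_of C' \<subseteq> K" by (rule closure_of_minimal) (use C'(2) VK in auto)
  \<comment> \<open>As the stratum is locally closed, \<open>?E\<close> is an open part of the
    closure of \<open>C\<close> in \<open>X\<close> and so has the same dimension
    \<open>d\<close>.\<close>
  ultimately have E_eq: "?E = ?X closure_of C \<inter> V" using VK(3) clC by blast
  obtain d where d: "\<And>N. openin ?X N \<Longrightarrow> N \<inter> ?X closure_of C \<noteq> {} \<Longrightarrow> dim_of ?X (?X closure_of C \<inter> N) = ereal (real d)"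
    "dim_of ?X (?X closure_of C) = ereal (real d)"
    by (rule scheme_dim[OF X.X closedin_closure_of irreducible_in_closure[OF C(2)]]) blast
  obtain y where y: "y \<in> C'" using irreducible_inD(2)[OF irrC'] by blast
  have "V \<inter> ?X closure_of C \<noteq> {}" using y C'E E_eq by blast
  from d(1)[OF VK(1) this] have dE: "dim_of ?T ?E = ereal (real d)"
    using dim_Z[of ?E] closure_of_subset_topspace[of ?T C'] by (simp add: E_eq)
  have "ereal (real l) \<le> ereal (real d)" using chain d(2) by (simp only: dim_of_ge_iff[symmetric])
  then have ld: "l \<le> d" by simp
  define W where "W = U \<inter> points Z"
  have yW: "y \<in> W \<inter> ?E" using y C'(1,2) CU C'E by (auto simp: W_def)
  have W: "openin ?T W" "W \<inter> ?E \<noteq> {}" using open_Z[OF U] yW by (auto simp: W_def)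
  obtain n k N where g: "dim_of ?T ?E = ereal (real (n + k))"
    "dim_of ?T' (?T' closure_of (pt \<pi> ` ?E)) = ereal (real n)"
    "openin ?T N" "N \<subseteq> W" "N \<inter> ?E \<noteq> {}"
    "\<And>x. x \<in> N \<inter> ?E \<Longrightarrow> has_chain ?T {x'\<in>?E \<inter> W. pt \<pi> x' = pt \<pi> x} k"
    by (rule generic_fibre[OF Z.X Y \<pi> E W]) blast
  have nk: "n + k = d" using g(1) dE by simp
  obtain e where e: "e \<in> N" "e \<in> ?E" using g(5) by blast
  then obtain x where x: "x \<in> C'" "x \<in> N" using g(3) unfolding in_closure_of by blast
  have xs: "x \<in> points Z" "x \<in> U" "x \<in> N \<inter> ?E" "x \<in> C" using x C'(1,2) CU C'E by auto
  have "has_chain ?T (Z.orb x) k"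
  proof (rule has_chain_mono[OF g(6)[OF xs(3)]])
    show "{x' \<in> ?E \<inter> W. pt \<pi> x' = pt \<pi> x} \<subseteq> Z.orb x"
      using fibre[OF xs(1)] by (auto simp: W_def)
  qed
  then have "ereal (real k) \<le> dim_of ?X (X.orb x)"
    using dim_Z[OF Z.orb_points[OF xs(1)]] orbits[OF xs(1)] by (simp flip: dim_of_ge_iff)
  also have "\<dots> = ereal (real i)" using X.mem_orbit_dim_locus[OF U xs(2)] C(1) xs(4) by blast
  finally have ki: "k \<le> i" by simp
  let ?D = "?T' closure_of (pt \<pi> ` ?E)" and ?B = "pt \<pi> ` W"
  have irrp: "irreducible_in ?T' (pt \<pi> ` ?E)" by (rule irreducible_image[OF E(2) morphismD(1)[OF \<pi>]])
  obtain d' where d': "\<And>N. openin ?T' N \<Longrightarrow> N \<inter> ?D \<noteq> {} \<Longrightarrow> dim_of ?T' (?D \<inter> N) = ereal (real d')"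
    "dim_of ?T' ?D = ereal (real d')"
    by (rule scheme_dim[OF Y closedin_closure_of irreducible_in_closure[OF irrp]]) blast
  have "pt \<pi> x \<in> ?B" using xs by (auto simp: W_def)
  moreover have "pt \<pi> x \<in> ?D" using xs(3) closure_of_subset[OF irreducible_inD(1)[OF irrp]] by blast
  ultimately have "dim_of ?T' (?D \<inter> ?B) = ereal (real d')" by (intro d'(1) image_open[OF W(1)]) blast
  then have "ereal (real n) = dim_of ?T' (?D \<inter> ?B)" using d'(2) g(2) by simp
  also have "\<dots> \<le> dim_of ?T' ?B" by (rule dim_of_mono) blast
  finally have nB: "ereal (real n) \<le> dim_of ?T' ?B" .
  have "ereal (real l) \<le> ereal (real n) + ereal (real i)" using ld nk ki by simp
  also have "\<dots> \<le> dim_of ?T' ?B + ereal (real i)" using nB by (intro add_mono) auto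
  finally show ?thesis unfolding W_def .
qed

end

section \<open>Passage from the strata to the whole variety\<close>

lemma invariant_orbit:
  assumes inv: "invariant_subvariety \<G> X \<A> Z j \<B>" and act: "is_action \<G> X \<A>" and x: "x \<in> points Z"
  shows "orbit \<G> \<B> x = orbit \<G> \<A> x"
proof -
  have B: "is_product (grp_sp \<G>) Z (prod_sp \<B>) (pr1 \<B>) (pr2 \<B>)" "morphism (prod_sp \<B>) Z (act \<B>)"
    and A: "is_product (grp_sp \<G>) X (prod_sp \<A>) (pr1 \<A>) (pr2 \<A>)"
    using inv act by (simp_all add: invariant_subvariety_def is_action_def Let_def)
  have j: "\<And>z. z \<in> points Z \<Longrightarrow> pt j z = z" using inv by (simp add: invariant_subvariety_def subvariety_def)
  obtain u where u: "is_pairing (prod_sp \<B>) (grp_sp \<G>) X (prod_sp \<A>) (pr1 \<A>) (pr2 \<A>)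
      (pr1 \<B>) (mor_comp Z j (pr2 \<B>)) u"
    "mor_eq (prod_sp \<B>) X (mor_comp (prod_sp \<A>) (act \<A>) u) (mor_comp Z j (act \<B>))"
    using inv unfolding invariant_subvariety_def by blast
  have "pt (act \<B>) (g, x) = pt (act \<A>) (g, x)" if g: "g \<in> points (grp_sp \<G>)" for g
  proof -
    have z: "(g, x) \<in> points (prod_sp \<B>)" using B(1) g x by (simp add: is_product_def)
    then have "pt (act \<B>) (g, x) \<in> points Z"
      using continuous_map_image_subset_topspace[OF morphismD(1)[OF B(2)]] by blast
    moreover have "pt (pr1 \<B>) (g, x) = g" "pt (pr2 \<B>) (g, x) = x" using B(1) z by (simp_all add: is_product_def)
    ultimately show ?thesis
      using pairing_point(2)[OF A u(1) z] bspec[OF u(2)[unfolded mor_eq_def, THEN conjunct1] z] j x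
      by (simp add: mor_comp_def)
  qed
  then show ?thesis unfolding orbit_def setcompr_eq_image by (intro image_cong refl) simp
qed

theorem propositionA2:
  fixes \<G> :: "('g, 'r, 'k::alg_closed_field) kgroup"
    and X :: "('x, 'r, 'k) kspace"
    and \<A> :: "('g, 'x, 'r, 'k) kaction"
    and S :: "nat \<Rightarrow> ('g, 'x, 'y, 'r, 'k) stratum"
    and s :: nat
  assumes "algebraic_group \<G>"
    and "variety X"
    and "is_action \<G> X \<A>"
    and "rosenlicht_stratification \<G> X \<A> s S"
  shows "(\<forall>x \<in> points X. \<forall>U. openin (zar X) U \<and> x \<in> U \<longrightarrow> G_par \<G> X \<A> U = G_mod s S U) \<and>
         (\<forall>x \<in> points X. G_par_at \<G> X \<A> x = G_mod_at X s S x)"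
proof -
  let ?Z = "\<lambda>i. points (str_sp (S i))"
  have X: "finite_type_scheme X" using assms(2) by (simp add: variety_def)
  have cover: "(\<Union>i\<in>{1..s}. ?Z i) = points X" using assms(4) by (simp add: rosenlicht_stratification_def)
  have stratum: "quotient_stratum \<G> X \<A> (str_sp (S i)) (str_act (S i)) (str_quot (S i)) (str_proj (S i))"
    if i: "i \<in> {1..s}" for i
  proof -
    have S: "invariant_subvariety \<G> X \<A> (str_sp (S i)) (str_inc (S i)) (str_act (S i))"
      "variety (str_quot (S i))"
      "geometric_quotient \<G> (str_sp (S i)) (str_act (S i)) (str_quot (S i)) (str_proj (S i))"
      using assms(4) i by (simp_all add: rosenlicht_stratification_def Let_def)
    note S' = S(1)[unfolded invariant_subvariety_def subvariety_def]
    show ?thesis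
    proof (intro quotient_stratum.intro group_action.intro quotient_stratum_axioms.intro assms X S(3))
      show "finite_type_scheme (str_sp (S i))" "is_action \<G> (str_sp (S i)) (str_act (S i))"
        "zar (str_sp (S i)) = subtopology (zar X) (?Z i)" "locally_closed_in (zar X) (?Z i)"
        using S' by (simp_all add: variety_def)
      show "finite_type_scheme (str_quot (S i))" using S(2) by (simp add: variety_def)
      show "orbit \<G> (str_act (S i)) x = orbit \<G> \<A> x" if "x \<in> ?Z i" for x
        by (rule invariant_orbit[OF S(1) assms(3) that])
    qed
  qed
  have main: "G_par \<G> X \<A> U = G_mod s S U" if U: "openin (zar X) U" "x \<in> U" for U x
  proof (rule antisym)
    let ?B = "\<lambda>i. dim_of (zar (str_quot (S i))) (pt (str_proj (S i)) ` (U \<inter> ?Z i))"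
    have "x \<in> points X" using U openin_subset by blast
    \<comment> \<open>A point in \<open>U\<close> forces at least one stratum, so that
      \<open>Max\<close> is taken over a nonempty set.\<close>
    then have ne: "{1..s} \<noteq> {}" using cover by auto
    show "G_mod s S U \<le> G_par \<G> X \<A> U"
      unfolding G_mod_def
    proof (rule Max.boundedI)
      show "finite (?B ` {1..s})" "?B ` {1..s} \<noteq> {}" using ne by auto
      fix b assume "b \<in> ?B ` {1..s}"
      then obtain i where i: "i \<in> {1..s}" "b = ?B i" by blast
      show "b \<le> G_par \<G> X \<A> U"
        unfolding i(2)
      proof (rule dim_of_le)
        fix n assume "has_chain (zar (str_quot (S i))) (pt (str_proj (S i)) ` (U \<inter> ?Z i)) n"
        from quotient_stratum.modality_le_parameter[OF stratum[OF i(1)] U(1) this]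
        obtain k where "ereal (real n) \<le> dim_of (zar X) (orbit_dim_locus \<G> X \<A> U k) - ereal (real k)" by blast
        also have "\<dots> \<le> G_par \<G> X \<A> U" unfolding G_par_def by (rule SUP_upper) simp
        finally show "ereal (real n) \<le> G_par \<G> X \<A> U" .
      qed
    qed
    show "G_par \<G> X \<A> U \<le> G_mod s S U"
      unfolding G_par_def
    proof (rule SUP_least)
      fix i :: nat
      \<comment> \<open>With \<open>i\<close> moved to the right, the bound concerns the dimension
        itself and can be checked chain by chain; the top of each chain is dense in one of the
        strata.\<close>
      have "dim_of (zar X) (orbit_dim_locus \<G> X \<A> U i) \<le> G_mod s S U + ereal (real i)"
      proof (rule dim_of_le)
        fix n assume "has_chain (zar X) (orbit_dim_locus \<G> X \<A> U i) n"
        then obtain C where C: "C \<subseteq> orbit_dim_locus \<G> X \<A> U i" "irreducible_in (zar X) C"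
          "has_chain (zar X) (zar X closure_of C) n" by (rule has_chain_top)
        have "C \<subseteq> (\<Union>i\<in>{1..s}. ?Z i)" unfolding cover by (rule irreducible_inD(1)[OF C(2)])
        then obtain t where t: "t \<in> {1..s}" "C \<subseteq> zar X closure_of (C \<inter> ?Z t)"
          using irreducible_dense_piece[OF C(2) finite_atLeastAtMost, of ?Z 1 s] by blast
        have "ereal (real n) \<le> ?B t + ereal (real i)"
          by (rule quotient_stratum.parameter_le_modality[OF stratum[OF t(1)] U(1) C(1,2) t(2) C(3)])
        also have "?B t \<le> G_mod s S U" unfolding G_mod_def using t(1) by (intro Max_ge) auto
        then have "?B t + ereal (real i) \<le> G_mod s S U + ereal (real i)" by (intro add_mono) auto
        finally show "ereal (real n) \<le> G_mod s S U + ereal (real i)" .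
      qed
      then show "dim_of (zar X) (orbit_dim_locus \<G> X \<A> U i) - ereal (real i) \<le> G_mod s S U"
        by (simp add: ereal_minus_le)
    qed
  qed
  have "G_par_at \<G> X \<A> x = G_mod_at X s S x" for x
  proof -
    have "{G_par \<G> X \<A> U | U. openin (zar X) U \<and> x \<in> U} = {G_mod s S U | U. openin (zar X) U \<and> x \<in> U}"
      unfolding setcompr_eq_image by (intro image_cong refl) (use main in blast)
    then show ?thesis by (simp add: G_par_at_def G_mod_at_def)
  qed
  with main show ?thesis by blast
qed

end
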